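(* In Martin-Löf type theory with a univalent universe $\mathcal{U}$ that is closed under graph quotients we can define, for every map $f:A\to X$ with $A,X:\mathcal{U}$, the image of $f$ with $\mathrm{im}(f):\mathcal{U}$. That is, we can define a type $\mathrm{im}(f):\mathcal{U}$, an embedding $i_f:\mathrm{im}(f)\to X$, a map $q_f:A\to\mathrm{im}(f)$ and a homotopy $Q_f:f\sim i_f\circ q_f$ such that for every embedding $g:B\to X$ the canonical map $$\varphi^g_{q_f,Q_f}:\mathrm{Hom}_X(i_f,g)\to\mathrm{Hom}_X(f,g)$$ is an equivalence.
   Context: Setting: Martin-Löf type theory with function extensionality and a univalent universe $\mathcal{U}$ containing the empty type, the unit type, the natural numbers $\mathbb{N}$, and closed under $\times,\Pi,+,\Sigma$, identity types and graph quotients. No propositional truncation or other recursive higher inductive types are assumed. A (small) graph $\Gamma$ is a type $\Gamma_0:\mathcal{U}$ with a family $\Gamma_1:\Gamma_0\to\Gamma_0\to\mathcal{U}$; its graph quotient is the higher inductive type in $\mathcal{U}$ with constructors $c_0:\Gamma_0\to\mathrm{colim}(\Gamma)$ and $c_1:\prod_{i,j:\Gamma_0}\Gamma_1(i,j)\to(c_0(i)=c_0(j))$, with the corresponding induction principle into type families of any size. Pushouts and sequential colimits are obtained from graph quotients. A map is an embedding if its homotopy fibers are mere propositions. For $f:A\to X$ and $g:B\to X$, $\mathrm{Hom}_X(f,g):=\sum_{h:A\to B} f\sim g\circ h$. Given $f':A'\to X$, $i:A\to A'$ and $I:f\sim f'\circ i$, the map $\varphi^g_{i,I}:\mathrm{Hom}_X(f',g)\to\mathrm{Hom}_X(f,g)$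 is $\varphi^g_{i,I}(h,H):=(h\circ i,\ \lambda a.\, I(a)\cdot H(i(a)))$. *)

theory Defs
  imports Main
begin

section \<open>Syntax\<close>

text \<open>
  Martin-Loef type theory is deeply embedded: raw terms with de Bruijn indices, and inductively
  generated judgements. There is no shallow embedding of binders as HOL functions, since HOL's
  choice operator would then yield a term of \<open>\<Pi>(A : U). A + \<not>A\<close>, which univalence refutes.

  The number of variables bound in an argument is indicated in the comments; the innermost bound
  variable has index 0. Constructors carry those parameters that cannot be read off from their
  arguments, as in \<open>Pair B a b\<close>, where \<open>B\<close> is the family.
\<close>

datatype tm =
    Var nat
  | Ty                            (* the sort of all types; not itself a type *)
  | U
  | Pi tm tm                      (* Pi A B: B binds 1 *)
  | Lam tm tm                     (* Lam A b: b binds 1 *)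
  | App tm tm
  | Sigma tm tm                   (* Sigma A B: B binds 1 *)
  | Pair tm tm tm                 (* Pair B a b: B binds 1 *)
  | IndSigma tm tm tm             (* IndSigma C g p: C binds 1, g binds 2 *)
  | Sum tm tm
  | InL tm tm                     (* InL B a : Sum A B *)
  | InR tm tm                     (* InR A b : Sum A B *)
  | IndSum tm tm tm tm            (* IndSum C l r t: C, l, r bind 1 *)
  | Empty
  | IndEmpty tm tm                (* IndEmpty C t: C binds 1 *)
  | Unit
  | Star
  | IndUnit tm tm tm              (* IndUnit C c t: C binds 1 *)
  | Nat
  | Zero
  | Succ tm
  | IndNat tm tm tm tm            (* IndNat C z s n: C binds 1, s binds 2 *)
  | Id tm tm tm                   (* Id A a b *)
  | Refl tm
  | J tm tm tm tm tm              (* J C c a b p: C binds 3, c binds 1 *)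
  | Colim tm tm                   (* Colim G0 G1, with G1 : G0 -> G0 -> U a term, not a binder *)
  | C0 tm tm                      (* C0 G1 i *)
  | C1 tm tm tm tm                (* C1 G1 i j e *)
  | IndColim tm tm tm tm          (* IndColim P d0 d1 t: P, d0 bind 1, d1 binds 3 *)
  | CompColim tm tm tm tm tm tm tm  (* CompColim G1 P d0 d1 i j e: P, d0 bind 1, d1 binds 3 *)
  | FunExt tm tm                  (* FunExt A B: B binds 1 *)
  | UA

definition scons :: "tm \<Rightarrow> (nat \<Rightarrow> tm) \<Rightarrow> nat \<Rightarrow> tm" (infixr "\<cdot>" 65) where
  "a \<cdot> \<sigma> = case_nat a \<sigma>"

definition shift :: "nat \<Rightarrow> nat \<Rightarrow> tm" ("\<up>_" [1000] 999) where
  "\<up>k = (\<lambda>n. Var (n + k))"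

definition upren :: "(nat \<Rightarrow> nat) \<Rightarrow> nat \<Rightarrow> nat" where
  "upren \<xi> = case_nat 0 (\<lambda>n. Suc (\<xi> n))"

primrec ren :: "tm \<Rightarrow> (nat \<Rightarrow> nat) \<Rightarrow> tm" where
  "ren (Var n) \<xi> = Var (\<xi> n)"
| "ren Ty \<xi> = Ty"
| "ren U \<xi> = U"
| "ren (Pi A B) \<xi> = Pi (ren A \<xi>) (ren B (upren \<xi>))"
| "ren (Lam A b) \<xi> = Lam (ren A \<xi>) (ren b (upren \<xi>))"
| "ren (App f a) \<xi> = App (ren f \<xi>) (ren a \<xi>)"
| "ren (Sigma A B) \<xi> = Sigma (ren A \<xi>) (ren B (upren \<xi>))"
| "ren (Pair B a b) \<xi> = Pair (ren B (upren \<xi>)) (ren a \<xi>) (ren b \<xi>)"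
| "ren (IndSigma C g p) \<xi> = IndSigma (ren C (upren \<xi>)) (ren g (upren (upren \<xi>))) (ren p \<xi>)"
| "ren (Sum A B) \<xi> = Sum (ren A \<xi>) (ren B \<xi>)"
| "ren (InL B a) \<xi> = InL (ren B \<xi>) (ren a \<xi>)"
| "ren (InR A b) \<xi> = InR (ren A \<xi>) (ren b \<xi>)"
| "ren (IndSum C l r t) \<xi> =
     IndSum (ren C (upren \<xi>)) (ren l (upren \<xi>)) (ren r (upren \<xi>)) (ren t \<xi>)"
| "ren Empty \<xi> = Empty"
| "ren (IndEmpty C t) \<xi> = IndEmpty (ren C (upren \<xi>)) (ren t \<xi>)"
| "ren Unit \<xi> = Unit"
| "ren Star \<xi> = Star"
| "ren (IndUnit C c t) \<xi> = IndUnit (ren C (upren \<xi>)) (ren c \<xi>) (ren t \<xi>)"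
| "ren Nat \<xi> = Nat"
| "ren Zero \<xi> = Zero"
| "ren (Succ n) \<xi> = Succ (ren n \<xi>)"
| "ren (IndNat C z s n) \<xi> =
     IndNat (ren C (upren \<xi>)) (ren z \<xi>) (ren s (upren (upren \<xi>))) (ren n \<xi>)"
| "ren (Id A a b) \<xi> = Id (ren A \<xi>) (ren a \<xi>) (ren b \<xi>)"
| "ren (Refl a) \<xi> = Refl (ren a \<xi>)"
| "ren (J C c a b p) \<xi> =
     J (ren C (upren (upren (upren \<xi>)))) (ren c (upren \<xi>)) (ren a \<xi>) (ren b \<xi>) (ren p \<xi>)"
| "ren (Colim G0 G1) \<xi> = Colim (ren G0 \<xi>) (ren G1 \<xi>)"
| "ren (C0 G1 i) \<xi> = C0 (ren G1 \<xi>) (ren i \<xi>)"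
| "ren (C1 G1 i j e) \<xi> = C1 (ren G1 \<xi>) (ren i \<xi>) (ren j \<xi>) (ren e \<xi>)"
| "ren (IndColim P d0 d1 t) \<xi> =
     IndColim (ren P (upren \<xi>)) (ren d0 (upren \<xi>)) (ren d1 (upren (upren (upren \<xi>)))) (ren t \<xi>)"
| "ren (CompColim G1 P d0 d1 i j e) \<xi> =
     CompColim (ren G1 \<xi>) (ren P (upren \<xi>)) (ren d0 (upren \<xi>)) (ren d1 (upren (upren (upren \<xi>))))
       (ren i \<xi>) (ren j \<xi>) (ren e \<xi>)"
| "ren (FunExt A B) \<xi> = FunExt (ren A \<xi>) (ren B (upren \<xi>))"
| "ren UA \<xi> = UA"

definition up :: "(nat \<Rightarrow> tm) \<Rightarrow> nat \<Rightarrow> tm" where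
  "up \<sigma> = Var 0 \<cdot> (\<lambda>n. ren (\<sigma> n) Suc)"

text \<open>
  Simultaneous substitution. In particular, \<open>t\<langle>\<up>k\<rangle>\<close> is weakening by \<open>k\<close> variables,
  \<open>b\<langle>a \<cdot> Var\<rangle>\<close> is the instance \<open>b[a]\<close>, and \<open>B\<langle>Var 0 \<cdot> \<up>(k + 1)\<rangle>\<close> weakens a term \<open>B\<close> with one
  bound variable by \<open>k\<close> variables inserted underneath that bound variable.
\<close>

primrec sub :: "tm \<Rightarrow> (nat \<Rightarrow> tm) \<Rightarrow> tm" ("_\<langle>_\<rangle>" [1000, 0] 1000) where
  "sub (Var n) \<sigma> = \<sigma> n"
| "sub Ty \<sigma> = Ty"
| "sub U \<sigma> = U"
| "sub (Pi A B) \<sigma> = Pi (sub A \<sigma>) (sub B (up \<sigma>))"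
| "sub (Lam A b) \<sigma> = Lam (sub A \<sigma>) (sub b (up \<sigma>))"
| "sub (App f a) \<sigma> = App (sub f \<sigma>) (sub a \<sigma>)"
| "sub (Sigma A B) \<sigma> = Sigma (sub A \<sigma>) (sub B (up \<sigma>))"
| "sub (Pair B a b) \<sigma> = Pair (sub B (up \<sigma>)) (sub a \<sigma>) (sub b \<sigma>)"
| "sub (IndSigma C g p) \<sigma> = IndSigma (sub C (up \<sigma>)) (sub g (up (up \<sigma>))) (sub p \<sigma>)"
| "sub (Sum A B) \<sigma> = Sum (sub A \<sigma>) (sub B \<sigma>)"
| "sub (InL B a) \<sigma> = InL (sub B \<sigma>) (sub a \<sigma>)"
| "sub (InR A b) \<sigma> = InR (sub A \<sigma>) (sub b \<sigma>)"
| "sub (IndSum C l r t) \<sigma> = IndSum (sub C (up \<sigma>)) (sub l (up \<sigma>)) (sub r (up \<sigma>)) (sub t \<sigma>)"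
| "sub Empty \<sigma> = Empty"
| "sub (IndEmpty C t) \<sigma> = IndEmpty (sub C (up \<sigma>)) (sub t \<sigma>)"
| "sub Unit \<sigma> = Unit"
| "sub Star \<sigma> = Star"
| "sub (IndUnit C c t) \<sigma> = IndUnit (sub C (up \<sigma>)) (sub c \<sigma>) (sub t \<sigma>)"
| "sub Nat \<sigma> = Nat"
| "sub Zero \<sigma> = Zero"
| "sub (Succ n) \<sigma> = Succ (sub n \<sigma>)"
| "sub (IndNat C z s n) \<sigma> =
     IndNat (sub C (up \<sigma>)) (sub z \<sigma>) (sub s (up (up \<sigma>))) (sub n \<sigma>)"
| "sub (Id A a b) \<sigma> = Id (sub A \<sigma>) (sub a \<sigma>) (sub b \<sigma>)"
| "sub (Refl a) \<sigma> = Refl (sub a \<sigma>)"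
| "sub (J C c a b p) \<sigma> =
     J (sub C (up (up (up \<sigma>)))) (sub c (up \<sigma>)) (sub a \<sigma>) (sub b \<sigma>) (sub p \<sigma>)"
| "sub (Colim G0 G1) \<sigma> = Colim (sub G0 \<sigma>) (sub G1 \<sigma>)"
| "sub (C0 G1 i) \<sigma> = C0 (sub G1 \<sigma>) (sub i \<sigma>)"
| "sub (C1 G1 i j e) \<sigma> = C1 (sub G1 \<sigma>) (sub i \<sigma>) (sub j \<sigma>) (sub e \<sigma>)"
| "sub (IndColim P d0 d1 t) \<sigma> =
     IndColim (sub P (up \<sigma>)) (sub d0 (up \<sigma>)) (sub d1 (up (up (up \<sigma>)))) (sub t \<sigma>)"
| "sub (CompColim G1 P d0 d1 i j e) \<sigma> =
     CompColim (sub G1 \<sigma>) (sub P (up \<sigma>)) (sub d0 (up \<sigma>)) (sub d1 (up (up (up \<sigma>))))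
       (sub i \<sigma>) (sub j \<sigma>) (sub e \<sigma>)"
| "sub (FunExt A B) \<sigma> = FunExt (sub A \<sigma>) (sub B (up \<sigma>))"
| "sub UA \<sigma> = UA"


section \<open>Notions definable in the type theory\<close>

text \<open>
  All arguments live in one ambient context, except that the following are families, i.e.
  have one further variable: \<open>P\<close> in \<open>tr\<close>, \<open>apd\<close> and \<open>glue_type\<close>; \<open>B\<close> in \<open>dhtpy\<close>, \<open>happly\<close>
  and \<open>funext_type\<close>.
\<close>

definition arrow :: "tm \<Rightarrow> tm \<Rightarrow> tm" where
  "arrow A B = Pi A B\<langle>\<up>1\<rangle>"

definition prod :: "tm \<Rightarrow> tm \<Rightarrow> tm" where
  "prod A B = Sigma A B\<langle>\<up>1\<rangle>"

definition idfun :: "tm \<Rightarrow> tm" where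
  "idfun A = Lam A (Var 0)"

text \<open>\<open>comp A g f\<close> is \<open>g \<circ> f\<close>, where \<open>A\<close> is the domain of \<open>f\<close>.\<close>

definition comp :: "tm \<Rightarrow> tm \<Rightarrow> tm \<Rightarrow> tm" where
  "comp A g f = Lam A (App g\<langle>\<up>1\<rangle> (App f\<langle>\<up>1\<rangle> (Var 0)))"

definition dhtpy :: "tm \<Rightarrow> tm \<Rightarrow> tm \<Rightarrow> tm \<Rightarrow> tm" where
  "dhtpy A B f g = Pi A (Id B (App f\<langle>\<up>1\<rangle> (Var 0)) (App g\<langle>\<up>1\<rangle> (Var 0)))"

definition htpy :: "tm \<Rightarrow> tm \<Rightarrow> tm \<Rightarrow> tm \<Rightarrow> tm" where
  "htpy A B f g = dhtpy A B\<langle>\<up>1\<rangle> f g"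

text \<open>Transport in the family \<open>P\<close> along \<open>p : a = b\<close>, as a function \<open>P[a] \<rightarrow> P[b]\<close> applied to \<open>u\<close>.\<close>

definition tr :: "tm \<Rightarrow> tm \<Rightarrow> tm \<Rightarrow> tm \<Rightarrow> tm \<Rightarrow> tm" where
  "tr P a b p u =
     App (J (Pi P\<langle>Var 2 \<cdot> \<up>3\<rangle> P\<langle>Var 2 \<cdot> \<up>4\<rangle>) (Lam P (Var 0)) a b p) u"

text \<open>The concatenation \<open>p \<cdot> q : x = z\<close> of \<open>p : x = y\<close> and \<open>q : y = z\<close>, by transport in \<open>x = _\<close>.\<close>

definition concat :: "tm \<Rightarrow> tm \<Rightarrow> tm \<Rightarrow> tm \<Rightarrow> tm \<Rightarrow> tm \<Rightarrow> tm" where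
  "concat A x y z p q = tr (Id A\<langle>\<up>1\<rangle> x\<langle>\<up>1\<rangle> (Var 0)) y z q p"

text \<open>For \<open>f : \<Pi>(x : A). P\<close> and \<open>p : a = b\<close>, this has type \<open>tr P p (f a) = f b\<close>.\<close>

definition apd :: "tm \<Rightarrow> tm \<Rightarrow> tm \<Rightarrow> tm \<Rightarrow> tm \<Rightarrow> tm" where
  "apd P f a b p =
     J (Id P\<langle>Var 1 \<cdot> \<up>3\<rangle>
          (tr P\<langle>Var 0 \<cdot> \<up>4\<rangle> (Var 2) (Var 1) (Var 0) (App f\<langle>\<up>3\<rangle> (Var 2)))
          (App f\<langle>\<up>3\<rangle> (Var 1)))
       (Refl (App f\<langle>\<up>1\<rangle> (Var 0))) a b p"

definition isprop :: "tm \<Rightarrow> tm" where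
  "isprop A = Pi A (Pi A\<langle>\<up>1\<rangle> (Id A\<langle>\<up>2\<rangle> (Var 1) (Var 0)))"

definition fiber :: "tm \<Rightarrow> tm \<Rightarrow> tm \<Rightarrow> tm \<Rightarrow> tm" where
  "fiber A B f b = Sigma A (Id B\<langle>\<up>1\<rangle> (App f\<langle>\<up>1\<rangle> (Var 0)) b\<langle>\<up>1\<rangle>)"

definition isemb :: "tm \<Rightarrow> tm \<Rightarrow> tm \<Rightarrow> tm" where
  "isemb A B f = Pi B (isprop (fiber A\<langle>\<up>1\<rangle> B\<langle>\<up>1\<rangle> f\<langle>\<up>1\<rangle> (Var 0)))"

text \<open>
  Equivalences are bi-invertible maps: maps with a section and a retraction. The families
  \<open>is_sec A B f\<close> and \<open>is_retr A B f\<close> have one further variable of type \<open>B \<rightarrow> A\<close>.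
\<close>

definition is_sec :: "tm \<Rightarrow> tm \<Rightarrow> tm \<Rightarrow> tm" where
  "is_sec A B f = htpy B\<langle>\<up>1\<rangle> B\<langle>\<up>1\<rangle> (comp B\<langle>\<up>1\<rangle> f\<langle>\<up>1\<rangle> (Var 0)) (idfun B\<langle>\<up>1\<rangle>)"

definition is_retr :: "tm \<Rightarrow> tm \<Rightarrow> tm \<Rightarrow> tm" where
  "is_retr A B f = htpy A\<langle>\<up>1\<rangle> A\<langle>\<up>1\<rangle> (comp A\<langle>\<up>1\<rangle> (Var 0) f\<langle>\<up>1\<rangle>) (idfun A\<langle>\<up>1\<rangle>)"

definition isequiv :: "tm \<Rightarrow> tm \<Rightarrow> tm \<Rightarrow> tm" where
  "isequiv A B f = prod (Sigma (arrow B A) (is_sec A B f)) (Sigma (arrow B A) (is_retr A B f))"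

definition equiv :: "tm \<Rightarrow> tm \<Rightarrow> tm" where
  "equiv A B = Sigma (arrow A B) (isequiv A\<langle>\<up>1\<rangle> B\<langle>\<up>1\<rangle> (Var 0))"

definition idequiv :: "tm \<Rightarrow> tm" where
  "idequiv A =
     Pair (isequiv A\<langle>\<up>1\<rangle> A\<langle>\<up>1\<rangle> (Var 0)) (idfun A)
       (Pair (Sigma (arrow A A) (is_retr A A (idfun A)))\<langle>\<up>1\<rangle>
         (Pair (is_sec A A (idfun A)) (idfun A) (Lam A (Refl (Var 0))))
         (Pair (is_retr A A (idfun A)) (idfun A) (Lam A (Refl (Var 0)))))"

text \<open>The canonical map \<open>(A = B) \<rightarrow> (A \<simeq> B)\<close>, for \<open>A, B : U\<close>, and the univalence axiom.\<close>

definition idtoequiv :: "tm \<Rightarrow> tm \<Rightarrow> tm" where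
  "idtoequiv A B =
     Lam (Id U A B) (J (equiv (Var 2) (Var 1)) (idequiv (Var 0)) A\<langle>\<up>1\<rangle> B\<langle>\<up>1\<rangle> (Var 0))"

definition univalence_type :: tm where
  "univalence_type =
     Pi U (Pi U (isequiv (Id U (Var 1) (Var 0)) (equiv (Var 1) (Var 0)) (idtoequiv (Var 1) (Var 0))))"

text \<open>The canonical map \<open>(f = g) \<rightarrow> (f \<sim> g)\<close>, for \<open>f, g : \<Pi>(x : A). B\<close>, and function extensionality.\<close>

definition happly :: "tm \<Rightarrow> tm \<Rightarrow> tm \<Rightarrow> tm \<Rightarrow> tm" where
  "happly A B f g =
     Lam (Id (Pi A B) f g)
       (J (dhtpy A\<langle>\<up>4\<rangle> B\<langle>Var 0 \<cdot> \<up>5\<rangle> (Var 2) (Var 1))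
          (Lam A\<langle>\<up>2\<rangle> (Refl (App (Var 1) (Var 0))))
          f\<langle>\<up>1\<rangle> g\<langle>\<up>1\<rangle> (Var 0))"

definition funext_type :: "tm \<Rightarrow> tm \<Rightarrow> tm" where
  "funext_type A B =
     Pi (Pi A B) (Pi (Pi A B)\<langle>\<up>1\<rangle>
       (isequiv (Id (Pi A B)\<langle>\<up>2\<rangle> (Var 1) (Var 0))
          (dhtpy A\<langle>\<up>2\<rangle> B\<langle>Var 0 \<cdot> \<up>3\<rangle> (Var 1) (Var 0))
          (happly A\<langle>\<up>2\<rangle> B\<langle>Var 0 \<cdot> \<up>3\<rangle> (Var 1) (Var 0))))"

text \<open>The type of dependent paths from \<open>a : P[c0 i]\<close> to \<open>b : P[c0 j]\<close> over \<open>c1 i j e\<close>.\<close>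

definition glue_type :: "tm \<Rightarrow> tm \<Rightarrow> tm \<Rightarrow> tm \<Rightarrow> tm \<Rightarrow> tm \<Rightarrow> tm \<Rightarrow> tm" where
  "glue_type G1 P i j e a b =
     Id P\<langle>C0 G1 j \<cdot> Var\<rangle> (tr P (C0 G1 i) (C0 G1 j) (C1 G1 i j e) a) b"

text \<open>
  Type of the data on paths for graph quotient induction, in the context extended by
  \<open>i, j : G0\<close> and \<open>e : G1 i j\<close>; and type of the computation rule on paths.
\<close>

definition d1_type :: "tm \<Rightarrow> tm \<Rightarrow> tm \<Rightarrow> tm" where
  "d1_type G1 P d0 =
     glue_type G1\<langle>\<up>3\<rangle> P\<langle>Var 0 \<cdot> \<up>4\<rangle> (Var 2) (Var 1) (Var 0) d0\<langle>Var 2 \<cdot> \<up>3\<rangle> d0\<langle>Var 1 \<cdot> \<up>3\<rangle>"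

definition comp1_type :: "tm \<Rightarrow> tm \<Rightarrow> tm \<Rightarrow> tm \<Rightarrow> tm \<Rightarrow> tm \<Rightarrow> tm \<Rightarrow> tm \<Rightarrow> tm" where
  "comp1_type G0 G1 P d0 d1 i j e =
     Id (glue_type G1 P i j e d0\<langle>i \<cdot> Var\<rangle> d0\<langle>j \<cdot> Var\<rangle>)
       (apd P
         (Lam (Colim G0 G1)
           (IndColim P\<langle>Var 0 \<cdot> \<up>2\<rangle> d0\<langle>Var 0 \<cdot> \<up>2\<rangle> d1\<langle>Var 0 \<cdot> Var 1 \<cdot> Var 2 \<cdot> \<up>4\<rangle> (Var 0)))
         (C0 G1 i) (C0 G1 j) (C1 G1 i j e))
       d1\<langle>e \<cdot> j \<cdot> i \<cdot> Var\<rangle>"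


section \<open>The type theory\<close>

text \<open>
  The judgements \<open>\<Gamma> ctx\<close>, \<open>\<Gamma> \<turnstile> a : A\<close> and \<open>\<Gamma> \<turnstile> a \<equiv> b : A\<close>; the head of a context is the most
  recent variable. The judgement that \<open>A\<close> is a type, not necessarily in the universe, is
  \<open>\<Gamma> \<turnstile> A : Ty\<close>. The universe is a la Russell. Eliminators and induction principles have
  arbitrary types as motives. The graph quotient has a judgemental computation rule on points
  and a propositional one on paths.

  The substitution rules are admissible in presentations that omit them; they are
  included as structural rules and also yield weakening.
\<close>

inductive
  ctx :: "tm list \<Rightarrow> bool" and
  has_ty :: "tm list \<Rightarrow> tm \<Rightarrow> tm \<Rightarrow> bool" ("_ \<turnstile> _ \<Colon> _" [51, 51, 51] 50) and
  eq_tm :: "tm list \<Rightarrow> tm \<Rightarrow> tm \<Rightarrow> tm \<Rightarrow> bool" ("_ \<turnstile> _ \<doteq> _ \<Colon> _" [51, 51, 51, 51] 50)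
where
  ctx_nil: "ctx []"
| ctx_cons: "\<Gamma> \<turnstile> A \<Colon> Ty \<Longrightarrow> ctx (A # \<Gamma>)"
| var: "ctx \<Gamma> \<Longrightarrow> i < length \<Gamma> \<Longrightarrow> \<Gamma> \<turnstile> Var i \<Colon> (\<Gamma> ! i)\<langle>\<up>(i + 1)\<rangle>"
| conv: "\<Gamma> \<turnstile> a \<Colon> A \<Longrightarrow> \<Gamma> \<turnstile> A \<doteq> B \<Colon> Ty \<Longrightarrow> \<Gamma> \<turnstile> a \<Colon> B"
| subst: "\<Delta> \<turnstile> a \<Colon> A \<Longrightarrow> ctx \<Gamma>
    \<Longrightarrow> (\<forall>i < length \<Delta>. \<Gamma> \<turnstile> \<sigma> i \<Colon> (\<Delta> ! i)\<langle>\<up>(i + 1)\<rangle>\<langle>\<sigma>\<rangle>)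
    \<Longrightarrow> \<Gamma> \<turnstile> a\<langle>\<sigma>\<rangle> \<Colon> A\<langle>\<sigma>\<rangle>"
| eq_refl: "\<Gamma> \<turnstile> a \<Colon> A \<Longrightarrow> \<Gamma> \<turnstile> a \<doteq> a \<Colon> A"
| eq_sym: "\<Gamma> \<turnstile> a \<doteq> b \<Colon> A \<Longrightarrow> \<Gamma> \<turnstile> b \<doteq> a \<Colon> A"
| eq_trans: "\<Gamma> \<turnstile> a \<doteq> b \<Colon> A \<Longrightarrow> \<Gamma> \<turnstile> b \<doteq> c \<Colon> A \<Longrightarrow> \<Gamma> \<turnstile> a \<doteq> c \<Colon> A"
| eq_conv: "\<Gamma> \<turnstile> a \<doteq> b \<Colon> A \<Longrightarrow> \<Gamma> \<turnstile> A \<doteq> B \<Colon> Ty \<Longrightarrow> \<Gamma> \<turnstile> a \<doteq> b \<Colon> B"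
| eq_subst: "\<Delta> \<turnstile> a \<doteq> b \<Colon> A \<Longrightarrow> ctx \<Gamma>
    \<Longrightarrow> (\<forall>i < length \<Delta>. \<Gamma> \<turnstile> \<sigma> i \<Colon> (\<Delta> ! i)\<langle>\<up>(i + 1)\<rangle>\<langle>\<sigma>\<rangle>)
    \<Longrightarrow> \<Gamma> \<turnstile> a\<langle>\<sigma>\<rangle> \<doteq> b\<langle>\<sigma>\<rangle> \<Colon> A\<langle>\<sigma>\<rangle>"
| subst_eq: "\<Delta> \<turnstile> a \<Colon> A \<Longrightarrow> ctx \<Gamma>
    \<Longrightarrow> (\<forall>i < length \<Delta>. \<Gamma> \<turnstile> \<sigma> i \<doteq> \<tau> i \<Colon> (\<Delta> ! i)\<langle>\<up>(i + 1)\<rangle>\<langle>\<sigma>\<rangle>)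
    \<Longrightarrow> \<Gamma> \<turnstile> a\<langle>\<sigma>\<rangle> \<doteq> a\<langle>\<tau>\<rangle> \<Colon> A\<langle>\<sigma>\<rangle>"

| univ: "ctx \<Gamma> \<Longrightarrow> \<Gamma> \<turnstile> U \<Colon> Ty"
| small: "\<Gamma> \<turnstile> A \<Colon> U \<Longrightarrow> \<Gamma> \<turnstile> A \<Colon> Ty"
| eq_small: "\<Gamma> \<turnstile> A \<doteq> B \<Colon> U \<Longrightarrow> \<Gamma> \<turnstile> A \<doteq> B \<Colon> Ty"

| Pi: "S \<in> {U, Ty} \<Longrightarrow> \<Gamma> \<turnstile> A \<Colon> S \<Longrightarrow> A # \<Gamma> \<turnstile> B \<Colon> S \<Longrightarrow> \<Gamma> \<turnstile> Pi A B \<Colon> S"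
| Lam: "A # \<Gamma> \<turnstile> B \<Colon> Ty \<Longrightarrow> A # \<Gamma> \<turnstile> b \<Colon> B \<Longrightarrow> \<Gamma> \<turnstile> Lam A b \<Colon> Pi A B"
| App: "\<Gamma> \<turnstile> f \<Colon> Pi A B \<Longrightarrow> \<Gamma> \<turnstile> a \<Colon> A \<Longrightarrow> \<Gamma> \<turnstile> App f a \<Colon> B\<langle>a \<cdot> Var\<rangle>"
| Pi_beta: "A # \<Gamma> \<turnstile> B \<Colon> Ty \<Longrightarrow> A # \<Gamma> \<turnstile> b \<Colon> B \<Longrightarrow> \<Gamma> \<turnstile> a \<Colon> A
    \<Longrightarrow> \<Gamma> \<turnstile> App (Lam A b) a \<doteq> b\<langle>a \<cdot> Var\<rangle> \<Colon> B\<langle>a \<cdot> Var\<rangle>"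
| Pi_eta: "\<Gamma> \<turnstile> f \<Colon> Pi A B \<Longrightarrow> \<Gamma> \<turnstile> f \<doteq> Lam A (App f\<langle>\<up>1\<rangle> (Var 0)) \<Colon> Pi A B"
| Pi_cong: "S \<in> {U, Ty} \<Longrightarrow> \<Gamma> \<turnstile> A \<doteq> A' \<Colon> S \<Longrightarrow> A # \<Gamma> \<turnstile> B \<doteq> B' \<Colon> S
    \<Longrightarrow> \<Gamma> \<turnstile> Pi A B \<doteq> Pi A' B' \<Colon> S"
| Lam_cong: "\<Gamma> \<turnstile> A \<doteq> A' \<Colon> Ty \<Longrightarrow> A # \<Gamma> \<turnstile> B \<Colon> Ty \<Longrightarrow> A # \<Gamma> \<turnstile> b \<doteq> b' \<Colon> B
    \<Longrightarrow> \<Gamma> \<turnstile> Lam A b \<doteq> Lam A' b' \<Colon> Pi A B"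
| App_cong: "\<Gamma> \<turnstile> f \<doteq> f' \<Colon> Pi A B \<Longrightarrow> \<Gamma> \<turnstile> a \<doteq> a' \<Colon> A
    \<Longrightarrow> \<Gamma> \<turnstile> App f a \<doteq> App f' a' \<Colon> B\<langle>a \<cdot> Var\<rangle>"

| Sigma: "S \<in> {U, Ty} \<Longrightarrow> \<Gamma> \<turnstile> A \<Colon> S \<Longrightarrow> A # \<Gamma> \<turnstile> B \<Colon> S \<Longrightarrow> \<Gamma> \<turnstile> Sigma A B \<Colon> S"
| Pair: "A # \<Gamma> \<turnstile> B \<Colon> Ty \<Longrightarrow> \<Gamma> \<turnstile> a \<Colon> A \<Longrightarrow> \<Gamma> \<turnstile> b \<Colon> B\<langle>a \<cdot> Var\<rangle>
    \<Longrightarrow> \<Gamma> \<turnstile> Pair B a b \<Colon> Sigma A B"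
| IndSigma: "Sigma A B # \<Gamma> \<turnstile> C \<Colon> Ty
    \<Longrightarrow> B # A # \<Gamma> \<turnstile> g \<Colon> C\<langle>Pair B\<langle>Var 0 \<cdot> \<up>3\<rangle> (Var 1) (Var 0) \<cdot> \<up>2\<rangle>
    \<Longrightarrow> \<Gamma> \<turnstile> p \<Colon> Sigma A B
    \<Longrightarrow> \<Gamma> \<turnstile> IndSigma C g p \<Colon> C\<langle>p \<cdot> Var\<rangle>"
| Sigma_beta: "Sigma A B # \<Gamma> \<turnstile> C \<Colon> Ty
    \<Longrightarrow> B # A # \<Gamma> \<turnstile> g \<Colon> C\<langle>Pair B\<langle>Var 0 \<cdot> \<up>3\<rangle> (Var 1) (Var 0) \<cdot> \<up>2\<rangle>
    \<Longrightarrow> \<Gamma> \<turnstile> a \<Colon> A \<Longrightarrow> \<Gamma> \<turnstile> b \<Colon> B\<langle>a \<cdot> Var\<rangle>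
    \<Longrightarrow> \<Gamma> \<turnstile> IndSigma C g (Pair B a b) \<doteq> g\<langle>b \<cdot> a \<cdot> Var\<rangle> \<Colon> C\<langle>Pair B a b \<cdot> Var\<rangle>"
| Sigma_cong: "S \<in> {U, Ty} \<Longrightarrow> \<Gamma> \<turnstile> A \<doteq> A' \<Colon> S \<Longrightarrow> A # \<Gamma> \<turnstile> B \<doteq> B' \<Colon> S
    \<Longrightarrow> \<Gamma> \<turnstile> Sigma A B \<doteq> Sigma A' B' \<Colon> S"
| Pair_cong: "A # \<Gamma> \<turnstile> B \<doteq> B' \<Colon> Ty \<Longrightarrow> \<Gamma> \<turnstile> a \<doteq> a' \<Colon> A \<Longrightarrow> \<Gamma> \<turnstile> b \<doteq> b' \<Colon> B\<langle>a \<cdot> Var\<rangle>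
    \<Longrightarrow> \<Gamma> \<turnstile> Pair B a b \<doteq> Pair B' a' b' \<Colon> Sigma A B"
| IndSigma_cong: "Sigma A B # \<Gamma> \<turnstile> C \<doteq> C' \<Colon> Ty
    \<Longrightarrow> B # A # \<Gamma> \<turnstile> g \<doteq> g' \<Colon> C\<langle>Pair B\<langle>Var 0 \<cdot> \<up>3\<rangle> (Var 1) (Var 0) \<cdot> \<up>2\<rangle>
    \<Longrightarrow> \<Gamma> \<turnstile> p \<doteq> p' \<Colon> Sigma A B
    \<Longrightarrow> \<Gamma> \<turnstile> IndSigma C g p \<doteq> IndSigma C' g' p' \<Colon> C\<langle>p \<cdot> Var\<rangle>"

| Sum: "S \<in> {U, Ty} \<Longrightarrow> \<Gamma> \<turnstile> A \<Colon> S \<Longrightarrow> \<Gamma> \<turnstile> B \<Colon> S \<Longrightarrow> \<Gamma> \<turnstile> Sum A B \<Colon> S"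
| InL: "\<Gamma> \<turnstile> A \<Colon> Ty \<Longrightarrow> \<Gamma> \<turnstile> B \<Colon> Ty \<Longrightarrow> \<Gamma> \<turnstile> a \<Colon> A \<Longrightarrow> \<Gamma> \<turnstile> InL B a \<Colon> Sum A B"
| InR: "\<Gamma> \<turnstile> A \<Colon> Ty \<Longrightarrow> \<Gamma> \<turnstile> B \<Colon> Ty \<Longrightarrow> \<Gamma> \<turnstile> b \<Colon> B \<Longrightarrow> \<Gamma> \<turnstile> InR A b \<Colon> Sum A B"
| IndSum: "Sum A B # \<Gamma> \<turnstile> C \<Colon> Ty
    \<Longrightarrow> A # \<Gamma> \<turnstile> l \<Colon> C\<langle>InL B\<langle>\<up>1\<rangle> (Var 0) \<cdot> \<up>1\<rangle>
    \<Longrightarrow> B # \<Gamma> \<turnstile> r \<Colon> C\<langle>InR A\<langle>\<up>1\<rangle> (Var 0) \<cdot> \<up>1\<rangle>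
    \<Longrightarrow> \<Gamma> \<turnstile> t \<Colon> Sum A B
    \<Longrightarrow> \<Gamma> \<turnstile> IndSum C l r t \<Colon> C\<langle>t \<cdot> Var\<rangle>"
| Sum_beta_l: "Sum A B # \<Gamma> \<turnstile> C \<Colon> Ty
    \<Longrightarrow> A # \<Gamma> \<turnstile> l \<Colon> C\<langle>InL B\<langle>\<up>1\<rangle> (Var 0) \<cdot> \<up>1\<rangle>
    \<Longrightarrow> B # \<Gamma> \<turnstile> r \<Colon> C\<langle>InR A\<langle>\<up>1\<rangle> (Var 0) \<cdot> \<up>1\<rangle>
    \<Longrightarrow> \<Gamma> \<turnstile> a \<Colon> A
    \<Longrightarrow> \<Gamma> \<turnstile> IndSum C l r (InL B a) \<doteq> l\<langle>a \<cdot> Var\<rangle> \<Colon> C\<langle>InL B a \<cdot> Var\<rangle>"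
| Sum_beta_r: "Sum A B # \<Gamma> \<turnstile> C \<Colon> Ty
    \<Longrightarrow> A # \<Gamma> \<turnstile> l \<Colon> C\<langle>InL B\<langle>\<up>1\<rangle> (Var 0) \<cdot> \<up>1\<rangle>
    \<Longrightarrow> B # \<Gamma> \<turnstile> r \<Colon> C\<langle>InR A\<langle>\<up>1\<rangle> (Var 0) \<cdot> \<up>1\<rangle>
    \<Longrightarrow> \<Gamma> \<turnstile> b \<Colon> B
    \<Longrightarrow> \<Gamma> \<turnstile> IndSum C l r (InR A b) \<doteq> r\<langle>b \<cdot> Var\<rangle> \<Colon> C\<langle>InR A b \<cdot> Var\<rangle>"
| Sum_cong: "S \<in> {U, Ty} \<Longrightarrow> \<Gamma> \<turnstile> A \<doteq> A' \<Colon> S \<Longrightarrow> \<Gamma> \<turnstile> B \<doteq> B' \<Colon> S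
    \<Longrightarrow> \<Gamma> \<turnstile> Sum A B \<doteq> Sum A' B' \<Colon> S"
| InL_cong: "\<Gamma> \<turnstile> A \<Colon> Ty \<Longrightarrow> \<Gamma> \<turnstile> B \<doteq> B' \<Colon> Ty \<Longrightarrow> \<Gamma> \<turnstile> a \<doteq> a' \<Colon> A
    \<Longrightarrow> \<Gamma> \<turnstile> InL B a \<doteq> InL B' a' \<Colon> Sum A B"
| InR_cong: "\<Gamma> \<turnstile> A \<doteq> A' \<Colon> Ty \<Longrightarrow> \<Gamma> \<turnstile> B \<Colon> Ty \<Longrightarrow> \<Gamma> \<turnstile> b \<doteq> b' \<Colon> B
    \<Longrightarrow> \<Gamma> \<turnstile> InR A b \<doteq> InR A' b' \<Colon> Sum A B"
| IndSum_cong: "Sum A B # \<Gamma> \<turnstile> C \<doteq> C' \<Colon> Ty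
    \<Longrightarrow> A # \<Gamma> \<turnstile> l \<doteq> l' \<Colon> C\<langle>InL B\<langle>\<up>1\<rangle> (Var 0) \<cdot> \<up>1\<rangle>
    \<Longrightarrow> B # \<Gamma> \<turnstile> r \<doteq> r' \<Colon> C\<langle>InR A\<langle>\<up>1\<rangle> (Var 0) \<cdot> \<up>1\<rangle>
    \<Longrightarrow> \<Gamma> \<turnstile> t \<doteq> t' \<Colon> Sum A B
    \<Longrightarrow> \<Gamma> \<turnstile> IndSum C l r t \<doteq> IndSum C' l' r' t' \<Colon> C\<langle>t \<cdot> Var\<rangle>"

| Empty: "ctx \<Gamma> \<Longrightarrow> \<Gamma> \<turnstile> Empty \<Colon> U"
| IndEmpty: "Empty # \<Gamma> \<turnstile> C \<Colon> Ty \<Longrightarrow> \<Gamma> \<turnstile> t \<Colon> Empty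
    \<Longrightarrow> \<Gamma> \<turnstile> IndEmpty C t \<Colon> C\<langle>t \<cdot> Var\<rangle>"
| IndEmpty_cong: "Empty # \<Gamma> \<turnstile> C \<doteq> C' \<Colon> Ty \<Longrightarrow> \<Gamma> \<turnstile> t \<doteq> t' \<Colon> Empty
    \<Longrightarrow> \<Gamma> \<turnstile> IndEmpty C t \<doteq> IndEmpty C' t' \<Colon> C\<langle>t \<cdot> Var\<rangle>"

| Unit: "ctx \<Gamma> \<Longrightarrow> \<Gamma> \<turnstile> Unit \<Colon> U"
| Star: "ctx \<Gamma> \<Longrightarrow> \<Gamma> \<turnstile> Star \<Colon> Unit"
| IndUnit: "Unit # \<Gamma> \<turnstile> C \<Colon> Ty \<Longrightarrow> \<Gamma> \<turnstile> c \<Colon> C\<langle>Star \<cdot> Var\<rangle> \<Longrightarrow> \<Gamma> \<turnstile> t \<Colon> Unit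
    \<Longrightarrow> \<Gamma> \<turnstile> IndUnit C c t \<Colon> C\<langle>t \<cdot> Var\<rangle>"
| Unit_beta: "Unit # \<Gamma> \<turnstile> C \<Colon> Ty \<Longrightarrow> \<Gamma> \<turnstile> c \<Colon> C\<langle>Star \<cdot> Var\<rangle>
    \<Longrightarrow> \<Gamma> \<turnstile> IndUnit C c Star \<doteq> c \<Colon> C\<langle>Star \<cdot> Var\<rangle>"
| IndUnit_cong: "Unit # \<Gamma> \<turnstile> C \<doteq> C' \<Colon> Ty \<Longrightarrow> \<Gamma> \<turnstile> c \<doteq> c' \<Colon> C\<langle>Star \<cdot> Var\<rangle> \<Longrightarrow> \<Gamma> \<turnstile> t \<doteq> t' \<Colon> Unit
    \<Longrightarrow> \<Gamma> \<turnstile> IndUnit C c t \<doteq> IndUnit C' c' t' \<Colon> C\<langle>t \<cdot> Var\<rangle>"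

| Nat: "ctx \<Gamma> \<Longrightarrow> \<Gamma> \<turnstile> Nat \<Colon> U"
| Zero: "ctx \<Gamma> \<Longrightarrow> \<Gamma> \<turnstile> Zero \<Colon> Nat"
| Succ: "\<Gamma> \<turnstile> n \<Colon> Nat \<Longrightarrow> \<Gamma> \<turnstile> Succ n \<Colon> Nat"
| IndNat: "Nat # \<Gamma> \<turnstile> C \<Colon> Ty \<Longrightarrow> \<Gamma> \<turnstile> z \<Colon> C\<langle>Zero \<cdot> Var\<rangle>
    \<Longrightarrow> C # Nat # \<Gamma> \<turnstile> s \<Colon> C\<langle>Succ (Var 1) \<cdot> \<up>2\<rangle> \<Longrightarrow> \<Gamma> \<turnstile> n \<Colon> Nat
    \<Longrightarrow> \<Gamma> \<turnstile> IndNat C z s n \<Colon> C\<langle>n \<cdot> Var\<rangle>"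
| Nat_beta_zero: "Nat # \<Gamma> \<turnstile> C \<Colon> Ty \<Longrightarrow> \<Gamma> \<turnstile> z \<Colon> C\<langle>Zero \<cdot> Var\<rangle>
    \<Longrightarrow> C # Nat # \<Gamma> \<turnstile> s \<Colon> C\<langle>Succ (Var 1) \<cdot> \<up>2\<rangle>
    \<Longrightarrow> \<Gamma> \<turnstile> IndNat C z s Zero \<doteq> z \<Colon> C\<langle>Zero \<cdot> Var\<rangle>"
| Nat_beta_succ: "Nat # \<Gamma> \<turnstile> C \<Colon> Ty \<Longrightarrow> \<Gamma> \<turnstile> z \<Colon> C\<langle>Zero \<cdot> Var\<rangle>
    \<Longrightarrow> C # Nat # \<Gamma> \<turnstile> s \<Colon> C\<langle>Succ (Var 1) \<cdot> \<up>2\<rangle> \<Longrightarrow> \<Gamma> \<turnstile> n \<Colon> Nat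
    \<Longrightarrow> \<Gamma> \<turnstile> IndNat C z s (Succ n) \<doteq> s\<langle>IndNat C z s n \<cdot> n \<cdot> Var\<rangle> \<Colon> C\<langle>Succ n \<cdot> Var\<rangle>"
| Succ_cong: "\<Gamma> \<turnstile> n \<doteq> n' \<Colon> Nat \<Longrightarrow> \<Gamma> \<turnstile> Succ n \<doteq> Succ n' \<Colon> Nat"
| IndNat_cong: "Nat # \<Gamma> \<turnstile> C \<doteq> C' \<Colon> Ty \<Longrightarrow> \<Gamma> \<turnstile> z \<doteq> z' \<Colon> C\<langle>Zero \<cdot> Var\<rangle>
    \<Longrightarrow> C # Nat # \<Gamma> \<turnstile> s \<doteq> s' \<Colon> C\<langle>Succ (Var 1) \<cdot> \<up>2\<rangle> \<Longrightarrow> \<Gamma> \<turnstile> n \<doteq> n' \<Colon> Nat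
    \<Longrightarrow> \<Gamma> \<turnstile> IndNat C z s n \<doteq> IndNat C' z' s' n' \<Colon> C\<langle>n \<cdot> Var\<rangle>"

| Id: "S \<in> {U, Ty} \<Longrightarrow> \<Gamma> \<turnstile> A \<Colon> S \<Longrightarrow> \<Gamma> \<turnstile> a \<Colon> A \<Longrightarrow> \<Gamma> \<turnstile> b \<Colon> A \<Longrightarrow> \<Gamma> \<turnstile> Id A a b \<Colon> S"
| Refl: "\<Gamma> \<turnstile> A \<Colon> Ty \<Longrightarrow> \<Gamma> \<turnstile> a \<Colon> A \<Longrightarrow> \<Gamma> \<turnstile> Refl a \<Colon> Id A a a"
| J: "Id A\<langle>\<up>2\<rangle> (Var 1) (Var 0) # A\<langle>\<up>1\<rangle> # A # \<Gamma> \<turnstile> C \<Colon> Ty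
    \<Longrightarrow> A # \<Gamma> \<turnstile> c \<Colon> C\<langle>Refl (Var 0) \<cdot> Var 0 \<cdot> Var 0 \<cdot> \<up>1\<rangle>
    \<Longrightarrow> \<Gamma> \<turnstile> a \<Colon> A \<Longrightarrow> \<Gamma> \<turnstile> b \<Colon> A \<Longrightarrow> \<Gamma> \<turnstile> p \<Colon> Id A a b
    \<Longrightarrow> \<Gamma> \<turnstile> J C c a b p \<Colon> C\<langle>p \<cdot> b \<cdot> a \<cdot> Var\<rangle>"
| Id_beta: "Id A\<langle>\<up>2\<rangle> (Var 1) (Var 0) # A\<langle>\<up>1\<rangle> # A # \<Gamma> \<turnstile> C \<Colon> Ty
    \<Longrightarrow> A # \<Gamma> \<turnstile> c \<Colon> C\<langle>Refl (Var 0) \<cdot> Var 0 \<cdot> Var 0 \<cdot> \<up>1\<rangle>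
    \<Longrightarrow> \<Gamma> \<turnstile> a \<Colon> A
    \<Longrightarrow> \<Gamma> \<turnstile> J C c a a (Refl a) \<doteq> c\<langle>a \<cdot> Var\<rangle> \<Colon> C\<langle>Refl a \<cdot> a \<cdot> a \<cdot> Var\<rangle>"
| Id_cong: "S \<in> {U, Ty} \<Longrightarrow> \<Gamma> \<turnstile> A \<doteq> A' \<Colon> S \<Longrightarrow> \<Gamma> \<turnstile> a \<doteq> a' \<Colon> A \<Longrightarrow> \<Gamma> \<turnstile> b \<doteq> b' \<Colon> A
    \<Longrightarrow> \<Gamma> \<turnstile> Id A a b \<doteq> Id A' a' b' \<Colon> S"
| Refl_cong: "\<Gamma> \<turnstile> A \<Colon> Ty \<Longrightarrow> \<Gamma> \<turnstile> a \<doteq> a' \<Colon> A \<Longrightarrow> \<Gamma> \<turnstile> Refl a \<doteq> Refl a' \<Colon> Id A a a"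
| J_cong: "Id A\<langle>\<up>2\<rangle> (Var 1) (Var 0) # A\<langle>\<up>1\<rangle> # A # \<Gamma> \<turnstile> C \<doteq> C' \<Colon> Ty
    \<Longrightarrow> A # \<Gamma> \<turnstile> c \<doteq> c' \<Colon> C\<langle>Refl (Var 0) \<cdot> Var 0 \<cdot> Var 0 \<cdot> \<up>1\<rangle>
    \<Longrightarrow> \<Gamma> \<turnstile> a \<doteq> a' \<Colon> A \<Longrightarrow> \<Gamma> \<turnstile> b \<doteq> b' \<Colon> A \<Longrightarrow> \<Gamma> \<turnstile> p \<doteq> p' \<Colon> Id A a b
    \<Longrightarrow> \<Gamma> \<turnstile> J C c a b p \<doteq> J C' c' a' b' p' \<Colon> C\<langle>p \<cdot> b \<cdot> a \<cdot> Var\<rangle>"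

| Colim: "\<Gamma> \<turnstile> G0 \<Colon> U \<Longrightarrow> \<Gamma> \<turnstile> G1 \<Colon> arrow G0 (arrow G0 U) \<Longrightarrow> \<Gamma> \<turnstile> Colim G0 G1 \<Colon> U"
| C0: "\<Gamma> \<turnstile> G0 \<Colon> U \<Longrightarrow> \<Gamma> \<turnstile> G1 \<Colon> arrow G0 (arrow G0 U) \<Longrightarrow> \<Gamma> \<turnstile> i \<Colon> G0
    \<Longrightarrow> \<Gamma> \<turnstile> C0 G1 i \<Colon> Colim G0 G1"
| C1: "\<Gamma> \<turnstile> G0 \<Colon> U \<Longrightarrow> \<Gamma> \<turnstile> G1 \<Colon> arrow G0 (arrow G0 U)
    \<Longrightarrow> \<Gamma> \<turnstile> i \<Colon> G0 \<Longrightarrow> \<Gamma> \<turnstile> j \<Colon> G0 \<Longrightarrow> \<Gamma> \<turnstile> e \<Colon> App (App G1 i) j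
    \<Longrightarrow> \<Gamma> \<turnstile> C1 G1 i j e \<Colon> Id (Colim G0 G1) (C0 G1 i) (C0 G1 j)"
| IndColim: "\<Gamma> \<turnstile> G0 \<Colon> U \<Longrightarrow> \<Gamma> \<turnstile> G1 \<Colon> arrow G0 (arrow G0 U)
    \<Longrightarrow> Colim G0 G1 # \<Gamma> \<turnstile> P \<Colon> Ty
    \<Longrightarrow> G0 # \<Gamma> \<turnstile> d0 \<Colon> P\<langle>C0 G1\<langle>\<up>1\<rangle> (Var 0) \<cdot> \<up>1\<rangle>
    \<Longrightarrow> App (App G1\<langle>\<up>2\<rangle> (Var 1)) (Var 0) # G0\<langle>\<up>1\<rangle> # G0 # \<Gamma> \<turnstile> d1 \<Colon> d1_type G1 P d0
    \<Longrightarrow> \<Gamma> \<turnstile> t \<Colon> Colim G0 G1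
    \<Longrightarrow> \<Gamma> \<turnstile> IndColim P d0 d1 t \<Colon> P\<langle>t \<cdot> Var\<rangle>"
| Colim_beta: "\<Gamma> \<turnstile> G0 \<Colon> U \<Longrightarrow> \<Gamma> \<turnstile> G1 \<Colon> arrow G0 (arrow G0 U)
    \<Longrightarrow> Colim G0 G1 # \<Gamma> \<turnstile> P \<Colon> Ty
    \<Longrightarrow> G0 # \<Gamma> \<turnstile> d0 \<Colon> P\<langle>C0 G1\<langle>\<up>1\<rangle> (Var 0) \<cdot> \<up>1\<rangle>
    \<Longrightarrow> App (App G1\<langle>\<up>2\<rangle> (Var 1)) (Var 0) # G0\<langle>\<up>1\<rangle> # G0 # \<Gamma> \<turnstile> d1 \<Colon> d1_type G1 P d0
    \<Longrightarrow> \<Gamma> \<turnstile> i \<Colon> G0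
    \<Longrightarrow> \<Gamma> \<turnstile> IndColim P d0 d1 (C0 G1 i) \<doteq> d0\<langle>i \<cdot> Var\<rangle> \<Colon> P\<langle>C0 G1 i \<cdot> Var\<rangle>"
| CompColim: "\<Gamma> \<turnstile> G0 \<Colon> U \<Longrightarrow> \<Gamma> \<turnstile> G1 \<Colon> arrow G0 (arrow G0 U)
    \<Longrightarrow> Colim G0 G1 # \<Gamma> \<turnstile> P \<Colon> Ty
    \<Longrightarrow> G0 # \<Gamma> \<turnstile> d0 \<Colon> P\<langle>C0 G1\<langle>\<up>1\<rangle> (Var 0) \<cdot> \<up>1\<rangle>
    \<Longrightarrow> App (App G1\<langle>\<up>2\<rangle> (Var 1)) (Var 0) # G0\<langle>\<up>1\<rangle> # G0 # \<Gamma> \<turnstile> d1 \<Colon> d1_type G1 P d0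
    \<Longrightarrow> \<Gamma> \<turnstile> i \<Colon> G0 \<Longrightarrow> \<Gamma> \<turnstile> j \<Colon> G0 \<Longrightarrow> \<Gamma> \<turnstile> e \<Colon> App (App G1 i) j
    \<Longrightarrow> \<Gamma> \<turnstile> CompColim G1 P d0 d1 i j e \<Colon> comp1_type G0 G1 P d0 d1 i j e"
| Colim_cong: "\<Gamma> \<turnstile> G0 \<doteq> G0' \<Colon> U \<Longrightarrow> \<Gamma> \<turnstile> G1 \<doteq> G1' \<Colon> arrow G0 (arrow G0 U)
    \<Longrightarrow> \<Gamma> \<turnstile> Colim G0 G1 \<doteq> Colim G0' G1' \<Colon> U"
| C0_cong: "\<Gamma> \<turnstile> G0 \<Colon> U \<Longrightarrow> \<Gamma> \<turnstile> G1 \<doteq> G1' \<Colon> arrow G0 (arrow G0 U) \<Longrightarrow> \<Gamma> \<turnstile> i \<doteq> i' \<Colon> G0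
    \<Longrightarrow> \<Gamma> \<turnstile> C0 G1 i \<doteq> C0 G1' i' \<Colon> Colim G0 G1"
| C1_cong: "\<Gamma> \<turnstile> G0 \<Colon> U \<Longrightarrow> \<Gamma> \<turnstile> G1 \<doteq> G1' \<Colon> arrow G0 (arrow G0 U)
    \<Longrightarrow> \<Gamma> \<turnstile> i \<doteq> i' \<Colon> G0 \<Longrightarrow> \<Gamma> \<turnstile> j \<doteq> j' \<Colon> G0 \<Longrightarrow> \<Gamma> \<turnstile> e \<doteq> e' \<Colon> App (App G1 i) j
    \<Longrightarrow> \<Gamma> \<turnstile> C1 G1 i j e \<doteq> C1 G1' i' j' e' \<Colon> Id (Colim G0 G1) (C0 G1 i) (C0 G1 j)"
| IndColim_cong: "\<Gamma> \<turnstile> G0 \<Colon> U \<Longrightarrow> \<Gamma> \<turnstile> G1 \<Colon> arrow G0 (arrow G0 U)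
    \<Longrightarrow> Colim G0 G1 # \<Gamma> \<turnstile> P \<doteq> P' \<Colon> Ty
    \<Longrightarrow> G0 # \<Gamma> \<turnstile> d0 \<doteq> d0' \<Colon> P\<langle>C0 G1\<langle>\<up>1\<rangle> (Var 0) \<cdot> \<up>1\<rangle>
    \<Longrightarrow> App (App G1\<langle>\<up>2\<rangle> (Var 1)) (Var 0) # G0\<langle>\<up>1\<rangle> # G0 # \<Gamma> \<turnstile> d1 \<doteq> d1' \<Colon> d1_type G1 P d0
    \<Longrightarrow> \<Gamma> \<turnstile> t \<doteq> t' \<Colon> Colim G0 G1
    \<Longrightarrow> \<Gamma> \<turnstile> IndColim P d0 d1 t \<doteq> IndColim P' d0' d1' t' \<Colon> P\<langle>t \<cdot> Var\<rangle>"
| CompColim_cong: "\<Gamma> \<turnstile> G0 \<Colon> U \<Longrightarrow> \<Gamma> \<turnstile> G1 \<doteq> G1' \<Colon> arrow G0 (arrow G0 U)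
    \<Longrightarrow> Colim G0 G1 # \<Gamma> \<turnstile> P \<doteq> P' \<Colon> Ty
    \<Longrightarrow> G0 # \<Gamma> \<turnstile> d0 \<doteq> d0' \<Colon> P\<langle>C0 G1\<langle>\<up>1\<rangle> (Var 0) \<cdot> \<up>1\<rangle>
    \<Longrightarrow> App (App G1\<langle>\<up>2\<rangle> (Var 1)) (Var 0) # G0\<langle>\<up>1\<rangle> # G0 # \<Gamma> \<turnstile> d1 \<doteq> d1' \<Colon> d1_type G1 P d0
    \<Longrightarrow> \<Gamma> \<turnstile> i \<doteq> i' \<Colon> G0 \<Longrightarrow> \<Gamma> \<turnstile> j \<doteq> j' \<Colon> G0 \<Longrightarrow> \<Gamma> \<turnstile> e \<doteq> e' \<Colon> App (App G1 i) j
    \<Longrightarrow> \<Gamma> \<turnstile> CompColim G1 P d0 d1 i j e \<doteq> CompColim G1' P' d0' d1' i' j' e'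
          \<Colon> comp1_type G0 G1 P d0 d1 i j e"

| FunExt: "A # \<Gamma> \<turnstile> B \<Colon> Ty \<Longrightarrow> \<Gamma> \<turnstile> FunExt A B \<Colon> funext_type A B"
| FunExt_cong: "\<Gamma> \<turnstile> A \<doteq> A' \<Colon> Ty \<Longrightarrow> A # \<Gamma> \<turnstile> B \<doteq> B' \<Colon> Ty
    \<Longrightarrow> \<Gamma> \<turnstile> FunExt A B \<doteq> FunExt A' B' \<Colon> funext_type A B"
| UA: "ctx \<Gamma> \<Longrightarrow> \<Gamma> \<turnstile> UA \<Colon> univalence_type"


section \<open>Images\<close>

text \<open>\<open>Hom A B X f g\<close> is \<open>Hom\<^sub>X(f, g) = \<Sigma>(h : A \<rightarrow> B). f \<sim> g \<circ> h\<close> for \<open>f : A \<rightarrow> X\<close> and \<open>g : B \<rightarrow> X\<close>.\<close>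

definition hom_fam :: "tm \<Rightarrow> tm \<Rightarrow> tm \<Rightarrow> tm \<Rightarrow> tm" where
  "hom_fam A X f g = htpy A\<langle>\<up>1\<rangle> X\<langle>\<up>1\<rangle> f\<langle>\<up>1\<rangle> (comp A\<langle>\<up>1\<rangle> g\<langle>\<up>1\<rangle> (Var 0))"

definition Hom :: "tm \<Rightarrow> tm \<Rightarrow> tm \<Rightarrow> tm \<Rightarrow> tm \<Rightarrow> tm" where
  "Hom A B X f g = Sigma (arrow A B) (hom_fam A X f g)"

text \<open>
  For \<open>f' : A' \<rightarrow> X\<close>, \<open>i : A \<rightarrow> A'\<close> and \<open>I : f \<sim> f' \<circ> i\<close>, the map
  \<open>phi A A' B X f f' g i I : Hom\<^sub>X(f', g) \<rightarrow> Hom\<^sub>X(f, g)\<close> is given on pairs by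
  \<open>(h, H) \<mapsto> (h \<circ> i, \<lambda>a. I(a) \<cdot> H(i(a)))\<close>.
\<close>

definition precomp :: "tm \<Rightarrow> tm \<Rightarrow> tm \<Rightarrow> tm \<Rightarrow> tm \<Rightarrow> tm \<Rightarrow> tm \<Rightarrow> tm \<Rightarrow> tm \<Rightarrow> tm" where
  "precomp A X f f' g i I h H =
     Pair (hom_fam A X f g) (comp A h i)
       (Lam A
         (let a = Var 0; ia = App i\<langle>\<up>1\<rangle> a in
          concat X\<langle>\<up>1\<rangle> (App f\<langle>\<up>1\<rangle> a) (App f'\<langle>\<up>1\<rangle> ia) (App g\<langle>\<up>1\<rangle> (App h\<langle>\<up>1\<rangle> ia))
            (App I\<langle>\<up>1\<rangle> a) (App H\<langle>\<up>1\<rangle> ia)))"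

definition phi :: "tm \<Rightarrow> tm \<Rightarrow> tm \<Rightarrow> tm \<Rightarrow> tm \<Rightarrow> tm \<Rightarrow> tm \<Rightarrow> tm \<Rightarrow> tm \<Rightarrow> tm" where
  "phi A A' B X f f' g i I =
     Lam (Hom A' B X f' g)
       (IndSigma (Hom A B X f g)\<langle>\<up>2\<rangle>
          (precomp A\<langle>\<up>3\<rangle> X\<langle>\<up>3\<rangle> f\<langle>\<up>3\<rangle> f'\<langle>\<up>3\<rangle> g\<langle>\<up>3\<rangle> i\<langle>\<up>3\<rangle> I\<langle>\<up>3\<rangle> (Var 1) (Var 0))
          (Var 0))"

text \<open>
  In context \<open>\<Gamma>\<close>, the terms \<open>im\<close>, \<open>i\<close>, \<open>q\<close>, \<open>Q\<close> form an image of \<open>f : A \<rightarrow> X\<close>. The test object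
  \<open>B\<close> may be any type, not necessarily in the universe.
\<close>

definition is_image :: "tm list \<Rightarrow> tm \<Rightarrow> tm \<Rightarrow> tm \<Rightarrow> tm \<Rightarrow> tm \<Rightarrow> tm \<Rightarrow> tm \<Rightarrow> bool" where
  "is_image \<Gamma> A X f im i q Q \<longleftrightarrow>
     \<Gamma> \<turnstile> im \<Colon> U \<and>
     \<Gamma> \<turnstile> i \<Colon> arrow im X \<and>
     (\<exists>e. \<Gamma> \<turnstile> e \<Colon> isemb im X i) \<and>
     \<Gamma> \<turnstile> q \<Colon> arrow A im \<and>
     \<Gamma> \<turnstile> Q \<Colon> htpy A X f (comp A i q) \<and>
     (\<forall>B g m. \<Gamma> \<turnstile> B \<Colon> Ty \<longrightarrow> \<Gamma> \<turnstile> g \<Colon> arrow B X \<longrightarrow> \<Gamma> \<turnstile> m \<Colon> isemb B X g \<longrightarrow>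
       (\<exists>t. \<Gamma> \<turnstile> t \<Colon> isequiv (Hom im B X i g) (Hom A B X f g) (phi A im B X f i g q Q)))"

definition app3 :: "tm \<Rightarrow> tm \<Rightarrow> tm \<Rightarrow> tm \<Rightarrow> tm" where
  "app3 t a b c = App (App (App t a) b) c"

end

theory Submission
  imports Defs
begin

text \<open>
  The image of \<open>f\<close> is \<open>\<Sigma>(x : X). \<parallel>fib\<^sub>f(x)\<parallel>\<close>. The truncation \<open>\<parallel>A\<parallel>\<close> is van Doorn's: the sequential
  colimit of \<open>A \<rightarrow> {A} \<rightarrow> {{A}} \<rightarrow> \<dots>\<close>, where \<open>{B}\<close> is the quotient of \<open>B\<close> by the graph with
  \<open>\<Gamma>\<^sub>1(i, j) = 1\<close>. It maps into a proposition of any size as soon as \<open>A\<close> does, since this holds for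
  \<open>{_}\<close> and for sequential colimits. The maps \<open>B \<rightarrow> {B}\<close> identify any two points; hence, given a point
  of \<open>A\<close>, the colimit is contractible, by naturality of the null-homotopies. As being a proposition is a
  proposition, the point may be supplied by an element of \<open>\<parallel>A\<parallel>\<close> itself, so \<open>\<parallel>A\<parallel>\<close> is a proposition.
  Finally, \<open>Hom\<^sub>X(f, g)\<close> is a proposition for every embedding \<open>g\<close>, by function extensionality, so the
  universal property only asks for a map backwards, which the elimination of truncations provides.

  Derivability of a type is used in the form \<open>inh \<Gamma> A\<close>: only those terms are named that occur in
  other types.
\<close>

section \<open>Substitution calculus\<close>

text \<open>Path algebra is largely avoided. An equation between paths is solved or cancelled
  because transport along a path is surjective (\<open>inh_tr_surj\<close>) and injective
  (\<open>inh_tr_inj\<close>), both immediate by path induction. In the same spirit a type is shown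
  to be a proposition by covering it with a proposition (\<open>inh_isprop_surj\<close>), instead of
  transferring along an equivalence.

  The naturality mentioned above is the real obstacle. Constancy of \<open>s\<close> yields paths
  \<open>K\<close> from \<open>a (n + 1)\<close> to \<open>s x\<close>, but for
  \<open>x = a n\<close> such a path is a loop that nothing forces to be trivial. Paths from the
  centre that ignore these loops therefore need not commute with the glue paths of the colimit; the
  recursion for \<open>C\<close> in \<open>null_sequence\<close> absorbs the loops.

  The theorem asks for closed terms that work in every context. The image is thus built for a
  generic map in a context of three variables and then abstracted. Applying the abstraction returns
  the construction only up to beta-conversion, so being an image has to be invariant under
  judgemental equality (\<open>is_image_eq\<close>).\<close>

declare One_nat_def [simp del]

abbreviation weaken :: "tm \<Rightarrow> nat \<Rightarrow> tm" ("_\<up>_" [1000, 1000] 1000) where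
  "t\<up>k \<equiv> sub t (\<up>k)"

text \<open>Type checking alternates two phases: \<open>sbs\<close> normalises explicit
  substitutions, \<open>tyr\<close> applies typing rules. Where a type would have to be matched up
  to substitution, the rules use a variable \<open>T\<close> and an equation, which
  \<open>refl\<close> closes after normalisation. Indices stay numerals, hence the removal of
  \<open>One_nat_def\<close>.\<close>

named_theorems sbs
named_theorems tyr

declare refl [tyr]

definition scomp :: "(nat \<Rightarrow> tm) \<Rightarrow> (nat \<Rightarrow> tm) \<Rightarrow> nat \<Rightarrow> tm" (infixr ";;" 60) where
  "\<sigma> ;; \<tau> = (\<lambda>n. (\<sigma> n)\<langle>\<tau>\<rangle>)"

lemma upren_apply: "upren \<xi> 0 = 0" "upren \<xi> (Suc n) = Suc (\<xi> n)"
  by (simp_all add: upren_def)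

lemma up_apply: "up \<sigma> 0 = Var 0" "up \<sigma> (Suc n) = ren (\<sigma> n) Suc"
  by (simp_all add: up_def scons_def)

lemma up_Var_comp: "up (\<lambda>n. Var (\<xi> n)) = (\<lambda>n. Var (upren \<xi> n))"
proof
  show "up (\<lambda>n. Var (\<xi> n)) n = Var (upren \<xi> n)" for n
    by (cases n) (simp_all add: up_apply upren_apply)
qed

lemma ren_eq_sub: "ren t \<xi> = t\<langle>\<lambda>n. Var (\<xi> n)\<rangle>"
  by (induction t arbitrary: \<xi>) (simp_all add: up_Var_comp)

lemma up_comp_upren: "(\<lambda>n. up \<tau> (upren \<xi> n)) = up (\<lambda>n. \<tau> (\<xi> n))"
proof
  show "up \<tau> (upren \<xi> n) = up (\<lambda>n. \<tau> (\<xi> n)) n" for n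
    by (cases n) (simp_all add: up_apply upren_apply)
qed

text \<open>Since \<open>up\<close> is defined through a renaming, the composition law
  \<open>sub_sub\<close> cannot be proved at once: its binder case needs the two mixed laws,
  renaming before substitution and substitution before renaming.\<close>

lemma sub_ren: "(ren t \<xi>)\<langle>\<tau>\<rangle> = t\<langle>\<lambda>n. \<tau> (\<xi> n)\<rangle>"
  by (induction t arbitrary: \<xi> \<tau>) (simp_all add: up_comp_upren)

lemma ren_ren: "ren (ren t \<xi>) \<zeta> = ren t (\<lambda>n. \<zeta> (\<xi> n))"
  unfolding ren_eq_sub[of "ren t \<xi>"] sub_ren by (simp add: ren_eq_sub)

lemma ren_up: "(\<lambda>n. ren (up \<sigma> n) (upren \<xi>)) = up (\<lambda>n. ren (\<sigma> n) \<xi>)"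
proof
  show "ren (up \<sigma> n) (upren \<xi>) = up (\<lambda>n. ren (\<sigma> n) \<xi>) n" for n
    by (cases n) (simp_all add: up_apply upren_apply ren_ren)
qed

lemma ren_sub: "ren (t\<langle>\<sigma>\<rangle>) \<xi> = t\<langle>\<lambda>n. ren (\<sigma> n) \<xi>\<rangle>"
  by (induction t arbitrary: \<xi> \<sigma>) (simp_all add: ren_up)

lemma up_scomp: "up \<sigma> ;; up \<tau> = up (\<sigma> ;; \<tau>)"
proof
  show "(up \<sigma> ;; up \<tau>) n = up (\<sigma> ;; \<tau>) n" for n
    by (cases n) (simp_all add: up_apply scomp_def sub_ren ren_sub)
qed

lemma sub_sub: "t\<langle>\<sigma>\<rangle>\<langle>\<tau>\<rangle> = t\<langle>\<sigma> ;; \<tau>\<rangle>"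
  by (induction t arbitrary: \<sigma> \<tau>) (simp_all add: up_scomp, simp add: scomp_def)

lemma up_Var: "up Var = Var"
  using up_Var_comp[of "\<lambda>n. n"] by (auto simp: upren_def fun_eq_iff split: nat.split)

lemma sub_Var: "t\<langle>Var\<rangle> = t"
  by (induction t) (simp_all add: up_Var)

lemma up_eq: "up \<sigma> = Var 0 \<cdot> (\<sigma> ;; \<up>1)"
  unfolding up_def scomp_def ren_eq_sub shift_def by (simp add: One_nat_def)

lemma scomp_assoc: "(\<sigma> ;; \<tau>) ;; \<rho> = \<sigma> ;; (\<tau> ;; \<rho>)"
  by (simp add: scomp_def sub_sub fun_eq_iff)

lemma scons_scomp: "(a \<cdot> \<sigma>) ;; \<tau> = a\<langle>\<tau>\<rangle> \<cdot> (\<sigma> ;; \<tau>)"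
  by (auto simp: scomp_def scons_def fun_eq_iff split: nat.split)

lemma Var_scomp: "Var ;; \<sigma> = \<sigma>" and scomp_Var: "\<sigma> ;; Var = \<sigma>"
  by (simp_all add: scomp_def sub_Var)

lemma shift_0: "\<up>0 = Var"
  by (simp add: shift_def)

lemma shift_shift: "\<up>j ;; \<up>k = \<up>(j + k)" "\<up>j ;; (\<up>k ;; \<sigma>) = \<up>(j + k) ;; \<sigma>"
  by (simp_all add: shift_def scomp_def fun_eq_iff add_ac)

lemma shift_Suc_scons: "\<up>(Suc k) ;; (a \<cdot> \<sigma>) = \<up>k ;; \<sigma>"
  by (simp add: shift_def scomp_def scons_def fun_eq_iff)

lemma shift_scons: "\<up>1 ;; (a \<cdot> \<sigma>) = \<sigma>" "\<up>(numeral k) ;; (a \<cdot> \<sigma>) = \<up>(pred_numeral k) ;; \<sigma>"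
  by (simp_all add: numeral_eq_Suc One_nat_def shift_Suc_scons shift_0 Var_scomp)

lemma scons_apply: "(a \<cdot> \<sigma>) 0 = a" "(a \<cdot> \<sigma>) (Suc n) = \<sigma> n" "(a \<cdot> \<sigma>) 1 = \<sigma> 0"
    "(a \<cdot> \<sigma>) (numeral k) = \<sigma> (pred_numeral k)"
  by (simp_all add: scons_def numeral_eq_Suc One_nat_def)

lemma scomp_apply: "(\<sigma> ;; \<tau>) n = (\<sigma> n)\<langle>\<tau>\<rangle>"
  by (simp add: scomp_def)

lemma shift_apply: "(\<up>k) n = Var (n + k)"
  by (simp add: shift_def)

lemma scons_eta: "\<sigma> k \<cdot> (\<up>(Suc k) ;; \<sigma>) = \<up>k ;; \<sigma>"
  by (auto simp: scomp_def shift_def scons_def fun_eq_iff split: nat.split)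

lemma Var_scons_shift_Suc: "Var k \<cdot> \<up>(Suc k) = \<up>k"
  by (auto simp: shift_def scons_def fun_eq_iff split: nat.split)

lemma scons_eta_numeral:
  "\<sigma> 0 \<cdot> (\<up>1 ;; \<sigma>) = \<sigma>" "\<sigma> 1 \<cdot> (\<up>2 ;; \<sigma>) = \<up>1 ;; \<sigma>" "\<sigma> 2 \<cdot> (\<up>3 ;; \<sigma>) = \<up>2 ;; \<sigma>"
  using scons_eta[of \<sigma> 0] scons_eta[of \<sigma> 1] scons_eta[of \<sigma> 2]
  by (simp_all add: shift_0 Var_scomp numeral_2_eq_2 numeral_3_eq_3 One_nat_def)

lemma Var_scons_shift:
  "Var 0 \<cdot> \<up>1 = Var" "Var 1 \<cdot> \<up>2 = \<up>1" "Var 2 \<cdot> \<up>3 = \<up>2" "Var 3 \<cdot> \<up>4 = \<up>3"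
  "Var 4 \<cdot> \<up>5 = \<up>4" "Var 5 \<cdot> \<up>6 = \<up>5" "Var 6 \<cdot> \<up>7 = \<up>6" "Var 7 \<cdot> \<up>8 = \<up>7"
  using Var_scons_shift_Suc[of 0] Var_scons_shift_Suc[of 1] Var_scons_shift_Suc[of 2]
    Var_scons_shift_Suc[of 3] Var_scons_shift_Suc[of 4] Var_scons_shift_Suc[of 5]
    Var_scons_shift_Suc[of 6] Var_scons_shift_Suc[of 7]
  by (simp_all add: shift_0 numeral_eq_Suc One_nat_def)

text \<open>Under \<open>simp only\<close>, index arithmetic such as \<open>2 + 1\<close> has to be
  carried out by explicit rules.\<close>

lemmas nat_lits = one_add_one numeral_plus_numeral numeral_plus_one one_plus_numeral add_num_simps
  pred_numeral_simps add_0 add_0_right BitM.simps numeral_One numeral_2_eq_2[symmetric]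

declare sub.simps [simp del]

lemmas [sbs] = sub.simps nat_lits sub_sub sub_Var up_eq scomp_assoc scons_scomp Var_scomp scomp_Var shift_0
  shift_shift shift_scons scons_apply scomp_apply shift_apply scons_eta_numeral Var_scons_shift

text \<open>With these laws the defined notions stay folded during type checking.
  \<open>is_sec\<close>, \<open>is_retr\<close> and \<open>hom_fam\<close> have a further variable,
  so they are only pushed through substitutions lifted under it.\<close>

lemma defs_sub:
  "(arrow A B)\<langle>\<sigma>\<rangle> = arrow A\<langle>\<sigma>\<rangle> B\<langle>\<sigma>\<rangle>"
  "(prod A B)\<langle>\<sigma>\<rangle> = prod A\<langle>\<sigma>\<rangle> B\<langle>\<sigma>\<rangle>"
  "(idfun A)\<langle>\<sigma>\<rangle> = idfun A\<langle>\<sigma>\<rangle>"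
  "(comp A g f)\<langle>\<sigma>\<rangle> = comp A\<langle>\<sigma>\<rangle> g\<langle>\<sigma>\<rangle> f\<langle>\<sigma>\<rangle>"
  "(dhtpy A P f g)\<langle>\<sigma>\<rangle> = dhtpy A\<langle>\<sigma>\<rangle> P\<langle>Var 0 \<cdot> (\<sigma> ;; \<up>1)\<rangle> f\<langle>\<sigma>\<rangle> g\<langle>\<sigma>\<rangle>"
  "(htpy A B f g)\<langle>\<sigma>\<rangle> = htpy A\<langle>\<sigma>\<rangle> B\<langle>\<sigma>\<rangle> f\<langle>\<sigma>\<rangle> g\<langle>\<sigma>\<rangle>"
  "(tr P a b p u)\<langle>\<sigma>\<rangle> = tr P\<langle>Var 0 \<cdot> (\<sigma> ;; \<up>1)\<rangle> a\<langle>\<sigma>\<rangle> b\<langle>\<sigma>\<rangle> p\<langle>\<sigma>\<rangle> u\<langle>\<sigma>\<rangle>"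
  "(concat A x y z p q)\<langle>\<sigma>\<rangle> = concat A\<langle>\<sigma>\<rangle> x\<langle>\<sigma>\<rangle> y\<langle>\<sigma>\<rangle> z\<langle>\<sigma>\<rangle> p\<langle>\<sigma>\<rangle> q\<langle>\<sigma>\<rangle>"
  "(isprop A)\<langle>\<sigma>\<rangle> = isprop A\<langle>\<sigma>\<rangle>"
  "(fiber A B f b)\<langle>\<sigma>\<rangle> = fiber A\<langle>\<sigma>\<rangle> B\<langle>\<sigma>\<rangle> f\<langle>\<sigma>\<rangle> b\<langle>\<sigma>\<rangle>"
  "(isemb A B f)\<langle>\<sigma>\<rangle> = isemb A\<langle>\<sigma>\<rangle> B\<langle>\<sigma>\<rangle> f\<langle>\<sigma>\<rangle>"
  "(is_sec A B f)\<langle>Var 0 \<cdot> (\<sigma> ;; \<up>1)\<rangle> = is_sec A\<langle>\<sigma>\<rangle> B\<langle>\<sigma>\<rangle> f\<langle>\<sigma>\<rangle>"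
  "(is_retr A B f)\<langle>Var 0 \<cdot> (\<sigma> ;; \<up>1)\<rangle> = is_retr A\<langle>\<sigma>\<rangle> B\<langle>\<sigma>\<rangle> f\<langle>\<sigma>\<rangle>"
  "(isequiv A B f)\<langle>\<sigma>\<rangle> = isequiv A\<langle>\<sigma>\<rangle> B\<langle>\<sigma>\<rangle> f\<langle>\<sigma>\<rangle>"
  "(happly A P f g)\<langle>\<sigma>\<rangle> = happly A\<langle>\<sigma>\<rangle> P\<langle>Var 0 \<cdot> (\<sigma> ;; \<up>1)\<rangle> f\<langle>\<sigma>\<rangle> g\<langle>\<sigma>\<rangle>"
  "(hom_fam A X f g)\<langle>Var 0 \<cdot> (\<sigma> ;; \<up>1)\<rangle> = hom_fam A\<langle>\<sigma>\<rangle> X\<langle>\<sigma>\<rangle> f\<langle>\<sigma>\<rangle> g\<langle>\<sigma>\<rangle>"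
  "(Hom A B X f g)\<langle>\<sigma>\<rangle> = Hom A\<langle>\<sigma>\<rangle> B\<langle>\<sigma>\<rangle> X\<langle>\<sigma>\<rangle> f\<langle>\<sigma>\<rangle> g\<langle>\<sigma>\<rangle>"
  "(phi A A' B X f f' g i I)\<langle>\<sigma>\<rangle> = phi A\<langle>\<sigma>\<rangle> A'\<langle>\<sigma>\<rangle> B\<langle>\<sigma>\<rangle> X\<langle>\<sigma>\<rangle> f\<langle>\<sigma>\<rangle> f'\<langle>\<sigma>\<rangle> g\<langle>\<sigma>\<rangle> i\<langle>\<sigma>\<rangle> I\<langle>\<sigma>\<rangle>"
  by (simp_all add: sbs arrow_def prod_def idfun_def comp_def dhtpy_def htpy_def tr_def concat_def isprop_def
     fiber_def isemb_def is_sec_def is_retr_def isequiv_def happly_def hom_fam_def Hom_def phi_def precomp_def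
     Let_def)

lemmas [sbs] = defs_sub

section \<open>Structural rules\<close>

lemma drop_tl: "\<forall>n. P (drop n (x # xs)) \<Longrightarrow> \<forall>n. P (drop n xs)"
  by (metis drop_Suc_Cons)

text \<open>Many rules have premises only in an extended context, so the claim for the whole context
  is too weak for the induction. Quantifying over all suffixes provides the tail as well.\<close>

lemma ctx_presup:
  "ctx \<Gamma> \<Longrightarrow> \<forall>n. ctx (drop n \<Gamma>)"
  "\<Gamma> \<turnstile> a \<Colon> A \<Longrightarrow> \<forall>n. ctx (drop n \<Gamma>)"
  "\<Gamma> \<turnstile> a \<doteq> b \<Colon> A \<Longrightarrow> \<forall>n. ctx (drop n \<Gamma>)"
proof (induction rule: ctx_has_ty_eq_tm.inducts)
  case (ctx_cons \<Gamma> A)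
  show ?case
  proof
    show "ctx (drop n (A # \<Gamma>))" for n
      using ctx_cons by (cases n) (auto intro: ctx_has_ty_eq_tm.ctx_cons)
  qed
qed (blast dest: drop_tl | simp add: ctx_nil)+

lemma ty_ctx: "\<Gamma> \<turnstile> a \<Colon> A \<Longrightarrow> ctx \<Gamma>" and eq_ctx: "\<Gamma> \<turnstile> a \<doteq> b \<Colon> A \<Longrightarrow> ctx \<Gamma>"
  by (metis ctx_presup drop_0)+

lemma ctx_tl: "ctx (A # \<Gamma>) \<Longrightarrow> ctx \<Gamma>"
  by (metis ctx_presup(1) drop_0 drop_Suc_Cons)

section \<open>Typed substitutions and typing rules in matching form\<close>

definition sb :: "tm list \<Rightarrow> (nat \<Rightarrow> tm) \<Rightarrow> tm list \<Rightarrow> bool" where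
  "sb \<Delta> \<sigma> \<Gamma> \<longleftrightarrow> ctx \<Gamma> \<and> (\<forall>i < length \<Delta>. \<Gamma> \<turnstile> \<sigma> i \<Colon> (\<Delta> ! i)\<langle>\<up>(i + 1)\<rangle>\<langle>\<sigma>\<rangle>)"

definition sbe :: "tm list \<Rightarrow> (nat \<Rightarrow> tm) \<Rightarrow> (nat \<Rightarrow> tm) \<Rightarrow> tm list \<Rightarrow> bool" where
  "sbe \<Delta> \<sigma> \<tau> \<Gamma> \<longleftrightarrow> ctx \<Gamma> \<and> (\<forall>i < length \<Delta>. \<Gamma> \<turnstile> \<sigma> i \<doteq> \<tau> i \<Colon> (\<Delta> ! i)\<langle>\<up>(i + 1)\<rangle>\<langle>\<sigma>\<rangle>)"

lemma ty_sub: "\<Delta> \<turnstile> a \<Colon> A \<Longrightarrow> sb \<Delta> \<sigma> \<Gamma> \<Longrightarrow> T = A\<langle>\<sigma>\<rangle> \<Longrightarrow> \<Gamma> \<turnstile> a\<langle>\<sigma>\<rangle> \<Colon> T"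
  by (auto simp: sb_def intro: subst)

lemma eq_sub: "\<Delta> \<turnstile> a \<doteq> b \<Colon> A \<Longrightarrow> sb \<Delta> \<sigma> \<Gamma> \<Longrightarrow> T = A\<langle>\<sigma>\<rangle> \<Longrightarrow> \<Gamma> \<turnstile> a\<langle>\<sigma>\<rangle> \<doteq> b\<langle>\<sigma>\<rangle> \<Colon> T"
  by (auto simp: sb_def intro: eq_subst)

lemma sub_eq: "\<Delta> \<turnstile> a \<Colon> A \<Longrightarrow> sbe \<Delta> \<sigma> \<tau> \<Gamma> \<Longrightarrow> T = A\<langle>\<sigma>\<rangle> \<Longrightarrow> \<Gamma> \<turnstile> a\<langle>\<sigma>\<rangle> \<doteq> a\<langle>\<tau>\<rangle> \<Colon> T"
  by (auto simp: sbe_def intro: subst_eq)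

lemma sb_shift: "ctx (\<Theta> @ \<Gamma>) \<Longrightarrow> sb \<Gamma> (\<up>(length \<Theta>)) (\<Theta> @ \<Gamma>)"
  unfolding sb_def
proof (intro conjI allI impI)
  fix i assume *: "ctx (\<Theta> @ \<Gamma>)" "i < length \<Gamma>"
  have "\<Theta> @ \<Gamma> \<turnstile> Var (i + length \<Theta>) \<Colon> ((\<Theta> @ \<Gamma>) ! (i + length \<Theta>))\<langle>\<up>(i + length \<Theta> + 1)\<rangle>"
    using * by (intro var) auto
  then show "\<Theta> @ \<Gamma> \<turnstile> (\<up>(length \<Theta>)) i \<Colon> (\<Gamma> ! i)\<langle>\<up>(i + 1)\<rangle>\<langle>\<up>(length \<Theta>)\<rangle>"
    by (simp add: sbs nth_append add_ac)
qed

lemma sb_id: "ctx \<Gamma> \<Longrightarrow> sb \<Gamma> Var \<Gamma>"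
  using sb_shift[of "[]" \<Gamma>] by (simp add: sbs)

lemma sb_shifts:
  "ctx (A # \<Gamma>) \<Longrightarrow> sb \<Gamma> (\<up>1) (A # \<Gamma>)"
  "ctx (A # B # \<Gamma>) \<Longrightarrow> sb \<Gamma> (\<up>2) (A # B # \<Gamma>)"
  "ctx (A # B # C # \<Gamma>) \<Longrightarrow> sb \<Gamma> (\<up>3) (A # B # C # \<Gamma>)"
  "ctx (A # B # C # D # \<Gamma>) \<Longrightarrow> sb \<Gamma> (\<up>4) (A # B # C # D # \<Gamma>)"
  "ctx (A # B # C # D # E # \<Gamma>) \<Longrightarrow> sb \<Gamma> (\<up>5) (A # B # C # D # E # \<Gamma>)"
  "ctx (A # B # C # D # E # F # \<Gamma>) \<Longrightarrow> sb \<Gamma> (\<up>6) (A # B # C # D # E # F # \<Gamma>)"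
  using sb_shift[of "[A]" \<Gamma>] sb_shift[of "[A, B]" \<Gamma>] sb_shift[of "[A, B, C]" \<Gamma>]
    sb_shift[of "[A, B, C, D]" \<Gamma>] sb_shift[of "[A, B, C, D, E]" \<Gamma>]
    sb_shift[of "[A, B, C, D, E, F]" \<Gamma>]
  by (simp_all add: numeral_eq_Suc One_nat_def)

lemma sb_scons: "sb \<Delta> \<sigma> \<Gamma> \<Longrightarrow> \<Gamma> \<turnstile> a \<Colon> A\<langle>\<sigma>\<rangle> \<Longrightarrow> sb (A # \<Delta>) (a \<cdot> \<sigma>) \<Gamma>"
  unfolding sb_def by (auto simp: sbs less_Suc_eq_0_disj shift_Suc_scons)

lemma sbe_refl: "sb \<Delta> \<sigma> \<Gamma> \<Longrightarrow> sbe \<Delta> \<sigma> \<sigma> \<Gamma>"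
  unfolding sb_def sbe_def by (auto intro: eq_refl)

lemma sbe_scons: "sbe \<Delta> \<sigma> \<tau> \<Gamma> \<Longrightarrow> \<Gamma> \<turnstile> a \<doteq> b \<Colon> A\<langle>\<sigma>\<rangle> \<Longrightarrow> sbe (A # \<Delta>) (a \<cdot> \<sigma>) (b \<cdot> \<tau>) \<Gamma>"
  unfolding sbe_def by (auto simp: sbs less_Suc_eq_0_disj shift_Suc_scons)

lemma var_ty:
  "ctx (A # \<Gamma>) \<Longrightarrow> T = A\<up>1 \<Longrightarrow> A # \<Gamma> \<turnstile> Var 0 \<Colon> T"
  "ctx (B # A # \<Gamma>) \<Longrightarrow> T = A\<up>2 \<Longrightarrow> B # A # \<Gamma> \<turnstile> Var 1 \<Colon> T"
  "ctx (C # B # A # \<Gamma>) \<Longrightarrow> T = A\<up>3 \<Longrightarrow> C # B # A # \<Gamma> \<turnstile> Var 2 \<Colon> T"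
  "ctx (D # C # B # A # \<Gamma>) \<Longrightarrow> T = A\<up>4 \<Longrightarrow> D # C # B # A # \<Gamma> \<turnstile> Var 3 \<Colon> T"
  "ctx (E # D # C # B # A # \<Gamma>) \<Longrightarrow> T = A\<up>5 \<Longrightarrow> E # D # C # B # A # \<Gamma> \<turnstile> Var 4 \<Colon> T"
  "ctx (F # E # D # C # B # A # \<Gamma>) \<Longrightarrow> T = A\<up>6 \<Longrightarrow> F # E # D # C # B # A # \<Gamma> \<turnstile> Var 5 \<Colon> T"
  using var[of "A # \<Gamma>" 0] var[of "B # A # \<Gamma>" 1] var[of "C # B # A # \<Gamma>" 2]
    var[of "D # C # B # A # \<Gamma>" 3] var[of "E # D # C # B # A # \<Gamma>" 4]
    var[of "F # E # D # C # B # A # \<Gamma>" 5]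
  by (simp_all add: numeral_eq_Suc One_nat_def)

lemma former_ty:
  "\<Gamma> \<turnstile> A \<Colon> Ty \<Longrightarrow> A # \<Gamma> \<turnstile> B \<Colon> Ty \<Longrightarrow> \<Gamma> \<turnstile> Pi A B \<Colon> Ty"
  "\<Gamma> \<turnstile> A \<Colon> U \<Longrightarrow> A # \<Gamma> \<turnstile> B \<Colon> U \<Longrightarrow> \<Gamma> \<turnstile> Pi A B \<Colon> U"
  "\<Gamma> \<turnstile> A \<Colon> Ty \<Longrightarrow> A # \<Gamma> \<turnstile> B \<Colon> Ty \<Longrightarrow> \<Gamma> \<turnstile> Sigma A B \<Colon> Ty"
  "\<Gamma> \<turnstile> A \<Colon> U \<Longrightarrow> A # \<Gamma> \<turnstile> B \<Colon> U \<Longrightarrow> \<Gamma> \<turnstile> Sigma A B \<Colon> U"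
  "\<Gamma> \<turnstile> A \<Colon> Ty \<Longrightarrow> \<Gamma> \<turnstile> a \<Colon> A \<Longrightarrow> \<Gamma> \<turnstile> b \<Colon> A \<Longrightarrow> \<Gamma> \<turnstile> Id A a b \<Colon> Ty"
  "\<Gamma> \<turnstile> A \<Colon> U \<Longrightarrow> \<Gamma> \<turnstile> a \<Colon> A \<Longrightarrow> \<Gamma> \<turnstile> b \<Colon> A \<Longrightarrow> \<Gamma> \<turnstile> Id A a b \<Colon> U"
  by (auto intro: Pi Sigma Id)

lemma Nat_Ty: "ctx \<Gamma> \<Longrightarrow> \<Gamma> \<turnstile> Nat \<Colon> Ty"
  by (intro small Nat)

lemma App_ty: "\<Gamma> \<turnstile> f \<Colon> Pi A B \<Longrightarrow> \<Gamma> \<turnstile> a \<Colon> A \<Longrightarrow> T = B\<langle>a \<cdot> Var\<rangle> \<Longrightarrow> \<Gamma> \<turnstile> App f a \<Colon> T"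
  by (auto intro: App)

lemma App_arrow: "\<Gamma> \<turnstile> f \<Colon> arrow A B \<Longrightarrow> \<Gamma> \<turnstile> a \<Colon> A \<Longrightarrow> \<Gamma> \<turnstile> App f a \<Colon> B"
  unfolding arrow_def by (erule App_ty) (simp_all add: sbs)

lemma arrow_ty: "\<Gamma> \<turnstile> A \<Colon> Ty \<Longrightarrow> \<Gamma> \<turnstile> B \<Colon> Ty \<Longrightarrow> \<Gamma> \<turnstile> arrow A B \<Colon> Ty"
  unfolding arrow_def by (rule former_ty, assumption, rule ty_sub, assumption)
    (auto intro: sb_shifts ctx_cons simp: sbs)

lemma Lam_arrow: "\<Gamma> \<turnstile> B \<Colon> Ty \<Longrightarrow> A # \<Gamma> \<turnstile> b \<Colon> B\<up>1 \<Longrightarrow> \<Gamma> \<turnstile> Lam A b \<Colon> arrow A B"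
  unfolding arrow_def by (rule Lam, rule ty_sub, assumption) (auto intro: sb_shifts ty_ctx simp: sbs)

lemmas [tyr] = univ former_ty var_ty sb_shifts sb_id sb_scons ctx_cons Nat_Ty Nat Zero Succ
  App_arrow arrow_ty Lam_arrow Refl

lemma isprop_ty:
  assumes "\<Gamma> \<turnstile> A \<Colon> Ty"
  shows "\<Gamma> \<turnstile> isprop A \<Colon> Ty"
  unfolding isprop_def
  supply ty = assms
  by (rule ty ty[THEN ty_sub] ty[THEN ty_ctx] | simp only: sbs | rule tyr)+

lemma fiber_ty:
  assumes "\<Gamma> \<turnstile> A \<Colon> Ty" "\<Gamma> \<turnstile> B \<Colon> Ty" "\<Gamma> \<turnstile> f \<Colon> arrow A B" "\<Gamma> \<turnstile> b \<Colon> B"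
  shows "\<Gamma> \<turnstile> fiber A B f b \<Colon> Ty"
  unfolding fiber_def
  supply ty = assms
  by (rule ty ty[THEN ty_sub] ty[THEN ty_ctx] | simp only: sbs | rule tyr)+

section \<open>Inhabited types\<close>

definition inh :: "tm list \<Rightarrow> tm \<Rightarrow> bool" where
  "inh \<Gamma> A \<longleftrightarrow> (\<exists>t. \<Gamma> \<turnstile> t \<Colon> A)"

lemma inhI: "\<Gamma> \<turnstile> t \<Colon> A \<Longrightarrow> inh \<Gamma> A"
  by (auto simp: inh_def)

lemma inhE: "inh \<Gamma> A \<Longrightarrow> (\<And>t. \<Gamma> \<turnstile> t \<Colon> A \<Longrightarrow> P) \<Longrightarrow> P"
  by (auto simp: inh_def)

lemma inh_conv: "inh \<Gamma> A \<Longrightarrow> \<Gamma> \<turnstile> A \<doteq> B \<Colon> Ty \<Longrightarrow> inh \<Gamma> B"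
  by (auto simp: inh_def intro: conv)

lemma inh_sub: "inh \<Delta> A \<Longrightarrow> sb \<Delta> \<sigma> \<Gamma> \<Longrightarrow> T = A\<langle>\<sigma>\<rangle> \<Longrightarrow> inh \<Gamma> T"
  by (auto simp: inh_def intro: ty_sub)

lemma inh_Pi: "A # \<Gamma> \<turnstile> B \<Colon> Ty \<Longrightarrow> inh (A # \<Gamma>) B \<Longrightarrow> inh \<Gamma> (Pi A B)"
  by (auto simp: inh_def intro: Lam)

lemma inh_App: "inh \<Gamma> (Pi A B) \<Longrightarrow> \<Gamma> \<turnstile> a \<Colon> A \<Longrightarrow> T = B\<langle>a \<cdot> Var\<rangle> \<Longrightarrow> inh \<Gamma> T"
  by (auto simp: inh_def intro: App)

lemma Pi_open:
  assumes A: "\<Gamma> \<turnstile> A \<Colon> Ty" and f: "\<Gamma> \<turnstile> f \<Colon> Pi A B"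
  shows "A # \<Gamma> \<turnstile> App f\<up>1 (Var 0) \<Colon> B"
  apply (rule App_ty, rule f[THEN ty_sub])
  supply ty = A
  by (rule ty ty[THEN ty_sub] ty[THEN ty_ctx] | simp only: sbs | rule tyr)+

lemma inh_open: "inh \<Gamma> (Pi A B) \<Longrightarrow> \<Gamma> \<turnstile> A \<Colon> Ty \<Longrightarrow> inh (A # \<Gamma>) B"
  by (auto simp: inh_def intro: Pi_open)

lemma inh_Sigma: "A # \<Gamma> \<turnstile> B \<Colon> Ty \<Longrightarrow> \<Gamma> \<turnstile> a \<Colon> A \<Longrightarrow> inh \<Gamma> B\<langle>a \<cdot> Var\<rangle> \<Longrightarrow> inh \<Gamma> (Sigma A B)"
  by (auto simp: inh_def intro: Pair)

text \<open>The one-variable case of \<open>subst_eq\<close>. Leaving \<open>T\<close>,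
  \<open>B1\<close> and \<open>B2\<close> to equations lets the rule match goals whose substitutions
  are already normalised.\<close>

lemma eq_inst:
  assumes "A # \<Gamma> \<turnstile> B \<Colon> S" "\<Gamma> \<turnstile> a \<doteq> b \<Colon> A" "T = S\<langle>a \<cdot> Var\<rangle>" "B1 = B\<langle>a \<cdot> Var\<rangle>" "B2 = B\<langle>b \<cdot> Var\<rangle>"
  shows "\<Gamma> \<turnstile> B1 \<doteq> B2 \<Colon> T"
  unfolding assms(3-5)
  by (rule sub_eq[OF assms(1)], rule sbe_scons, rule sbe_refl, rule sb_id)
    (use assms(2) in \<open>simp_all add: sbs eq_ctx\<close>)

section \<open>Projections, derived from Sigma induction\<close>

definition pfst :: "tm \<Rightarrow> tm \<Rightarrow> tm" where
  "pfst A p = IndSigma A\<up>1 (Var 1) p"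

definition psnd :: "tm \<Rightarrow> tm \<Rightarrow> tm \<Rightarrow> tm" where
  "psnd A B p = IndSigma B\<langle>pfst A\<up>1 (Var 0) \<cdot> \<up>1\<rangle> (Var 0) p"

lemma proj_sub:
  "(pfst A p)\<langle>\<sigma>\<rangle> = pfst A\<langle>\<sigma>\<rangle> p\<langle>\<sigma>\<rangle>"
  "(psnd A B p)\<langle>\<sigma>\<rangle> = psnd A\<langle>\<sigma>\<rangle> B\<langle>Var 0 \<cdot> (\<sigma> ;; \<up>1)\<rangle> p\<langle>\<sigma>\<rangle>"
  by (simp_all add: pfst_def psnd_def sbs)

lemma pfst_ty:
  assumes p: "\<Gamma> \<turnstile> p \<Colon> Sigma A B" and A: "\<Gamma> \<turnstile> A \<Colon> Ty" and B: "A # \<Gamma> \<turnstile> B \<Colon> Ty"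
  shows "\<Gamma> \<turnstile> pfst A p \<Colon> A"
proof -
  have "\<Gamma> \<turnstile> pfst A p \<Colon> A\<up>1\<langle>p \<cdot> Var\<rangle>"
    unfolding pfst_def
    apply (rule IndSigma[OF _ _ p])
    supply ty = A B
    by (rule ty ty[THEN ty_sub] ty[THEN ty_ctx] | simp only: sbs | rule tyr)+
  then show ?thesis by (simp add: sbs)
qed

lemma pfst_beta:
  assumes A: "\<Gamma> \<turnstile> A \<Colon> Ty" and B: "A # \<Gamma> \<turnstile> B \<Colon> Ty" and a: "\<Gamma> \<turnstile> a \<Colon> A" and b: "\<Gamma> \<turnstile> b \<Colon> B\<langle>a \<cdot> Var\<rangle>"
  shows "\<Gamma> \<turnstile> pfst A (Pair B a b) \<doteq> a \<Colon> A"
proof -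
  have "\<Gamma> \<turnstile> pfst A (Pair B a b) \<doteq> (Var 1)\<langle>b \<cdot> a \<cdot> Var\<rangle> \<Colon> A\<up>1\<langle>Pair B a b \<cdot> Var\<rangle>"
    unfolding pfst_def
    apply (rule Sigma_beta[OF _ _ a b])
    supply ty = A B
    by (rule ty ty[THEN ty_sub] ty[THEN ty_ctx] | simp only: sbs | rule tyr)+
  then show ?thesis by (simp add: sbs)
qed

text \<open>The motive mentions the first projection of the pair. At an actual pair it is
  \<open>B\<close> at \<open>pfst (a, b)\<close>, which agrees with \<open>B\<close> at
  \<open>a\<close> only by \<open>pfst_beta\<close>; the variable \<open>Var 0\<close> is therefore
  retyped by conversion.\<close>

lemma psnd_motive:
  assumes A: "\<Gamma> \<turnstile> A \<Colon> Ty" and B: "A # \<Gamma> \<turnstile> B \<Colon> Ty"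
  shows "Sigma A B # \<Gamma> \<turnstile> B\<langle>pfst A\<up>1 (Var 0) \<cdot> \<up>1\<rangle> \<Colon> Ty"
    "B # A # \<Gamma> \<turnstile> Var 0 \<Colon> B\<langle>pfst A\<up>1 (Var 0) \<cdot> \<up>1\<rangle>\<langle>Pair B\<langle>Var 0 \<cdot> \<up>3\<rangle> (Var 1) (Var 0) \<cdot> \<up>2\<rangle>"
proof -
  show "Sigma A B # \<Gamma> \<turnstile> B\<langle>pfst A\<up>1 (Var 0) \<cdot> \<up>1\<rangle> \<Colon> Ty"
    supply ty = A B
    by (rule ty ty[THEN ty_sub] ty[THEN ty_ctx] pfst_ty | simp only: sbs | rule tyr)+
  have c: "ctx (B # A # \<Gamma>)"
    supply ty = A B
    by (rule ty ty[THEN ty_sub] ty[THEN ty_ctx] | simp only: sbs | rule tyr)+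
  have 1: "B # A # \<Gamma> \<turnstile> pfst A\<up>2 (Pair B\<langle>Var 0 \<cdot> \<up>3\<rangle> (Var 1) (Var 0)) \<doteq> Var 1 \<Colon> A\<up>2"
    apply (rule pfst_beta)
    supply ty = A B
    by (rule ty ty[THEN ty_sub] ty[THEN ty_ctx] | simp only: sbs | rule tyr)+
  have "B # A # \<Gamma> \<turnstile> B\<langle>pfst A\<up>2 (Pair B\<langle>Var 0 \<cdot> \<up>3\<rangle> (Var 1) (Var 0)) \<cdot> \<up>2\<rangle> \<doteq> B\<langle>Var 1 \<cdot> \<up>2\<rangle> \<Colon> Ty"
    by (rule sub_eq[OF B], rule sbe_scons, rule sbe_refl, rule sb_shifts, rule c, rule 1) (simp add: sbs)
  then have "B # A # \<Gamma> \<turnstile> B\<langle>Var 1 \<cdot> \<up>2\<rangle> \<doteq> B\<langle>pfst A\<up>1 (Var 0) \<cdot> \<up>1\<rangle>\<langle>Pair B\<langle>Var 0 \<cdot> \<up>3\<rangle> (Var 1) (Var 0) \<cdot> \<up>2\<rangle> \<Colon> Ty"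
    by (simp add: sbs proj_sub eq_sym)
  then show "B # A # \<Gamma> \<turnstile> Var 0 \<Colon> B\<langle>pfst A\<up>1 (Var 0) \<cdot> \<up>1\<rangle>\<langle>Pair B\<langle>Var 0 \<cdot> \<up>3\<rangle> (Var 1) (Var 0) \<cdot> \<up>2\<rangle>"
    apply (rule conv[rotated])
    supply ty = A B
    by (rule ty ty[THEN ty_sub] ty[THEN ty_ctx] | simp only: sbs | rule tyr)+
qed

lemma psnd_ty:
  assumes p: "\<Gamma> \<turnstile> p \<Colon> Sigma A B" and A: "\<Gamma> \<turnstile> A \<Colon> Ty" and B: "A # \<Gamma> \<turnstile> B \<Colon> Ty"
  shows "\<Gamma> \<turnstile> psnd A B p \<Colon> B\<langle>pfst A p \<cdot> Var\<rangle>"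
  using IndSigma[OF psnd_motive[OF A B] p] by (simp add: psnd_def sbs proj_sub)

lemma psnd_beta:
  assumes A: "\<Gamma> \<turnstile> A \<Colon> Ty" and B: "A # \<Gamma> \<turnstile> B \<Colon> Ty" and a: "\<Gamma> \<turnstile> a \<Colon> A" and b: "\<Gamma> \<turnstile> b \<Colon> B\<langle>a \<cdot> Var\<rangle>"
  shows "\<Gamma> \<turnstile> psnd A B (Pair B a b) \<doteq> b \<Colon> B\<langle>a \<cdot> Var\<rangle>"
proof -
  have "\<Gamma> \<turnstile> psnd A B (Pair B a b) \<doteq> b \<Colon> B\<langle>pfst A (Pair B a b) \<cdot> Var\<rangle>"
    using Sigma_beta[OF psnd_motive[OF A B] a b] by (simp add: psnd_def sbs proj_sub)
  moreover have "\<Gamma> \<turnstile> B\<langle>pfst A (Pair B a b) \<cdot> Var\<rangle> \<doteq> B\<langle>a \<cdot> Var\<rangle> \<Colon> Ty"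
    by (rule eq_inst[OF B pfst_beta[OF A B a b]]) (simp_all add: sbs)
  ultimately show ?thesis by (rule eq_conv)
qed

lemma inh_Sigma_obtain:
  assumes "inh \<Gamma> (Sigma A B)" and A: "\<Gamma> \<turnstile> A \<Colon> Ty" and B: "A # \<Gamma> \<turnstile> B \<Colon> Ty"
  obtains a where "\<Gamma> \<turnstile> a \<Colon> A" "inh \<Gamma> B\<langle>a \<cdot> Var\<rangle>"
  using assms by (auto simp: inh_def dest: pfst_ty[OF _ A B] psnd_ty[OF _ A B])

section \<open>Identity types\<close>

lemma ty_eq: "\<Gamma> \<turnstile> a \<Colon> A \<Longrightarrow> T = A \<Longrightarrow> \<Gamma> \<turnstile> a \<Colon> T"
  by simp

lemma tr_motive:
  assumes A: "\<Gamma> \<turnstile> A \<Colon> Ty" and P: "A # \<Gamma> \<turnstile> P \<Colon> Ty"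
  shows "Id A\<up>2 (Var 1) (Var 0) # A\<up>1 # A # \<Gamma> \<turnstile> Pi P\<langle>Var 2 \<cdot> \<up>3\<rangle> P\<langle>Var 2 \<cdot> \<up>4\<rangle> \<Colon> Ty"
    "A # \<Gamma> \<turnstile> Lam P (Var 0) \<Colon> (Pi P\<langle>Var 2 \<cdot> \<up>3\<rangle> P\<langle>Var 2 \<cdot> \<up>4\<rangle>)\<langle>Refl (Var 0) \<cdot> Var 0 \<cdot> Var 0 \<cdot> \<up>1\<rangle>"
  supply ty = A P
  by (rule ty ty[THEN ty_sub] ty[THEN ty_ctx] Lam | simp only: sbs | rule tyr)+

lemma tr_ty:
  assumes "\<Gamma> \<turnstile> p \<Colon> Id A a b" and A: "\<Gamma> \<turnstile> A \<Colon> Ty" and P: "A # \<Gamma> \<turnstile> P \<Colon> Ty"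
    and "\<Gamma> \<turnstile> a \<Colon> A" "\<Gamma> \<turnstile> b \<Colon> A" "\<Gamma> \<turnstile> u \<Colon> P\<langle>a \<cdot> Var\<rangle>" and T: "T = P\<langle>b \<cdot> Var\<rangle>"
  shows "\<Gamma> \<turnstile> tr P a b p u \<Colon> T"
  unfolding tr_def T
  apply (rule App_ty, rule J[OF tr_motive[OF A P], THEN ty_eq])
  supply ty = assms(1) assms(4) assms(5) assms(6)
  by (rule ty ty[THEN ty_sub] ty[THEN ty_ctx] | simp only: sbs | rule tyr)+

lemma tr_beta:
  assumes A: "\<Gamma> \<turnstile> A \<Colon> Ty" and P: "A # \<Gamma> \<turnstile> P \<Colon> Ty" and a: "\<Gamma> \<turnstile> a \<Colon> A" and u: "\<Gamma> \<turnstile> u \<Colon> P\<langle>a \<cdot> Var\<rangle>"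
  shows "\<Gamma> \<turnstile> tr P a a (Refl a) u \<doteq> u \<Colon> P\<langle>a \<cdot> Var\<rangle>"
proof -
  have 1: "\<Gamma> \<turnstile> J (Pi P\<langle>Var 2 \<cdot> \<up>3\<rangle> P\<langle>Var 2 \<cdot> \<up>4\<rangle>) (Lam P (Var 0)) a a (Refl a) \<doteq> Lam P\<langle>a \<cdot> Var\<rangle> (Var 0)
    \<Colon> Pi P\<langle>a \<cdot> Var\<rangle> P\<langle>a\<up>1 \<cdot> \<up>1\<rangle>"
    using Id_beta[OF tr_motive[OF A P] a] by (simp add: sbs)
  have 2: "\<Gamma> \<turnstile> App (Lam P\<langle>a \<cdot> Var\<rangle> (Var 0)) u \<doteq> (Var 0)\<langle>u \<cdot> Var\<rangle> \<Colon> P\<langle>a \<cdot> Var\<rangle>\<up>1\<langle>u \<cdot> Var\<rangle>"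
    apply (rule Pi_beta)
    supply ty = A P a u
    by (rule ty ty[THEN ty_sub] ty[THEN ty_ctx] | simp only: sbs | rule tyr)+
  show ?thesis unfolding tr_def
    using eq_trans[OF App_cong[OF 1 eq_refl[OF u]]] 2 by (simp add: sbs)
qed

lemma concat_ty:
  assumes "\<Gamma> \<turnstile> p \<Colon> Id A x y" "\<Gamma> \<turnstile> q \<Colon> Id A y z" "\<Gamma> \<turnstile> A \<Colon> Ty" "\<Gamma> \<turnstile> x \<Colon> A" "\<Gamma> \<turnstile> y \<Colon> A" "\<Gamma> \<turnstile> z \<Colon> A"
  shows "\<Gamma> \<turnstile> concat A x y z p q \<Colon> Id A x z"
  unfolding concat_def
  apply (rule tr_ty, rule assms(2))
  supply ty = assms(1) assms(3) assms(4) assms(5) assms(6)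
  by (rule ty ty[THEN ty_sub] ty[THEN ty_ctx] | simp only: sbs | rule tyr)+

lemma inh_transport:
  assumes P: "A # \<Gamma> \<turnstile> P \<Colon> Ty" and "inh \<Gamma> (Id A a b)" and "\<Gamma> \<turnstile> A \<Colon> Ty" "\<Gamma> \<turnstile> a \<Colon> A" "\<Gamma> \<turnstile> b \<Colon> A"
    and "inh \<Gamma> P\<langle>a \<cdot> Var\<rangle>" and "T = P\<langle>b \<cdot> Var\<rangle>"
  shows "inh \<Gamma> T"
  using assms by (auto simp: inh_def intro: tr_ty)

lemma inh_refl: "\<Gamma> \<turnstile> A \<Colon> Ty \<Longrightarrow> \<Gamma> \<turnstile> a \<Colon> A \<Longrightarrow> inh \<Gamma> (Id A a a)"
  by (auto simp: inh_def intro: Refl)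

lemma inh_eq: "\<Gamma> \<turnstile> a \<doteq> b \<Colon> A \<Longrightarrow> \<Gamma> \<turnstile> A \<Colon> Ty \<Longrightarrow> \<Gamma> \<turnstile> b \<Colon> A \<Longrightarrow> inh \<Gamma> (Id A a b)"
  by (rule inh_conv[OF inh_refl[of \<Gamma> A b]], assumption+, rule Id_cong) (simp_all add: eq_refl eq_sym)

lemma inh_sym:
  assumes "inh \<Gamma> (Id A a b)" "\<Gamma> \<turnstile> A \<Colon> Ty" "\<Gamma> \<turnstile> a \<Colon> A" "\<Gamma> \<turnstile> b \<Colon> A"
  shows "inh \<Gamma> (Id A b a)"
  apply (rule inh_transport[OF _ assms, of "Id A\<up>1 (Var 0) a\<up>1"])
    defer
    apply (simp add: sbs, rule inh_refl, rule assms, rule assms, simp add: sbs)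
  supply ty = assms(2) assms(3) assms(4)
  by (rule ty ty[THEN ty_sub] ty[THEN ty_ctx] | simp only: sbs | rule tyr)+

lemma inh_trans:
  assumes "inh \<Gamma> (Id A a b)" and bc: "inh \<Gamma> (Id A b c)" and "\<Gamma> \<turnstile> A \<Colon> Ty" "\<Gamma> \<turnstile> a \<Colon> A" "\<Gamma> \<turnstile> b \<Colon> A" "\<Gamma> \<turnstile> c \<Colon> A"
  shows "inh \<Gamma> (Id A a c)"
  using assms by (auto simp: inh_def intro: concat_ty)

lemma inh_ap:
  assumes r: "S # \<Gamma> \<turnstile> r \<Colon> R\<up>1" and "inh \<Gamma> (Id S a b)" and R: "\<Gamma> \<turnstile> R \<Colon> Ty" and S: "\<Gamma> \<turnstile> S \<Colon> Ty" "\<Gamma> \<turnstile> a \<Colon> S" "\<Gamma> \<turnstile> b \<Colon> S"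
    and T: "T = Id R r\<langle>a \<cdot> Var\<rangle> r\<langle>b \<cdot> Var\<rangle>"
  shows "inh \<Gamma> T"
proof (rule inh_transport[OF _ assms(2) S])
  show "S # \<Gamma> \<turnstile> Id R\<up>1 r\<langle>a\<up>1 \<cdot> \<up>1\<rangle> r \<Colon> Ty"
    supply ty = r R S(1) S(2) S(3)
    by (rule ty ty[THEN ty_sub] ty[THEN ty_ctx] | simp only: sbs | rule tyr)+
  have "inh \<Gamma> (Id R r\<langle>a \<cdot> Var\<rangle> r\<langle>a \<cdot> Var\<rangle>)"
    apply (rule inh_refl)
    supply ty = r R S(1) S(2) S(3)
    by (rule ty ty[THEN ty_sub] ty[THEN ty_ctx] | simp only: sbs | rule tyr)+
  then show "inh \<Gamma> (Id R\<up>1 r\<langle>a\<up>1 \<cdot> \<up>1\<rangle> r)\<langle>a \<cdot> Var\<rangle>"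
    by (simp add: sbs)
qed (simp add: sbs T)

text \<open>Based path induction, by contractibility of singletons.\<close>

lemma inh_bJ:
  assumes p: "\<Gamma> \<turnstile> p \<Colon> Id A a b" and A: "\<Gamma> \<turnstile> A \<Colon> Ty" and a: "\<Gamma> \<turnstile> a \<Colon> A" and b: "\<Gamma> \<turnstile> b \<Colon> A"
    and D: "Id A\<up>1 a\<up>1 (Var 0) # A # \<Gamma> \<turnstile> D \<Colon> Ty"
    and d: "inh \<Gamma> D\<langle>Refl a \<cdot> a \<cdot> Var\<rangle>" and T: "T = D\<langle>p \<cdot> b \<cdot> Var\<rangle>"
  shows "inh \<Gamma> T"
proof -
  define F where "F = Id A\<up>1 a\<up>1 (Var 0)"
  \<comment> \<open>The family \<open>D\<close> in an endpoint and a path becomes a family over the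
    singleton type \<open>Sigma A F\<close>, where ordinary transport applies.\<close>
  define D' where "D' = D\<langle>psnd A\<up>1 F\<langle>Var 0 \<cdot> \<up>2\<rangle> (Var 0) \<cdot> pfst A\<up>1 (Var 0) \<cdot> \<up>1\<rangle>"
  have F: "A # \<Gamma> \<turnstile> F \<Colon> Ty"
    unfolding F_def
    supply ty = A a
    by (rule ty ty[THEN ty_sub] ty[THEN ty_ctx] | simp only: sbs | rule tyr)+
  have D'': "F # A # \<Gamma> \<turnstile> D \<Colon> Ty"
    using D by (simp add: F_def)
  have S: "\<Gamma> \<turnstile> Sigma A F \<Colon> Ty"
    supply ty = A F
    by (rule ty ty[THEN ty_sub] ty[THEN ty_ctx] | simp only: sbs | rule tyr)+
  have D': "Sigma A F # \<Gamma> \<turnstile> D' \<Colon> Ty"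
    unfolding D'_def
    supply ty = A F D''
    by (rule ty ty[THEN ty_sub] ty[THEN ty_ctx] pfst_ty psnd_ty[THEN ty_eq] | simp only: sbs | rule tyr)+
  have conv: "\<Gamma> \<turnstile> D'\<langle>Pair F y q \<cdot> Var\<rangle> \<doteq> D\<langle>q \<cdot> y \<cdot> Var\<rangle> \<Colon> Ty"
    if y: "\<Gamma> \<turnstile> y \<Colon> A" and q: "\<Gamma> \<turnstile> q \<Colon> F\<langle>y \<cdot> Var\<rangle>" for y q
  proof -
    have "\<Gamma> \<turnstile> pfst A (Pair F y q) \<doteq> y \<Colon> A\<langle>Var\<rangle>"
      using pfst_beta[OF A F y q] by (simp add: sbs)
    moreover have "\<Gamma> \<turnstile> psnd A F (Pair F y q) \<doteq> q \<Colon> F\<langle>pfst A (Pair F y q) \<cdot> Var\<rangle>"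
      by (rule eq_conv[OF psnd_beta[OF A F y q]], rule eq_sym, rule eq_inst[OF F pfst_beta[OF A F y q]])
        (simp_all add: sbs)
    ultimately have "sbe (F # A # \<Gamma>) (psnd A F (Pair F y q) \<cdot> pfst A (Pair F y q) \<cdot> Var) (q \<cdot> y \<cdot> Var) \<Gamma>"
      using ty_ctx[OF A] by (intro sbe_scons sbe_refl sb_id)
    from sub_eq[OF D'' this] show ?thesis
      by (simp add: D'_def sbs proj_sub)
  qed
  have q0: "\<Gamma> \<turnstile> Refl a \<Colon> F\<langle>a \<cdot> Var\<rangle>"
    unfolding F_def
    supply ty = A a
    by (rule ty ty[THEN ty_sub] ty[THEN ty_ctx] | simp only: sbs | rule tyr)+
  have q1: "\<Gamma> \<turnstile> p \<Colon> F\<langle>b \<cdot> Var\<rangle>"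
    unfolding F_def
    supply ty = p
    by (rule ty ty[THEN ty_sub] ty[THEN ty_ctx] | simp only: sbs | rule tyr)+
  \<comment> \<open>Unbased \<open>J\<close> suffices here: with the left endpoint free as well,
    \<open>(x, refl) = (y, p)\<close> is a statement about all \<open>x\<close>, \<open>y\<close>,
    \<open>p\<close>, and holds by reflexivity on the diagonal.\<close>
  let ?G = "Id A\<up>4 (Var 3) (Var 0)"
  let ?C = "Id (Sigma A\<up>3 ?G) (Pair ?G (Var 2) (Refl (Var 2))) (Pair ?G (Var 1) (Var 0))"
  have "\<Gamma> \<turnstile> J ?C (Refl (Pair (Id A\<up>2 (Var 1) (Var 0)) (Var 0) (Refl (Var 0)))) a b p
    \<Colon> ?C\<langle>p \<cdot> b \<cdot> a \<cdot> Var\<rangle>"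
    apply (rule J[OF _ _ a b p])
    supply ty = A
    by (rule ty ty[THEN ty_sub] ty[THEN ty_ctx] Pair | simp only: sbs | rule tyr)+
  then have "inh \<Gamma> (Id (Sigma A F) (Pair F a (Refl a)) (Pair F b p))"
    by (simp add: sbs F_def inhI)
  moreover have "inh \<Gamma> D'\<langle>Pair F a (Refl a) \<cdot> Var\<rangle>"
    by (rule inh_conv[OF d eq_sym[OF conv[OF a q0]]])
  ultimately have "inh \<Gamma> D'\<langle>Pair F b p \<cdot> Var\<rangle>"
    using inh_transport[OF D' _ S Pair[OF F a q0] Pair[OF F b q1]] by blast
  then show ?thesis
    unfolding T by (rule inh_conv[OF _ conv[OF b q1]])
qed

lemmas [tyr] = tr_ty concat_ty isprop_ty fiber_ty
lemmas [sbs] = proj_sub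

text \<open>By based path induction on \<open>q\<close>: at reflexivity, \<open>r\<close> is its own
  preimage by \<open>tr_beta\<close>. The induction must be over \<open>Pi\<close>, because the type
  of \<open>r\<close> depends on the endpoint.\<close>

lemma inh_tr_surj:
  assumes P: "A # \<Gamma> \<turnstile> P \<Colon> Ty" and q: "\<Gamma> \<turnstile> q \<Colon> Id A x y" and r: "\<Gamma> \<turnstile> r \<Colon> P\<langle>y \<cdot> Var\<rangle>"
    and A: "\<Gamma> \<turnstile> A \<Colon> Ty" and x: "\<Gamma> \<turnstile> x \<Colon> A" and y: "\<Gamma> \<turnstile> y \<Colon> A"
  obtains s where "\<Gamma> \<turnstile> s \<Colon> P\<langle>x \<cdot> Var\<rangle>" "inh \<Gamma> (Id P\<langle>y \<cdot> Var\<rangle> (tr P x y q s) r)"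
proof -
  let ?D = "Pi P\<langle>Var 1 \<cdot> \<up>2\<rangle> (Sigma P\<langle>x\<up>3 \<cdot> \<up>3\<rangle>
    (Id P\<langle>Var 3 \<cdot> \<up>4\<rangle> (tr P\<langle>Var 0 \<cdot> \<up>5\<rangle> x\<up>4 (Var 3) (Var 2) (Var 0)) (Var 1)))"
  have D: "Id A\<up>1 x\<up>1 (Var 0) # A # \<Gamma> \<turnstile> ?D \<Colon> Ty"
    supply ty = A x P
    by (rule ty ty[THEN ty_sub] ty[THEN ty_ctx] | simp only: sbs | rule tyr)+
  let ?Px = "P\<langle>x \<cdot> Var\<rangle>"
  let ?E = "Id P\<langle>x\<up>2 \<cdot> \<up>2\<rangle> (tr P\<langle>Var 0 \<cdot> \<up>3\<rangle> x\<up>2 x\<up>2 (Refl x\<up>2) (Var 0)) (Var 1)"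
  have E: "P\<langle>x\<up>1 \<cdot> \<up>1\<rangle> # ?Px # \<Gamma> \<turnstile> ?E \<Colon> Ty"
    supply ty = A x P
    by (rule ty ty[THEN ty_sub] ty[THEN ty_ctx] | simp only: sbs | rule tyr)+
  have e: "?Px # \<Gamma> \<turnstile> P\<langle>x\<up>1 \<cdot> \<up>1\<rangle> \<Colon> Ty"
    supply ty = A x P
    by (rule ty ty[THEN ty_sub] ty[THEN ty_ctx] | simp only: sbs | rule tyr)+
  have v: "?Px # \<Gamma> \<turnstile> Var 0 \<Colon> P\<langle>x\<up>1 \<cdot> \<up>1\<rangle>"
    supply ty = A x P
    by (rule ty ty[THEN ty_sub] ty[THEN ty_ctx] | simp only: sbs | rule tyr)+
  have "?Px # \<Gamma> \<turnstile> tr P\<langle>Var 0 \<cdot> \<up>2\<rangle> x\<up>1 x\<up>1 (Refl x\<up>1) (Var 0) \<doteq> Var 0 \<Colon> P\<langle>Var 0 \<cdot> \<up>2\<rangle>\<langle>x\<up>1 \<cdot> Var\<rangle>"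
    apply (rule tr_beta)
    supply ty = A x P
    by (rule ty ty[THEN ty_sub] ty[THEN ty_ctx] | simp only: sbs | rule tyr)+
  then have b: "?Px # \<Gamma> \<turnstile> tr P\<langle>Var 0 \<cdot> \<up>2\<rangle> x\<up>1 x\<up>1 (Refl x\<up>1) (Var 0) \<doteq> Var 0 \<Colon> P\<langle>x\<up>1 \<cdot> \<up>1\<rangle>"
    by (simp add: sbs)
  have "inh (?Px # \<Gamma>) ?E\<langle>Var 0 \<cdot> Var\<rangle>"
    using inh_eq[OF b e v] by (simp add: sbs)
  from inh_Sigma[OF E v this] have "inh \<Gamma> (Pi ?Px (Sigma P\<langle>x\<up>1 \<cdot> \<up>1\<rangle> ?E))"
    apply (rule inh_Pi[rotated])
    supply ty = E A x P
    by (rule ty ty[THEN ty_sub] ty[THEN ty_ctx] | simp only: sbs | rule tyr)+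
  then have "inh \<Gamma> ?D\<langle>Refl x \<cdot> x \<cdot> Var\<rangle>"
    by (simp add: sbs)
  from inh_bJ[OF q A x y D this refl]
  have "inh \<Gamma> (Pi P\<langle>y \<cdot> Var\<rangle> (Sigma P\<langle>x\<up>1 \<cdot> \<up>1\<rangle>
    (Id P\<langle>y\<up>2 \<cdot> \<up>2\<rangle> (tr P\<langle>Var 0 \<cdot> \<up>3\<rangle> x\<up>2 y\<up>2 q\<up>2 (Var 0)) (Var 1))))"
    by (simp add: sbs)
  from inh_App[OF this r refl]
  have S: "inh \<Gamma> (Sigma ?Px (Id P\<langle>y\<up>1 \<cdot> \<up>1\<rangle>
    (tr P\<langle>Var 0 \<cdot> \<up>2\<rangle> x\<up>1 y\<up>1 q\<up>1 (Var 0)) r\<up>1))"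
    by (simp add: sbs)
  have Px: "\<Gamma> \<turnstile> ?Px \<Colon> Ty"
    supply ty = A x P
    by (rule ty ty[THEN ty_sub] ty[THEN ty_ctx] | simp only: sbs | rule tyr)+
  show thesis
    apply (rule inh_Sigma_obtain[OF S Px])
     defer
     apply (erule that, simp add: sbs)
    supply ty = Px A x y P q r
    by (rule ty ty[THEN ty_sub] ty[THEN ty_ctx] | simp only: sbs | rule tyr)+
qed

text \<open>\<open>concat\<close> is transport in the family \<open>c = _\<close> along its second
  argument, so solving \<open>d \<cdot> g = r\<close> for \<open>d\<close> is surjectivity of that
  transport.\<close>

lemma inh_divide:
  assumes g: "\<Gamma> \<turnstile> g \<Colon> Id T x y" and r: "\<Gamma> \<turnstile> r \<Colon> Id T c y"
    and T: "\<Gamma> \<turnstile> T \<Colon> Ty" and xyc: "\<Gamma> \<turnstile> x \<Colon> T" "\<Gamma> \<turnstile> y \<Colon> T" "\<Gamma> \<turnstile> c \<Colon> T"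
  obtains d where "\<Gamma> \<turnstile> d \<Colon> Id T c x" "inh \<Gamma> (Id (Id T c y) (concat T c x y d g) r)"
proof -
  have P: "T # \<Gamma> \<turnstile> Id T\<up>1 c\<up>1 (Var 0) \<Colon> Ty"
    supply ty = T xyc(3)
    by (rule ty ty[THEN ty_sub] ty[THEN ty_ctx] | simp only: sbs | rule tyr)+
  show thesis
    apply (rule inh_tr_surj[OF P g _ T xyc(1,2), of r])
     apply (simp add: sbs r)
    apply (rule that)
     apply (simp_all add: sbs concat_def)
    done
qed

text \<open>At \<open>q = refl\<close> the identity type of the transported points is judgementally
  that of the points themselves, so the identity function proves the implication; path induction
  does the rest. For \<open>P\<close> of the form \<open>c = _\<close> this cancels a path on the
  right.\<close>

lemma inh_tr_inj:
  assumes q: "\<Gamma> \<turnstile> q \<Colon> Id A x y" and P: "A # \<Gamma> \<turnstile> P \<Colon> Ty" and A: "\<Gamma> \<turnstile> A \<Colon> Ty" and x: "\<Gamma> \<turnstile> x \<Colon> A" and y: "\<Gamma> \<turnstile> y \<Colon> A"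
    and u: "\<Gamma> \<turnstile> u \<Colon> P\<langle>x \<cdot> Var\<rangle>" and v: "\<Gamma> \<turnstile> v \<Colon> P\<langle>x \<cdot> Var\<rangle>"
    and h: "inh \<Gamma> (Id P\<langle>y \<cdot> Var\<rangle> (tr P x y q u) (tr P x y q v))"
  shows "inh \<Gamma> (Id P\<langle>x \<cdot> Var\<rangle> u v)"
proof -
  let ?D = "arrow (Id P\<langle>Var 1 \<cdot> \<up>2\<rangle> (tr P\<langle>Var 0 \<cdot> \<up>3\<rangle> x\<up>2 (Var 1) (Var 0) u\<up>2)
    (tr P\<langle>Var 0 \<cdot> \<up>3\<rangle> x\<up>2 (Var 1) (Var 0) v\<up>2)) (Id P\<langle>x\<up>2 \<cdot> \<up>2\<rangle> u\<up>2 v\<up>2)"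
  have D: "Id A\<up>1 x\<up>1 (Var 0) # A # \<Gamma> \<turnstile> ?D \<Colon> Ty"
    supply ty = A x P u v
    by (rule ty ty[THEN ty_sub] ty[THEN ty_ctx] | simp only: sbs | rule tyr)+
  let ?X = "Id P\<langle>x \<cdot> Var\<rangle> (tr P x x (Refl x) u) (tr P x x (Refl x) v)"
  have X: "\<Gamma> \<turnstile> ?X \<Colon> Ty" and Y: "\<Gamma> \<turnstile> Id P\<langle>x \<cdot> Var\<rangle> u v \<Colon> Ty" and Px: "\<Gamma> \<turnstile> P\<langle>x \<cdot> Var\<rangle> \<Colon> Ty"
    supply ty = A x P u v
    by (rule ty ty[THEN ty_sub] ty[THEN ty_ctx] | simp only: sbs | rule tyr)+
  have XY: "\<Gamma> \<turnstile> ?X \<doteq> Id P\<langle>x \<cdot> Var\<rangle> u v \<Colon> Ty"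
    by (rule Id_cong) (simp_all add: eq_refl Px tr_beta[OF A P x] u v)
  have "?X # \<Gamma> \<turnstile> Var 0 \<Colon> (Id P\<langle>x \<cdot> Var\<rangle> u v)\<up>1"
    apply (rule conv, rule var_ty(1), rule ctx_cons[OF X], rule refl, rule eq_sub[OF XY])
    supply ty = X
    by (rule ty ty[THEN ty_sub] ty[THEN ty_ctx] | simp only: sbs | rule tyr)+
  from Lam_arrow[OF Y this] have "inh \<Gamma> ?D\<langle>Refl x \<cdot> x \<cdot> Var\<rangle>"
    by (simp add: sbs inhI)
  from inh_bJ[OF q A x y D this refl]
  obtain k where k: "\<Gamma> \<turnstile> k \<Colon> arrow (Id P\<langle>y \<cdot> Var\<rangle> (tr P x y q u) (tr P x y q v)) (Id P\<langle>x \<cdot> Var\<rangle> u v)"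
    by (auto simp: sbs elim: inhE)
  from h obtain t where "\<Gamma> \<turnstile> t \<Colon> Id P\<langle>y \<cdot> Var\<rangle> (tr P x y q u) (tr P x y q v)"
    by (rule inhE)
  from App_arrow[OF k this] show ?thesis
    by (rule inhI)
qed

section \<open>Propositions\<close>

lemma inh_isprop_elim:
  assumes "inh \<Gamma> (isprop A)" and x: "\<Gamma> \<turnstile> x \<Colon> A" and y: "\<Gamma> \<turnstile> y \<Colon> A"
  shows "inh \<Gamma> (Id A x y)"
proof -
  have "inh \<Gamma> (Pi A (Pi A\<up>1 (Id A\<up>2 (Var 1) (Var 0))))"
    using assms(1) by (simp add: isprop_def)
  from inh_App[OF this x refl] have "inh \<Gamma> (Pi A (Id A\<up>1 x\<up>1 (Var 0)))"
    by (simp add: sbs)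
  from inh_App[OF this y refl] show ?thesis
    by (simp add: sbs)
qed

lemma inh_isprop:
  assumes "inh (A\<up>1 # A # \<Gamma>) (Id A\<up>2 (Var 1) (Var 0))" and A: "\<Gamma> \<turnstile> A \<Colon> Ty"
  shows "inh \<Gamma> (isprop A)"
  unfolding isprop_def
  apply (rule inh_Pi, rule former_ty) prefer 3 apply (rule inh_Pi, rule former_ty) prefer 4 apply (rule assms)
  supply ty = A
  by (rule ty ty[THEN ty_sub] ty[THEN ty_ctx] | simp only: sbs | rule tyr)+

text \<open>The usual argument that propositions are sets: a family of paths
  \<open>E y : x = y\<close> with \<open>E x = refl\<close> forces every \<open>p : x = y\<close> to
  equal \<open>E y\<close>, by path induction.\<close>

lemma inh_prop_set:
  assumes F: "inh \<Gamma> (isprop A)" and A: "\<Gamma> \<turnstile> A \<Colon> Ty" and x: "\<Gamma> \<turnstile> x \<Colon> A" and y: "\<Gamma> \<turnstile> y \<Colon> A"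
    and p: "\<Gamma> \<turnstile> p \<Colon> Id A x y" and q: "\<Gamma> \<turnstile> q \<Colon> Id A x y"
  shows "inh \<Gamma> (Id (Id A x y) p q)"
proof -
  have "inh (A # \<Gamma>) (Id A\<up>1 x\<up>1 (Var 0))"
    apply (rule inh_isprop_elim)
      apply (rule inh_sub[OF F sb_shifts(1)])
    supply ty = A x
    by (rule ty ty[THEN ty_sub] ty[THEN ty_ctx] | simp only: sbs | rule tyr)+
  then obtain g where g: "A # \<Gamma> \<turnstile> g \<Colon> Id A\<up>1 x\<up>1 (Var 0)"
    by (rule inhE)
  have gx: "\<Gamma> \<turnstile> g\<langle>x \<cdot> Var\<rangle> \<Colon> Id A x x"
    supply ty = g x
    by (rule ty ty[THEN ty_sub] ty[THEN ty_ctx] | simp only: sbs | rule tyr)+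
  obtain d where d: "\<Gamma> \<turnstile> d \<Colon> Id A x x" "inh \<Gamma> (Id (Id A x x) (concat A x x x d g\<langle>x \<cdot> Var\<rangle>) (Refl x))"
    by (rule inh_divide[OF gx Refl[OF A x] A x x x])
  \<comment> \<open>The paths \<open>g y\<close> given by propositionality need not be trivial at
    \<open>y = x\<close>. Prefixing \<open>d\<close>, chosen with
    \<open>d \<cdot> g x = refl\<close>, corrects this.\<close>
  define E where "E = concat A\<up>1 x\<up>1 x\<up>1 (Var 0) d\<up>1 g"
  have E: "A # \<Gamma> \<turnstile> E \<Colon> Id A\<up>1 x\<up>1 (Var 0)"
    unfolding E_def
    supply ty = A x d(1) g
    by (rule ty ty[THEN ty_sub] ty[THEN ty_ctx] | simp only: sbs | rule tyr)+
  have xx: "\<Gamma> \<turnstile> Id A x x \<Colon> Ty" and xy: "\<Gamma> \<turnstile> Id A x y \<Colon> Ty"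
    by (intro former_ty A x y)+
  have "inh \<Gamma> (Id (Id A x x) (Refl x) E\<langle>x \<cdot> Var\<rangle>)"
    apply (rule inh_sym)
    using d(2) apply (simp add: E_def sbs)
    supply ty = xx A x E
    by (rule ty ty[THEN ty_sub] ty[THEN ty_ctx] | simp only: sbs | rule tyr)+
  then have base: "inh \<Gamma> (Id (Id A\<up>2 x\<up>2 (Var 1)) (Var 0) E\<up>1)\<langle>Refl x \<cdot> x \<cdot> Var\<rangle>"
    by (simp add: sbs)
  have mot: "Id A\<up>1 x\<up>1 (Var 0) # A # \<Gamma> \<turnstile> Id (Id A\<up>2 x\<up>2 (Var 1)) (Var 0) E\<up>1 \<Colon> Ty"
    supply ty = A x E
    by (rule ty ty[THEN ty_sub] ty[THEN ty_ctx] | simp only: sbs | rule tyr)+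
  have *: "inh \<Gamma> (Id (Id A x y) p E\<langle>y \<cdot> Var\<rangle>)" if p: "\<Gamma> \<turnstile> p \<Colon> Id A x y" for p
    by (rule inh_bJ[OF p A x y mot base]) (simp add: sbs)
  have Ey: "\<Gamma> \<turnstile> E\<langle>y \<cdot> Var\<rangle> \<Colon> Id A x y"
    supply ty = E y
    by (rule ty ty[THEN ty_sub] ty[THEN ty_ctx] | simp only: sbs | rule tyr)+
  show ?thesis
    by (rule inh_trans[OF *[OF p] inh_sym[OF *[OF q] xy q Ey] xy p Ey q])
qed

section \<open>Equivalences and function extensionality\<close>

lemma dhtpy_ty:
  assumes A: "\<Gamma> \<turnstile> A \<Colon> Ty" and B: "A # \<Gamma> \<turnstile> B \<Colon> Ty" and f: "\<Gamma> \<turnstile> f \<Colon> Pi A B" and g: "\<Gamma> \<turnstile> g \<Colon> Pi A B"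
  shows "\<Gamma> \<turnstile> dhtpy A B f g \<Colon> Ty"
  unfolding dhtpy_def
  supply ty = A B
  by (rule ty ty[THEN ty_sub] ty[THEN ty_ctx] Pi_open[OF A f] Pi_open[OF A g] | simp only: sbs | rule tyr)+

lemma htpy_ty:
  assumes A: "\<Gamma> \<turnstile> A \<Colon> Ty" and B: "\<Gamma> \<turnstile> B \<Colon> Ty" and f: "\<Gamma> \<turnstile> f \<Colon> arrow A B" and g: "\<Gamma> \<turnstile> g \<Colon> arrow A B"
  shows "\<Gamma> \<turnstile> htpy A B f g \<Colon> Ty"
  unfolding htpy_def
  supply ty = A B f[unfolded arrow_def] g[unfolded arrow_def]
  by (rule ty ty[THEN ty_sub] ty[THEN ty_ctx] dhtpy_ty | simp only: sbs | rule tyr)+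

lemma comp_ty:
  assumes f: "\<Gamma> \<turnstile> f \<Colon> arrow A B" and g: "\<Gamma> \<turnstile> g \<Colon> arrow B C" and A: "\<Gamma> \<turnstile> A \<Colon> Ty" and C: "\<Gamma> \<turnstile> C \<Colon> Ty"
  shows "\<Gamma> \<turnstile> comp A g f \<Colon> arrow A C"
  unfolding comp_def
  supply ty = A C f g
  by (rule ty ty[THEN ty_sub] ty[THEN ty_ctx] | simp only: sbs | rule tyr)+

lemma idfun_ty: "\<Gamma> \<turnstile> A \<Colon> Ty \<Longrightarrow> \<Gamma> \<turnstile> idfun A \<Colon> arrow A A"
  unfolding idfun_def by (rule Lam_arrow) (auto intro: var_ty ctx_cons)

lemmas [tyr] = dhtpy_ty htpy_ty comp_ty idfun_ty

lemma is_sec_ty: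
  assumes A: "\<Gamma> \<turnstile> A \<Colon> Ty" and B: "\<Gamma> \<turnstile> B \<Colon> Ty" and f: "\<Gamma> \<turnstile> f \<Colon> arrow A B"
  shows "arrow B A # \<Gamma> \<turnstile> is_sec A B f \<Colon> Ty"
  unfolding is_sec_def
  supply ty = A B f
  by (rule ty ty[THEN ty_sub] ty[THEN ty_ctx] | simp only: sbs | rule tyr)+

lemma is_retr_ty:
  assumes A: "\<Gamma> \<turnstile> A \<Colon> Ty" and B: "\<Gamma> \<turnstile> B \<Colon> Ty" and f: "\<Gamma> \<turnstile> f \<Colon> arrow A B"
  shows "arrow B A # \<Gamma> \<turnstile> is_retr A B f \<Colon> Ty"
  unfolding is_retr_def
  supply ty = A B f
  by (rule ty ty[THEN ty_sub] ty[THEN ty_ctx] | simp only: sbs | rule tyr)+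

lemma isequiv_back:
  assumes e: "inh \<Gamma> (isequiv A B f)" and A: "\<Gamma> \<turnstile> A \<Colon> Ty" and B: "\<Gamma> \<turnstile> B \<Colon> Ty" and f: "\<Gamma> \<turnstile> f \<Colon> arrow A B"
  shows "inh \<Gamma> (arrow B A)"
proof -
  have S: "\<Gamma> \<turnstile> Sigma (arrow B A) (is_sec A B f) \<Colon> Ty"
    and R: "\<Gamma> \<turnstile> Sigma (arrow B A) (is_retr A B f) \<Colon> Ty"
    supply ty = A B f
    by (rule ty ty[THEN ty_sub] ty[THEN ty_ctx] is_sec_ty[OF A B f] is_retr_ty[OF A B f] | simp only: sbs | rule tyr)+
  from inh_Sigma_obtain[OF e[unfolded isequiv_def prod_def] S]
  obtain a where "\<Gamma> \<turnstile> a \<Colon> Sigma (arrow B A) (is_sec A B f)"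
    using ty_sub[OF R sb_shifts(1)[OF ctx_cons[OF S]]] by (metis sub.simps(2))
  then have "inh \<Gamma> (Sigma (arrow B A) (is_sec A B f))" by (rule inhI)
  then obtain g where "\<Gamma> \<turnstile> g \<Colon> arrow B A"
    by (rule inh_Sigma_obtain[OF _ arrow_ty[OF B A] is_sec_ty[OF A B f]])
  then show ?thesis by (rule inhI)
qed

lemma happly_ty:
  assumes A: "\<Gamma> \<turnstile> A \<Colon> Ty" and B: "A # \<Gamma> \<turnstile> B \<Colon> Ty" and f: "\<Gamma> \<turnstile> f \<Colon> Pi A B" and g: "\<Gamma> \<turnstile> g \<Colon> Pi A B"
  shows "\<Gamma> \<turnstile> happly A B f g \<Colon> arrow (Id (Pi A B) f g) (dhtpy A B f g)"
proof -
  have d: "\<Gamma> \<turnstile> dhtpy A B f g \<Colon> Ty"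
    by (rule dhtpy_ty[OF A B f g])
  have 1: "A\<up>1 # Pi A B # \<Gamma> \<turnstile> App (Var 1) (Var 0) \<Colon> B\<langle>Var 0 \<cdot> \<up>2\<rangle>"
    apply (rule App_ty)
    supply ty = A B
    by (rule ty ty[THEN ty_sub] ty[THEN ty_ctx] | simp only: sbs | rule tyr)+
  have 2: "Pi A B # \<Gamma> \<turnstile> Lam A\<up>1 (Refl (App (Var 1) (Var 0))) \<Colon> dhtpy A\<up>1 B\<langle>Var 0 \<cdot> \<up>2\<rangle> (Var 0) (Var 0)"
    unfolding dhtpy_def
    supply ty = 1 A B
    by (rule ty ty[THEN ty_sub] ty[THEN ty_ctx] Lam | simp only: sbs | rule tyr)+
  \<comment> \<open>In \<open>happly\<close> the path is bound before \<open>J\<close> is called.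
    Motive and reflexivity case are typed over \<open>\<Gamma>\<close> first and then weakened past
    that path variable.\<close>
  let ?\<Delta> = "Id (Pi A B)\<up>2 (Var 1) (Var 0) # (Pi A B)\<up>1 # Pi A B # \<Gamma>"
  have 3: "?\<Delta> \<turnstile> dhtpy A\<up>3 B\<langle>Var 0 \<cdot> \<up>4\<rangle> (Var 2) (Var 1) \<Colon> Ty"
    supply ty = A B
    by (rule ty ty[THEN ty_sub] ty[THEN ty_ctx] | simp only: sbs | rule tyr)+
  define P where "P = Pi A B"
  have P: "\<Gamma> \<turnstile> P \<Colon> Ty" and fP: "\<Gamma> \<turnstile> f \<Colon> P" and gP: "\<Gamma> \<turnstile> g \<Colon> P"
    using f g by (auto simp: P_def intro: former_ty A B)
  have 5: "Id P f g # \<Gamma> \<turnstile> J (dhtpy A\<up>4 B\<langle>Var 0 \<cdot> \<up>5\<rangle> (Var 2) (Var 1))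
          (Lam A\<up>2 (Refl (App (Var 1) (Var 0)))) f\<up>1 g\<up>1 (Var 0)
     \<Colon> (dhtpy A\<up>4 B\<langle>Var 0 \<cdot> \<up>5\<rangle> (Var 2) (Var 1))\<langle>Var 0 \<cdot> g\<up>1 \<cdot> f\<up>1 \<cdot> Var\<rangle>"
  proof (rule J[where A = "P\<up>1"])
    show "Id P\<up>1\<up>2 (Var 1) (Var 0) # P\<up>1\<up>1 # P\<up>1 # Id P f g # \<Gamma> \<turnstile>
      dhtpy A\<up>4 B\<langle>Var 0 \<cdot> \<up>5\<rangle> (Var 2) (Var 1) \<Colon> Ty"
      apply (rule ty_sub[OF 3[folded P_def], of "Var 0 \<cdot> Var 1 \<cdot> Var 2 \<cdot> \<up>4", simplified sbs sub.simps])
      supply ty = P fP gP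
      by (rule ty ty[THEN ty_sub] ty[THEN ty_ctx] | simp only: sbs | rule tyr)+
    show "P\<up>1 # Id P f g # \<Gamma> \<turnstile> Lam A\<up>2 (Refl (App (Var 1) (Var 0)))
      \<Colon> (dhtpy A\<up>4 B\<langle>Var 0 \<cdot> \<up>5\<rangle> (Var 2) (Var 1))\<langle>Refl (Var 0) \<cdot> Var 0 \<cdot> Var 0 \<cdot> \<up>1\<rangle>"
      apply (rule ty_sub[OF 2[folded P_def], of "Var 0 \<cdot> \<up>2", simplified sbs sub.simps])
      supply ty = P fP gP
      by (rule ty ty[THEN ty_sub] ty[THEN ty_ctx] | simp only: sbs | rule tyr)+
    show "Id P f g # \<Gamma> \<turnstile> f\<up>1 \<Colon> P\<up>1" "Id P f g # \<Gamma> \<turnstile> g\<up>1 \<Colon> P\<up>1"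
      "Id P f g # \<Gamma> \<turnstile> Var 0 \<Colon> Id P\<up>1 f\<up>1 g\<up>1"
      supply ty = P fP gP
      by (rule ty ty[THEN ty_sub] ty[THEN ty_ctx] | simp only: sbs | rule tyr)+
  qed
  show ?thesis
    unfolding happly_def
    apply (rule Lam_arrow[OF d], rule ty_eq[OF 5[unfolded P_def]]) by (simp add: sbs)
qed

text \<open>The axiom makes \<open>happly\<close> an equivalence; its section sends the pointwise
  homotopy to the required path.\<close>

lemma inh_funext:
  assumes A: "\<Gamma> \<turnstile> A \<Colon> Ty" and B: "A # \<Gamma> \<turnstile> B \<Colon> Ty" and f: "\<Gamma> \<turnstile> f \<Colon> Pi A B" and g: "\<Gamma> \<turnstile> g \<Colon> Pi A B"
    and h: "inh (A # \<Gamma>) (Id B (App f\<up>1 (Var 0)) (App g\<up>1 (Var 0)))"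
  shows "inh \<Gamma> (Id (Pi A B) f g)"
proof -
  from inhI[OF FunExt[OF B]]
  have "inh \<Gamma> (Pi (Pi A B) (Pi (Pi A B)\<up>1
       (isequiv (Id (Pi A B)\<up>2 (Var 1) (Var 0))
          (dhtpy A\<up>2 B\<langle>Var 0 \<cdot> \<up>3\<rangle> (Var 1) (Var 0))
          (happly A\<up>2 B\<langle>Var 0 \<cdot> \<up>3\<rangle> (Var 1) (Var 0)))))"
    by (simp add: funext_type_def)
  from inh_App[OF this f refl]
  have "inh \<Gamma> (Pi (Pi A B)
       (isequiv (Id (Pi A B)\<up>1 f\<up>1 (Var 0))
          (dhtpy A\<up>1 B\<langle>Var 0 \<cdot> \<up>2\<rangle> f\<up>1 (Var 0))
          (happly A\<up>1 B\<langle>Var 0 \<cdot> \<up>2\<rangle> f\<up>1 (Var 0))))"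
    by (simp add: sbs)
  from inh_App[OF this g refl]
  have e: "inh \<Gamma> (isequiv (Id (Pi A B) f g) (dhtpy A B f g) (happly A B f g))"
    by (simp add: sbs)
  have d: "\<Gamma> \<turnstile> dhtpy A B f g \<Colon> Ty"
    by (rule dhtpy_ty[OF A B f g])
  have I: "\<Gamma> \<turnstile> Id (Pi A B) f g \<Colon> Ty"
    by (intro former_ty A B f g)
  from isequiv_back[OF e I d happly_ty[OF A B f g]]
  obtain k where k: "\<Gamma> \<turnstile> k \<Colon> arrow (dhtpy A B f g) (Id (Pi A B) f g)"
    by (rule inhE)
  have "inh \<Gamma> (dhtpy A B f g)"
    unfolding dhtpy_def apply (rule inh_Pi[OF _ h])
    supply ty = A B
    by (rule ty ty[THEN ty_sub] ty[THEN ty_ctx] Pi_open[OF A f] Pi_open[OF A g] | simp only: sbs | rule tyr)+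
  then obtain t where "\<Gamma> \<turnstile> t \<Colon> dhtpy A B f g"
    by (rule inhE)
  from App_arrow[OF k this] show ?thesis
    by (rule inhI)
qed

lemma inh_isprop_Pi:
  assumes A: "\<Gamma> \<turnstile> A \<Colon> Ty" and B: "A # \<Gamma> \<turnstile> B \<Colon> Ty" and p: "inh (A # \<Gamma>) (isprop B)"
  shows "inh \<Gamma> (isprop (Pi A B))"
proof (rule inh_isprop)
  let ?\<Delta> = "Pi A\<up>1 B\<langle>Var 0 \<cdot> \<up>2\<rangle> # Pi A B # \<Gamma>"
  have v: "A\<up>2 # ?\<Delta> \<turnstile> App (Var 2) (Var 0) \<Colon> B\<langle>Var 0 \<cdot> \<up>3\<rangle>"
    "A\<up>2 # ?\<Delta> \<turnstile> App (Var 1) (Var 0) \<Colon> B\<langle>Var 0 \<cdot> \<up>3\<rangle>"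
    subgoal apply (rule App_ty)
      supply ty = A B
      by (rule ty ty[THEN ty_sub] ty[THEN ty_ctx] | simp only: sbs | rule tyr)+
    subgoal apply (rule App_ty)
      supply ty = A B
      by (rule ty ty[THEN ty_sub] ty[THEN ty_ctx] | simp only: sbs | rule tyr)+
    done
  have "inh ?\<Delta> (Id (Pi A\<up>2 B\<langle>Var 0 \<cdot> \<up>3\<rangle>) (Var 1) (Var 0))"
    apply (rule inh_funext)
        prefer 5
        apply (simp only: sbs)
        apply (rule inh_isprop_elim[OF _ v])
        apply (rule inh_sub[OF p, of "Var 0 \<cdot> \<up>3"])
    supply ty = A B
    by (rule ty ty[THEN ty_sub] ty[THEN ty_ctx] | simp only: sbs | rule tyr)+
  then show "inh ((Pi A B)\<up>1 # Pi A B # \<Gamma>) (Id (Pi A B)\<up>2 (Var 1) (Var 0))"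
    by (simp add: sbs)
qed (intro former_ty A B)

text \<open>Proving \<open>isprop A\<close> starts with an element of \<open>A\<close>, so the
  hypothesis can be instantiated with the first of the two points to be compared.\<close>

lemma inh_isprop_if_inhabited:
  assumes A: "\<Gamma> \<turnstile> A \<Colon> Ty" and p: "inh (A # \<Gamma>) (isprop A\<up>1)"
  shows "inh \<Gamma> (isprop A)"
  apply (rule inh_isprop[OF inh_isprop_elim A])
    apply (rule inh_sub[OF p, of "Var 1 \<cdot> \<up>2"])
  supply ty = A
  by (rule ty ty[THEN ty_sub] ty[THEN ty_ctx] | simp only: sbs | rule tyr)+

text \<open>By \<open>inh_isprop_if_inhabited\<close> a proof of \<open>isprop A\<close> may be
  assumed. Then all identity types of \<open>A\<close> are propositions, and so is a product of
  them.\<close>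

lemma inh_isprop_isprop:
  assumes A: "\<Gamma> \<turnstile> A \<Colon> Ty"
  shows "inh \<Gamma> (isprop (isprop A))"
proof -
  have pA: "\<Gamma> \<turnstile> isprop A \<Colon> Ty"
    by (rule isprop_ty[OF A])
  let ?\<Delta> = "A\<up>2 # A\<up>1 # isprop A # \<Gamma>"
  have I: "?\<Delta> \<turnstile> Id A\<up>3 (Var 1) (Var 0) \<Colon> Ty"
    supply ty = A
    by (rule ty ty[THEN ty_sub] ty[THEN ty_ctx] | simp only: sbs | rule tyr)+
  have "inh (Id A\<up>4 (Var 2) (Var 1) # Id A\<up>3 (Var 1) (Var 0) # ?\<Delta>)
    (Id (Id A\<up>5 (Var 3) (Var 2)) (Var 1) (Var 0))"
    \<comment> \<open>\<open>Var 4\<close> is the assumed proof of \<open>isprop A\<close>, below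
      two points and two paths between them.\<close>
    apply (rule inh_prop_set, rule inhI[of _ "Var 4"])
    supply ty = A
    by (rule ty ty[THEN ty_sub] ty[THEN ty_ctx] | simp only: sbs | rule tyr)+
  then have H: "inh ?\<Delta> (isprop (Id A\<up>3 (Var 1) (Var 0)))"
    by (intro inh_isprop I) (simp add: sbs)
  have "inh (isprop A # \<Gamma>) (isprop (Pi A\<up>1 (Pi A\<up>2 (Id A\<up>3 (Var 1) (Var 0)))))"
    apply (rule inh_isprop_Pi) prefer 3 apply (rule inh_isprop_Pi) prefer 3 apply (rule H)
    supply ty = A
    by (rule ty ty[THEN ty_sub] ty[THEN ty_ctx] | simp only: sbs | rule tyr)+
  then show ?thesis
    by - (rule inh_isprop_if_inhabited[OF pA], simp add: isprop_def sbs)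
qed

lemma inh_htpy_prop:
  assumes "inh \<Gamma> (isprop B)" and A: "\<Gamma> \<turnstile> A \<Colon> Ty" and B: "\<Gamma> \<turnstile> B \<Colon> Ty" and f: "\<Gamma> \<turnstile> f \<Colon> arrow A B" and g: "\<Gamma> \<turnstile> g \<Colon> arrow A B"
  shows "inh \<Gamma> (htpy A B f g)"
  unfolding htpy_def dhtpy_def
  apply (rule inh_Pi) prefer 2 apply (rule inh_isprop_elim, rule inh_sub[OF assms(1) sb_shifts(1)])
  supply ty = A B f g
  by (rule ty ty[THEN ty_sub] ty[THEN ty_ctx] | simp only: sbs | rule tyr)+

text \<open>Both homotopies required of a bi-invertible map compare points of propositions, so one
  map backwards is a section and a retraction at once.\<close>

lemma inh_isequiv_props:
  assumes pA: "inh \<Gamma> (isprop A)" and pB: "inh \<Gamma> (isprop B)" and A: "\<Gamma> \<turnstile> A \<Colon> Ty" and B: "\<Gamma> \<turnstile> B \<Colon> Ty"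
    and f: "\<Gamma> \<turnstile> f \<Colon> arrow A B" and "inh \<Gamma> (arrow B A)"
  shows "inh \<Gamma> (isequiv A B f)"
proof -
  obtain g where g: "\<Gamma> \<turnstile> g \<Colon> arrow B A"
    using assms(6) by (rule inhE)
  have "inh \<Gamma> (is_sec A B f)\<langle>g \<cdot> Var\<rangle>"
    unfolding is_sec_def apply (simp only: sbs) apply (rule inh_htpy_prop[OF pB])
    supply ty = A B f g
    by (rule ty ty[THEN ty_sub] ty[THEN ty_ctx] comp_ty idfun_ty | simp only: sbs | rule tyr)+
  then have s: "inh \<Gamma> (Sigma (arrow B A) (is_sec A B f))"
    by (rule inh_Sigma[OF is_sec_ty[OF A B f] g])
  have "inh \<Gamma> (is_retr A B f)\<langle>g \<cdot> Var\<rangle>"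
    unfolding is_retr_def apply (simp only: sbs) apply (rule inh_htpy_prop[OF pA])
    supply ty = A B f g
    by (rule ty ty[THEN ty_sub] ty[THEN ty_ctx] comp_ty idfun_ty | simp only: sbs | rule tyr)+
  then have r: "inh \<Gamma> (Sigma (arrow B A) (is_retr A B f))"
    by (rule inh_Sigma[OF is_retr_ty[OF A B f] g])
  from s obtain u where u: "\<Gamma> \<turnstile> u \<Colon> Sigma (arrow B A) (is_sec A B f)"
    by (rule inhE)
  show ?thesis
    unfolding isequiv_def prod_def
    apply (rule inh_Sigma[OF _ u])
    prefer 2 apply (simp only: sbs) apply (rule r)
    supply ty = A B f u
    by (rule ty ty[THEN ty_sub] ty[THEN ty_ctx] is_retr_ty[THEN ty_sub] is_sec_ty is_retr_ty | simp only: sbs | rule tyr)+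
qed

lemma tr_cong:
  assumes p: "\<Gamma> \<turnstile> p \<Colon> Id A a b" and A: "\<Gamma> \<turnstile> A \<Colon> Ty" and P: "A # \<Gamma> \<turnstile> P \<Colon> Ty"
    and a: "\<Gamma> \<turnstile> a \<Colon> A" and b: "\<Gamma> \<turnstile> b \<Colon> A" and u: "\<Gamma> \<turnstile> u \<doteq> v \<Colon> P\<langle>a \<cdot> Var\<rangle>" and T: "T = P\<langle>b \<cdot> Var\<rangle>"
  shows "\<Gamma> \<turnstile> tr P a b p u \<doteq> tr P a b p v \<Colon> T"
proof -
  have "\<Gamma> \<turnstile> J (Pi P\<langle>Var 2 \<cdot> \<up>3\<rangle> P\<langle>Var 2 \<cdot> \<up>4\<rangle>) (Lam P (Var 0)) a b p \<Colon> Pi P\<langle>a \<cdot> Var\<rangle> P\<langle>b\<up>1 \<cdot> \<up>1\<rangle>"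
    using J[OF tr_motive[OF A P] a b p] by (simp add: sbs)
  from App_cong[OF eq_refl[OF this] u] show ?thesis
    by (simp add: tr_def T sbs)
qed

section \<open>Sequences of null-homotopic maps\<close>

text \<open>Recursion on \<open>Nat\<close>, packaged as an open term with its two judgemental
  equations, so that users need not see \<open>IndNat\<close>. The data are weakened by one variable
  because the recursor is applied to a variable of the context.\<close>

lemma nat_chain:
  assumes F: "Nat # \<Gamma> \<turnstile> F \<Colon> Ty" and z: "\<Gamma> \<turnstile> z \<Colon> F\<langle>Zero \<cdot> Var\<rangle>"
    and S: "F # Nat # \<Gamma> \<turnstile> S \<Colon> F\<langle>Succ (Var 1) \<cdot> \<up>2\<rangle>"
  obtains C where "Nat # \<Gamma> \<turnstile> C \<Colon> F"
    "Nat # \<Gamma> \<turnstile> S\<langle>C \<cdot> Var\<rangle> \<doteq> C\<langle>Succ (Var 0) \<cdot> \<up>1\<rangle> \<Colon> F\<langle>Succ (Var 0) \<cdot> \<up>1\<rangle>"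
    "\<Gamma> \<turnstile> C\<langle>Zero \<cdot> Var\<rangle> \<doteq> z \<Colon> F\<langle>Zero \<cdot> Var\<rangle>"
proof -
  define C where "C = IndNat F\<langle>Var 0 \<cdot> \<up>2\<rangle> z\<up>1 S\<langle>Var 0 \<cdot> Var 1 \<cdot> \<up>3\<rangle> (Var 0)"
  have F': "Nat # Nat # \<Gamma> \<turnstile> F\<langle>Var 0 \<cdot> \<up>2\<rangle> \<Colon> Ty"
    supply ty = F z
    by (rule ty ty[THEN ty_sub] ty[THEN ty_ctx] | simp only: sbs | rule tyr)+
  have z': "Nat # \<Gamma> \<turnstile> z\<up>1 \<Colon> F\<langle>Var 0 \<cdot> \<up>2\<rangle>\<langle>Zero \<cdot> Var\<rangle>"
    supply ty = F z
    by (rule ty ty[THEN ty_sub] ty[THEN ty_ctx] | simp only: sbs | rule tyr)+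
  have S': "F\<langle>Var 0 \<cdot> \<up>2\<rangle> # Nat # Nat # \<Gamma> \<turnstile> S\<langle>Var 0 \<cdot> Var 1 \<cdot> \<up>3\<rangle> \<Colon> F\<langle>Var 0 \<cdot> \<up>2\<rangle>\<langle>Succ (Var 1) \<cdot> \<up>2\<rangle>"
    supply ty = F z S
    by (rule ty ty[THEN ty_sub] ty[THEN ty_ctx] | simp only: sbs | rule tyr)+
  have v: "Nat # \<Gamma> \<turnstile> Var 0 \<Colon> Nat"
    supply ty = F
    by (rule ty ty[THEN ty_sub] ty[THEN ty_ctx] | simp only: sbs | rule tyr)+
  show thesis
  proof
    show "Nat # \<Gamma> \<turnstile> C \<Colon> F"
      using IndNat[OF F' z' S' v] by (simp add: C_def sbs)
    show "Nat # \<Gamma> \<turnstile> S\<langle>C \<cdot> Var\<rangle> \<doteq> C\<langle>Succ (Var 0) \<cdot> \<up>1\<rangle> \<Colon> F\<langle>Succ (Var 0) \<cdot> \<up>1\<rangle>"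
      using eq_sym[OF Nat_beta_succ[OF F' z' S' v]] by (simp add: C_def sbs)
    show "\<Gamma> \<turnstile> C\<langle>Zero \<cdot> Var\<rangle> \<doteq> z \<Colon> F\<langle>Zero \<cdot> Var\<rangle>"
      using Nat_beta_zero[OF F z S] by (simp add: C_def sbs)
  qed
qed

text \<open>Based path induction for the generic endpoint and path, which can afterwards be
  instantiated by any substitution.\<close>

lemma inh_bJ_open:
  assumes A: "\<Gamma> \<turnstile> A \<Colon> Ty" and a: "\<Gamma> \<turnstile> a \<Colon> A"
    and D: "Id A\<up>1 a\<up>1 (Var 0) # A # \<Gamma> \<turnstile> D \<Colon> Ty"
    and d: "inh \<Gamma> D\<langle>Refl a \<cdot> a \<cdot> Var\<rangle>"
  shows "inh (Id A\<up>1 a\<up>1 (Var 0) # A # \<Gamma>) D"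
proof -
  let ?\<Delta> = "Id A\<up>1 a\<up>1 (Var 0) # A # \<Gamma>"
  have "inh ?\<Delta> D\<langle>Var 0 \<cdot> Var 1 \<cdot> \<up>4\<rangle>\<langle>Var 0 \<cdot> Var 1 \<cdot> Var\<rangle>"
    apply (rule inh_bJ[where p = "Var 0" and D = "D\<langle>Var 0 \<cdot> Var 1 \<cdot> \<up>4\<rangle>" and A = "A\<up>2" and a = "a\<up>2" and b = "Var 1"])
    prefer 6 apply (rule inh_sub[OF d])
    supply ty = A a D
    by (rule ty ty[THEN ty_sub] ty[THEN ty_ctx] | simp only: sbs | rule tyr)+
  then show ?thesis
    by (simp add: sbs)
qed

text \<open>
  Here \<open>A n\<close> is a sequence of types with maps \<open>s : A n \<rightarrow> A (n + 1)\<close> that are constant up to homotopy,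
  and \<open>I, g\<close> is a cocone on it with vertex \<open>T\<close>. Let \<open>a n\<close> be the image of \<open>a0\<close> in \<open>A n\<close>, let
  \<open>K : a (n + 1) = s x\<close> be given by the constancy of \<open>s\<close>, and choose \<open>C n : c = I n (a n)\<close> with
  \<open>C n \<cdot> g = tr K (C (n + 1))\<close>. Then \<open>D n x\<close>, the solution of \<open>D n x \<cdot> g = tr K (C (n + 1))\<close>, satisfies
  \<open>D n (a n) = C n\<close>, by cancelling \<open>g\<close>, and hence \<open>D (n + 1) (s x) = tr K (C (n + 1)) = D n x \<cdot> g\<close>,
  by induction on \<open>K\<close>.
\<close>

lemma null_sequence:
  assumes A: "Nat # \<Gamma> \<turnstile> A \<Colon> Ty" and s: "A # Nat # \<Gamma> \<turnstile> s \<Colon> A\<langle>Succ (Var 1) \<cdot> \<up>2\<rangle>"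
    and T: "\<Gamma> \<turnstile> T \<Colon> Ty" and I: "A # Nat # \<Gamma> \<turnstile> I \<Colon> T\<up>2"
    and g: "A # Nat # \<Gamma> \<turnstile> g \<Colon> Id T\<up>2 I I\<langle>s \<cdot> Succ (Var 1) \<cdot> \<up>2\<rangle>"
    and null: "inh (A\<up>1 # A # Nat # \<Gamma>) (Id A\<langle>Succ (Var 2) \<cdot> \<up>3\<rangle> s\<langle>Var 1 \<cdot> \<up>2\<rangle> s\<langle>Var 0 \<cdot> \<up>2\<rangle>)"
    and a0: "\<Gamma> \<turnstile> a0 \<Colon> A\<langle>Zero \<cdot> Var\<rangle>"
  obtains c D where "\<Gamma> \<turnstile> c \<Colon> T" "A # Nat # \<Gamma> \<turnstile> D \<Colon> Id T\<up>2 c\<up>2 I"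
    "inh (A # Nat # \<Gamma>) (Id (Id T\<up>2 c\<up>2 I\<langle>s \<cdot> Succ (Var 1) \<cdot> \<up>2\<rangle>)
      (concat T\<up>2 c\<up>2 I I\<langle>s \<cdot> Succ (Var 1) \<cdot> \<up>2\<rangle> D g) D\<langle>s \<cdot> Succ (Var 1) \<cdot> \<up>2\<rangle>)"
proof -
  obtain a where a: "Nat # \<Gamma> \<turnstile> a \<Colon> A"
    and as: "Nat # \<Gamma> \<turnstile> s\<langle>a \<cdot> Var\<rangle> \<doteq> a\<langle>Succ (Var 0) \<cdot> \<up>1\<rangle> \<Colon> A\<langle>Succ (Var 0) \<cdot> \<up>1\<rangle>"
    by (rule nat_chain[OF A a0 s])
  \<comment> \<open>The centre is the image of \<open>a0\<close> at stage zero. With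
    \<open>a\<close> at \<open>Zero\<close> written out, \<open>Refl c\<close> has literally the
    type required of \<open>C\<close> at \<open>Zero\<close>.\<close>
  define c where "c = I\<langle>a\<langle>Zero \<cdot> Var\<rangle> \<cdot> Zero \<cdot> Var\<rangle>"
  have c: "\<Gamma> \<turnstile> c \<Colon> T"
    unfolding c_def
    supply ty = I a T
    by (rule ty ty[THEN ty_sub] ty[THEN ty_ctx] | simp only: sbs | rule tyr)+
  have nA: "\<Gamma> \<turnstile> Nat \<Colon> Ty"
    supply ty = T
    by (rule ty ty[THEN ty_sub] ty[THEN ty_ctx] | simp only: sbs | rule tyr)+
  have AA: "A # Nat # \<Gamma> \<turnstile> A\<langle>Succ (Var 1) \<cdot> \<up>2\<rangle> \<Colon> Ty"
    supply ty = A
    by (rule ty ty[THEN ty_sub] ty[THEN ty_ctx] | simp only: sbs | rule tyr)+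
  \<comment> \<open>Constancy of \<open>s\<close> at the points \<open>a n\<close> and
    \<open>x\<close> gives \<open>s (a n) = s x\<close>, and \<open>s (a n)\<close> is judgementally
    \<open>a (n + 1)\<close>.\<close>
  have "inh (A # Nat # \<Gamma>) (Id A\<langle>Succ (Var 1) \<cdot> \<up>2\<rangle> a\<langle>Succ (Var 1) \<cdot> \<up>2\<rangle> s)"
  proof (rule inh_conv)
    show "inh (A # Nat # \<Gamma>) (Id A\<langle>Succ (Var 1) \<cdot> \<up>2\<rangle> s\<langle>a\<up>1 \<cdot> \<up>1\<rangle> s)"
      apply (rule inh_sub[OF null, of "Var 0 \<cdot> a\<up>1 \<cdot> \<up>1"])
      supply ty = A a
      by (rule ty ty[THEN ty_sub] ty[THEN ty_ctx] | simp only: sbs | rule tyr)+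
    have 1: "A # Nat # \<Gamma> \<turnstile> s\<langle>a\<up>1 \<cdot> \<up>1\<rangle> \<doteq> a\<langle>Succ (Var 1) \<cdot> \<up>2\<rangle> \<Colon> A\<langle>Succ (Var 1) \<cdot> \<up>2\<rangle>"
      using eq_sub[OF as sb_shifts(1)[OF ctx_cons[OF A]] refl] by (simp add: sbs)
    show "A # Nat # \<Gamma> \<turnstile> Id A\<langle>Succ (Var 1) \<cdot> \<up>2\<rangle> s\<langle>a\<up>1 \<cdot> \<up>1\<rangle> s \<doteq> Id A\<langle>Succ (Var 1) \<cdot> \<up>2\<rangle> a\<langle>Succ (Var 1) \<cdot> \<up>2\<rangle> s \<Colon> Ty"
      by (rule Id_cong) (simp_all add: 1 eq_refl AA s)
  qed
  then obtain K where K: "A # Nat # \<Gamma> \<turnstile> K \<Colon> Id A\<langle>Succ (Var 1) \<cdot> \<up>2\<rangle> a\<langle>Succ (Var 1) \<cdot> \<up>2\<rangle> s"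
    by (rule inhE)
  define P where "P = Id T\<up>2 c\<up>2 I"
  have P: "A # Nat # \<Gamma> \<turnstile> P \<Colon> Ty"
    unfolding P_def
    supply ty = T c I A
    by (rule ty ty[THEN ty_sub] ty[THEN ty_ctx] | simp only: sbs | rule tyr)+
  define F where "F = P\<langle>a \<cdot> Var\<rangle>"
  have F: "Nat # \<Gamma> \<turnstile> F \<Colon> Ty"
    unfolding F_def
    supply ty = P a
    by (rule ty ty[THEN ty_sub] ty[THEN ty_ctx] | simp only: sbs | rule tyr)+
  have z: "\<Gamma> \<turnstile> Refl c \<Colon> F\<langle>Zero \<cdot> Var\<rangle>"
    unfolding F_def P_def c_def
    supply ty = T I a
    by (rule ty ty[THEN ty_sub] ty[THEN ty_ctx] | simp only: sbs | rule tyr)+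
  let ?P = "P\<langle>Var 0 \<cdot> Succ (Var 1) \<cdot> \<up>2\<rangle>"
  let ?I = "I\<langle>a\<up>1 \<cdot> \<up>1\<rangle>" and ?I' = "I\<langle>s\<langle>a\<up>1 \<cdot> \<up>1\<rangle> \<cdot> Succ (Var 1) \<cdot> \<up>2\<rangle>"
  have 1: "F # Nat # \<Gamma> \<turnstile> concat T\<up>2 c\<up>2 ?I ?I' (Var 0) g\<langle>a\<up>1 \<cdot> \<up>1\<rangle> \<Colon> Id T\<up>2 c\<up>2 ?I'"
    unfolding F_def P_def
    supply ty = T c g a I s F[unfolded F_def P_def]
    by (rule ty ty[THEN ty_sub] ty[THEN ty_ctx] | simp only: sbs | rule tyr)+
  have 2: "A\<langle>Succ (Var 1) \<cdot> \<up>2\<rangle> # F # Nat # \<Gamma> \<turnstile> P\<langle>Var 0 \<cdot> Succ (Var 2) \<cdot> \<up>3\<rangle> \<Colon> Ty"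
    supply ty = P A F
    by (rule ty ty[THEN ty_sub] ty[THEN ty_ctx] | simp only: sbs | rule tyr)+
  have 3: "F # Nat # \<Gamma> \<turnstile> K\<langle>a\<up>1 \<cdot> \<up>1\<rangle> \<Colon> Id A\<langle>Succ (Var 1) \<cdot> \<up>2\<rangle> a\<langle>Succ (Var 1) \<cdot> \<up>2\<rangle> s\<langle>a\<up>1 \<cdot> \<up>1\<rangle>"
    supply ty = K a F
    by (rule ty ty[THEN ty_sub] ty[THEN ty_ctx] | simp only: sbs | rule tyr)+
  have 4: "F # Nat # \<Gamma> \<turnstile> A\<langle>Succ (Var 1) \<cdot> \<up>2\<rangle> \<Colon> Ty" "F # Nat # \<Gamma> \<turnstile> a\<langle>Succ (Var 1) \<cdot> \<up>2\<rangle> \<Colon> A\<langle>Succ (Var 1) \<cdot> \<up>2\<rangle>"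
     "F # Nat # \<Gamma> \<turnstile> s\<langle>a\<up>1 \<cdot> \<up>1\<rangle> \<Colon> A\<langle>Succ (Var 1) \<cdot> \<up>2\<rangle>"
    supply ty = A F a s
    by (rule ty ty[THEN ty_sub] ty[THEN ty_ctx] | simp only: sbs | rule tyr)+
  \<comment> \<open>The step of the recursion for \<open>C\<close>: from a path
    \<open>u : c = I n (a n)\<close> to a solution \<open>S\<close> of
    \<open>tr K S = u \<cdot> g\<close>, with \<open>K\<close> taken at \<open>x = a n\<close>. This
    is where the possibly nontrivial loop is absorbed.\<close>
  obtain S where "F # Nat # \<Gamma> \<turnstile> S \<Colon> P\<langle>Var 0 \<cdot> Succ (Var 2) \<cdot> \<up>3\<rangle>\<langle>a\<langle>Succ (Var 1) \<cdot> \<up>2\<rangle> \<cdot> Var\<rangle>"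
    and "inh (F # Nat # \<Gamma>) (Id P\<langle>Var 0 \<cdot> Succ (Var 2) \<cdot> \<up>3\<rangle>\<langle>s\<langle>a\<up>1 \<cdot> \<up>1\<rangle> \<cdot> Var\<rangle>
      (tr P\<langle>Var 0 \<cdot> Succ (Var 2) \<cdot> \<up>3\<rangle> a\<langle>Succ (Var 1) \<cdot> \<up>2\<rangle> s\<langle>a\<up>1 \<cdot> \<up>1\<rangle> K\<langle>a\<up>1 \<cdot> \<up>1\<rangle> S)
      (concat T\<up>2 c\<up>2 ?I ?I' (Var 0) g\<langle>a\<up>1 \<cdot> \<up>1\<rangle>))"
    by (rule inh_tr_surj[OF 2 3 _ 4, of "concat T\<up>2 c\<up>2 ?I ?I' (Var 0) g\<langle>a\<up>1 \<cdot> \<up>1\<rangle>"])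
      (use 1 in \<open>simp_all add: sbs P_def\<close>)
  then have S: "F # Nat # \<Gamma> \<turnstile> S \<Colon> F\<langle>Succ (Var 1) \<cdot> \<up>2\<rangle>"
    and R: "inh (F # Nat # \<Gamma>) (Id P\<langle>s\<langle>a\<up>1 \<cdot> \<up>1\<rangle> \<cdot> Succ (Var 1) \<cdot> \<up>2\<rangle>
      (tr P\<langle>Var 0 \<cdot> Succ (Var 2) \<cdot> \<up>3\<rangle> a\<langle>Succ (Var 1) \<cdot> \<up>2\<rangle> s\<langle>a\<up>1 \<cdot> \<up>1\<rangle> K\<langle>a\<up>1 \<cdot> \<up>1\<rangle> S)
      (concat T\<up>2 c\<up>2 ?I ?I' (Var 0) g\<langle>a\<up>1 \<cdot> \<up>1\<rangle>))"
    by (simp_all add: sbs F_def)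
  obtain C where C: "Nat # \<Gamma> \<turnstile> C \<Colon> F"
    and CS: "Nat # \<Gamma> \<turnstile> S\<langle>C \<cdot> Var\<rangle> \<doteq> C\<langle>Succ (Var 0) \<cdot> \<up>1\<rangle> \<Colon> F\<langle>Succ (Var 0) \<cdot> \<up>1\<rangle>"
    by (rule nat_chain[OF F z S])
  let ?sa = "s\<langle>a \<cdot> Var\<rangle>" and ?Ka = "K\<langle>a \<cdot> Var\<rangle>" and ?a' = "a\<langle>Succ (Var 0) \<cdot> \<up>1\<rangle>" and ?C' = "C\<langle>Succ (Var 0) \<cdot> \<up>1\<rangle>"
    and ?Q = "P\<langle>Var 0 \<cdot> Succ (Var 1) \<cdot> \<up>2\<rangle>" and ?Psa = "P\<langle>s\<langle>a \<cdot> Var\<rangle> \<cdot> Succ (Var 0) \<cdot> \<up>1\<rangle>"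
    and ?Ia = "I\<langle>a \<cdot> Var\<rangle>" and ?Isa = "I\<langle>s\<langle>a \<cdot> Var\<rangle> \<cdot> Succ (Var 0) \<cdot> \<up>1\<rangle>" and ?ga = "g\<langle>a \<cdot> Var\<rangle>"
  have Aa: "Nat # \<Gamma> \<turnstile> A\<langle>Succ (Var 0) \<cdot> \<up>1\<rangle> \<Colon> Ty" and a': "Nat # \<Gamma> \<turnstile> ?a' \<Colon> A\<langle>Succ (Var 0) \<cdot> \<up>1\<rangle>"
    and sa: "Nat # \<Gamma> \<turnstile> ?sa \<Colon> A\<langle>Succ (Var 0) \<cdot> \<up>1\<rangle>" and C': "Nat # \<Gamma> \<turnstile> ?C' \<Colon> ?Q\<langle>?a' \<cdot> Var\<rangle>"
    and Ka: "Nat # \<Gamma> \<turnstile> ?Ka \<Colon> Id A\<langle>Succ (Var 0) \<cdot> \<up>1\<rangle> ?a' ?sa"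
    and Q: "A\<langle>Succ (Var 0) \<cdot> \<up>1\<rangle> # Nat # \<Gamma> \<turnstile> ?Q \<Colon> Ty"
    and Ia: "Nat # \<Gamma> \<turnstile> ?Ia \<Colon> T\<up>1" and Isa: "Nat # \<Gamma> \<turnstile> ?Isa \<Colon> T\<up>1"
    and ga: "Nat # \<Gamma> \<turnstile> ?ga \<Colon> Id T\<up>1 ?Ia ?Isa" and T1: "Nat # \<Gamma> \<turnstile> T\<up>1 \<Colon> Ty" and c1: "Nat # \<Gamma> \<turnstile> c\<up>1 \<Colon> T\<up>1"
    subgoal
      supply ty = A nA
      by (rule ty ty[THEN ty_sub] ty[THEN ty_ctx] | simp only: sbs | rule tyr)+
    subgoal
      supply ty = a nA
      by (rule ty ty[THEN ty_sub] ty[THEN ty_ctx] | simp only: sbs | rule tyr)+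
    subgoal
      supply ty = s a nA
      by (rule ty ty[THEN ty_sub] ty[THEN ty_ctx] | simp only: sbs | rule tyr)+
    subgoal using ty_sub[OF C, of "Succ (Var 0) \<cdot> \<up>1"] apply (rule ty_eq) apply (simp_all add: F_def sbs)
      supply ty = nA
      by (rule ty ty[THEN ty_sub] ty[THEN ty_ctx] | simp only: sbs | rule tyr)+
    supply ty = K a nA P A I s g T c
    by (rule ty ty[THEN ty_sub] ty[THEN ty_ctx] | simp only: sbs | rule tyr)+
  have Psa: "?Psa = Id T\<up>1 c\<up>1 ?Isa" and F': "F = Id T\<up>1 c\<up>1 ?Ia"
    by (simp_all add: P_def F_def sbs)
  have Cc: "Nat # \<Gamma> \<turnstile> C \<Colon> Id T\<up>1 c\<up>1 ?Ia"
    using C by (simp add: F')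
  have PsaTy: "Nat # \<Gamma> \<turnstile> ?Psa \<Colon> Ty"
    unfolding Psa by (intro former_ty T1 c1 Isa)
  have E1: "inh (Nat # \<Gamma>) (Id ?Psa (tr ?Q ?a' ?sa ?Ka S\<langle>C \<cdot> Var\<rangle>) (concat T\<up>1 c\<up>1 ?Ia ?Isa C ?ga))"
    apply (rule inh_sub[OF R, of "C \<cdot> Var"])
    supply ty = C F
    by (rule ty ty[THEN ty_sub] ty[THEN ty_ctx] | simp only: sbs | rule tyr)+
  have Cg: "Nat # \<Gamma> \<turnstile> concat T\<up>1 c\<up>1 ?Ia ?Isa C ?ga \<Colon> ?Psa"
    unfolding Psa by (rule concat_ty[OF Cc ga T1 c1 Ia Isa])
  have trC: "Nat # \<Gamma> \<turnstile> tr ?Q ?a' ?sa ?Ka ?C' \<Colon> ?Psa"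
    by (rule tr_ty[OF Ka Aa Q a' sa C']) (simp add: sbs)
  \<comment> \<open>The recursion equation \<open>CS\<close> holds judgementally, so
    \<open>S\<close> applied to \<open>C n\<close> can be replaced by \<open>C (n + 1)\<close>
    inside the transport by conversion.\<close>
  have E2: "inh (Nat # \<Gamma>) (Id ?Psa (tr ?Q ?a' ?sa ?Ka ?C') (concat T\<up>1 c\<up>1 ?Ia ?Isa C ?ga))"
    apply (rule inh_conv[OF E1], rule Id_cong)
       apply simp
      apply (rule eq_refl[OF PsaTy])
     apply (rule tr_cong[OF Ka Aa Q a' sa])
      apply (simp add: sbs)
    using CS apply (simp add: sbs F_def)
     apply (simp add: sbs)
    apply (rule eq_refl[OF Cg])
    done
  let ?r = "tr P\<langle>Var 0 \<cdot> Succ (Var 2) \<cdot> \<up>3\<rangle> a\<langle>Succ (Var 1) \<cdot> \<up>2\<rangle> s K C\<langle>Succ (Var 1) \<cdot> \<up>2\<rangle>"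
    and ?I2 = "I\<langle>s \<cdot> Succ (Var 1) \<cdot> \<up>2\<rangle>"
  have r: "A # Nat # \<Gamma> \<turnstile> ?r \<Colon> Id T\<up>2 c\<up>2 ?I2"
    apply (rule tr_ty, rule K)
    unfolding P_def
    supply ty = s A a T c I C[unfolded F_def P_def]
    by (rule ty ty[THEN ty_sub] ty[THEN ty_ctx] | simp only: sbs | rule tyr)+
  have T2: "A # Nat # \<Gamma> \<turnstile> T\<up>2 \<Colon> Ty" "A # Nat # \<Gamma> \<turnstile> ?I2 \<Colon> T\<up>2" "A # Nat # \<Gamma> \<turnstile> c\<up>2 \<Colon> T\<up>2"
    supply ty = T A I s c
    by (rule ty ty[THEN ty_sub] ty[THEN ty_ctx] | simp only: sbs | rule tyr)+
  \<comment> \<open>\<open>?r\<close> is \<open>tr K (C (n + 1))\<close>, a path from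
    \<open>c\<close> to \<open>I (n + 1) (s x)\<close>. Dividing it by \<open>g\<close> defines
    \<open>D\<close> without recursion, so only \<open>?r = D (n + 1) (s x)\<close> remains to be
    shown.\<close>
  obtain D where D: "A # Nat # \<Gamma> \<turnstile> D \<Colon> Id T\<up>2 c\<up>2 I"
    and Dg: "inh (A # Nat # \<Gamma>) (Id (Id T\<up>2 c\<up>2 ?I2) (concat T\<up>2 c\<up>2 I ?I2 D g) ?r)"
    by (rule inh_divide[OF g r T2(1) I T2(2,3)])
  have Da: "Nat # \<Gamma> \<turnstile> D\<langle>a \<cdot> Var\<rangle> \<Colon> Id T\<up>1 c\<up>1 ?Ia"
    supply ty = D a nA
    by (rule ty ty[THEN ty_sub] ty[THEN ty_ctx] | simp only: sbs | rule tyr)+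
  have E3: "inh (Nat # \<Gamma>) (Id ?Psa (concat T\<up>1 c\<up>1 ?Ia ?Isa D\<langle>a \<cdot> Var\<rangle> ?ga) (tr ?Q ?a' ?sa ?Ka ?C'))"
    unfolding Psa
    apply (rule inh_sub[OF Dg, of "a \<cdot> Var"])
    supply ty = a nA
    by (rule ty ty[THEN ty_sub] ty[THEN ty_ctx] | simp only: sbs | rule tyr)+
  have Dag: "Nat # \<Gamma> \<turnstile> concat T\<up>1 c\<up>1 ?Ia ?Isa D\<langle>a \<cdot> Var\<rangle> ?ga \<Colon> ?Psa"
    unfolding Psa by (rule concat_ty[OF Da ga T1 c1 Ia Isa])
  have E4: "inh (Nat # \<Gamma>) (Id ?Psa (concat T\<up>1 c\<up>1 ?Ia ?Isa C ?ga) (concat T\<up>1 c\<up>1 ?Ia ?Isa D\<langle>a \<cdot> Var\<rangle> ?ga))"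
    by (rule inh_sym[OF inh_trans[OF E3 E2 PsaTy Dag trC Cg] PsaTy Dag Cg])
  \<comment> \<open>Both \<open>C n\<close> and \<open>D n (a n)\<close> yield the same path after
    composing with \<open>g\<close>; composition with \<open>g\<close> is a transport and hence
    injective.\<close>
  have E5: "inh (Nat # \<Gamma>) (Id F C D\<langle>a \<cdot> Var\<rangle>)"
  proof -
    have "T\<up>1 # Nat # \<Gamma> \<turnstile> Id T\<up>2 c\<up>2 (Var 0) \<Colon> Ty"
      supply ty = T1 c1 T c
      by (rule ty ty[THEN ty_sub] ty[THEN ty_ctx] | simp only: sbs | rule tyr)+
    from inh_tr_inj[OF ga this T1 Ia Isa, of C "D\<langle>a \<cdot> Var\<rangle>"] show ?thesis
      using Cc Da E4 by (simp add: sbs F' concat_def Psa)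
  qed
  \<comment> \<open>For any path \<open>k : a n = x\<close>, transporting \<open>C n\<close> along
    \<open>k\<close> gives \<open>D n x\<close>. The case \<open>k = refl\<close> is
    \<open>E5\<close> up to \<open>tr_beta\<close>.\<close>
  let ?M = "Id P\<up>1 (tr P\<langle>Var 0 \<cdot> \<up>3\<rangle> a\<up>2 (Var 1) (Var 0) C\<up>2) D\<up>1"
  have M: "Id A\<up>1 a\<up>1 (Var 0) # A # Nat # \<Gamma> \<turnstile> ?M \<Colon> Ty"
    unfolding P_def
    supply ty = A a T c I D C[unfolded F_def P_def]
    by (rule ty ty[THEN ty_sub] ty[THEN ty_ctx] | simp only: sbs | rule tyr)+
  have CF: "Nat # \<Gamma> \<turnstile> C \<Colon> P\<langle>a \<cdot> Var\<rangle>" and DF: "Nat # \<Gamma> \<turnstile> D\<langle>a \<cdot> Var\<rangle> \<Colon> P\<langle>a \<cdot> Var\<rangle>"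
    and FF: "Nat # \<Gamma> \<turnstile> P\<langle>a \<cdot> Var\<rangle> \<Colon> Ty"
    using C F Da F' unfolding F_def by simp_all
  note b = tr_beta[OF A P a CF]
  have trF: "Nat # \<Gamma> \<turnstile> tr P a a (Refl a) C \<Colon> P\<langle>a \<cdot> Var\<rangle>"
    apply (rule tr_ty)
    supply ty = A P a CF
    by (rule ty ty[THEN ty_sub] ty[THEN ty_ctx] | simp only: sbs | rule tyr)+
  have "inh (Nat # \<Gamma>) (Id P\<langle>a \<cdot> Var\<rangle> (tr P a a (Refl a) C) D\<langle>a \<cdot> Var\<rangle>)"
    by (rule inh_trans[OF inh_eq[OF b FF CF] _ FF trF CF DF]) (use E5 in \<open>simp add: F_def\<close>)
  then have "inh (Nat # \<Gamma>) ?M\<langle>Refl a \<cdot> a \<cdot> Var\<rangle>"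
    by (simp add: sbs)
  from inh_bJ_open[OF A a M this]
  have "inh (Id A\<up>1 a\<up>1 (Var 0) # A # Nat # \<Gamma>) ?M" .
  \<comment> \<open>The instance of \<open>?M\<close> at stage \<open>n + 1\<close>, the point
    \<open>s x\<close> and the path \<open>K\<close>.\<close>
  then have E6: "inh (A # Nat # \<Gamma>) (Id (Id T\<up>2 c\<up>2 ?I2) ?r D\<langle>s \<cdot> Succ (Var 1) \<cdot> \<up>2\<rangle>)"
    unfolding P_def apply (rule inh_sub[of _ _ "K \<cdot> s \<cdot> Succ (Var 1) \<cdot> \<up>2"])
    supply ty = K s A
    by (rule ty ty[THEN ty_sub] ty[THEN ty_ctx] | simp only: sbs | rule tyr)+
  have Ds: "A # Nat # \<Gamma> \<turnstile> D\<langle>s \<cdot> Succ (Var 1) \<cdot> \<up>2\<rangle> \<Colon> Id T\<up>2 c\<up>2 ?I2"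
    supply ty = D s A
    by (rule ty ty[THEN ty_sub] ty[THEN ty_ctx] | simp only: sbs | rule tyr)+
  have cty: "A # Nat # \<Gamma> \<turnstile> concat T\<up>2 c\<up>2 I ?I2 D g \<Colon> Id T\<up>2 c\<up>2 ?I2"
    by (rule concat_ty[OF D g T2(1,3) I T2(2)])
  show thesis
    by (rule that[OF c D inh_trans[OF Dg E6 former_ty(5)[OF T2(1,3,2)] cty r Ds]])
qed

section \<open>Graph quotients\<close>

lemma sub_Ty: "\<Delta> \<turnstile> A \<Colon> Ty \<Longrightarrow> sb \<Delta> \<sigma> \<Gamma> \<Longrightarrow> \<Gamma> \<turnstile> A\<langle>\<sigma>\<rangle> \<Colon> Ty"
  and sub_U: "\<Delta> \<turnstile> A \<Colon> U \<Longrightarrow> sb \<Delta> \<sigma> \<Gamma> \<Longrightarrow> \<Gamma> \<turnstile> A\<langle>\<sigma>\<rangle> \<Colon> U"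
  and sub_small: "\<Delta> \<turnstile> A \<Colon> U \<Longrightarrow> sb \<Delta> \<sigma> \<Gamma> \<Longrightarrow> \<Gamma> \<turnstile> A\<langle>\<sigma>\<rangle> \<Colon> Ty"
  by (erule ty_sub[OF small] ty_sub, assumption, simp add: sbs)+

lemma sb_ctx_conv:
  assumes E: "\<Gamma> \<turnstile> A' \<doteq> A \<Colon> Ty" and A': "\<Gamma> \<turnstile> A' \<Colon> Ty"
  shows "sb (A # \<Gamma>) Var (A' # \<Gamma>)"
proof -
  note c = ctx_cons[OF A']
  have "A' # \<Gamma> \<turnstile> A'\<up>1 \<doteq> A\<up>1 \<Colon> Ty"
    by (rule eq_sub[OF E sb_shifts(1)[OF c]]) (simp add: sbs)
  from sb_scons[OF sb_shifts(1)[OF c] conv[OF var_ty(1)[OF c refl] this]] show ?thesis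
    by (simp add: sbs)
qed

text \<open>Edge types of graphs and the types of the sequence for the truncation occur in contexts
  in unreduced form; this exchanges them for their values.\<close>

lemma ctx_conv:
  assumes "\<Gamma> \<turnstile> A' \<doteq> A \<Colon> Ty" "\<Gamma> \<turnstile> A' \<Colon> Ty"
  shows ty_ctx_conv: "A # \<Gamma> \<turnstile> b \<Colon> B \<Longrightarrow> A' # \<Gamma> \<turnstile> b \<Colon> B"
    and inh_ctx_conv: "inh (A # \<Gamma>) B \<Longrightarrow> inh (A' # \<Gamma>) B"
  using ty_sub[OF _ sb_ctx_conv[OF assms]] inh_sub[OF _ sb_ctx_conv[OF assms]] by (force simp: sbs)+

lemma d1_type_sub:
  "(d1_type G1 P d0)\<langle>Var 0 \<cdot> Var 1 \<cdot> Var 2 \<cdot> (\<sigma> ;; \<up>3)\<rangle> = d1_type G1\<langle>\<sigma>\<rangle> P\<langle>Var 0 \<cdot> (\<sigma> ;; \<up>1)\<rangle> d0\<langle>Var 0 \<cdot> (\<sigma> ;; \<up>1)\<rangle>"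
  by (simp add: d1_type_def glue_type_def sbs)

lemma edge_ty:
  assumes "\<Gamma> \<turnstile> G1 \<Colon> arrow G0 (arrow G0 U)" "\<Gamma> \<turnstile> i \<Colon> G0" "\<Gamma> \<turnstile> j \<Colon> G0"
  shows "\<Gamma> \<turnstile> App (App G1 i) j \<Colon> Ty"
  by (rule small, rule App_arrow, rule App_arrow) (rule assms)+

text \<open>Induction for the generic point of the quotient. All data are weakened past the new
  variable, underneath the variables that they bind, before \<open>IndColim\<close> is applied to
  that variable.\<close>

lemma inh_Colim:
  assumes G0: "\<Gamma> \<turnstile> G0 \<Colon> U" and G1: "\<Gamma> \<turnstile> G1 \<Colon> arrow G0 (arrow G0 U)"
    and P: "Colim G0 G1 # \<Gamma> \<turnstile> P \<Colon> Ty"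
    and d0: "G0 # \<Gamma> \<turnstile> d0 \<Colon> P\<langle>C0 G1\<up>1 (Var 0) \<cdot> \<up>1\<rangle>"
    and d1: "inh (App (App G1\<up>2 (Var 1)) (Var 0) # G0\<up>1 # G0 # \<Gamma>) (d1_type G1 P d0)"
  shows "inh (Colim G0 G1 # \<Gamma>) P"
proof -
  let ?\<Delta> = "Colim G0 G1 # \<Gamma>"
  have C: "\<Gamma> \<turnstile> Colim G0 G1 \<Colon> Ty"
    by (rule small[OF Colim[OF G0 G1]])
  obtain e where e: "App (App G1\<up>2 (Var 1)) (Var 0) # G0\<up>1 # G0 # \<Gamma> \<turnstile> e \<Colon> d1_type G1 P d0"
    using d1 by (rule inhE)
  have 0: "?\<Delta> \<turnstile> G0\<up>1 \<Colon> U" "?\<Delta> \<turnstile> G1\<up>1 \<Colon> arrow G0\<up>1 (arrow G0\<up>1 U)"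
    supply ty = C G1 and tyU = G0
    by (rule ty tyU tyU[THEN small] tyU[THEN sub_U] tyU[THEN sub_small] ty[THEN ty_sub] ty[THEN ty_ctx] tyU[THEN ty_ctx]
        | simp only: sbs | rule tyr)+
  have 1: "Colim G0\<up>1 G1\<up>1 # ?\<Delta> \<turnstile> P\<langle>Var 0 \<cdot> \<up>2\<rangle> \<Colon> Ty"
    supply ty = P C G1 and tyU = G0
    by (rule ty tyU tyU[THEN small] tyU[THEN sub_U] tyU[THEN sub_small] ty[THEN ty_sub] ty[THEN ty_ctx] tyU[THEN ty_ctx] Colim[THEN small]
        | simp only: sbs | rule tyr)+
  have 2: "G0\<up>1 # ?\<Delta> \<turnstile> d0\<langle>Var 0 \<cdot> \<up>2\<rangle> \<Colon> P\<langle>Var 0 \<cdot> \<up>2\<rangle>\<langle>C0 G1\<up>1\<up>1 (Var 0) \<cdot> \<up>1\<rangle>"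
    supply ty = d0 C and tyU = G0
    by (rule ty tyU tyU[THEN small] tyU[THEN sub_U] tyU[THEN sub_small] ty[THEN ty_sub] ty[THEN ty_ctx] tyU[THEN ty_ctx]
        | simp only: sbs | rule tyr)+
  have 3: "App (App G1\<up>1\<up>2 (Var 1)) (Var 0) # G0\<up>1\<up>1 # G0\<up>1 # ?\<Delta> \<turnstile>
    e\<langle>Var 0 \<cdot> Var 1 \<cdot> Var 2 \<cdot> \<up>4\<rangle> \<Colon> d1_type G1\<up>1 P\<langle>Var 0 \<cdot> \<up>2\<rangle> d0\<langle>Var 0 \<cdot> \<up>2\<rangle>"
    apply (rule ty_sub[OF e])
     defer
     apply (use d1_type_sub[of G1 P d0 "\<up>1"] in \<open>simp add: sbs\<close>)
    supply ty = C G1 and tyU = G0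
    by (rule ty tyU tyU[THEN small] tyU[THEN sub_U] tyU[THEN sub_small] ty[THEN ty_sub] ty[THEN ty_ctx] tyU[THEN ty_ctx] edge_ty
        | simp only: sbs | rule tyr)+
  have "?\<Delta> \<turnstile> Var 0 \<Colon> Colim G0\<up>1 G1\<up>1"
    supply ty = C
    by (rule ty ty[THEN ty_sub] ty[THEN ty_ctx] | simp only: sbs | rule tyr)+
  from inhI[OF IndColim[OF 0 1 2 3 this]] show ?thesis
    by (simp add: sbs)
qed

text \<open>In a family of propositions the data on edges are paths between two points of a
  proposition, hence automatic.\<close>

lemma inh_Colim_prop:
  assumes G0: "\<Gamma> \<turnstile> G0 \<Colon> U" and G1: "\<Gamma> \<turnstile> G1 \<Colon> arrow G0 (arrow G0 U)"
    and P: "Colim G0 G1 # \<Gamma> \<turnstile> P \<Colon> Ty" and pr: "inh (Colim G0 G1 # \<Gamma>) (isprop P)"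
    and d: "inh (G0 # \<Gamma>) P\<langle>C0 G1\<up>1 (Var 0) \<cdot> \<up>1\<rangle>"
  shows "inh (Colim G0 G1 # \<Gamma>) P"
proof -
  obtain d0 where d0: "G0 # \<Gamma> \<turnstile> d0 \<Colon> P\<langle>C0 G1\<up>1 (Var 0) \<cdot> \<up>1\<rangle>"
    using d by (rule inhE)
  have C: "\<Gamma> \<turnstile> Colim G0 G1 \<Colon> Ty"
    by (rule small[OF Colim[OF G0 G1]])
  let ?\<Theta> = "App (App G1\<up>2 (Var 1)) (Var 0) # G0\<up>1 # G0 # \<Gamma>"
  have "inh ?\<Theta> (Id P\<langle>C0 G1\<up>3 (Var 1) \<cdot> \<up>3\<rangle> (tr P\<langle>Var 0 \<cdot> \<up>4\<rangle> (C0 G1\<up>3 (Var 2)) (C0 G1\<up>3 (Var 1))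
     (C1 G1\<up>3 (Var 2) (Var 1) (Var 0)) d0\<langle>Var 2 \<cdot> \<up>3\<rangle>) d0\<langle>Var 1 \<cdot> \<up>3\<rangle>)"
    apply (rule inh_isprop_elim)
      apply (rule inh_sub[OF pr, of "C0 G1\<up>3 (Var 1) \<cdot> \<up>3"])
    supply ty = C G1 P d0 and tyU = G0
    by (rule ty tyU tyU[THEN small] tyU[THEN sub_U] tyU[THEN sub_small] ty[THEN ty_sub] ty[THEN ty_ctx] tyU[THEN ty_ctx] edge_ty C0 C1 Colim[THEN small]
        | simp only: sbs | rule tyr)+
  then have "inh ?\<Theta> (d1_type G1 P d0)"
    by (simp add: d1_type_def glue_type_def sbs)
  from inh_Colim[OF G0 G1 P d0 this] show ?thesis .
qed

section \<open>Graphs given by a relation, and coequalizers\<close>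

lemma graph_ty:
  assumes W: "\<Gamma> \<turnstile> W \<Colon> Ty" and E: "W\<up>1 # W # \<Gamma> \<turnstile> E \<Colon> U"
  shows "\<Gamma> \<turnstile> Lam W (Lam W\<up>1 E) \<Colon> arrow W (arrow W U)"
  supply ty = E W
  by (rule ty ty[THEN ty_sub] ty[THEN ty_ctx] | simp only: sbs | rule tyr)+

lemma graph_beta:
  assumes W: "\<Gamma> \<turnstile> W \<Colon> Ty" and E: "W\<up>1 # W # \<Gamma> \<turnstile> E \<Colon> U" and x: "\<Gamma> \<turnstile> x \<Colon> W" and y: "\<Gamma> \<turnstile> y \<Colon> W"
  shows "\<Gamma> \<turnstile> App (App (Lam W (Lam W\<up>1 E)) x) y \<doteq> E\<langle>y \<cdot> x \<cdot> Var\<rangle> \<Colon> U"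
proof -
  have 1: "W # \<Gamma> \<turnstile> arrow W\<up>1 U \<Colon> Ty" "W # \<Gamma> \<turnstile> Lam W\<up>1 E \<Colon> arrow W\<up>1 U"
    supply ty = W E
    by (rule ty ty[THEN ty_sub] ty[THEN ty_ctx] | simp only: sbs | rule tyr)+
  have 2: "\<Gamma> \<turnstile> App (Lam W (Lam W\<up>1 E)) x \<doteq> Lam W E\<langle>Var 0 \<cdot> x\<up>1 \<cdot> \<up>1\<rangle> \<Colon> Pi W U"
    using Pi_beta[OF 1 x] by (simp add: sbs arrow_def)
  have 3: "W # \<Gamma> \<turnstile> U \<Colon> Ty" "W # \<Gamma> \<turnstile> E\<langle>Var 0 \<cdot> x\<up>1 \<cdot> \<up>1\<rangle> \<Colon> U"
    supply ty = W E x
    by (rule ty ty[THEN ty_sub] ty[THEN ty_ctx] | simp only: sbs | rule tyr)+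
  have "\<Gamma> \<turnstile> App (App (Lam W (Lam W\<up>1 E)) x) y \<doteq> App (Lam W E\<langle>Var 0 \<cdot> x\<up>1 \<cdot> \<up>1\<rangle>) y \<Colon> U"
    using App_cong[OF 2 eq_refl[OF y]] by (simp add: sbs)
  moreover have "\<Gamma> \<turnstile> App (Lam W E\<langle>Var 0 \<cdot> x\<up>1 \<cdot> \<up>1\<rangle>) y \<doteq> E\<langle>y \<cdot> x \<cdot> Var\<rangle> \<Colon> U"
    using Pi_beta[OF 3 y] by (simp add: sbs)
  ultimately show ?thesis by (rule eq_trans)
qed

text \<open>The coequalizer of the identity and \<open>h\<close>, a term with one further variable of type \<open>W\<close>.\<close>

definition cgraph :: "tm \<Rightarrow> tm \<Rightarrow> tm" where
  "cgraph W h = Lam W (Lam W\<up>1 (Id W\<up>2 h\<up>1 (Var 0)))"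

definition coeq :: "tm \<Rightarrow> tm \<Rightarrow> tm" where
  "coeq W h = Colim W (cgraph W h)"

lemma coeq_sub:
  "(cgraph W h)\<langle>\<sigma>\<rangle> = cgraph W\<langle>\<sigma>\<rangle> h\<langle>Var 0 \<cdot> (\<sigma> ;; \<up>1)\<rangle>"
  "(coeq W h)\<langle>\<sigma>\<rangle> = coeq W\<langle>\<sigma>\<rangle> h\<langle>Var 0 \<cdot> (\<sigma> ;; \<up>1)\<rangle>"
  by (simp_all add: cgraph_def coeq_def sbs)

lemmas sbs4 = sbs coeq_sub

lemma cgraph_E:
  assumes W: "\<Gamma> \<turnstile> W \<Colon> U" and h: "W # \<Gamma> \<turnstile> h \<Colon> W\<up>1"
  shows "W\<up>1 # W # \<Gamma> \<turnstile> Id W\<up>2 h\<up>1 (Var 0) \<Colon> U"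
  supply ty = h and tyU = W
  by (rule ty tyU tyU[THEN small] tyU[THEN sub_U] tyU[THEN sub_small] ty[THEN ty_sub] ty[THEN ty_ctx] tyU[THEN ty_ctx]
      | simp only: sbs4 | rule tyr)+

lemma cgraph_ty:
  assumes W: "\<Gamma> \<turnstile> W \<Colon> U" and h: "W # \<Gamma> \<turnstile> h \<Colon> W\<up>1"
  shows "\<Gamma> \<turnstile> cgraph W h \<Colon> arrow W (arrow W U)"
  unfolding cgraph_def by (rule graph_ty[OF small[OF W] cgraph_E[OF W h]])

lemma coeq_U:
  assumes W: "\<Gamma> \<turnstile> W \<Colon> U" and h: "W # \<Gamma> \<turnstile> h \<Colon> W\<up>1"
  shows "\<Gamma> \<turnstile> coeq W h \<Colon> U"
  unfolding coeq_def by (rule Colim[OF W cgraph_ty[OF W h]])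

lemma coeq_C0:
  assumes W: "\<Gamma> \<turnstile> W \<Colon> U" and h: "W # \<Gamma> \<turnstile> h \<Colon> W\<up>1" and w: "\<Gamma> \<turnstile> w \<Colon> W"
  shows "\<Gamma> \<turnstile> C0 (cgraph W h) w \<Colon> coeq W h"
  unfolding coeq_def by (rule C0[OF W cgraph_ty[OF W h] w])

lemma coeq_C1:
  assumes W: "\<Gamma> \<turnstile> W \<Colon> U" and h: "W # \<Gamma> \<turnstile> h \<Colon> W\<up>1" and w: "\<Gamma> \<turnstile> w \<Colon> W" and y: "\<Gamma> \<turnstile> y \<Colon> W"
    and q: "\<Gamma> \<turnstile> q \<Colon> Id W h\<langle>w \<cdot> Var\<rangle> y"
  shows "\<Gamma> \<turnstile> C1 (cgraph W h) w y q \<Colon> Id (coeq W h) (C0 (cgraph W h) w) (C0 (cgraph W h) y)"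
  unfolding coeq_def
proof (rule C1[OF W cgraph_ty[OF W h] w y])
  from graph_beta[OF small[OF W] cgraph_E[OF W h] w y]
  have "\<Gamma> \<turnstile> App (App (cgraph W h) w) y \<doteq> Id W h\<langle>w \<cdot> Var\<rangle> y \<Colon> U"
    by (simp add: cgraph_def sbs)
  from conv[OF q eq_sym[OF eq_small[OF this]]]
  show "\<Gamma> \<turnstile> q \<Colon> App (App (cgraph W h) w) y" .
qed

text \<open>\<open>Q\<close> is the condition on an edge from \<open>w\<close>
  (\<open>Var 2\<close>) to \<open>y\<close> (\<open>Var 1\<close>). An edge is a path
  \<open>h w = y\<close> with free endpoint, so based path induction reduces the condition to the
  edge \<open>refl\<close> from \<open>w\<close> to \<open>h w\<close>.\<close>

lemma inh_coeq_path:
  fixes Q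
  assumes W: "\<Gamma> \<turnstile> W \<Colon> U" and h: "W # \<Gamma> \<turnstile> h \<Colon> W\<up>1" and c: "\<Gamma> \<turnstile> c \<Colon> coeq W h"
    and d0: "W # \<Gamma> \<turnstile> d0 \<Colon> Id (coeq W h)\<up>1 c\<up>1 (C0 (cgraph W h)\<up>1 (Var 0))"
  defines "Q \<equiv> Id (Id (coeq W h)\<up>3 c\<up>3 (C0 (cgraph W h)\<up>3 (Var 1)))
    (concat (coeq W h)\<up>3 c\<up>3 (C0 (cgraph W h)\<up>3 (Var 2)) (C0 (cgraph W h)\<up>3 (Var 1)) d0\<langle>Var 2 \<cdot> \<up>3\<rangle>
      (C1 (cgraph W h)\<up>3 (Var 2) (Var 1) (Var 0))) d0\<langle>Var 1 \<cdot> \<up>3\<rangle>"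
  shows Q_ty: "Id W\<up>2 h\<up>1 (Var 0) # W\<up>1 # W # \<Gamma> \<turnstile> Q \<Colon> Ty" (is "?\<Delta> \<turnstile> Q \<Colon> Ty")
    and "inh (W # \<Gamma>) Q\<langle>Refl h \<cdot> h \<cdot> Var\<rangle> \<Longrightarrow> inh (coeq W h # \<Gamma>) (Id (coeq W h)\<up>1 c\<up>1 (Var 0))"
proof -
  note W' = small[OF W] and G = cgraph_ty[OF W h] and T = coeq_U[OF W h]
  note T' = small[OF T]
  show Q: "?\<Delta> \<turnstile> Q \<Colon> Ty"
    unfolding Q_def
    supply ty = c d0 h and tyU = W T
    by (rule ty tyU tyU[THEN small] tyU[THEN sub_U] tyU[THEN sub_small] ty[THEN ty_sub] ty[THEN ty_ctx] tyU[THEN ty_ctx] coeq_C0 coeq_C1 coeq_U coeq_U[THEN small]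
        | simp only: sbs4 | rule tyr)+
  \<comment> \<open>Graph quotient induction supplies edges of this type, which is judgementally but
    not syntactically the identity type used in \<open>Q\<close>.\<close>
  let ?E = "App (App (cgraph W h)\<up>2 (Var 1)) (Var 0)"
  let ?\<Delta>' = "?E # W\<up>1 # W # \<Gamma>"
  have "W\<up>1 # W # \<Gamma> \<turnstile> App (App (cgraph W\<up>2 h\<langle>Var 0 \<cdot> \<up>3\<rangle>) (Var 1)) (Var 0)
     \<doteq> (Id W\<up>2\<up>2 h\<langle>Var 0 \<cdot> \<up>3\<rangle>\<up>1 (Var 0))\<langle>Var 0 \<cdot> Var 1 \<cdot> Var\<rangle> \<Colon> U"
    unfolding cgraph_def
    apply (rule graph_beta)
    supply ty = h and tyU = W
    by (rule ty tyU tyU[THEN small] tyU[THEN sub_U] tyU[THEN sub_small] ty[THEN ty_sub] ty[THEN ty_ctx] tyU[THEN ty_ctx]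
        | simp only: sbs4 | rule tyr)+
  then have E: "W\<up>1 # W # \<Gamma> \<turnstile> ?E \<doteq> Id W\<up>2 h\<up>1 (Var 0) \<Colon> Ty"
    by (simp add: sbs4 eq_small)
  have ET: "W\<up>1 # W # \<Gamma> \<turnstile> ?E \<Colon> Ty"
    apply (rule edge_ty)
    supply ty = G W'
    by (rule ty ty[THEN ty_sub] ty[THEN ty_ctx] | simp only: sbs4 | rule tyr)+
  show "inh (coeq W h # \<Gamma>) (Id (coeq W h)\<up>1 c\<up>1 (Var 0))" if 1: "inh (W # \<Gamma>) Q\<langle>Refl h \<cdot> h \<cdot> Var\<rangle>"
  proof -
    have "W # \<Gamma> \<turnstile> W\<up>1 \<Colon> Ty"
      supply ty = W'
      by (rule ty ty[THEN ty_sub] ty[THEN ty_ctx] | simp only: sbs4 | rule tyr)+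
    from inh_bJ_open[OF this h _ 1] Q have "inh ?\<Delta> Q"
      by (simp add: sbs)
    from inh_ctx_conv[OF E ET this] have "inh ?\<Delta>' Q" .
    \<comment> \<open>Transport in the family \<open>c = _\<close> is \<open>concat\<close> by
      definition, so \<open>Q\<close> is the required type of path data.\<close>
    then have d1: "inh ?\<Delta>' (d1_type (cgraph W h) (Id (coeq W h)\<up>1 c\<up>1 (Var 0)) d0)"
      by (simp add: d1_type_def glue_type_def sbs Q_def concat_def)
    have P: "coeq W h # \<Gamma> \<turnstile> Id (coeq W h)\<up>1 c\<up>1 (Var 0) \<Colon> Ty"
      supply ty = T' c h and tyU = W
      by (rule ty tyU tyU[THEN small] tyU[THEN sub_U] tyU[THEN sub_small] ty[THEN ty_sub] ty[THEN ty_ctx] tyU[THEN ty_ctx] coeq_U[THEN small]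
          | simp only: sbs4 | rule tyr)+
    from inh_Colim[OF W G _ _ d1] P d0 show ?thesis
      by (simp add: sbs coeq_def)
  qed
qed

lemma inh_isprop_center:
  assumes T: "\<Gamma> \<turnstile> T \<Colon> Ty" and c: "\<Gamma> \<turnstile> c \<Colon> T" and h: "inh (T # \<Gamma>) (Id T\<up>1 c\<up>1 (Var 0))"
  shows "inh \<Gamma> (isprop T)"
proof (rule inh_isprop[OF inh_trans[OF inh_sym] T])
  show "inh (T\<up>1 # T # \<Gamma>) (Id T\<up>2 c\<up>2 (Var 1))"
    apply (rule inh_sub[OF h, of "\<up>1"])
    supply ty = T
    by (rule ty ty[THEN ty_sub] ty[THEN ty_ctx] | simp only: sbs4 | rule tyr)+
  show "inh (T\<up>1 # T # \<Gamma>) (Id T\<up>2 c\<up>2 (Var 0))"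
    apply (rule inh_sub[OF h, of "Var 0 \<cdot> \<up>2"])
    supply ty = T
    by (rule ty ty[THEN ty_sub] ty[THEN ty_ctx] | simp only: sbs4 | rule tyr)+
qed ((rule T c T[THEN ty_sub] c[THEN ty_sub] tyr | simp only: sbs)+)

lemma concat_cong:
  assumes p: "\<Gamma> \<turnstile> p \<doteq> p' \<Colon> Id A x y" and q: "\<Gamma> \<turnstile> q \<Colon> Id A y z" and A: "\<Gamma> \<turnstile> A \<Colon> Ty" and xyz: "\<Gamma> \<turnstile> x \<Colon> A" "\<Gamma> \<turnstile> y \<Colon> A" "\<Gamma> \<turnstile> z \<Colon> A"
  shows "\<Gamma> \<turnstile> concat A x y z p q \<doteq> concat A x y z p' q \<Colon> Id A x z"
proof -
  have "A # \<Gamma> \<turnstile> Id A\<up>1 x\<up>1 (Var 0) \<Colon> Ty"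
    supply ty = A xyz(1)
    by (rule ty ty[THEN ty_sub] ty[THEN ty_ctx] | simp only: sbs | rule tyr)+
  from tr_cong[OF q A this xyz(2,3)] p show ?thesis
    by (simp add: concat_def sbs)
qed

text \<open>Besides the section \<open>d\<close>, its judgemental value at the generic pair is
  needed: terms built from \<open>d\<close> are later compared with terms built from
  \<open>D\<close>.\<close>

lemma Sigma_rec_open:
  assumes A: "\<Gamma> \<turnstile> A \<Colon> Ty" and B: "A # \<Gamma> \<turnstile> B \<Colon> Ty" and P: "Sigma A B # \<Gamma> \<turnstile> P \<Colon> Ty"
    and D: "B # A # \<Gamma> \<turnstile> D \<Colon> P\<langle>Pair B\<langle>Var 0 \<cdot> \<up>3\<rangle> (Var 1) (Var 0) \<cdot> \<up>2\<rangle>"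
  obtains d where "Sigma A B # \<Gamma> \<turnstile> d \<Colon> P"
    "B # A # \<Gamma> \<turnstile> d\<langle>Pair B\<langle>Var 0 \<cdot> \<up>3\<rangle> (Var 1) (Var 0) \<cdot> \<up>2\<rangle> \<doteq> D \<Colon> P\<langle>Pair B\<langle>Var 0 \<cdot> \<up>3\<rangle> (Var 1) (Var 0) \<cdot> \<up>2\<rangle>"
proof -
  define d where "d = IndSigma P\<langle>Var 0 \<cdot> \<up>2\<rangle> D\<langle>Var 0 \<cdot> Var 1 \<cdot> \<up>3\<rangle> (Var 0)"
  have 1: "Sigma A\<up>1 B\<langle>Var 0 \<cdot> \<up>2\<rangle> # Sigma A B # \<Gamma> \<turnstile> P\<langle>Var 0 \<cdot> \<up>2\<rangle> \<Colon> Ty"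
    supply ty = A B P
    by (rule ty ty[THEN ty_sub] ty[THEN ty_ctx] | simp only: sbs | rule tyr)+
  have 2: "B\<langle>Var 0 \<cdot> \<up>2\<rangle> # A\<up>1 # Sigma A B # \<Gamma> \<turnstile> D\<langle>Var 0 \<cdot> Var 1 \<cdot> \<up>3\<rangle>
    \<Colon> P\<langle>Var 0 \<cdot> \<up>2\<rangle>\<langle>Pair B\<langle>Var 0 \<cdot> \<up>2\<rangle>\<langle>Var 0 \<cdot> \<up>3\<rangle> (Var 1) (Var 0) \<cdot> \<up>2\<rangle>"
    supply ty = A B D
    by (rule ty ty[THEN ty_sub] ty[THEN ty_ctx] | simp only: sbs | rule tyr)+
  have 3: "Sigma A B # \<Gamma> \<turnstile> Var 0 \<Colon> Sigma A\<up>1 B\<langle>Var 0 \<cdot> \<up>2\<rangle>"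
    supply ty = A B
    by (rule ty ty[THEN ty_sub] ty[THEN ty_ctx] | simp only: sbs | rule tyr)+
  have 4: "Sigma A\<up>2 B\<langle>Var 0 \<cdot> \<up>3\<rangle> # B # A # \<Gamma> \<turnstile> P\<langle>Var 0 \<cdot> \<up>3\<rangle> \<Colon> Ty"
    supply ty = A B P
    by (rule ty ty[THEN ty_sub] ty[THEN ty_ctx] | simp only: sbs | rule tyr)+
  have 5: "B\<langle>Var 0 \<cdot> \<up>3\<rangle> # A\<up>2 # B # A # \<Gamma> \<turnstile> D\<langle>Var 0 \<cdot> Var 1 \<cdot> \<up>4\<rangle>
    \<Colon> P\<langle>Var 0 \<cdot> \<up>3\<rangle>\<langle>Pair B\<langle>Var 0 \<cdot> \<up>3\<rangle>\<langle>Var 0 \<cdot> \<up>3\<rangle> (Var 1) (Var 0) \<cdot> \<up>2\<rangle>"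
    supply ty = A B D
    by (rule ty ty[THEN ty_sub] ty[THEN ty_ctx] | simp only: sbs | rule tyr)+
  have 6: "B # A # \<Gamma> \<turnstile> Var 1 \<Colon> A\<up>2" "B # A # \<Gamma> \<turnstile> Var 0 \<Colon> B\<langle>Var 0 \<cdot> \<up>3\<rangle>\<langle>Var 1 \<cdot> Var\<rangle>"
    supply ty = A B
    by (rule ty ty[THEN ty_sub] ty[THEN ty_ctx] | simp only: sbs | rule tyr)+
  show thesis
    by (rule that[of d]) (use IndSigma[OF 1 2 3] Sigma_beta[OF 4 5 6] in \<open>simp_all add: d_def sbs\<close>)
qed

text \<open>Pairs have no judgemental eta rule here, so a statement about an element of a Sigma type
  is reduced to a generic pair by induction.\<close>

lemma inh_Sigma_open:
  assumes A: "\<Gamma> \<turnstile> A \<Colon> Ty" and B: "A # \<Gamma> \<turnstile> B \<Colon> Ty" and P: "Sigma A B # \<Gamma> \<turnstile> P \<Colon> Ty"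
    and D: "inh (B # A # \<Gamma>) P\<langle>Pair B\<langle>Var 0 \<cdot> \<up>3\<rangle> (Var 1) (Var 0) \<cdot> \<up>2\<rangle>"
  shows "inh (Sigma A B # \<Gamma>) P"
  using D by (metis inhE inhI Sigma_rec_open[OF A B P])

section \<open>Sequential colimits\<close>

text \<open>
  The colimit of \<open>s : A n \<rightarrow> A (n + 1)\<close> is the coequalizer of the identity and \<open>(n, x) \<mapsto> (n + 1, s x)\<close> on
  \<open>\<Sigma>(n : Nat). A n\<close>. The terms \<open>A\<close> and \<open>s\<close> have one and two further variables.
\<close>

definition tele_step :: "tm \<Rightarrow> tm \<Rightarrow> tm" where
  "tele_step A s = IndSigma (Sigma Nat A)\<up>2 (Pair A\<langle>Var 0 \<cdot> \<up>4\<rangle> (Succ (Var 1)) s\<langle>Var 0 \<cdot> Var 1 \<cdot> \<up>3\<rangle>) (Var 0)"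

definition tele :: "tm \<Rightarrow> tm \<Rightarrow> tm" where
  "tele A s = coeq (Sigma Nat A) (tele_step A s)"

definition tin :: "tm \<Rightarrow> tm \<Rightarrow> tm \<Rightarrow> tm \<Rightarrow> tm" where
  "tin A s n x = C0 (cgraph (Sigma Nat A) (tele_step A s)) (Pair A n x)"

lemma tele_sub:
  "(tele_step A s)\<langle>Var 0 \<cdot> (\<sigma> ;; \<up>1)\<rangle> = tele_step A\<langle>Var 0 \<cdot> (\<sigma> ;; \<up>1)\<rangle> s\<langle>Var 0 \<cdot> Var 1 \<cdot> (\<sigma> ;; \<up>2)\<rangle>"
  "(tele A s)\<langle>\<sigma>\<rangle> = tele A\<langle>Var 0 \<cdot> (\<sigma> ;; \<up>1)\<rangle> s\<langle>Var 0 \<cdot> Var 1 \<cdot> (\<sigma> ;; \<up>2)\<rangle>"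
  "(tin A s n x)\<langle>\<sigma>\<rangle> = tin A\<langle>Var 0 \<cdot> (\<sigma> ;; \<up>1)\<rangle> s\<langle>Var 0 \<cdot> Var 1 \<cdot> (\<sigma> ;; \<up>2)\<rangle> n\<langle>\<sigma>\<rangle> x\<langle>\<sigma>\<rangle>"
  by (simp_all add: tele_def tin_def tele_step_def sbs4)

locale sequence =
  fixes \<Gamma> A s
  assumes A: "Nat # \<Gamma> \<turnstile> A \<Colon> U" and s: "A # Nat # \<Gamma> \<turnstile> s \<Colon> A\<langle>Succ (Var 1) \<cdot> \<up>2\<rangle>"
begin

lemma ctx: "ctx \<Gamma>"
  using ty_ctx[OF A] by (rule ctx_tl)

definition "W = Sigma Nat A"
definition "h = tele_step A s"
definition "T = tele A s"
definition "G = cgraph W h"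
text \<open>Over \<open>A # Nat # \<Gamma>\<close>, \<open>p\<close> is the generic point
  \<open>(n, x)\<close> of the telescope and \<open>p'\<close> the value \<open>(n + 1, s x)\<close>
  of \<open>h\<close> at it.\<close>

definition "p = Pair A\<langle>Var 0 \<cdot> \<up>3\<rangle> (Var 1) (Var 0)"
definition "p' = Pair A\<langle>Var 0 \<cdot> \<up>3\<rangle> (Succ (Var 1)) s"
abbreviation "I \<equiv> C0 G\<up>2 p"
abbreviation "I' \<equiv> C0 G\<up>2 p'"

lemma pp': "p\<langle>s \<cdot> Succ (Var 1) \<cdot> \<up>2\<rangle> = p'"
  by (simp add: p_def p'_def sbs)

lemma W: "\<Gamma> \<turnstile> W \<Colon> U"
  unfolding W_def
  supply ty = A
  by (rule ty ty[THEN ty_sub] ty[THEN ty_ctx] ctx | simp only: sbs | rule tyr)+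

lemma p: "A # Nat # \<Gamma> \<turnstile> p \<Colon> W\<up>2"
  unfolding p_def W_def
  supply tyU = A
  by (rule tyU tyU[THEN small] tyU[THEN sub_U] tyU[THEN sub_small] tyU[THEN ty_ctx] Pair | simp only: sbs | rule tyr)+

lemma p': "A # Nat # \<Gamma> \<turnstile> p' \<Colon> W\<up>2"
  unfolding p'_def W_def
  supply ty = s and tyU = A
  by (rule ty tyU tyU[THEN small] tyU[THEN sub_U] tyU[THEN sub_small] ty[THEN ty_sub] ty[THEN ty_ctx] tyU[THEN ty_ctx] Pair
      | simp only: sbs | rule tyr)+

lemma h: "W # \<Gamma> \<turnstile> h \<Colon> W\<up>1"
proof -
  have 1: "W\<up>1 # W # \<Gamma> \<turnstile> W\<up>2 \<Colon> Ty"
    supply tyU = W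
    by (rule tyU tyU[THEN small] tyU[THEN sub_U] tyU[THEN sub_small] tyU[THEN ty_ctx] | simp only: sbs | rule tyr)+
  have 2: "A\<langle>Var 0 \<cdot> \<up>2\<rangle> # Nat # W # \<Gamma> \<turnstile> Pair A\<langle>Var 0 \<cdot> \<up>4\<rangle> (Succ (Var 1)) s\<langle>Var 0 \<cdot> Var 1 \<cdot> \<up>3\<rangle> \<Colon> Sigma Nat A\<langle>Var 0 \<cdot> \<up>4\<rangle>"
    supply ty = s and tyU = A W
    by (rule ty tyU tyU[THEN small] tyU[THEN sub_U] tyU[THEN sub_small] ty[THEN ty_sub] ty[THEN ty_ctx] tyU[THEN ty_ctx] Pair
        | simp only: sbs | rule tyr)+
  have "W # \<Gamma> \<turnstile> Var 0 \<Colon> W\<up>1"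
    supply tyU = W
    by (rule tyU tyU[THEN small] tyU[THEN sub_U] tyU[THEN sub_small] tyU[THEN ty_ctx] | simp only: sbs | rule tyr)+
  with IndSigma[of Nat "A\<langle>Var 0 \<cdot> \<up>2\<rangle>" "W # \<Gamma>" "W\<up>2" "Pair A\<langle>Var 0 \<cdot> \<up>4\<rangle> (Succ (Var 1)) s\<langle>Var 0 \<cdot> Var 1 \<cdot> \<up>3\<rangle>" "Var 0"] 1 2
  show ?thesis
    by (simp add: W_def h_def tele_step_def sbs)
qed

lemma hp: "A # Nat # \<Gamma> \<turnstile> h\<langle>p \<cdot> \<up>2\<rangle> \<doteq> p' \<Colon> W\<up>2"
proof -
  have 1: "Sigma Nat A\<langle>Var 0 \<cdot> \<up>3\<rangle> # A # Nat # \<Gamma> \<turnstile> Sigma Nat A\<langle>Var 0 \<cdot> \<up>4\<rangle> \<Colon> Ty"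
    supply tyU = A
    by (rule tyU tyU[THEN small] tyU[THEN sub_U] tyU[THEN sub_small] tyU[THEN ty_ctx] | simp only: sbs | rule tyr)+
  have 2: "A\<langle>Var 0 \<cdot> \<up>3\<rangle> # Nat # A # Nat # \<Gamma> \<turnstile> Pair A\<langle>Var 0 \<cdot> \<up>5\<rangle> (Succ (Var 1)) s\<langle>Var 0 \<cdot> Var 1 \<cdot> \<up>4\<rangle>
    \<Colon> (Sigma Nat A\<langle>Var 0 \<cdot> \<up>4\<rangle>)\<langle>Pair A\<langle>Var 0 \<cdot> \<up>3\<rangle>\<langle>Var 0 \<cdot> \<up>3\<rangle> (Var 1) (Var 0) \<cdot> \<up>2\<rangle>"
    supply ty = s and tyU = A
    by (rule ty tyU tyU[THEN small] tyU[THEN sub_U] tyU[THEN sub_small] ty[THEN ty_sub] ty[THEN ty_ctx] tyU[THEN ty_ctx] Pair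
        | simp only: sbs | rule tyr)+
  have 3: "A # Nat # \<Gamma> \<turnstile> Var 1 \<Colon> Nat" "A # Nat # \<Gamma> \<turnstile> Var 0 \<Colon> A\<langle>Var 0 \<cdot> \<up>3\<rangle>\<langle>Var 1 \<cdot> Var\<rangle>"
    supply tyU = A
    by (rule tyU tyU[THEN small] tyU[THEN sub_U] tyU[THEN sub_small] tyU[THEN ty_ctx] | simp only: sbs | rule tyr)+
  from Sigma_beta[OF 1 2 3] show ?thesis
    by (simp add: h_def tele_step_def p_def p'_def W_def sbs)
qed

lemma T: "\<Gamma> \<turnstile> T \<Colon> U"
  unfolding T_def tele_def using coeq_U[OF W h] by (simp add: W_def h_def)

lemma G: "\<Gamma> \<turnstile> G \<Colon> arrow W (arrow W U)"
  unfolding G_def by (rule cgraph_ty[OF W h])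

text \<open>Quantifying over \<open>\<sigma>\<close> turns this into a typing rule usable in every
  extension of \<open>\<Gamma>\<close>, with \<open>G\<close> and \<open>T\<close> kept
  folded.\<close>

lemma C0_G: "sb \<Gamma> \<sigma> \<Delta> \<Longrightarrow> \<Delta> \<turnstile> w \<Colon> W\<langle>\<sigma>\<rangle> \<Longrightarrow> \<Delta> \<turnstile> C0 G\<langle>\<sigma>\<rangle> w \<Colon> T\<langle>\<sigma>\<rangle>"
proof -
  assume \<sigma>: "sb \<Gamma> \<sigma> \<Delta>" and w: "\<Delta> \<turnstile> w \<Colon> W\<langle>\<sigma>\<rangle>"
  have "\<Delta> \<turnstile> G\<langle>\<sigma>\<rangle> \<Colon> arrow W\<langle>\<sigma>\<rangle> (arrow W\<langle>\<sigma>\<rangle> U)"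
    by (rule ty_sub[OF G \<sigma>]) (simp add: sbs)
  from C0[OF sub_U[OF W \<sigma>] this w] show ?thesis
    by (simp add: T_def tele_def coeq_def W_def h_def G_def sbs)
qed

text \<open>By \<open>hp\<close>, reflexivity at \<open>p'\<close> is an edge from \<open>p\<close>
  to \<open>p'\<close>; the glue path \<open>g\<close> is the path constructor at this edge.\<close>

lemma Refl_p': "A # Nat # \<Gamma> \<turnstile> Refl p' \<Colon> Id W\<up>2 h\<langle>p \<cdot> \<up>2\<rangle> p'"
proof -
  have W2: "A # Nat # \<Gamma> \<turnstile> W\<up>2 \<Colon> Ty"
    supply tyU = A W
    by (rule tyU tyU[THEN small] tyU[THEN sub_U] tyU[THEN sub_small] tyU[THEN ty_ctx] | simp only: sbs | rule tyr)+
  show ?thesis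
    by (rule conv[OF Refl[OF W2 p']], rule Id_cong) (simp_all add: eq_refl W2 p' eq_sym hp)
qed

definition "g = C1 G\<up>2 p p' (Refl p')"

lemma g: "A # Nat # \<Gamma> \<turnstile> g \<Colon> Id T\<up>2 I I'"
proof -
  have 1: "A # Nat # \<Gamma> \<turnstile> W\<up>2 \<Colon> U" "W\<up>2 # A # Nat # \<Gamma> \<turnstile> h\<langle>Var 0 \<cdot> \<up>3\<rangle> \<Colon> W\<up>2\<up>1"
    supply ty = h and tyU = A W
    by (rule ty tyU tyU[THEN small] tyU[THEN sub_U] tyU[THEN sub_small] ty[THEN ty_sub] ty[THEN ty_ctx] tyU[THEN ty_ctx]
        | simp only: sbs | rule tyr)+
  from coeq_C1[OF 1 p p'] Refl_p' show ?thesis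
    by (simp add: sbs4 g_def G_def T_def tele_def W_def h_def)
qed

text \<open>No data on glue paths are needed in a family of propositions, and a point of the
  telescope may be taken to be a pair.\<close>

lemma inh_tele_prop_elim:
  assumes P: "T # \<Gamma> \<turnstile> P \<Colon> Ty" and pr: "inh (T # \<Gamma>) (isprop P)" and d: "inh (A # Nat # \<Gamma>) P\<langle>I \<cdot> \<up>2\<rangle>"
  shows "inh (T # \<Gamma>) P"
proof -
  have T_eq: "T = Colim W G"
    by (simp add: T_def tele_def coeq_def W_def G_def h_def)
  have nA: "\<Gamma> \<turnstile> Nat \<Colon> Ty"
    by (rule ctx | simp only: sbs | rule tyr)+
  have "W # \<Gamma> \<turnstile> P\<langle>C0 G\<up>1 (Var 0) \<cdot> \<up>1\<rangle> \<Colon> Ty"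
    supply ty = P G and tyU = W
    by (rule ty tyU tyU[THEN small] tyU[THEN sub_U] tyU[THEN sub_small] ty[THEN ty_sub] ty[THEN ty_ctx] tyU[THEN ty_ctx] C0_G
        | simp only: sbs | rule tyr)+
  from inh_Sigma_open[OF nA small[OF A] this[unfolded W_def]] d
  have "inh (W # \<Gamma>) P\<langle>C0 G\<up>1 (Var 0) \<cdot> \<up>1\<rangle>"
    by (simp add: sbs W_def p_def)
  with inh_Colim_prop[OF W G, folded T_eq, OF P pr] show ?thesis .
qed

text \<open>The paths \<open>D\<close> from \<open>c\<close> supplied by
  \<open>null_sequence\<close> are compatible with the glue paths, which is exactly the edge
  condition of \<open>inh_coeq_path\<close>. So \<open>c\<close> is a centre of contraction.\<close>

lemma inh_isprop_tele:
  assumes null: "inh (A\<up>1 # A # Nat # \<Gamma>) (Id A\<langle>Succ (Var 2) \<cdot> \<up>3\<rangle> s\<langle>Var 1 \<cdot> \<up>2\<rangle> s\<langle>Var 0 \<cdot> \<up>2\<rangle>)"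
    and a0: "\<Gamma> \<turnstile> a0 \<Colon> A\<langle>Zero \<cdot> Var\<rangle>"
  shows "inh \<Gamma> (isprop T)"
proof -
  have nA: "\<Gamma> \<turnstile> Nat \<Colon> Ty"
    by (rule ctx | simp only: sbs | rule tyr)+
  have I: "A # Nat # \<Gamma> \<turnstile> I \<Colon> T\<up>2"
    supply ty = p and tyU = A
    by (rule ty tyU tyU[THEN small] tyU[THEN sub_U] tyU[THEN sub_small] ty[THEN ty_sub] ty[THEN ty_ctx] tyU[THEN ty_ctx] C0_G
        | simp only: sbs | rule tyr)+
  have g': "A # Nat # \<Gamma> \<turnstile> g \<Colon> Id T\<up>2 I I\<langle>s \<cdot> Succ (Var 1) \<cdot> \<up>2\<rangle>"
    using g by (simp add: sbs pp')
  obtain c D where c: "\<Gamma> \<turnstile> c \<Colon> T" and D: "A # Nat # \<Gamma> \<turnstile> D \<Colon> Id T\<up>2 c\<up>2 I"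
    and coh: "inh (A # Nat # \<Gamma>) (Id (Id T\<up>2 c\<up>2 I\<langle>s \<cdot> Succ (Var 1) \<cdot> \<up>2\<rangle>)
      (concat T\<up>2 c\<up>2 I I\<langle>s \<cdot> Succ (Var 1) \<cdot> \<up>2\<rangle> D g) D\<langle>s \<cdot> Succ (Var 1) \<cdot> \<up>2\<rangle>)"
    by (rule null_sequence[OF small[OF A] s small[OF T] I g' null a0])
  define P where "P = Id T\<up>1 c\<up>1 (C0 G\<up>1 (Var 0))"
  have P: "W # \<Gamma> \<turnstile> P \<Colon> Ty"
    unfolding P_def
    supply ty = c and tyU = T W
    by (rule ty tyU tyU[THEN small] tyU[THEN sub_U] tyU[THEN sub_small] ty[THEN ty_sub] ty[THEN ty_ctx] tyU[THEN ty_ctx] C0_G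
        | simp only: sbs | rule tyr)+
  have "P\<langle>Pair A\<langle>Var 0 \<cdot> \<up>3\<rangle> (Var 1) (Var 0) \<cdot> \<up>2\<rangle> = Id T\<up>2 c\<up>2 I"
    by (simp add: P_def sbs p_def)
  \<comment> \<open>\<open>D\<close> is a family in \<open>n\<close> and \<open>x\<close>
    separately, while the coequalizer wants a family over the Sigma type \<open>W\<close>. The value
    of \<open>d\<close> at a pair is \<open>D\<close> judgementally, and so the coherence of
    \<open>D\<close> becomes one of \<open>d\<close> by conversion.\<close>
  with Sigma_rec_open[OF nA small[OF A] P[unfolded W_def], of D] D
  obtain d where d: "W # \<Gamma> \<turnstile> d \<Colon> P" and dp: "A # Nat # \<Gamma> \<turnstile> d\<langle>p \<cdot> \<up>2\<rangle> \<doteq> D \<Colon> Id T\<up>2 c\<up>2 I"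
    unfolding p_def W_def by metis
  have dp': "A # Nat # \<Gamma> \<turnstile> d\<langle>p' \<cdot> \<up>2\<rangle> \<doteq> D\<langle>s \<cdot> Succ (Var 1) \<cdot> \<up>2\<rangle> \<Colon> Id T\<up>2 c\<up>2 I'"
  proof -
    have "sb (A # Nat # \<Gamma>) (s \<cdot> Succ (Var 1) \<cdot> \<up>2) (A # Nat # \<Gamma>)"
      supply ty = s and tyU = A
      by (rule ty tyU tyU[THEN small] tyU[THEN sub_U] tyU[THEN sub_small] ty[THEN ty_sub] ty[THEN ty_ctx] tyU[THEN ty_ctx]
          | simp only: sbs | rule tyr)+
    from eq_sub[OF dp this refl] show ?thesis
      by (simp add: sbs pp')
  qed
  have T_eq: "coeq W h = T"
    by (simp add: T_def tele_def W_def h_def)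
  define Q where "Q = Id (Id T\<up>3 c\<up>3 (C0 G\<up>3 (Var 1)))
    (concat T\<up>3 c\<up>3 (C0 G\<up>3 (Var 2)) (C0 G\<up>3 (Var 1)) d\<langle>Var 2 \<cdot> \<up>3\<rangle>
      (C1 G\<up>3 (Var 2) (Var 1) (Var 0))) d\<langle>Var 1 \<cdot> \<up>3\<rangle>"
  have Q: "Id W\<up>2 h\<up>1 (Var 0) # W\<up>1 # W # \<Gamma> \<turnstile> Q \<Colon> Ty"
    using Q_ty[OF W h, unfolded T_eq, folded G_def, OF c d[unfolded P_def]] by (simp add: Q_def)
  have W2: "A # Nat # \<Gamma> \<turnstile> W\<up>2 \<Colon> Ty"
    supply tyU = W A
    by (rule tyU tyU[THEN small] tyU[THEN sub_U] tyU[THEN sub_small] tyU[THEN ty_ctx] | simp only: sbs | rule tyr)+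
  have 1: "A # Nat # \<Gamma> \<turnstile> concat T\<up>2 c\<up>2 I I' D g \<doteq> concat T\<up>2 c\<up>2 I I' d\<langle>p \<cdot> \<up>2\<rangle> g \<Colon> Id T\<up>2 c\<up>2 I'"
    apply (rule concat_cong[OF eq_sym[OF dp] g])
    supply ty = c p p' and tyU = T A
    by (rule ty tyU tyU[THEN small] tyU[THEN sub_U] tyU[THEN sub_small] ty[THEN ty_sub] ty[THEN ty_ctx] tyU[THEN ty_ctx] C0_G
        | simp only: sbs | rule tyr)+
  have 2: "A # Nat # \<Gamma> \<turnstile> Id T\<up>2 c\<up>2 I' \<Colon> Ty"
    supply ty = c p' and tyU = T A
    by (rule ty tyU tyU[THEN small] tyU[THEN sub_U] tyU[THEN sub_small] ty[THEN ty_sub] ty[THEN ty_ctx] tyU[THEN ty_ctx] C0_G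
        | simp only: sbs | rule tyr)+
  have "inh (A # Nat # \<Gamma>) (Id (Id T\<up>2 c\<up>2 I') (concat T\<up>2 c\<up>2 I I' d\<langle>p \<cdot> \<up>2\<rangle> g) d\<langle>p' \<cdot> \<up>2\<rangle>)"
    apply (rule inh_conv[OF coh])
    apply (simp only: sub.simps sub_sub scons_scomp shift_scons sbs pp')
    apply (rule Id_cong, simp, rule eq_refl[OF 2], rule 1, rule eq_sym[OF dp'])
    done
  then have "inh (A # Nat # \<Gamma>) Q\<langle>Refl p' \<cdot> p' \<cdot> p \<cdot> \<up>2\<rangle>"
    by (simp add: Q_def sbs g_def)
  \<comment> \<open>The coherence uses the edge \<open>refl\<close> at \<open>p'\<close>, whereas
    the reduction to reflexivity asks for \<open>refl\<close> at \<open>h p\<close>. The two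
    instances of \<open>Q\<close> agree judgementally, by \<open>hp\<close>.\<close>
  moreover have "sbe (Id W\<up>2 h\<up>1 (Var 0) # W\<up>1 # W # \<Gamma>)
    (Refl p' \<cdot> p' \<cdot> p \<cdot> \<up>2) (Refl h\<langle>p \<cdot> \<up>2\<rangle> \<cdot> h\<langle>p \<cdot> \<up>2\<rangle> \<cdot> p \<cdot> \<up>2) (A # Nat # \<Gamma>)"
  proof (intro sbe_scons sbe_refl sb_shifts ty_ctx[OF W2])
    show "A # Nat # \<Gamma> \<turnstile> p \<doteq> p \<Colon> W\<up>2"
      by (rule eq_refl[OF p])
    show "A # Nat # \<Gamma> \<turnstile> p' \<doteq> h\<langle>p \<cdot> \<up>2\<rangle> \<Colon> W\<up>1\<langle>p \<cdot> \<up>2\<rangle>"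
      using eq_sym[OF hp] by (simp add: sbs)
    have "A # Nat # \<Gamma> \<turnstile> Refl p' \<doteq> Refl h\<langle>p \<cdot> \<up>2\<rangle> \<Colon> Id W\<up>2 p' p'"
      by (rule Refl_cong[OF W2 eq_sym[OF hp]])
    moreover have "A # Nat # \<Gamma> \<turnstile> Id W\<up>2 p' p' \<doteq> Id W\<up>2 h\<langle>p \<cdot> \<up>2\<rangle> p' \<Colon> Ty"
      by (rule Id_cong) (simp_all add: eq_refl W2 p' eq_sym hp)
    ultimately show "A # Nat # \<Gamma> \<turnstile> Refl p' \<doteq> Refl h\<langle>p \<cdot> \<up>2\<rangle> \<Colon> (Id W\<up>2 h\<up>1 (Var 0))\<langle>p' \<cdot> p \<cdot> \<up>2\<rangle>"
      using eq_conv by (simp add: sbs)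
  qed
  ultimately have "inh (A # Nat # \<Gamma>) Q\<langle>Refl h\<langle>p \<cdot> \<up>2\<rangle> \<cdot> h\<langle>p \<cdot> \<up>2\<rangle> \<cdot> p \<cdot> \<up>2\<rangle>"
    using inh_conv sub_eq[OF Q] by (metis sub.simps(2))
  moreover have "W # \<Gamma> \<turnstile> Q\<langle>Refl h \<cdot> h \<cdot> Var\<rangle> \<Colon> Ty"
    supply ty = Q h and tyU = W
    by (rule ty tyU tyU[THEN small] tyU[THEN sub_U] tyU[THEN sub_small] ty[THEN ty_sub] ty[THEN ty_ctx] tyU[THEN ty_ctx]
        | simp only: sbs | rule tyr)+
  ultimately have "inh (W # \<Gamma>) Q\<langle>Refl h \<cdot> h \<cdot> Var\<rangle>"
    using inh_Sigma_open[OF nA small[OF A], of "Q\<langle>Refl h \<cdot> h \<cdot> Var\<rangle>"] by (simp add: W_def p_def sbs)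
  with inh_coeq_path[OF W h, unfolded T_eq, folded G_def, OF c d[unfolded P_def]]
  have "inh (T # \<Gamma>) (Id T\<up>1 c\<up>1 (Var 0))"
    by (simp add: Q_def)
  from inh_isprop_center[OF small[OF T] c this] show ?thesis .
qed

end

section \<open>Propositional truncation\<close>

definition full :: "tm \<Rightarrow> tm" where
  "full B = Lam B (Lam B\<up>1 Unit)"

definition sq :: "tm \<Rightarrow> tm" where
  "sq B = Colim B (full B)"

text \<open>\<open>seqf A\<close> and \<open>seqs A\<close> are the type \<open>A\<^sub>n\<close> and the map \<open>A\<^sub>n \<rightarrow> {A\<^sub>n}\<close>, where \<open>A\<^sub>0 = A\<close>, \<open>A\<^sub>n\<^sub>+\<^sub>1 = {A\<^sub>n}\<close>.\<close>

definition seqf :: "tm \<Rightarrow> tm" where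
  "seqf A = IndNat U A\<up>1 (sq (Var 0)) (Var 0)"

definition seqs :: "tm \<Rightarrow> tm" where
  "seqs A = C0 (full (seqf A)\<up>1) (Var 0)"

definition trunc :: "tm \<Rightarrow> tm" where
  "trunc A = tele (seqf A) (seqs A)"

definition trin :: "tm \<Rightarrow> tm \<Rightarrow> tm" where
  "trin A a = tin (seqf A) (seqs A) Zero a"

lemma sq_sub: "(full B)\<langle>\<sigma>\<rangle> = full B\<langle>\<sigma>\<rangle>" "(sq B)\<langle>\<sigma>\<rangle> = sq B\<langle>\<sigma>\<rangle>"
  by (simp_all add: sq_def full_def sbs)

lemma seq_sub:
  "(seqf A)\<langle>Var 0 \<cdot> (\<sigma> ;; \<up>1)\<rangle> = seqf A\<langle>\<sigma>\<rangle>"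
  "(seqs A)\<langle>Var 0 \<cdot> Var 1 \<cdot> (\<sigma> ;; \<up>2)\<rangle> = seqs A\<langle>\<sigma>\<rangle>"
  by (simp_all add: seqf_def seqs_def sq_sub sbs)

lemma trunc_sub: "(trunc A)\<langle>\<sigma>\<rangle> = trunc A\<langle>\<sigma>\<rangle>" "(trin A a)\<langle>\<sigma>\<rangle> = trin A\<langle>\<sigma>\<rangle> a\<langle>\<sigma>\<rangle>"
  by (simp_all add: trunc_def trin_def tele_sub seq_sub sbs)

lemmas sbs5 = sbs sq_sub

lemma full_ty:
  assumes B: "\<Gamma> \<turnstile> B \<Colon> Ty"
  shows "\<Gamma> \<turnstile> full B \<Colon> arrow B (arrow B U)"
  unfolding full_def
  apply (rule graph_ty[OF B], rule Unit)
  supply ty = B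
  by (rule ty ty[THEN ty_sub] ty[THEN ty_ctx] | simp only: sbs5 | rule tyr)+

lemma sq_U: "\<Gamma> \<turnstile> B \<Colon> U \<Longrightarrow> \<Gamma> \<turnstile> sq B \<Colon> U"
  unfolding sq_def by (intro Colim full_ty small)

lemma sq_C0: "\<Gamma> \<turnstile> B \<Colon> U \<Longrightarrow> \<Gamma> \<turnstile> b \<Colon> B \<Longrightarrow> \<Gamma> \<turnstile> C0 (full B) b \<Colon> sq B"
  unfolding sq_def by (intro C0 full_ty small)

text \<open>\<open>Star\<close> is an edge between any two points, after computing the edge
  type.\<close>

lemma inh_sq_path:
  assumes B: "\<Gamma> \<turnstile> B \<Colon> U" and x: "\<Gamma> \<turnstile> x \<Colon> B" and y: "\<Gamma> \<turnstile> y \<Colon> B"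
  shows "inh \<Gamma> (Id (sq B) (C0 (full B) x) (C0 (full B) y))"
proof -
  have "B\<up>1 # B # \<Gamma> \<turnstile> Unit \<Colon> U"
    apply (rule Unit)
    supply tyU = B
    by (rule tyU tyU[THEN small] tyU[THEN sub_U] tyU[THEN sub_small] tyU[THEN ty_ctx] | simp only: sbs5 | rule tyr)+
  from graph_beta[OF small[OF B] this x y]
  have "\<Gamma> \<turnstile> App (App (full B) x) y \<doteq> Unit \<Colon> Ty"
    by (simp add: full_def sbs eq_small)
  from conv[OF Star[OF ty_ctx[OF B]] eq_sym[OF this]]
  show ?thesis
    unfolding sq_def by (rule inhI[OF C1[OF B full_ty[OF small[OF B]] x y]])
qed

text \<open>The sequence is defined by recursion into the universe, so both equations are
  computation rules of \<open>IndNat\<close>. Because they are judgemental, no transport between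
  consecutive types is ever needed.\<close>

lemma
  assumes A: "\<Gamma> \<turnstile> A \<Colon> U"
  shows seqf_U: "Nat # \<Gamma> \<turnstile> seqf A \<Colon> U"
    and seqf_Zero: "\<Gamma> \<turnstile> (seqf A)\<langle>Zero \<cdot> Var\<rangle> \<doteq> A \<Colon> U"
    and seqf_Succ: "Nat # \<Gamma> \<turnstile> (seqf A)\<langle>Succ (Var 0) \<cdot> \<up>1\<rangle> \<doteq> sq (seqf A) \<Colon> U"
proof -
  have 1: "Nat # Nat # \<Gamma> \<turnstile> U \<Colon> Ty" "Nat # \<Gamma> \<turnstile> U \<Colon> Ty"
    supply tyU = A
    by (rule tyU tyU[THEN small] tyU[THEN sub_U] tyU[THEN sub_small] tyU[THEN ty_ctx] | simp only: sbs5 | rule tyr)+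
  have 2: "Nat # \<Gamma> \<turnstile> A\<up>1 \<Colon> U\<langle>Zero \<cdot> Var\<rangle>" "\<Gamma> \<turnstile> A \<Colon> U\<langle>Zero \<cdot> Var\<rangle>"
    supply tyU = A
    by (rule tyU tyU[THEN small] tyU[THEN sub_U] tyU[THEN sub_small] tyU[THEN ty_ctx] | simp only: sbs5 | rule tyr)+
  have v: "U # \<Delta> \<turnstile> Var 0 \<Colon> U" if "ctx \<Delta>" for \<Delta>
    by (rule that | simp only: sbs5 | rule tyr)+
  have 3: "U # Nat # Nat # \<Gamma> \<turnstile> sq (Var 0) \<Colon> U\<langle>Succ (Var 1) \<cdot> \<up>2\<rangle>" "U # Nat # \<Gamma> \<turnstile> sq (Var 0) \<Colon> U\<langle>Succ (Var 1) \<cdot> \<up>2\<rangle>"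
    using sq_U[OF v] 1[THEN ty_ctx] by (simp_all add: sbs)
  have n: "Nat # \<Gamma> \<turnstile> Var 0 \<Colon> Nat"
    supply tyU = A
    by (rule tyU tyU[THEN small] tyU[THEN sub_U] tyU[THEN sub_small] tyU[THEN ty_ctx] | simp only: sbs5 | rule tyr)+
  show "Nat # \<Gamma> \<turnstile> seqf A \<Colon> U"
    using IndNat[OF 1(1) 2(1) 3(1) n] by (simp add: seqf_def sbs)
  show "\<Gamma> \<turnstile> (seqf A)\<langle>Zero \<cdot> Var\<rangle> \<doteq> A \<Colon> U"
    using Nat_beta_zero[OF 1(2) 2(2) 3(2)] by (simp add: seqf_def sbs5)
  show "Nat # \<Gamma> \<turnstile> (seqf A)\<langle>Succ (Var 0) \<cdot> \<up>1\<rangle> \<doteq> sq (seqf A) \<Colon> U"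
    using Nat_beta_succ[OF 1(1) 2(1) 3(1) n] by (simp add: seqf_def sbs5)
qed

lemma seq_sequence:
  assumes A: "\<Gamma> \<turnstile> A \<Colon> U"
  shows "sequence \<Gamma> (seqf A) (seqs A)"
proof
  note A0 = seqf_U[OF A]
  show "Nat # \<Gamma> \<turnstile> seqf A \<Colon> U"
    by (rule A0)
  have sb: "sb (Nat # \<Gamma>) (\<up>1) (seqf A # Nat # \<Gamma>)"
    supply tyU = A0
    by (rule tyU tyU[THEN small] tyU[THEN sub_U] tyU[THEN sub_small] tyU[THEN ty_ctx] | simp only: sbs5 | rule tyr)+
  have "seqf A # Nat # \<Gamma> \<turnstile> seqs A \<Colon> sq (seqf A)\<up>1"
    unfolding seqs_def sq_sub
    apply (rule sq_C0)
    supply tyU = A0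
    by (rule tyU tyU[THEN small] tyU[THEN sub_U] tyU[THEN sub_small] tyU[THEN ty_ctx] | simp only: sbs5 | rule tyr)+
  moreover have "seqf A # Nat # \<Gamma> \<turnstile> sq (seqf A)\<up>1 \<doteq> (seqf A)\<langle>Succ (Var 1) \<cdot> \<up>2\<rangle> \<Colon> Ty"
    using eq_sub[OF eq_sym[OF eq_small[OF seqf_Succ[OF A]]] sb refl] by (simp add: sbs5)
  ultimately show "seqf A # Nat # \<Gamma> \<turnstile> seqs A \<Colon> (seqf A)\<langle>Succ (Var 1) \<cdot> \<up>2\<rangle>"
    by (rule conv)
qed

lemma trunc_U:
  assumes A: "\<Gamma> \<turnstile> A \<Colon> U"
  shows "\<Gamma> \<turnstile> trunc A \<Colon> U"
proof -
  interpret S: sequence \<Gamma> "seqf A" "seqs A"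
    by (rule seq_sequence[OF A])
  show ?thesis
    using S.T by (simp add: trunc_def S.T_def)
qed

lemma trin_ty:
  assumes A: "\<Gamma> \<turnstile> A \<Colon> U" and a: "\<Gamma> \<turnstile> a \<Colon> A"
  shows "\<Gamma> \<turnstile> trin A a \<Colon> trunc A"
proof -
  interpret S: sequence \<Gamma> "seqf A" "seqs A"
    by (rule seq_sequence[OF A])
  have "\<Gamma> \<turnstile> a \<Colon> (seqf A)\<langle>Zero \<cdot> Var\<rangle>"
    by (rule conv[OF a eq_sym[OF eq_small[OF seqf_Zero[OF A]]]])
  then have "\<Gamma> \<turnstile> Pair (seqf A) Zero a \<Colon> S.W"
    unfolding S.W_def by (intro Pair small[OF seqf_U[OF A]] Zero ty_ctx[OF A])
  then have "\<Gamma> \<turnstile> Pair (seqf A) Zero a \<Colon> S.W\<langle>Var\<rangle>"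
    by (simp add: sbs)
  from S.C0_G[OF sb_id[OF S.ctx] this] show ?thesis
    by (simp add: sbs trin_def tin_def S.G_def S.W_def S.h_def S.T_def trunc_def)
qed

text \<open>The maps of the sequence are constant up to homotopy by \<open>inh_sq_path\<close>, and
  \<open>a\<close> is a point of the type at \<open>Zero\<close> by conversion.\<close>

lemma inh_isprop_trunc_pointed:
  assumes A: "\<Gamma> \<turnstile> A \<Colon> U" and a: "\<Gamma> \<turnstile> a \<Colon> A"
  shows "inh \<Gamma> (isprop (trunc A))"
proof -
  interpret S: sequence \<Gamma> "seqf A" "seqs A"
    by (rule seq_sequence[OF A])
  note A0 = seqf_U[OF A]
  let ?\<Delta> = "(seqf A)\<up>1 # seqf A # Nat # \<Gamma>"
  have a0: "\<Gamma> \<turnstile> a \<Colon> (seqf A)\<langle>Zero \<cdot> Var\<rangle>"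
    by (rule conv[OF a eq_sym[OF eq_small[OF seqf_Zero[OF A]]]])
  have sb: "sb (Nat # \<Gamma>) (Var 2 \<cdot> \<up>3) ?\<Delta>"
    supply tyU = A0
    by (rule tyU tyU[THEN small] tyU[THEN sub_U] tyU[THEN sub_small] tyU[THEN ty_ctx] | simp only: sbs5 | rule tyr)+
  have "inh ?\<Delta> (Id (sq (seqf A)\<up>2) (C0 (full (seqf A)\<up>2) (Var 1)) (C0 (full (seqf A)\<up>2) (Var 0)))"
    apply (rule inh_sq_path)
    supply tyU = A0
    by (rule tyU tyU[THEN small] tyU[THEN sub_U] tyU[THEN sub_small] tyU[THEN ty_ctx] | simp only: sbs5 | rule tyr)+
  moreover have E: "?\<Delta> \<turnstile> sq (seqf A)\<up>2 \<doteq> (seqf A)\<langle>Succ (Var 2) \<cdot> \<up>3\<rangle> \<Colon> Ty"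
    using eq_sub[OF eq_sym[OF eq_small[OF seqf_Succ[OF A]]] sb refl] by (simp add: sbs5)
  have "?\<Delta> \<turnstile> Id (sq (seqf A)\<up>2) (C0 (full (seqf A)\<up>2) (Var 1)) (C0 (full (seqf A)\<up>2) (Var 0))
    \<doteq> Id (seqf A)\<langle>Succ (Var 2) \<cdot> \<up>3\<rangle> (C0 (full (seqf A)\<up>2) (Var 1)) (C0 (full (seqf A)\<up>2) (Var 0)) \<Colon> Ty"
    apply (rule Id_cong, simp, rule E)
     apply (rule eq_refl, rule sq_C0) prefer 3 apply (rule eq_refl, rule sq_C0)
    supply tyU = A0
    by (rule tyU tyU[THEN small] tyU[THEN sub_U] tyU[THEN sub_small] tyU[THEN ty_ctx] | simp only: sbs5 | rule tyr)+
  ultimately have "inh ?\<Delta> (Id (seqf A)\<langle>Succ (Var 2) \<cdot> \<up>3\<rangle> (seqs A)\<langle>Var 1 \<cdot> \<up>2\<rangle> (seqs A)\<langle>Var 0 \<cdot> \<up>2\<rangle>)"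
    using inh_conv by (simp add: seqs_def sbs5)
  from S.inh_isprop_tele[OF this a0] show ?thesis
    by (simp add: trunc_def S.T_def)
qed

lemma inh_nat:
  assumes F: "Nat # \<Gamma> \<turnstile> F \<Colon> Ty" and "inh \<Gamma> F\<langle>Zero \<cdot> Var\<rangle>" and "inh (F # Nat # \<Gamma>) F\<langle>Succ (Var 1) \<cdot> \<up>2\<rangle>"
  shows "inh (Nat # \<Gamma>) F"
  using assms(2,3) by (metis inhE inhI nat_chain[OF F])

text \<open>Induction on the stage: every point coming from the type at stage \<open>n\<close>
  satisfies \<open>P\<close>. As \<open>P\<close> consists of propositions, neither the edges of the
  quotients nor the glue paths of the colimit impose conditions.\<close>

lemma inh_trunc_elim:
  assumes A: "\<Gamma> \<turnstile> A \<Colon> U" and P: "trunc A # \<Gamma> \<turnstile> P \<Colon> Ty" and pr: "inh (trunc A # \<Gamma>) (isprop P)"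
    and d: "inh (A # \<Gamma>) P\<langle>trin A\<up>1 (Var 0) \<cdot> \<up>1\<rangle>"
  shows "inh (trunc A # \<Gamma>) P"
proof -
  interpret S: sequence \<Gamma> "seqf A" "seqs A"
    by (rule seq_sequence[OF A])
  have T_eq: "S.T = trunc A"
    by (simp add: S.T_def trunc_def)
  let ?F = "seqf A" and ?s = "seqs A"
  note F = S.A and s = S.s and F0 = eq_small[OF seqf_Zero[OF A]]
  have PT: "S.T # \<Gamma> \<turnstile> P \<Colon> Ty" and pT: "inh (S.T # \<Gamma>) (isprop P)"
    using P pr by (simp_all add: T_eq)
  \<comment> \<open>The product over the whole type at stage \<open>n\<close> is part of the motive,
    since the induction step needs the hypothesis at arbitrary points of that type.\<close>
  define M where "M = Pi ?F P\<langle>S.I \<cdot> \<up>2\<rangle>"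
  have M: "Nat # \<Gamma> \<turnstile> M \<Colon> Ty"
    unfolding M_def
    supply ty = PT S.p and tyU = F
    by (rule ty tyU tyU[THEN small] tyU[THEN sub_U] tyU[THEN sub_small] ty[THEN ty_sub] ty[THEN ty_ctx] tyU[THEN ty_ctx] S.C0_G
        | simp only: sbs5 | rule tyr)+
  have base: "inh \<Gamma> M\<langle>Zero \<cdot> Var\<rangle>"
  proof -
    let ?p = "Pair ?F\<langle>Var 0 \<cdot> \<up>2\<rangle> Zero (Var 0)"
    have FZ: "\<Gamma> \<turnstile> ?F\<langle>Zero \<cdot> Var\<rangle> \<Colon> Ty"
      supply tyU = F A
      by (rule tyU tyU[THEN small] tyU[THEN sub_U] tyU[THEN sub_small] tyU[THEN ty_ctx] | simp only: sbs5 | rule tyr)+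
    have q: "?F\<langle>Zero \<cdot> Var\<rangle> # \<Gamma> \<turnstile> ?p \<Colon> S.W\<up>1"
      unfolding S.W_def
      supply ty = FZ and tyU = F
      by (rule ty tyU tyU[THEN small] tyU[THEN sub_U] tyU[THEN sub_small] ty[THEN ty_sub] ty[THEN ty_ctx] tyU[THEN ty_ctx] Pair
          | simp only: sbs5 | rule tyr)+
    have 1: "?F\<langle>Zero \<cdot> Var\<rangle> # \<Gamma> \<turnstile> P\<langle>C0 S.G\<up>1 ?p \<cdot> \<up>1\<rangle> \<Colon> Ty"
      supply ty = PT FZ q
      by (rule ty ty[THEN ty_sub] ty[THEN ty_ctx] S.C0_G | simp only: sbs5 | rule tyr)+
    have "trin A\<up>1 (Var 0) = C0 S.G\<up>1 ?p"
      using seq_sub[of A "\<up>1"] tele_sub(1)[of "seqf A" "seqs A" "\<up>1"]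
      by (simp add: trin_def tin_def S.G_def S.W_def S.h_def sbs4 tele_sub)
    with d have "inh (A # \<Gamma>) P\<langle>C0 S.G\<up>1 ?p \<cdot> \<up>1\<rangle>"
      by simp
    from inh_Pi[OF 1 inh_ctx_conv[OF F0 FZ this]] show ?thesis
      by (simp add: M_def sbs S.p_def)
  qed
  have step: "inh (M # Nat # \<Gamma>) M\<langle>Succ (Var 1) \<cdot> \<up>2\<rangle>"
  proof -
    let ?\<Theta> = "M # Nat # \<Gamma>" and ?q = "Pair ?F\<langle>Var 0 \<cdot> \<up>4\<rangle> (Succ (Var 2)) (Var 0)"
    let ?F' = "?F\<langle>Succ (Var 1) \<cdot> \<up>2\<rangle>" and ?R = "P\<langle>C0 S.G\<up>3 ?q \<cdot> \<up>3\<rangle>"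
    have F': "?\<Theta> \<turnstile> ?F' \<Colon> Ty"
      supply ty = M and tyU = F
      by (rule ty tyU tyU[THEN small] tyU[THEN sub_U] tyU[THEN sub_small] ty[THEN ty_sub] ty[THEN ty_ctx] tyU[THEN ty_ctx]
          | simp only: sbs5 | rule tyr)+
    have q: "?F' # ?\<Theta> \<turnstile> ?q \<Colon> S.W\<up>3"
      unfolding S.W_def
      supply ty = M and tyU = F
      by (rule ty tyU tyU[THEN small] tyU[THEN sub_U] tyU[THEN sub_small] ty[THEN ty_sub] ty[THEN ty_ctx] tyU[THEN ty_ctx] Pair
          | simp only: sbs5 | rule tyr)+
    have R: "?F' # ?\<Theta> \<turnstile> ?R \<Colon> Ty"
      supply ty = PT F' q
      by (rule ty ty[THEN ty_sub] ty[THEN ty_ctx] S.C0_G | simp only: sbs5 | rule tyr)+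
    have pR: "inh (?F' # ?\<Theta>) (isprop ?R)"
      apply (rule inh_sub[OF pT, of "C0 S.G\<up>3 ?q \<cdot> \<up>3"])
      supply ty = PT F' q
      by (rule ty ty[THEN ty_sub] ty[THEN ty_ctx] S.C0_G | simp only: sbs5 | rule tyr)+
    have F1: "?\<Theta> \<turnstile> ?F\<up>1 \<Colon> U"
      supply ty = M and tyU = F
      by (rule ty tyU tyU[THEN small] tyU[THEN sub_U] tyU[THEN sub_small] ty[THEN ty_sub] ty[THEN ty_ctx] tyU[THEN ty_ctx]
          | simp only: sbs5 | rule tyr)+
    have "sb (Nat # \<Gamma>) (\<up>1) ?\<Theta>"
      supply ty = M
      by (rule ty ty[THEN ty_sub] ty[THEN ty_ctx] | simp only: sbs5 | rule tyr)+
    from eq_sub[OF eq_sym[OF eq_small[OF seqf_Succ[OF A]]] this refl]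
    have E: "?\<Theta> \<turnstile> sq ?F\<up>1 \<doteq> ?F' \<Colon> Ty"
      by (simp add: sbs5)
    have C: "?\<Theta> \<turnstile> sq ?F\<up>1 \<Colon> Ty"
      by (rule small[OF sq_U[OF F1]])
    \<comment> \<open>The type at stage \<open>n + 1\<close> in the context is exchanged for the
      quotient to which it computes, so that graph quotient induction applies.\<close>
    have R': "sq ?F\<up>1 # ?\<Theta> \<turnstile> ?R \<Colon> Ty" and pR': "inh (sq ?F\<up>1 # ?\<Theta>) (isprop ?R)"
      by (rule ty_ctx_conv[OF E C R], rule inh_ctx_conv[OF E C pR])
    let ?\<Theta>' = "?F\<up>1 # ?\<Theta>" and ?x = "S.p\<langle>Var 0 \<cdot> Var 2 \<cdot> \<up>3\<rangle>" and ?y = "S.p'\<langle>Var 0 \<cdot> Var 2 \<cdot> \<up>3\<rangle>"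
    have x: "?\<Theta>' \<turnstile> ?x \<Colon> S.W\<up>3" and y: "?\<Theta>' \<turnstile> ?y \<Colon> S.W\<up>3"
      and g: "?\<Theta>' \<turnstile> S.g\<langle>Var 0 \<cdot> Var 2 \<cdot> \<up>3\<rangle> \<Colon> Id S.T\<up>3 (C0 S.G\<up>3 ?x) (C0 S.G\<up>3 ?y)"
      supply ty = S.p M S.p' S.g and tyU = F1
      by (rule ty tyU tyU[THEN small] tyU[THEN sub_U] tyU[THEN sub_small] ty[THEN ty_sub] ty[THEN ty_ctx] tyU[THEN ty_ctx]
          | simp only: sbs5 | rule tyr)+
    have "inh ?\<Theta>' P\<langle>C0 S.G\<up>3 ?x \<cdot> \<up>3\<rangle>"
    proof (rule inh_App)
      have "inh ?\<Theta>' M\<up>2"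
        apply (rule inhI[of _ "Var 1"])
        supply ty = M and tyU = F1
        by (rule ty tyU tyU[THEN small] tyU[THEN sub_U] tyU[THEN sub_small] ty[THEN ty_sub] ty[THEN ty_ctx] tyU[THEN ty_ctx]
            | simp only: sbs5 | rule tyr)+
      then show "inh ?\<Theta>' (Pi ?F\<up>2 P\<langle>S.I \<cdot> \<up>2\<rangle>\<langle>Var 0 \<cdot> \<up>3\<rangle>)"
        by (simp add: M_def sbs)
      show "?\<Theta>' \<turnstile> Var 0 \<Colon> ?F\<up>2"
        supply ty = M and tyU = F1
        by (rule ty tyU tyU[THEN small] tyU[THEN sub_U] tyU[THEN sub_small] ty[THEN ty_sub] ty[THEN ty_ctx] tyU[THEN ty_ctx]
            | simp only: sbs5 | rule tyr)+
    qed (simp add: sbs)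
    then have Px: "inh ?\<Theta>' P\<langle>Var 0 \<cdot> \<up>4\<rangle>\<langle>C0 S.G\<up>3 ?x \<cdot> Var\<rangle>"
      by (simp add: sbs)
    \<comment> \<open>On a point constructor, the element of stage \<open>n + 1\<close> is
      \<open>s x\<close>. Its image in the colimit is joined by the glue path to that of
      \<open>x\<close>, where the induction hypothesis holds.\<close>
    have "inh ?\<Theta>' P\<langle>C0 S.G\<up>3 ?y \<cdot> \<up>3\<rangle>"
      apply (rule inh_transport[OF _ inhI[OF g] _ _ _ Px])
      supply ty = PT M x y and tyU = S.T F1
      by (rule ty tyU tyU[THEN small] tyU[THEN sub_U] tyU[THEN sub_small] ty[THEN ty_sub] ty[THEN ty_ctx] tyU[THEN ty_ctx] S.C0_G
          | simp only: sbs5 | rule tyr)+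
    moreover have "?R\<langle>C0 (full ?F\<up>1)\<up>1 (Var 0) \<cdot> \<up>1\<rangle> = P\<langle>C0 S.G\<up>3 ?y \<cdot> \<up>3\<rangle>"
      unfolding S.p'_def by (simp add: sbs5 seqs_def)
    ultimately have "inh (sq ?F\<up>1 # ?\<Theta>) ?R"
      using inh_Colim_prop[OF F1 full_ty[OF small[OF F1]], folded sq_def, OF R' pR'] by simp
    from inh_Pi[OF R inh_ctx_conv[OF eq_sym[OF E] F' this]]
    show ?thesis
      by (simp add: M_def sbs S.p_def)
  qed
  from inh_open[OF inh_nat[OF M base step, unfolded M_def] small[OF F]]
  have "inh (?F # Nat # \<Gamma>) P\<langle>S.I \<cdot> \<up>2\<rangle>" .
  from S.inh_tele_prop_elim[OF PT pT this] show ?thesis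
    by (simp add: T_eq)
qed

lemma inh_isprop_trunc:
  assumes A: "\<Gamma> \<turnstile> A \<Colon> U"
  shows "inh \<Gamma> (isprop (trunc A))"
proof -
  note T = trunc_U[OF A]
  have p: "trunc A # \<Gamma> \<turnstile> isprop (trunc A)\<up>1 \<Colon> Ty" "trunc A # \<Gamma> \<turnstile> (trunc A)\<up>1 \<Colon> Ty"
    supply tyU = T
    by (rule tyU tyU[THEN small] tyU[THEN sub_U] tyU[THEN sub_small] tyU[THEN ty_ctx] | simp only: sbs5 | rule tyr)+
  have 1: "A # \<Gamma> \<turnstile> A\<up>1 \<Colon> U" "A # \<Gamma> \<turnstile> Var 0 \<Colon> A\<up>1"
    supply tyU = A
    by (rule tyU tyU[THEN small] tyU[THEN sub_U] tyU[THEN sub_small] tyU[THEN ty_ctx] | simp only: sbs5 | rule tyr)+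
  from inh_isprop_trunc_pointed[OF this]
  have "inh (A # \<Gamma>) (isprop (trunc A)\<up>1)\<langle>trin A\<up>1 (Var 0) \<cdot> \<up>1\<rangle>"
    by (simp add: sbs trunc_sub)
  from inh_trunc_elim[OF A p(1) inh_isprop_isprop[OF p(2)] this]
  show ?thesis
    by - (rule inh_isprop_if_inhabited[OF small[OF T]])
qed

section \<open>Embeddings\<close>

text \<open>Each \<open>y\<close> is chosen a preimage \<open>z\<close>; any two preimages agree,
  hence so do their images. Only a path \<open>y = m z\<close> is required, which is much less than
  an equivalence.\<close>

lemma inh_isprop_surj:
  assumes Y: "\<Gamma> \<turnstile> Y \<Colon> Ty" and Z: "\<Gamma> \<turnstile> Z \<Colon> Ty" and m: "Z # \<Gamma> \<turnstile> m \<Colon> Y\<up>1" and pZ: "inh \<Gamma> (isprop Z)"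
    and surj: "inh (Y # \<Gamma>) (Sigma Z\<up>1 (Id Y\<up>2 (Var 1) m\<langle>Var 0 \<cdot> \<up>2\<rangle>))"
  shows "inh \<Gamma> (isprop Y)"
proof -
  have 1: "Y # \<Gamma> \<turnstile> Z\<up>1 \<Colon> Ty" "Z\<up>1 # Y # \<Gamma> \<turnstile> Id Y\<up>2 (Var 1) m\<langle>Var 0 \<cdot> \<up>2\<rangle> \<Colon> Ty"
    supply ty = Y Z m
    by (rule ty ty[THEN ty_sub] ty[THEN ty_ctx] | simp only: sbs | rule tyr)+
  obtain z where z: "Y # \<Gamma> \<turnstile> z \<Colon> Z\<up>1" and e: "inh (Y # \<Gamma>) (Id Y\<up>1 (Var 0) m\<langle>z \<cdot> \<up>1\<rangle>)"
    using inh_Sigma_obtain[OF surj 1] by (auto simp: sbs)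
  let ?\<Delta> = "Y\<up>1 # Y # \<Gamma>"
  let ?u = "m\<langle>z\<up>1 \<cdot> \<up>2\<rangle>" and ?v = "m\<langle>z\<langle>Var 0 \<cdot> \<up>2\<rangle> \<cdot> \<up>2\<rangle>"
  have Y2: "?\<Delta> \<turnstile> Y\<up>2 \<Colon> Ty" "?\<Delta> \<turnstile> Var 1 \<Colon> Y\<up>2" "?\<Delta> \<turnstile> Var 0 \<Colon> Y\<up>2" "?\<Delta> \<turnstile> ?u \<Colon> Y\<up>2" "?\<Delta> \<turnstile> ?v \<Colon> Y\<up>2"
    "?\<Delta> \<turnstile> z\<up>1 \<Colon> Z\<up>2" "?\<Delta> \<turnstile> z\<langle>Var 0 \<cdot> \<up>2\<rangle> \<Colon> Z\<up>2" "?\<Delta> \<turnstile> Z\<up>2 \<Colon> Ty" "Z\<up>2 # ?\<Delta> \<turnstile> m\<langle>Var 0 \<cdot> \<up>3\<rangle> \<Colon> Y\<up>2\<up>1"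
    supply ty = Y m z Z
    by (rule ty ty[THEN ty_sub] ty[THEN ty_ctx] | simp only: sbs | rule tyr)+
  have e1: "inh ?\<Delta> (Id Y\<up>2 (Var 1) ?u)"
    apply (rule inh_sub[OF e, of "\<up>1"])
    supply ty = Y
    by (rule ty ty[THEN ty_sub] ty[THEN ty_ctx] | simp only: sbs | rule tyr)+
  have e2: "inh ?\<Delta> (Id Y\<up>2 (Var 0) ?v)"
    apply (rule inh_sub[OF e, of "Var 0 \<cdot> \<up>2"])
    supply ty = Y
    by (rule ty ty[THEN ty_sub] ty[THEN ty_ctx] | simp only: sbs | rule tyr)+
  have "inh ?\<Delta> (isprop Z\<up>2)"
    apply (rule inh_sub[OF pZ, of "\<up>2"])
    supply ty = Y
    by (rule ty ty[THEN ty_sub] ty[THEN ty_ctx] | simp only: sbs | rule tyr)+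
  from inh_isprop_elim[OF this Y2(6,7)]
  have "inh ?\<Delta> (Id Z\<up>2 z\<up>1 z\<langle>Var 0 \<cdot> \<up>2\<rangle>)" .
  from inh_ap[OF Y2(9) this Y2(1,8,6,7) refl]
  have "inh ?\<Delta> (Id Y\<up>2 ?u ?v)"
    by (simp add: sbs)
  then show ?thesis
    by - (rule inh_isprop[OF _ Y], rule inh_trans[OF e1 inh_trans[OF _ inh_sym[OF e2 Y2(1,3,5)] Y2(1,4,5,3)] Y2(1,2,4,3)])
qed

definition fpair :: "tm \<Rightarrow> tm \<Rightarrow> tm \<Rightarrow> tm \<Rightarrow> tm \<Rightarrow> tm" where
  "fpair B g x b p = Pair (Id B\<up>1 (App g\<up>1 (Var 0)) x\<up>1) b p"

lemma fpair_sub: "(fpair B g x b p)\<langle>\<sigma>\<rangle> = fpair B\<langle>\<sigma>\<rangle> g\<langle>\<sigma>\<rangle> x\<langle>\<sigma>\<rangle> b\<langle>\<sigma>\<rangle> p\<langle>\<sigma>\<rangle>"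
  by (simp add: fpair_def sbs)

lemma fpair_ty:
  assumes p: "\<Gamma> \<turnstile> p \<Colon> Id B (App g b) x" and A: "\<Gamma> \<turnstile> A \<Colon> Ty" and B: "\<Gamma> \<turnstile> B \<Colon> Ty" and g: "\<Gamma> \<turnstile> g \<Colon> arrow A B" and x: "\<Gamma> \<turnstile> x \<Colon> B"
    and b: "\<Gamma> \<turnstile> b \<Colon> A"
  shows "\<Gamma> \<turnstile> fpair B g x b p \<Colon> fiber A B g x"
  unfolding fpair_def fiber_def
  supply ty = p A B g x b
  by (rule ty ty[THEN ty_sub] ty[THEN ty_ctx] Pair | simp only: sbs | rule tyr)+

lemmas [tyr] = fpair_ty
lemmas [sbs] = fpair_sub

text \<open>The fiber over \<open>x\<close> is covered by \<open>P x\<close> through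
  \<open>y \<mapsto> ((x, y), refl)\<close>. The map \<open>i\<close> is kept abstract, with its
  computation on pairs as a hypothesis, so that no projection terms have to be normalised.\<close>

lemma inh_isemb_fst:
  assumes X: "\<Gamma> \<turnstile> X \<Colon> Ty" and P: "X # \<Gamma> \<turnstile> P \<Colon> Ty" and pP: "inh (X # \<Gamma>) (isprop P)"
    and i: "\<Gamma> \<turnstile> i \<Colon> arrow (Sigma X P) X"
    and i_beta: "P # X # \<Gamma> \<turnstile> App i\<up>2 (Pair P\<langle>Var 0 \<cdot> \<up>3\<rangle> (Var 1) (Var 0)) \<doteq> Var 1 \<Colon> X\<up>2"
  shows "inh \<Gamma> (isemb (Sigma X P) X i)"
proof -
  define S where "S = Sigma X P"
  have S: "\<Gamma> \<turnstile> S \<Colon> Ty" and iS: "\<Gamma> \<turnstile> i \<Colon> arrow S X"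
    using i by (simp_all add: S_def former_ty X P)
  \<comment> \<open>\<open>S\<close> stays folded to keep terms small, so pairing needs its own
    typing rule. Its instances at shifts by two, three and four are extracted below.\<close>
  have pair: "\<Delta> \<turnstile> Pair P\<langle>Var 0 \<cdot> (\<sigma> ;; \<up>1)\<rangle> x y \<Colon> S\<langle>\<sigma>\<rangle>"
    if "sb \<Gamma> \<sigma> \<Delta>" and "\<Delta> \<turnstile> x \<Colon> X\<langle>\<sigma>\<rangle>" and "\<Delta> \<turnstile> y \<Colon> P\<langle>x \<cdot> \<sigma>\<rangle>" for \<Delta> \<sigma> x y
  proof -
    have XP: "P # X # \<Gamma> \<turnstile> Pair P\<langle>Var 0 \<cdot> \<up>3\<rangle> (Var 1) (Var 0) \<Colon> S\<up>2"
      unfolding S_def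
      supply ty = X P
      by (rule ty ty[THEN ty_sub] ty[THEN ty_ctx] Pair | simp only: sbs | rule tyr)+
    show ?thesis
      using ty_sub[OF XP sb_scons[OF sb_scons[OF that(1,2)] that(3)] refl] by (simp add: sbs)
  qed
  have Refl_fst: "\<Delta> \<turnstile> Refl x \<Colon> Id X\<langle>\<sigma>\<rangle> (App i\<langle>\<sigma>\<rangle> (Pair P\<langle>Var 0 \<cdot> (\<sigma> ;; \<up>1)\<rangle> x y)) x"
    if "sb \<Gamma> \<sigma> \<Delta>" and "\<Delta> \<turnstile> x \<Colon> X\<langle>\<sigma>\<rangle>" and "\<Delta> \<turnstile> y \<Colon> P\<langle>x \<cdot> \<sigma>\<rangle>" for \<Delta> \<sigma> x y
  proof -
    have "\<Delta> \<turnstile> X\<langle>\<sigma>\<rangle> \<Colon> Ty"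
      by (rule sub_Ty[OF X that(1)])
    moreover have "\<Delta> \<turnstile> App i\<langle>\<sigma>\<rangle> (Pair P\<langle>Var 0 \<cdot> (\<sigma> ;; \<up>1)\<rangle> x y) \<doteq> x \<Colon> X\<langle>\<sigma>\<rangle>"
      using eq_sub[OF i_beta sb_scons[OF sb_scons[OF that(1,2)] that(3)] refl] by (simp add: sbs)
    ultimately show ?thesis
      by - (rule conv[OF Refl[OF _ that(2)]], assumption, rule Id_cong, simp_all add: eq_refl eq_sym that)
  qed
  note pair2 = pair[of "\<up>2", simplified sbs sub.simps]
    and pair3 = pair[of "\<up>3", simplified sbs sub.simps] and pair4 = pair[of "\<up>4", simplified sbs sub.simps]
    and Refl3 = Refl_fst[of "\<up>3", simplified sbs sub.simps] and Refl4 = Refl_fst[of "\<up>4", simplified sbs sub.simps] and Refl2 = Refl_fst[of "\<up>2", simplified sbs sub.simps]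
  \<comment> \<open>The covering condition in variables: \<open>Var 3\<close> is the point
    \<open>s\<close> of \<open>S\<close>, \<open>Var 2\<close> the base point \<open>x\<close>,
    \<open>Var 1\<close> the path \<open>i s = x\<close>, and \<open>Var 0\<close> the preimage in
    \<open>P x\<close>.\<close>
  define MB where "MB = Id (fiber S\<up>4 X\<up>4 i\<up>4 (Var 2))
    (fpair X\<up>4 i\<up>4 (Var 2) (Var 3) (Var 1))
    (fpair X\<up>4 i\<up>4 (Var 2) (Pair P\<langle>Var 0 \<cdot> \<up>5\<rangle> (Var 2) (Var 0)) (Refl (Var 2)))"
  define M where "M = Sigma P\<langle>Var 1 \<cdot> \<up>3\<rangle> MB"
  let ?E = "Id X\<up>2 (App i\<up>2 (Var 1)) (Var 0)"
  have MB: "P\<langle>Var 1 \<cdot> \<up>3\<rangle> # ?E # X\<up>1 # S # \<Gamma> \<turnstile> MB \<Colon> Ty"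
    unfolding MB_def
    supply ty = X P iS S
    by (rule ty ty[THEN ty_sub] ty[THEN ty_ctx] pair4 Refl4 | simp only: sbs | rule tyr)+
  have M: "?E # X\<up>1 # S # \<Gamma> \<turnstile> M \<Colon> Ty"
    unfolding M_def
    supply ty = X P iS S MB
    by (rule ty ty[THEN ty_sub] ty[THEN ty_ctx] | simp only: sbs | rule tyr)+
  \<comment> \<open>Base point and path are generalised, so that Sigma induction on \<open>s\<close>
    can precede path induction; only for a pair does \<open>i s\<close> compute.\<close>
  let ?N = "Pi X\<up>1 (Pi ?E M)"
  have N: "S # \<Gamma> \<turnstile> ?N \<Colon> Ty"
    supply ty = M X iS S
    by (rule ty ty[THEN ty_sub] ty[THEN ty_ctx] | simp only: sbs | rule tyr)+
  let ?p = "Pair P\<langle>Var 0 \<cdot> \<up>3\<rangle> (Var 1) (Var 0)"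
  let ?a = "App i\<up>2 ?p"
  have XP: "ctx (P # X # \<Gamma>)"
    supply ty = X P
    by (rule ty ty[THEN ty_sub] ty[THEN ty_ctx] | simp only: sbs | rule tyr)+
  have p: "P # X # \<Gamma> \<turnstile> ?p \<Colon> S\<up>2"
    apply (rule pair2[OF sb_shifts(2)[OF XP]])
    supply ty = X P
    by (rule ty ty[THEN ty_sub] ty[THEN ty_ctx] | simp only: sbs | rule tyr)+
  let ?\<Delta> = "P # X # \<Gamma>" and ?a1 = "App i\<up>3 (Pair P\<langle>Var 0 \<cdot> \<up>4\<rangle> (Var 2) (Var 1))"
  have a: "?\<Delta> \<turnstile> ?a \<Colon> X\<up>2" and X2: "?\<Delta> \<turnstile> X\<up>2 \<Colon> Ty"
    supply ty = X P p iS
    by (rule ty ty[THEN ty_sub] ty[THEN ty_ctx] | simp only: sbs | rule tyr)+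
  \<comment> \<open>At reflexivity the base point is \<open>i (x, y)\<close> instead of
    \<open>x\<close>, so the preimage \<open>y\<close> must be retyped along this
    conversion.\<close>
  have sP: "?\<Delta> \<turnstile> P\<langle>Var 1 \<cdot> \<up>2\<rangle> \<doteq> P\<langle>?a \<cdot> \<up>2\<rangle> \<Colon> Ty"
    by (rule sub_eq[OF P], rule sbe_scons[OF sbe_refl[OF sb_shifts(2)[OF XP]] eq_sym[OF i_beta]]) (simp add: sbs)
  have v0: "?\<Delta> \<turnstile> Var 0 \<Colon> P\<langle>Var 1 \<cdot> \<up>2\<rangle>" "?\<Delta> \<turnstile> Var 1 \<Colon> X\<up>2"
    supply ty = X P
    by (rule ty ty[THEN ty_sub] ty[THEN ty_ctx] | simp only: sbs | rule tyr)+
  note v = conv[OF v0(1) sP]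
  define D where "D = M\<langle>Var 0 \<cdot> Var 1 \<cdot> Pair P\<langle>Var 0 \<cdot> \<up>5\<rangle> (Var 3) (Var 2) \<cdot> \<up>4\<rangle>"
  have Da: "D\<langle>Refl ?a \<cdot> ?a \<cdot> Var\<rangle> = Sigma P\<langle>?a \<cdot> \<up>2\<rangle> MB\<langle>Var 0 \<cdot> Refl ?a1 \<cdot> ?a1 \<cdot> Pair P\<langle>Var 0 \<cdot> \<up>4\<rangle> (Var 2) (Var 1) \<cdot> \<up>3\<rangle>"
    by (simp add: D_def M_def sbs)
  have D: "Id X\<up>3 ?a1 (Var 0) # X\<up>2 # ?\<Delta> \<turnstile> D \<Colon> Ty"
    unfolding D_def
    supply ty = M X P iS
    by (rule ty ty[THEN ty_sub] ty[THEN ty_ctx] pair3 pair4 | simp only: sbs | rule tyr)+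
  \<comment> \<open>The pair to be reached has first component \<open>i (x, y)\<close>. It equals
    \<open>(x, y)\<close> judgementally, so reflexivity settles the remaining path.\<close>
  have "?\<Delta> \<turnstile> ?p \<doteq> Pair P\<langle>Var 0 \<cdot> \<up>3\<rangle> ?a (Var 0) \<Colon> Sigma X\<up>2 P\<langle>Var 0 \<cdot> \<up>3\<rangle>"
    apply (rule Pair_cong[OF eq_refl eq_sym[OF i_beta] eq_refl])
    supply ty = X P
    by (rule ty ty[THEN ty_sub] ty[THEN ty_ctx] | simp only: sbs | rule tyr)+
  then have pp: "?\<Delta> \<turnstile> ?p \<doteq> Pair P\<langle>Var 0 \<cdot> \<up>3\<rangle> ?a (Var 0) \<Colon> S\<up>2"
    by (simp add: S_def sbs)
  have q: "?\<Delta> \<turnstile> Pair P\<langle>Var 0 \<cdot> \<up>3\<rangle> ?a (Var 0) \<Colon> S\<up>2"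
    by (rule pair2[OF sb_shifts(2)[OF XP] a v])
  have FE: "S\<up>2 # ?\<Delta> \<turnstile> Id X\<up>3 (App i\<up>3 (Var 0)) ?a1 \<Colon> Ty"
    supply ty = X P iS S
    by (rule ty ty[THEN ty_sub] ty[THEN ty_ctx] pair3 | simp only: sbs | rule tyr)+
  have ra: "?\<Delta> \<turnstile> Refl ?a \<Colon> Id X\<up>2 ?a ?a"
    by (rule Refl[OF X2 a])
  have "?\<Delta> \<turnstile> fpair X\<up>2 i\<up>2 ?a ?p (Refl ?a) \<doteq> fpair X\<up>2 i\<up>2 ?a (Pair P\<langle>Var 0 \<cdot> \<up>3\<rangle> ?a (Var 0)) (Refl ?a)
     \<Colon> fiber S\<up>2 X\<up>2 i\<up>2 ?a"
    unfolding fpair_def fiber_def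
    apply (simp only: sbs)
    apply (rule Pair_cong[OF eq_refl[OF FE] pp])
    using eq_refl[OF ra] by (simp add: sbs)
  moreover have "?\<Delta> \<turnstile> fpair X\<up>2 i\<up>2 ?a (Pair P\<langle>Var 0 \<cdot> \<up>3\<rangle> ?a (Var 0)) (Refl ?a) \<Colon> fiber S\<up>2 X\<up>2 i\<up>2 ?a"
    apply (rule fpair_ty[OF Refl2[OF sb_shifts(2)[OF XP] a v]])
    supply ty = X2 S iS a q X P
    by (rule ty ty[THEN ty_sub] ty[THEN ty_ctx] | simp only: sbs | rule tyr)+
  moreover have "?\<Delta> \<turnstile> fiber S\<up>2 X\<up>2 i\<up>2 ?a \<Colon> Ty"
    supply ty = X2 S iS a X P
    by (rule ty ty[THEN ty_sub] ty[THEN ty_ctx] | simp only: sbs | rule tyr)+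
  ultimately have b: "inh ?\<Delta> MB\<langle>Var 0 \<cdot> Refl ?a1 \<cdot> ?a1 \<cdot> Pair P\<langle>Var 0 \<cdot> \<up>4\<rangle> (Var 2) (Var 1) \<cdot> \<up>3\<rangle>\<langle>Var 0 \<cdot> Var\<rangle>"
    using inh_eq by (simp add: MB_def sbs)
  have Pa: "?\<Delta> \<turnstile> P\<langle>?a \<cdot> \<up>2\<rangle> \<Colon> Ty"
    supply ty = X P a
    by (rule ty ty[THEN ty_sub] ty[THEN ty_ctx] | simp only: sbs | rule tyr)+
  have "P\<langle>?a \<cdot> \<up>2\<rangle> # ?\<Delta> \<turnstile> MB\<langle>Var 0 \<cdot> Refl ?a1 \<cdot> ?a1 \<cdot> Pair P\<langle>Var 0 \<cdot> \<up>4\<rangle> (Var 2) (Var 1) \<cdot> \<up>3\<rangle> \<Colon> Ty"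
    supply ty = MB Pa X P iS S
    by (rule ty ty[THEN ty_sub] ty[THEN ty_ctx] pair3 | simp only: sbs | rule tyr)+
  from inh_Sigma[OF this v b]
  have base: "inh ?\<Delta> D\<langle>Refl ?a \<cdot> ?a \<cdot> Var\<rangle>"
    unfolding Da .
  from inh_bJ_open[OF X2 a _ base] D
  have "inh (Id X\<up>3 ?a1 (Var 0) # X\<up>2 # ?\<Delta>) D"
    by (simp add: sbs)
  then have "inh ?\<Delta> (Pi X\<up>2 (Pi (Id X\<up>3 ?a1 (Var 0)) D))"
    apply - apply (rule inh_Pi[OF _ inh_Pi[OF D]])
     prefer 2 apply assumption
    supply ty = D X P iS S
    by (rule ty ty[THEN ty_sub] ty[THEN ty_ctx] pair3 | simp only: sbs | rule tyr)+
  then have "inh (S # \<Gamma>) ?N"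
    using inh_Sigma_open[OF X P N[unfolded S_def]] by (simp add: D_def sbs S_def)
  have XS: "S # \<Gamma> \<turnstile> X\<up>1 \<Colon> Ty" and E: "X\<up>1 # S # \<Gamma> \<turnstile> ?E \<Colon> Ty"
    supply ty = X S iS
    by (rule ty ty[THEN ty_sub] ty[THEN ty_ctx] | simp only: sbs | rule tyr)+
  have "inh (?E # X\<up>1 # S # \<Gamma>) M"
    by (rule inh_open[OF inh_open[OF \<open>inh (S # \<Gamma>) ?N\<close> XS] E])
  let ?F = "Id X\<up>2 (App i\<up>2 (Var 0)) (Var 1)"
  \<comment> \<open>The induction had \<open>s\<close> before the base point; the fiber over a given
    base point has it after. The exchange makes the last two variables a Sigma type again.\<close>
  have swap: "inh (?F # S\<up>1 # X # \<Gamma>) M\<langle>Var 0 \<cdot> Var 2 \<cdot> Var 1 \<cdot> \<up>3\<rangle>"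
    apply (rule inh_sub[OF \<open>inh (?E # _) M\<close>, of "Var 0 \<cdot> Var 2 \<cdot> Var 1 \<cdot> \<up>3"])
    supply ty = X S iS
    by (rule ty ty[THEN ty_sub] ty[THEN ty_ctx] | simp only: sbs | rule tyr)+
  let ?Y = "fiber S\<up>1 X\<up>1 i\<up>1 (Var 0)"
    and ?m = "fpair X\<up>2 i\<up>2 (Var 1) ?p (Refl (Var 1))"
  have Y: "X # \<Gamma> \<turnstile> ?Y \<Colon> Ty"
    supply ty = X S iS
    by (rule ty ty[THEN ty_sub] ty[THEN ty_ctx] | simp only: sbs | rule tyr)+
  have m: "?\<Delta> \<turnstile> ?m \<Colon> ?Y\<up>1"
    apply (simp only: sbs) apply (rule fpair_ty[OF Refl2[OF sb_shifts(2)[OF XP] v0(2)]])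
    supply ty = X S iS p P
    by (rule ty ty[THEN ty_sub] ty[THEN ty_ctx] | simp only: sbs | rule tyr)+
  have "inh (?Y # X # \<Gamma>) (Sigma P\<up>1 (Id ?Y\<up>2 (Var 1) ?m\<langle>Var 0 \<cdot> \<up>2\<rangle>))"
  proof -
    have 1: "X # \<Gamma> \<turnstile> S\<up>1 \<Colon> Ty" "S\<up>1 # X # \<Gamma> \<turnstile> ?F \<Colon> Ty"
      supply ty = X S iS
      by (rule ty ty[THEN ty_sub] ty[THEN ty_ctx] | simp only: sbs | rule tyr)+
    have 2: "?Y # X # \<Gamma> \<turnstile> Sigma P\<up>1 (Id ?Y\<up>2 (Var 1) ?m\<langle>Var 0 \<cdot> \<up>2\<rangle>) \<Colon> Ty"
      supply ty = X S iS P Y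
      by (rule ty ty[THEN ty_sub] ty[THEN ty_ctx] pair3 Refl3 | simp only: sbs | rule tyr)+
    have Ye: "?Y = Sigma S\<up>1 ?F"
      by (simp add: fiber_def sbs)
    show ?thesis
      using inh_Sigma_open[OF 1, folded Ye, OF 2] swap
      by (simp add: sbs M_def MB_def) (simp add: fpair_def sbs)
  qed
  from inh_isprop_surj[OF Y P m pP this]
  have "inh (X # \<Gamma>) (isprop ?Y)" .
  then show ?thesis
    unfolding isemb_def S_def[symmetric]
    apply (rule inh_Pi[rotated])
    supply ty = Y X
    by (rule ty ty[THEN ty_sub] ty[THEN ty_ctx] | simp only: sbs | rule tyr)+
qed

text \<open>A named inverse is needed in addition to \<open>inh_sym\<close>, because it occurs
  inside the covering map of \<open>inh_isprop_cofiber\<close>.\<close>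

definition inv :: "tm \<Rightarrow> tm \<Rightarrow> tm \<Rightarrow> tm \<Rightarrow> tm" where
  "inv X a b p = tr (Id X\<up>1 (Var 0) a\<up>1) a b p (Refl a)"

lemma inv_sub: "(inv X a b p)\<langle>\<sigma>\<rangle> = inv X\<langle>\<sigma>\<rangle> a\<langle>\<sigma>\<rangle> b\<langle>\<sigma>\<rangle> p\<langle>\<sigma>\<rangle>"
  by (simp add: inv_def sbs)

lemma inv_ty:
  assumes "\<Gamma> \<turnstile> p \<Colon> Id X a b" and "\<Gamma> \<turnstile> X \<Colon> Ty" "\<Gamma> \<turnstile> a \<Colon> X" "\<Gamma> \<turnstile> b \<Colon> X"
  shows "\<Gamma> \<turnstile> inv X a b p \<Colon> Id X b a"
  unfolding inv_def apply (rule tr_ty[OF assms(1,2)])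
  supply ty = assms(2) assms(3) assms(4)
  by (rule ty ty[THEN ty_sub] ty[THEN ty_ctx] | simp only: sbs | rule tyr)+

lemma inv_beta:
  assumes X: "\<Gamma> \<turnstile> X \<Colon> Ty" and a: "\<Gamma> \<turnstile> a \<Colon> X"
  shows "\<Gamma> \<turnstile> inv X a a (Refl a) \<doteq> Refl a \<Colon> Id X a a"
proof -
  have 1: "X # \<Gamma> \<turnstile> Id X\<up>1 (Var 0) a\<up>1 \<Colon> Ty" "\<Gamma> \<turnstile> Refl a \<Colon> (Id X\<up>1 (Var 0) a\<up>1)\<langle>a \<cdot> Var\<rangle>"
    supply ty = X a
    by (rule ty ty[THEN ty_sub] ty[THEN ty_ctx] | simp only: sbs | rule tyr)+
  from tr_beta[OF X 1(1) a 1(2)] show ?thesis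
    by (simp add: inv_def sbs)
qed

lemmas [tyr] = inv_ty
lemmas [sbs] = inv_sub

lemma inv_surj:
  assumes p: "\<Gamma> \<turnstile> p \<Colon> Id X a b" and X: "\<Gamma> \<turnstile> X \<Colon> Ty" and a: "\<Gamma> \<turnstile> a \<Colon> X" and b: "\<Gamma> \<turnstile> b \<Colon> X"
  obtains q where "\<Gamma> \<turnstile> q \<Colon> Id X b a" "inh \<Gamma> (Id (Id X a b) (inv X b a q) p)"
proof -
  let ?D = "Sigma (Id X\<up>2 (Var 1) a\<up>2) (Id (Id X\<up>3 a\<up>3 (Var 2)) (inv X\<up>3 (Var 2) a\<up>3 (Var 0)) (Var 1))"
  have D: "Id X\<up>1 a\<up>1 (Var 0) # X # \<Gamma> \<turnstile> ?D \<Colon> Ty"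
    supply ty = X a
    by (rule ty ty[THEN ty_sub] ty[THEN ty_ctx] | simp only: sbs | rule tyr)+
  let ?E = "Id (Id X\<up>1 a\<up>1 a\<up>1) (inv X\<up>1 a\<up>1 a\<up>1 (Var 0)) (Refl a\<up>1)"
  have E: "Id X a a # \<Gamma> \<turnstile> ?E \<Colon> Ty" and r: "\<Gamma> \<turnstile> Refl a \<Colon> Id X a a" and I: "\<Gamma> \<turnstile> Id X a a \<Colon> Ty"
    and Iba: "\<Gamma> \<turnstile> Id X b a \<Colon> Ty"
    and F: "Id X b a # \<Gamma> \<turnstile> Id (Id X\<up>1 a\<up>1 b\<up>1) (inv X\<up>1 b\<up>1 a\<up>1 (Var 0)) p\<up>1 \<Colon> Ty"
    supply ty = X a b p
    by (rule ty ty[THEN ty_sub] ty[THEN ty_ctx] | simp only: sbs | rule tyr)+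
  have "inh \<Gamma> ?E\<langle>Refl a \<cdot> Var\<rangle>"
    using inh_eq[OF inv_beta[OF X a] I r] by (simp add: sbs)
  from inh_Sigma[OF E r this] have "inh \<Gamma> ?D\<langle>Refl a \<cdot> a \<cdot> Var\<rangle>"
    by (simp add: sbs)
  from inh_bJ[OF p X a b D this refl]
  have "inh \<Gamma> (Sigma (Id X b a) (Id (Id X\<up>1 a\<up>1 b\<up>1) (inv X\<up>1 b\<up>1 a\<up>1 (Var 0)) p\<up>1))"
    by (simp add: sbs)
  then show thesis
    by (rule inh_Sigma_obtain[OF _ Iba F]) (simp add: sbs that)
qed

text \<open>Fibers use paths \<open>g b = x\<close>, homotopies in \<open>Hom\<close> use
  \<open>f a = g b\<close>. The map \<open>(b, q) \<mapsto> (b, inv q)\<close> from the fiber covers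
  the type with reversed paths, by \<open>inv_surj\<close>.\<close>

lemma inh_isprop_cofiber:
  fixes \<Gamma> B X g x
  defines "C \<equiv> Id X\<up>1 x\<up>1 (App g\<up>1 (Var 0))"
  assumes B: "\<Gamma> \<turnstile> B \<Colon> Ty" and X: "\<Gamma> \<turnstile> X \<Colon> Ty" and g: "\<Gamma> \<turnstile> g \<Colon> arrow B X" and x: "\<Gamma> \<turnstile> x \<Colon> X"
    and pF: "inh \<Gamma> (isprop (fiber B X g x))"
  shows "inh \<Gamma> (isprop (Sigma B C))"
proof -
  let ?F = "Id X\<up>1 (App g\<up>1 (Var 0)) x\<up>1"
  have C: "B # \<Gamma> \<turnstile> C \<Colon> Ty" and F: "B # \<Gamma> \<turnstile> ?F \<Colon> Ty" and fib: "\<Gamma> \<turnstile> fiber B X g x \<Colon> Ty"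
    subgoal unfolding C_def
      supply ty = B X g x
      by (rule ty ty[THEN ty_sub] ty[THEN ty_ctx] | simp only: sbs | rule tyr)+
    supply ty = B X g x
    by (rule ty ty[THEN ty_sub] ty[THEN ty_ctx] | simp only: sbs | rule tyr)+
  define Y where "Y = Sigma B C"
  have Y: "\<Gamma> \<turnstile> Y \<Colon> Ty"
    unfolding Y_def
    supply ty = B C
    by (rule ty ty[THEN ty_sub] ty[THEN ty_ctx] | simp only: sbs | rule tyr)+
  have S: "fiber B X g x = Sigma B ?F"
    by (simp add: fiber_def)
  let ?D = "Pair C\<langle>Var 0 \<cdot> \<up>3\<rangle> (Var 1) (inv X\<up>2 (App g\<up>2 (Var 1)) x\<up>2 (Var 0))"
  have Pty: "\<Delta> \<turnstile> Pair C\<langle>Var 0 \<cdot> (\<sigma> ;; \<up>1)\<rangle> b q \<Colon> Y\<langle>\<sigma>\<rangle>"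
    if \<sigma>: "sb \<Gamma> \<sigma> \<Delta>" and b: "\<Delta> \<turnstile> b \<Colon> B\<langle>\<sigma>\<rangle>" and q: "\<Delta> \<turnstile> q \<Colon> Id X\<langle>\<sigma>\<rangle> x\<langle>\<sigma>\<rangle> (App g\<langle>\<sigma>\<rangle> b)" for \<Delta> \<sigma> b q
  proof -
    have 1: "C # B # \<Gamma> \<turnstile> Pair C\<langle>Var 0 \<cdot> \<up>3\<rangle> (Var 1) (Var 0) \<Colon> Y\<up>2"
      unfolding Y_def
      supply ty = B C
      by (rule ty ty[THEN ty_sub] ty[THEN ty_ctx] Pair | simp only: sbs | rule tyr)+
    have "\<Delta> \<turnstile> q \<Colon> C\<langle>b \<cdot> \<sigma>\<rangle>"
      using q by (simp add: C_def sbs)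
    from ty_sub[OF 1 sb_scons[OF sb_scons[OF \<sigma> b] this] refl] show ?thesis
      by (simp add: sbs)
  qed
  note Pty2 = Pty[of "\<up>2", simplified sbs sub.simps] and Pty3 = Pty[of "\<up>3", simplified sbs sub.simps]
  have D: "?F # B # \<Gamma> \<turnstile> ?D \<Colon> Y\<up>1\<langle>Pair ?F\<langle>Var 0 \<cdot> \<up>3\<rangle> (Var 1) (Var 0) \<cdot> \<up>2\<rangle>"
    supply ty = B X g x F
    by (rule ty ty[THEN ty_sub] ty[THEN ty_ctx] Pty2 | simp only: sbs | rule tyr)+
  have Y1: "Sigma B ?F # \<Gamma> \<turnstile> Y\<up>1 \<Colon> Ty"
    supply ty = Y F B
    by (rule ty ty[THEN ty_sub] ty[THEN ty_ctx] | simp only: sbs | rule tyr)+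
  obtain m where m: "fiber B X g x # \<Gamma> \<turnstile> m \<Colon> Y\<up>1"
    and m_beta: "?F # B # \<Gamma> \<turnstile> m\<langle>Pair ?F\<langle>Var 0 \<cdot> \<up>3\<rangle> (Var 1) (Var 0) \<cdot> \<up>2\<rangle> \<doteq> ?D \<Colon> Y\<up>2"
    using Sigma_rec_open[OF B F Y1 D] by (auto simp: S sbs)
  let ?\<Theta> = "C # B # \<Gamma>"
  have \<Theta>: "?\<Theta> \<turnstile> Var 0 \<Colon> Id X\<up>2 x\<up>2 (App g\<up>2 (Var 1))" "?\<Theta> \<turnstile> X\<up>2 \<Colon> Ty" "?\<Theta> \<turnstile> x\<up>2 \<Colon> X\<up>2" "?\<Theta> \<turnstile> App g\<up>2 (Var 1) \<Colon> X\<up>2"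
    "?\<Theta> \<turnstile> Y\<up>2 \<Colon> Ty" "?\<Theta> \<turnstile> Id X\<up>2 x\<up>2 (App g\<up>2 (Var 1)) \<Colon> Ty" and sb2: "sb \<Gamma> (\<up>2) ?\<Theta>" and v1: "?\<Theta> \<turnstile> Var 1 \<Colon> B\<up>2"
    subgoal apply (rule var_ty(1)[THEN ty_eq]) prefer 2 apply (rule refl) prefer 2 apply (simp add: C_def sbs)
      supply ty = C B
      by (rule ty ty[THEN ty_sub] ty[THEN ty_ctx] | simp only: sbs | rule tyr)+
    supply ty = C B X x g Y
    by (rule ty ty[THEN ty_sub] ty[THEN ty_ctx] | simp only: sbs | rule tyr)+
  \<comment> \<open>For a generic point \<open>(b, r)\<close> of the target, a \<open>q\<close> with
    \<open>inv q = r\<close>; then \<open>(b, q)\<close> is the preimage sought.\<close>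
  obtain q where q: "?\<Theta> \<turnstile> q \<Colon> Id X\<up>2 (App g\<up>2 (Var 1)) x\<up>2"
    and qi: "inh ?\<Theta> (Id (Id X\<up>2 x\<up>2 (App g\<up>2 (Var 1))) (inv X\<up>2 (App g\<up>2 (Var 1)) x\<up>2 q) (Var 0))"
    by (rule inv_surj[OF \<Theta>(1-4)])
  let ?w = "fpair X\<up>2 g\<up>2 x\<up>2 (Var 1) q" and ?pr = "Pair C\<langle>Var 0 \<cdot> \<up>3\<rangle> (Var 1)"
  have w: "?\<Theta> \<turnstile> ?w \<Colon> fiber B\<up>2 X\<up>2 g\<up>2 x\<up>2"
    supply ty = q B X x g C
    by (rule ty ty[THEN ty_sub] ty[THEN ty_ctx] | simp only: sbs | rule tyr)+
  have iq: "?\<Theta> \<turnstile> inv X\<up>2 (App g\<up>2 (Var 1)) x\<up>2 q \<Colon> Id X\<up>2 x\<up>2 (App g\<up>2 (Var 1))"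
    by (rule inv_ty[OF q \<Theta>(2,4,3)])
  note piq = Pty2[OF sb2 v1 iq] and pv = Pty2[OF sb2 v1 \<Theta>(1)]
  have r: "Id X\<up>2 x\<up>2 (App g\<up>2 (Var 1)) # ?\<Theta> \<turnstile> Pair C\<langle>Var 0 \<cdot> \<up>4\<rangle> (Var 2) (Var 0) \<Colon> Y\<up>2\<up>1"
    supply ty = C B X x g \<Theta>(6)
    by (rule ty ty[THEN ty_sub] ty[THEN ty_ctx] Pty3 | simp only: sbs | rule tyr)+
  have e1: "inh ?\<Theta> (Id Y\<up>2 (?pr (Var 0)) (?pr (inv X\<up>2 (App g\<up>2 (Var 1)) x\<up>2 q)))"
    using inh_ap[OF r inh_sym[OF qi \<Theta>(6) iq \<Theta>(1)] \<Theta>(5,6,1) iq refl] by (simp add: sbs)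
  have "sb (?F # B # \<Gamma>) (q \<cdot> Var 1 \<cdot> \<up>2) ?\<Theta>"
    supply ty = C B q
    by (rule ty ty[THEN ty_sub] ty[THEN ty_ctx] | simp only: sbs | rule tyr)+
  from eq_sub[OF m_beta this refl]
  have e2: "?\<Theta> \<turnstile> ?pr (inv X\<up>2 (App g\<up>2 (Var 1)) x\<up>2 q) \<doteq> m\<langle>?w \<cdot> \<up>2\<rangle> \<Colon> Y\<up>2"
    by (simp add: sbs fpair_def eq_sym)
  have mw: "?\<Theta> \<turnstile> m\<langle>?w \<cdot> \<up>2\<rangle> \<Colon> Y\<up>2"
    supply ty = m w C B
    by (rule ty ty[THEN ty_sub] ty[THEN ty_ctx] | simp only: sbs | rule tyr)+
  have e3: "inh ?\<Theta> (Id Y\<up>3 (Pair C\<langle>Var 0 \<cdot> \<up>4\<rangle> (Var 2) (Var 1)) m\<langle>Var 0 \<cdot> \<up>3\<rangle>)\<langle>?w \<cdot> Var\<rangle>"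
    using inh_trans[OF e1 inh_eq[OF e2 \<Theta>(5) mw] \<Theta>(5) pv piq mw] by (simp add: sbs)
  have "sb ?\<Theta> (\<up>1) (fiber B\<up>2 X\<up>2 g\<up>2 x\<up>2 # ?\<Theta>)"
    supply ty = C B X g x
    by (rule ty ty[THEN ty_sub] ty[THEN ty_ctx] | simp only: sbs | rule tyr)+
  from ty_sub[OF \<Theta>(1) this refl]
  have v3: "fiber B\<up>2 X\<up>2 g\<up>2 x\<up>2 # ?\<Theta> \<turnstile> Var 1 \<Colon> Id X\<up>3 x\<up>3 (App g\<up>3 (Var 2))"
    by (simp add: sbs)
  have "fiber B\<up>2 X\<up>2 g\<up>2 x\<up>2 # ?\<Theta> \<turnstile> Id Y\<up>3 (Pair C\<langle>Var 0 \<cdot> \<up>4\<rangle> (Var 2) (Var 1)) m\<langle>Var 0 \<cdot> \<up>3\<rangle> \<Colon> Ty"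
    supply ty = C B m Y X g x v3
    by (rule ty ty[THEN ty_sub] ty[THEN ty_ctx] Pty3 | simp only: sbs | rule tyr)+
  from inh_Sigma[OF this w e3]
  have s: "inh ?\<Theta> (Sigma (fiber B\<up>2 X\<up>2 g\<up>2 x\<up>2) (Id Y\<up>3 (Pair C\<langle>Var 0 \<cdot> \<up>4\<rangle> (Var 2) (Var 1)) m\<langle>Var 0 \<cdot> \<up>3\<rangle>))" .
  have "Y # \<Gamma> \<turnstile> Sigma (fiber B X g x)\<up>1 (Id Y\<up>2 (Var 1) m\<langle>Var 0 \<cdot> \<up>2\<rangle>) \<Colon> Ty"
    supply ty = Y B X g x m
    by (rule ty ty[THEN ty_sub] ty[THEN ty_ctx] | simp only: sbs | rule tyr)+
  from inh_Sigma_open[OF B C this[unfolded Y_def]] s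
  have "inh (Y # \<Gamma>) (Sigma (fiber B X g x)\<up>1 (Id Y\<up>2 (Var 1) m\<langle>Var 0 \<cdot> \<up>2\<rangle>))"
    by (simp add: Y_def sbs)
  from inh_isprop_surj[OF Y fib m pF this] show ?thesis
    by (simp add: Y_def)
qed

section \<open>Maps over a type\<close>

lemma comp_beta:
  assumes A: "\<Gamma> \<turnstile> A \<Colon> Ty" and C: "\<Gamma> \<turnstile> C \<Colon> Ty" and f: "\<Gamma> \<turnstile> f \<Colon> arrow A B" and g: "\<Gamma> \<turnstile> g \<Colon> arrow B C" and a: "\<Gamma> \<turnstile> a \<Colon> A"
  shows "\<Gamma> \<turnstile> App (comp A g f) a \<doteq> App g (App f a) \<Colon> C"
proof -
  have 1: "A # \<Gamma> \<turnstile> C\<up>1 \<Colon> Ty" "A # \<Gamma> \<turnstile> App g\<up>1 (App f\<up>1 (Var 0)) \<Colon> C\<up>1"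
    supply ty = A C f g
    by (rule ty ty[THEN ty_sub] ty[THEN ty_ctx] | simp only: sbs | rule tyr)+
  from Pi_beta[OF 1 a] show ?thesis
    by (simp add: comp_def sbs)
qed

text \<open>The type of a homotopy contains \<open>comp A g h\<close> as a lambda term. This
  conversion unfolds it, and at the same time replaces the values of \<open>h\<close> by
  judgementally equal ones.\<close>

lemma htpy_comp_eq:
  assumes A: "\<Gamma> \<turnstile> A \<Colon> Ty" and X: "\<Gamma> \<turnstile> X \<Colon> Ty" and f: "\<Gamma> \<turnstile> f \<Colon> arrow A X" and g: "\<Gamma> \<turnstile> g \<Colon> arrow B X" and h: "\<Gamma> \<turnstile> h \<Colon> arrow A B"
    and b: "A # \<Gamma> \<turnstile> App h\<up>1 (Var 0) \<doteq> b \<Colon> B\<up>1"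
  shows "\<Gamma> \<turnstile> htpy A X f (comp A g h) \<doteq> Pi A (Id X\<up>1 (App f\<up>1 (Var 0)) (App g\<up>1 b)) \<Colon> Ty"
proof -
  have 1: "A # \<Gamma> \<turnstile> A\<up>1 \<Colon> Ty" "A # \<Gamma> \<turnstile> X\<up>1 \<Colon> Ty" "A # \<Gamma> \<turnstile> h\<up>1 \<Colon> arrow A\<up>1 B\<up>1" "A # \<Gamma> \<turnstile> g\<up>1 \<Colon> arrow B\<up>1 X\<up>1" "A # \<Gamma> \<turnstile> Var 0 \<Colon> A\<up>1"
    "A # \<Gamma> \<turnstile> App f\<up>1 (Var 0) \<Colon> X\<up>1"
    supply ty = A X h g f
    by (rule ty ty[THEN ty_sub] ty[THEN ty_ctx] | simp only: sbs | rule tyr)+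
  have "A # \<Gamma> \<turnstile> App g\<up>1 (App h\<up>1 (Var 0)) \<doteq> App g\<up>1 b \<Colon> X\<up>1"
    using App_cong[OF eq_refl[OF 1(4)[unfolded arrow_def]] b] by (simp add: sbs)
  with comp_beta[OF 1(1-5)] have "A # \<Gamma> \<turnstile> App (comp A g h)\<up>1 (Var 0) \<doteq> App g\<up>1 b \<Colon> X\<up>1"
    using eq_trans by (simp add: sbs)
  then show ?thesis
    unfolding htpy_def dhtpy_def
    by - (rule Pi_cong[of Ty, OF _ eq_refl[OF A] Id_cong[of Ty, OF _ eq_refl[OF 1(2)] eq_refl[OF 1(6)]]], simp_all)
qed

lemma htpy_comp_app:
  assumes A: "\<Gamma> \<turnstile> A \<Colon> Ty" and X: "\<Gamma> \<turnstile> X \<Colon> Ty" and f: "\<Gamma> \<turnstile> f \<Colon> arrow A X" and g: "\<Gamma> \<turnstile> g \<Colon> arrow B X" and h: "\<Gamma> \<turnstile> h \<Colon> arrow A B"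
    and H: "\<Gamma> \<turnstile> H \<Colon> htpy A X f (comp A g h)"
  shows "\<Gamma> \<turnstile> H \<Colon> Pi A (Id X\<up>1 (App f\<up>1 (Var 0)) (App g\<up>1 (App h\<up>1 (Var 0))))"
    and "\<Gamma> \<turnstile> a \<Colon> A \<Longrightarrow> \<Gamma> \<turnstile> App H a \<Colon> Id X (App f a) (App g (App h a))"
proof -
  have "A # \<Gamma> \<turnstile> App h\<up>1 (Var 0) \<Colon> B\<up>1"
    supply ty = A h
    by (rule ty ty[THEN ty_sub] ty[THEN ty_ctx] | simp only: sbs | rule tyr)+
  from conv[OF H htpy_comp_eq[OF A X f g h eq_refl[OF this]]]
  show 1: "\<Gamma> \<turnstile> H \<Colon> Pi A (Id X\<up>1 (App f\<up>1 (Var 0)) (App g\<up>1 (App h\<up>1 (Var 0))))" .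
  show "\<Gamma> \<turnstile> App H a \<Colon> Id X (App f a) (App g (App h a))" if "\<Gamma> \<turnstile> a \<Colon> A"
    by (rule App_ty[OF 1 that]) (simp add: sbs)
qed

lemma hom_fam_ty:
  assumes A: "\<Gamma> \<turnstile> A \<Colon> Ty" and B: "\<Gamma> \<turnstile> B \<Colon> Ty" and X: "\<Gamma> \<turnstile> X \<Colon> Ty" and f: "\<Gamma> \<turnstile> f \<Colon> arrow A X" and g: "\<Gamma> \<turnstile> g \<Colon> arrow B X"
  shows "arrow A B # \<Gamma> \<turnstile> hom_fam A X f g \<Colon> Ty"
  unfolding hom_fam_def
  supply ty = A B X f g
  by (rule ty ty[THEN ty_sub] ty[THEN ty_ctx] | simp only: sbs | rule tyr)+

lemma Hom_ty:
  assumes "\<Gamma> \<turnstile> A \<Colon> Ty" "\<Gamma> \<turnstile> B \<Colon> Ty" "\<Gamma> \<turnstile> X \<Colon> Ty" "\<Gamma> \<turnstile> f \<Colon> arrow A X" "\<Gamma> \<turnstile> g \<Colon> arrow B X"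
  shows "\<Gamma> \<turnstile> Hom A B X f g \<Colon> Ty"
  unfolding Hom_def by (intro former_ty hom_fam_ty arrow_ty assms)

lemma hom_fam_inst: "(hom_fam A X f g)\<langle>h \<cdot> \<sigma>\<rangle> = htpy A\<langle>\<sigma>\<rangle> X\<langle>\<sigma>\<rangle> f\<langle>\<sigma>\<rangle> (comp A\<langle>\<sigma>\<rangle> g\<langle>\<sigma>\<rangle> h)"
  by (simp add: hom_fam_def sbs)

lemma Lam_eq_beta:
  assumes A: "\<Gamma> \<turnstile> A \<Colon> Ty" and B: "A # \<Gamma> \<turnstile> B \<Colon> Ty" and b: "A # \<Gamma> \<turnstile> b \<Colon> B"
  shows "A # \<Gamma> \<turnstile> App (Lam A b)\<up>1 (Var 0) \<doteq> b \<Colon> B"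
proof -
  have 1: "A\<up>1 # A # \<Gamma> \<turnstile> B\<langle>Var 0 \<cdot> \<up>2\<rangle> \<Colon> Ty" "A\<up>1 # A # \<Gamma> \<turnstile> b\<langle>Var 0 \<cdot> \<up>2\<rangle> \<Colon> B\<langle>Var 0 \<cdot> \<up>2\<rangle>" "A # \<Gamma> \<turnstile> Var 0 \<Colon> A\<up>1"
    supply ty = A B b
    by (rule ty ty[THEN ty_sub] ty[THEN ty_ctx] | simp only: sbs | rule tyr)+
  from Pi_beta[OF 1] show ?thesis
    by (simp add: sbs)
qed

lemma hom_intro:
  assumes A: "\<Gamma> \<turnstile> A \<Colon> Ty" and B: "\<Gamma> \<turnstile> B \<Colon> Ty" and X: "\<Gamma> \<turnstile> X \<Colon> Ty" and f: "\<Gamma> \<turnstile> f \<Colon> arrow A X" and g: "\<Gamma> \<turnstile> g \<Colon> arrow B X"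
    and b: "A # \<Gamma> \<turnstile> b \<Colon> B\<up>1" and e: "A # \<Gamma> \<turnstile> e \<Colon> Id X\<up>1 (App f\<up>1 (Var 0)) (App g\<up>1 b)"
  shows "\<Gamma> \<turnstile> htpy A X f (comp A g (Lam A b)) \<doteq> Pi A (Id X\<up>1 (App f\<up>1 (Var 0)) (App g\<up>1 b)) \<Colon> Ty"
    and "\<Gamma> \<turnstile> Pair (hom_fam A X f g) (Lam A b) (Lam A e) \<Colon> Hom A B X f g"
proof -
  have l: "\<Gamma> \<turnstile> Lam A b \<Colon> arrow A B"
    by (rule Lam_arrow[OF B b])
  have I: "A # \<Gamma> \<turnstile> Id X\<up>1 (App f\<up>1 (Var 0)) (App g\<up>1 b) \<Colon> Ty" and B1: "A # \<Gamma> \<turnstile> B\<up>1 \<Colon> Ty"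
    supply ty = A X f g b B
    by (rule ty ty[THEN ty_sub] ty[THEN ty_ctx] | simp only: sbs | rule tyr)+
  show E: "\<Gamma> \<turnstile> htpy A X f (comp A g (Lam A b)) \<doteq> Pi A (Id X\<up>1 (App f\<up>1 (Var 0)) (App g\<up>1 b)) \<Colon> Ty"
    by (rule htpy_comp_eq[OF A X f g l Lam_eq_beta[OF A B1 b]])
  have "\<Gamma> \<turnstile> Lam A e \<Colon> (hom_fam A X f g)\<langle>Lam A b \<cdot> Var\<rangle>"
    unfolding hom_fam_inst sub_Var by (rule conv[OF Lam[OF I e] eq_sym[OF E]])
  then show "\<Gamma> \<turnstile> Pair (hom_fam A X f g) (Lam A b) (Lam A e) \<Colon> Hom A B X f g"
    unfolding Hom_def by (rule Pair[OF hom_fam_ty[OF A B X f g] l])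
qed

lemma precomp_ty:
  assumes A: "\<Gamma> \<turnstile> A \<Colon> Ty" and A': "\<Gamma> \<turnstile> A' \<Colon> Ty" and B: "\<Gamma> \<turnstile> B \<Colon> Ty" and X: "\<Gamma> \<turnstile> X \<Colon> Ty"
    and f: "\<Gamma> \<turnstile> f \<Colon> arrow A X" and f': "\<Gamma> \<turnstile> f' \<Colon> arrow A' X" and g: "\<Gamma> \<turnstile> g \<Colon> arrow B X" and i: "\<Gamma> \<turnstile> i \<Colon> arrow A A'"
    and I: "\<Gamma> \<turnstile> I \<Colon> htpy A X f (comp A f' i)" and h: "\<Gamma> \<turnstile> h \<Colon> arrow A' B" and H: "\<Gamma> \<turnstile> H \<Colon> htpy A' X f' (comp A' g h)"
  shows "\<Gamma> \<turnstile> precomp A X f f' g i I h H \<Colon> Hom A B X f g"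
proof -
  note I' = htpy_comp_app(1)[OF A X f f' i I] and H' = htpy_comp_app(1)[OF A' X f' g h H]
  have "A # \<Gamma> \<turnstile> App I\<up>1 (Var 0) \<Colon> Id X\<up>1 (App f\<up>1 (Var 0)) (App f'\<up>1 (App i\<up>1 (Var 0)))"
    by (rule Pi_open[OF A I'])
  moreover have "A # \<Gamma> \<turnstile> App H\<up>1 (App i\<up>1 (Var 0)) \<Colon> Id X\<up>1 (App f'\<up>1 (App i\<up>1 (Var 0))) (App g\<up>1 (App h\<up>1 (App i\<up>1 (Var 0))))"
    apply (rule App_ty, rule H'[THEN ty_sub])
    supply ty = A i
    by (rule ty ty[THEN ty_sub] ty[THEN ty_ctx] | simp only: sbs | rule tyr)+
  ultimately have "A # \<Gamma> \<turnstile> concat X\<up>1 (App f\<up>1 (Var 0)) (App f'\<up>1 (App i\<up>1 (Var 0))) (App g\<up>1 (App h\<up>1 (App i\<up>1 (Var 0))))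
            (App I\<up>1 (Var 0)) (App H\<up>1 (App i\<up>1 (Var 0)))
       \<Colon> Id X\<up>1 (App f\<up>1 (Var 0)) (App g\<up>1 (App h\<up>1 (App i\<up>1 (Var 0))))"
    apply (rule concat_ty)
    supply ty = A X f f' i g h
    by (rule ty ty[THEN ty_sub] ty[THEN ty_ctx] | simp only: sbs | rule tyr)+
  moreover have "A # \<Gamma> \<turnstile> App h\<up>1 (App i\<up>1 (Var 0)) \<Colon> B\<up>1"
    supply ty = A i h
    by (rule ty ty[THEN ty_sub] ty[THEN ty_ctx] | simp only: sbs | rule tyr)+
  ultimately show ?thesis
    using hom_intro(2)[OF A B X f g] by (simp add: precomp_def comp_def Let_def)
qed

lemma phi_ty:
  assumes A: "\<Gamma> \<turnstile> A \<Colon> Ty" and A': "\<Gamma> \<turnstile> A' \<Colon> Ty" and B: "\<Gamma> \<turnstile> B \<Colon> Ty" and X: "\<Gamma> \<turnstile> X \<Colon> Ty"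
    and f: "\<Gamma> \<turnstile> f \<Colon> arrow A X" and f': "\<Gamma> \<turnstile> f' \<Colon> arrow A' X" and g: "\<Gamma> \<turnstile> g \<Colon> arrow B X" and i: "\<Gamma> \<turnstile> i \<Colon> arrow A A'"
    and I: "\<Gamma> \<turnstile> I \<Colon> htpy A X f (comp A f' i)"
  shows "\<Gamma> \<turnstile> phi A A' B X f f' g i I \<Colon> arrow (Hom A' B X f' g) (Hom A B X f g)"
proof -
  note H' = Hom_ty[OF A' B X f' g] and H = Hom_ty[OF A B X f g]
  note F = hom_fam_ty[OF A' B X f' g]
  let ?\<Delta> = "Hom A' B X f' g # \<Gamma>"
  let ?F = "hom_fam A'\<up>1 X\<up>1 f'\<up>1 g\<up>1"
  have F1: "arrow A'\<up>1 B\<up>1 # ?\<Delta> \<turnstile> ?F \<Colon> Ty"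
    apply (rule hom_fam_ty)
    supply ty = A' B X f' g H'
    by (rule ty ty[THEN ty_sub] ty[THEN ty_ctx] | simp only: sbs | rule tyr)+
  have 1: "Sigma (arrow A'\<up>1 B\<up>1) ?F # ?\<Delta> \<turnstile> (Hom A B X f g)\<up>2 \<Colon> Ty"
    apply (rule sub_Ty[OF H])
    supply ty = A' B F1 H'
    by (rule ty ty[THEN ty_sub] ty[THEN ty_ctx] | simp only: sbs | rule tyr)+
  let ?\<Theta> = "?F # arrow A'\<up>1 B\<up>1 # ?\<Delta>"
  have sb3: "sb \<Gamma> (\<up>3) ?\<Theta>"
    supply ty = F1
    by (rule ty ty[THEN ty_sub] ty[THEN ty_ctx] | simp only: sbs | rule tyr)+
  have 2: "?\<Theta> \<turnstile> precomp A\<up>3 X\<up>3 f\<up>3 f'\<up>3 g\<up>3 i\<up>3 I\<up>3 (Var 1) (Var 0) \<Colon> Hom A\<up>3 B\<up>3 X\<up>3 f\<up>3 g\<up>3"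
  proof (rule precomp_ty)
    have "?\<Theta> \<turnstile> Var 0 \<Colon> ?F\<up>1"
      supply ty = F1
      by (rule ty ty[THEN ty_sub] ty[THEN ty_ctx] | simp only: sbs | rule tyr)+
    then show "?\<Theta> \<turnstile> Var 0 \<Colon> htpy A'\<up>3 X\<up>3 f'\<up>3 (comp A'\<up>3 g\<up>3 (Var 1))"
      by (simp add: hom_fam_def sbs)
    show "?\<Theta> \<turnstile> Var 1 \<Colon> arrow A'\<up>3 B\<up>3"
      supply ty = F1
      by (rule ty ty[THEN ty_sub] ty[THEN ty_ctx] | simp only: sbs | rule tyr)+
  qed ((rule ty_sub[OF A sb3] ty_sub[OF A' sb3] ty_sub[OF B sb3] ty_sub[OF X sb3] ty_sub[OF f sb3] ty_sub[OF f' sb3] ty_sub[OF g sb3]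
    ty_sub[OF i sb3] ty_sub[OF I sb3], simp add: sbs; fail)+)
  have 3: "?\<Delta> \<turnstile> Var 0 \<Colon> Sigma (arrow A'\<up>1 B\<up>1) ?F"
    using var_ty(1)[OF ctx_cons[OF H'] refl] by (simp only: defs_sub flip: Hom_def)
  have "?\<Delta> \<turnstile> IndSigma (Hom A B X f g)\<up>2
          (precomp A\<up>3 X\<up>3 f\<up>3 f'\<up>3 g\<up>3 i\<up>3 I\<up>3 (Var 1) (Var 0)) (Var 0) \<Colon> (Hom A B X f g)\<up>2\<langle>Var 0 \<cdot> Var\<rangle>"
    apply (rule IndSigma[OF 1 _ 3])
    using 2 by (simp add: sbs)
  then show ?thesis
    unfolding phi_def by (intro Lam_arrow[OF H]) (simp add: sbs)
qed

text \<open>Type-theoretic choice: a map with a homotopy is a pointwise family of pairs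
  \<open>(b, f a = g b)\<close>. Starting from \<open>(h, H)\<close>, forming the family and
  projecting again is the identity judgementally, by the eta rule for functions and the beta rules
  for projections.\<close>

lemma hom_eta:
  fixes \<Gamma> A B X f g h H
  defines "CB \<equiv> Id X\<up>2 (App f\<up>2 (Var 1)) (App g\<up>2 (Var 0))"
  defines "\<phi> \<equiv> Lam A (Pair CB (App h\<up>1 (Var 0)) (App H\<up>1 (Var 0)))"
  assumes A: "\<Gamma> \<turnstile> A \<Colon> Ty" and B: "\<Gamma> \<turnstile> B \<Colon> Ty" and X: "\<Gamma> \<turnstile> X \<Colon> Ty" and f: "\<Gamma> \<turnstile> f \<Colon> arrow A X" and g: "\<Gamma> \<turnstile> g \<Colon> arrow B X"
    and h: "\<Gamma> \<turnstile> h \<Colon> arrow A B" and H: "\<Gamma> \<turnstile> H \<Colon> htpy A X f (comp A g h)"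
  shows "\<Gamma> \<turnstile> \<phi> \<Colon> Pi A (Sigma B\<up>1 CB)"
    and "\<Gamma> \<turnstile> Pair (hom_fam A X f g) (Lam A (pfst B\<up>1 (App \<phi>\<up>1 (Var 0)))) (Lam A (psnd B\<up>1 CB (App \<phi>\<up>1 (Var 0))))
      \<doteq> Pair (hom_fam A X f g) h H \<Colon> Hom A B X f g"
proof -
  note H' = htpy_comp_app(1)[OF A X f g h H]
  let ?C = "Sigma B\<up>1 CB" and ?h = "App h\<up>1 (Var 0)" and ?H = "App H\<up>1 (Var 0)"
  have CB: "B\<up>1 # A # \<Gamma> \<turnstile> CB \<Colon> Ty"
    unfolding CB_def
    supply ty = A B X f g
    by (rule ty ty[THEN ty_sub] ty[THEN ty_ctx] | simp only: sbs | rule tyr)+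
  have B1: "A # \<Gamma> \<turnstile> B\<up>1 \<Colon> Ty"
    supply ty = A B
    by (rule ty ty[THEN ty_sub] ty[THEN ty_ctx] | simp only: sbs | rule tyr)+
  note C = former_ty(3)[OF B1 CB]
  have ha: "A # \<Gamma> \<turnstile> ?h \<Colon> B\<up>1"
    supply ty = A h
    by (rule ty ty[THEN ty_sub] ty[THEN ty_ctx] | simp only: sbs | rule tyr)+
  have CBi: "CB\<langle>b \<cdot> Var\<rangle> = Id X\<up>1 (App f\<up>1 (Var 0)) (App g\<up>1 b)" for b
    by (simp add: CB_def sbs)
  have Ha: "A # \<Gamma> \<turnstile> ?H \<Colon> CB\<langle>?h \<cdot> Var\<rangle>"
    unfolding CBi by (rule Pi_open[OF A H'])
  note w = Pair[OF CB ha Ha]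
  show \<phi>: "\<Gamma> \<turnstile> \<phi> \<Colon> Pi A ?C"
    unfolding \<phi>_def by (rule Lam[OF C w])
  let ?v = "App \<phi>\<up>1 (Var 0)" and ?w = "Pair CB ?h ?H"
  have vw: "A # \<Gamma> \<turnstile> ?v \<doteq> ?w \<Colon> ?C"
    unfolding \<phi>_def by (rule Lam_eq_beta[OF A C w])
  have v: "A # \<Gamma> \<turnstile> ?v \<Colon> ?C"
    by (rule Pi_open[OF A \<phi>])
  have pf: "?C # A # \<Gamma> \<turnstile> pfst B\<up>2 (Var 0) \<Colon> B\<up>2"
    and ps: "?C # A # \<Gamma> \<turnstile> psnd B\<up>2 CB\<langle>Var 0 \<cdot> \<up>2\<rangle> (Var 0) \<Colon> CB\<langle>pfst B\<up>2 (Var 0) \<cdot> \<up>1\<rangle>"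
    supply ty = A B CB
    by (rule ty ty[THEN ty_sub] ty[THEN ty_ctx] pfst_ty pfst_ty psnd_ty[THEN ty_eq] | simp only: sbs | rule tyr)+
  let ?pv = "pfst B\<up>1 ?v" and ?sv = "psnd B\<up>1 CB ?v"
  have "A # \<Gamma> \<turnstile> ?pv \<doteq> pfst B\<up>1 ?w \<Colon> B\<up>1"
    by (rule eq_inst[OF pf vw]) (simp_all add: sbs)
  from eq_trans[OF this pfst_beta[OF B1 CB ha Ha]]
  have pv: "A # \<Gamma> \<turnstile> ?pv \<doteq> ?h \<Colon> B\<up>1" .
  have pvty: "A # \<Gamma> \<turnstile> ?pv \<Colon> B\<up>1"
    by (rule pfst_ty[OF v B1 CB])
  have E: "A # \<Gamma> \<turnstile> CB\<langle>?h \<cdot> Var\<rangle> \<doteq> CB\<langle>?pv \<cdot> Var\<rangle> \<Colon> Ty"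
    by (rule eq_inst[OF CB eq_sym[OF pv]]) (simp_all add: sbs)
  have "A # \<Gamma> \<turnstile> ?sv \<doteq> psnd B\<up>1 CB ?w \<Colon> CB\<langle>?pv \<cdot> Var\<rangle>"
    by (rule eq_inst[OF ps vw]) (simp_all add: sbs)
  from eq_trans[OF this eq_conv[OF psnd_beta[OF B1 CB ha Ha] E]]
  have sv: "A # \<Gamma> \<turnstile> ?sv \<doteq> ?H \<Colon> CB\<langle>?pv \<cdot> Var\<rangle>" .
  have svty: "A # \<Gamma> \<turnstile> ?sv \<Colon> CB\<langle>?pv \<cdot> Var\<rangle>"
    by (rule psnd_ty[OF v B1 CB])
  have CBv: "A # \<Gamma> \<turnstile> CB\<langle>?pv \<cdot> Var\<rangle> \<Colon> Ty"
    apply (rule sub_Ty[OF CB])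
    supply ty = A pvty
    by (rule ty ty[THEN ty_sub] ty[THEN ty_ctx] | simp only: sbs | rule tyr)+
  have 1: "\<Gamma> \<turnstile> Lam A ?pv \<doteq> h \<Colon> arrow A B"
    unfolding arrow_def
    by (rule eq_trans[OF Lam_cong[OF eq_refl[OF A] B1 pv] eq_sym[OF Pi_eta[OF h[unfolded arrow_def]]]])
  \<comment> \<open>The eta rule for \<open>H\<close> lives at the type formed from
    \<open>h\<close>, the projected homotopy at the type formed from the projections.\<close>
  have "\<Gamma> \<turnstile> Pi A CB\<langle>?h \<cdot> Var\<rangle> \<doteq> Pi A CB\<langle>?pv \<cdot> Var\<rangle> \<Colon> Ty"
    by (rule Pi_cong[of Ty, OF _ eq_refl[OF A] E]) simp
  from eq_trans[OF Lam_cong[OF eq_refl[OF A] CBv sv] eq_conv[OF eq_sym[OF Pi_eta[OF H'[folded CBi]]] this]]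
  have "\<Gamma> \<turnstile> Lam A ?sv \<doteq> H \<Colon> Pi A CB\<langle>?pv \<cdot> Var\<rangle>" .
  from eq_conv[OF this[unfolded CBi] eq_sym[OF hom_intro(1)[OF A B X f g pvty svty[unfolded CBi]]]]
  have 2: "\<Gamma> \<turnstile> Lam A ?sv \<doteq> H \<Colon> (hom_fam A X f g)\<langle>Lam A ?pv \<cdot> Var\<rangle>"
    by (simp add: hom_fam_inst sbs)
  show "\<Gamma> \<turnstile> Pair (hom_fam A X f g) (Lam A ?pv) (Lam A ?sv) \<doteq> Pair (hom_fam A X f g) h H \<Colon> Hom A B X f g"
    unfolding Hom_def by (rule Pair_cong[OF eq_refl[OF hom_fam_ty[OF A B X f g]] 1 2])
qed

text \<open>\<open>Hom\<close> is covered by a product over \<open>A\<close> of reversed fibers of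
  \<open>g\<close>, which is a proposition when \<open>g\<close> is an embedding. That the covering
  reaches every pair is \<open>hom_eta\<close>.\<close>

lemma inh_isprop_Hom:
  assumes A: "\<Gamma> \<turnstile> A \<Colon> Ty" and B: "\<Gamma> \<turnstile> B \<Colon> Ty" and X: "\<Gamma> \<turnstile> X \<Colon> Ty" and f: "\<Gamma> \<turnstile> f \<Colon> arrow A X" and g: "\<Gamma> \<turnstile> g \<Colon> arrow B X"
    and emb: "inh \<Gamma> (isemb B X g)"
  shows "inh \<Gamma> (isprop (Hom A B X f g))"
proof -
  define CB where "CB = Id X\<up>2 (App f\<up>2 (Var 1)) (App g\<up>2 (Var 0))"
  define S where "S = Pi A (Sigma B\<up>1 CB)"
  have CB: "B\<up>1 # A # \<Gamma> \<turnstile> CB \<Colon> Ty"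
    unfolding CB_def
    supply ty = A B X f g
    by (rule ty ty[THEN ty_sub] ty[THEN ty_ctx] | simp only: sbs | rule tyr)+
  have 1: "A # \<Gamma> \<turnstile> B\<up>1 \<Colon> Ty" "A # \<Gamma> \<turnstile> X\<up>1 \<Colon> Ty" "A # \<Gamma> \<turnstile> g\<up>1 \<Colon> arrow B\<up>1 X\<up>1" "A # \<Gamma> \<turnstile> App f\<up>1 (Var 0) \<Colon> X\<up>1"
    supply ty = A B X g f
    by (rule ty ty[THEN ty_sub] ty[THEN ty_ctx] | simp only: sbs | rule tyr)+
  have "inh (X # \<Gamma>) (isprop (fiber B\<up>1 X\<up>1 g\<up>1 (Var 0)))"
    by (rule inh_open[OF emb[unfolded isemb_def] X])
  then have "inh (A # \<Gamma>) (isprop (fiber B\<up>1 X\<up>1 g\<up>1 (App f\<up>1 (Var 0))))"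
    apply - apply (rule inh_sub[of "X # \<Gamma>" _ "App f\<up>1 (Var 0) \<cdot> \<up>1"], assumption)
    supply ty = A f
    by (rule ty ty[THEN ty_sub] ty[THEN ty_ctx] | simp only: sbs | rule tyr)+
  from inh_isprop_cofiber[OF 1 this]
  have pC: "inh (A # \<Gamma>) (isprop (Sigma B\<up>1 CB))"
    by (simp add: CB_def sbs)
  note C = former_ty(3)[OF 1(1) CB]
  have pS: "inh \<Gamma> (isprop S)" and S: "\<Gamma> \<turnstile> S \<Colon> Ty"
    unfolding S_def by (rule inh_isprop_Pi[OF A C pC], rule former_ty(1)[OF A C])
  note H = Hom_ty[OF A B X f g] and F = hom_fam_ty[OF A B X f g]
  let ?v = "App (Var 1) (Var 0)" and ?CB = "CB\<langle>Var 0 \<cdot> Var 1 \<cdot> \<up>3\<rangle>"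
  \<comment> \<open>The covering map, sending a section to the pair of its pointwise projections;
    \<open>Var 0\<close> is the section outside the inner lambdas.\<close>
  let ?r = "Pair (hom_fam A\<up>1 X\<up>1 f\<up>1 g\<up>1) (Lam A\<up>1 (pfst B\<up>2 ?v)) (Lam A\<up>1 (psnd B\<up>2 ?CB ?v))"
  have S0: "S # \<Gamma> \<turnstile> Var 0 \<Colon> Pi A\<up>1 (Sigma B\<up>2 ?CB)"
    using var_ty(1)[OF ctx_cons[OF S] refl] by (simp add: S_def sbs)
  have A1: "S # \<Gamma> \<turnstile> A\<up>1 \<Colon> Ty"
    supply ty = S A
    by (rule ty ty[THEN ty_sub] ty[THEN ty_ctx] | simp only: sbs | rule tyr)+
  have v: "A\<up>1 # S # \<Gamma> \<turnstile> ?v \<Colon> Sigma B\<up>2 ?CB"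
    using Pi_open[OF A1 S0] by (simp add: sbs)
  have 2: "A\<up>1 # S # \<Gamma> \<turnstile> B\<up>2 \<Colon> Ty" "B\<up>2 # A\<up>1 # S # \<Gamma> \<turnstile> ?CB \<Colon> Ty"
    supply ty = S A B CB
    by (rule ty ty[THEN ty_sub] ty[THEN ty_ctx] | simp only: sbs | rule tyr)+
  have r: "S # \<Gamma> \<turnstile> ?r \<Colon> (Hom A B X f g)\<up>1"
    unfolding defs_sub
    apply (rule hom_intro(2))
    prefer 7 apply (rule ty_eq[OF psnd_ty[OF v 2]], simp add: CB_def sbs)
    supply ty = A B X f g S pfst_ty[OF v 2]
    by (rule ty ty[THEN ty_sub] ty[THEN ty_ctx] | simp only: sbs | rule tyr)+
  let ?\<Theta> = "hom_fam A X f g # arrow A B # \<Gamma>"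
  have sb2: "sb \<Gamma> (\<up>2) ?\<Theta>"
    supply ty = F
    by (rule ty ty[THEN ty_sub] ty[THEN ty_ctx] | simp only: sbs | rule tyr)+
  define \<phi> where "\<phi> = Lam A\<up>2 (Pair CB\<langle>Var 0 \<cdot> Var 1 \<cdot> \<up>4\<rangle> (App (Var 2) (Var 0)) (App (Var 1) (Var 0)))"
  have h: "?\<Theta> \<turnstile> Var 1 \<Colon> arrow A\<up>2 B\<up>2"
    supply ty = F
    by (rule ty ty[THEN ty_sub] ty[THEN ty_ctx] | simp only: sbs | rule tyr)+
  have "?\<Theta> \<turnstile> Var 0 \<Colon> (hom_fam A X f g)\<up>1"
    supply ty = F
    by (rule ty ty[THEN ty_sub] ty[THEN ty_ctx] | simp only: sbs | rule tyr)+
  then have HH: "?\<Theta> \<turnstile> Var 0 \<Colon> htpy A\<up>2 X\<up>2 f\<up>2 (comp A\<up>2 g\<up>2 (Var 1))"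
    by (simp add: hom_fam_def sbs)
  have w: "?\<Theta> \<turnstile> A\<up>2 \<Colon> Ty" "?\<Theta> \<turnstile> B\<up>2 \<Colon> Ty" "?\<Theta> \<turnstile> X\<up>2 \<Colon> Ty" "?\<Theta> \<turnstile> f\<up>2 \<Colon> arrow A\<up>2 X\<up>2" "?\<Theta> \<turnstile> g\<up>2 \<Colon> arrow B\<up>2 X\<up>2"
    using sub_Ty[OF A sb2] sub_Ty[OF B sb2] sub_Ty[OF X sb2] ty_sub[OF f sb2 refl] ty_sub[OF g sb2 refl] by (simp_all add: sbs)
  have \<phi>_eq: "Lam A\<up>2 (Pair (Id X\<up>2\<up>2 (App f\<up>2\<up>2 (Var 1)) (App g\<up>2\<up>2 (Var 0)))
     (App (Var 1)\<up>1 (Var 0)) (App (Var 0)\<up>1 (Var 0))) = \<phi>"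
    by (simp add: \<phi>_def CB_def sbs)
  note eta = hom_eta[OF w h HH, unfolded \<phi>_eq]
  have \<phi>: "?\<Theta> \<turnstile> \<phi> \<Colon> S\<up>2"
    using eta(1) by (simp add: S_def CB_def sbs)
  let ?Hp = "Hom A\<up>2 B\<up>2 X\<up>2 f\<up>2 g\<up>2" and ?hf = "hom_fam A\<up>2 X\<up>2 f\<up>2 g\<up>2"
  have pr: "?\<Theta> \<turnstile> Pair ?hf (Var 1) (Var 0) \<Colon> ?Hp"
    unfolding Hom_def
    apply (rule Pair[OF hom_fam_ty[OF w] h])
    using HH by (simp add: hom_fam_inst sbs)
  have sbS: "sb (S # \<Gamma>) (\<phi> \<cdot> \<up>2) ?\<Theta>"
    by (rule sb_scons[OF sb2 \<phi>])
  have HpTy: "?\<Theta> \<turnstile> ?Hp \<Colon> Ty"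
    by (rule Hom_ty[OF w])
  have rphi: "?\<Theta> \<turnstile> ?r\<langle>\<phi> \<cdot> \<up>2\<rangle> \<Colon> ?Hp"
    by (rule ty_sub[OF r sbS]) (simp add: sbs)
  have "?\<Theta> \<turnstile> Pair ?hf (Var 1) (Var 0) \<doteq> ?r\<langle>\<phi> \<cdot> \<up>2\<rangle> \<Colon> ?Hp"
    using eq_sym[OF eta(2)] by (simp add: sbs hom_fam_def CB_def)
  from inh_eq[OF this HpTy rphi]
  have e: "inh ?\<Theta> (Id ?Hp (Pair ?hf (Var 1) (Var 0)) ?r\<langle>\<phi> \<cdot> \<up>2\<rangle>)" .
  let ?E = "Id (Hom A B X f g)\<up>3 (Pair (hom_fam A\<up>3 X\<up>3 f\<up>3 g\<up>3) (Var 2) (Var 1)) ?r\<langle>Var 0 \<cdot> \<up>3\<rangle>"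
  have sb1: "sb ?\<Theta> (\<up>1) (S\<up>2 # ?\<Theta>)"
    supply ty = F S
    by (rule ty ty[THEN ty_sub] ty[THEN ty_ctx] | simp only: sbs | rule tyr)+
  have pr3: "S\<up>2 # ?\<Theta> \<turnstile> Pair (hom_fam A\<up>3 X\<up>3 f\<up>3 g\<up>3) (Var 2) (Var 1) \<Colon> (Hom A B X f g)\<up>3"
    using ty_sub[OF pr sb1 refl] by (simp add: sbs hom_fam_def)
  have r3: "S\<up>2 # ?\<Theta> \<turnstile> ?r\<langle>Var 0 \<cdot> \<up>3\<rangle> \<Colon> (Hom A B X f g)\<up>3"
    apply (rule ty_sub[OF r])
    supply ty = F S
    by (rule ty ty[THEN ty_sub] ty[THEN ty_ctx] | simp only: sbs | rule tyr)+
  have H3: "S\<up>2 # ?\<Theta> \<turnstile> (Hom A B X f g)\<up>3 \<Colon> Ty"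
    apply (rule sub_Ty[OF H])
    supply ty = F S
    by (rule ty ty[THEN ty_sub] ty[THEN ty_ctx] | simp only: sbs | rule tyr)+
  have "inh ?\<Theta> ?E\<langle>\<phi> \<cdot> Var\<rangle>"
    using e by (simp add: sbs hom_fam_def)
  from inh_Sigma[OF former_ty(5)[OF H3 pr3 r3] \<phi> this]
  have s: "inh ?\<Theta> (Sigma S\<up>2 ?E)" .
  let ?Y = "Hom A B X f g"
  have sH: "sb \<Gamma> (\<up>2) (S\<up>1 # ?Y # \<Gamma>)" and sr: "sb (S # \<Gamma>) (Var 0 \<cdot> \<up>2) (S\<up>1 # ?Y # \<Gamma>)"
    and SY: "?Y # \<Gamma> \<turnstile> S\<up>1 \<Colon> Ty" and c2: "ctx (S\<up>1 # ?Y # \<Gamma>)"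
    supply ty = H S
    by (rule ty ty[THEN ty_sub] ty[THEN ty_ctx] | simp only: sbs | rule tyr)+
  have "S\<up>1 # ?Y # \<Gamma> \<turnstile> Id ?Y\<up>2 (Var 1) ?r\<langle>Var 0 \<cdot> \<up>2\<rangle> \<Colon> Ty"
    by (rule former_ty(5)[OF sub_Ty[OF H sH] var_ty(2)[OF c2 refl] ty_sub[OF r sr]]) (simp add: sbs)
  note Q = former_ty(3)[OF SY this]
  have "inh (?Y # \<Gamma>) (Sigma S\<up>1 (Id ?Y\<up>2 (Var 1) ?r\<langle>Var 0 \<cdot> \<up>2\<rangle>))"
    using inh_Sigma_open[OF arrow_ty[OF A B] F, folded Hom_def, OF Q] s
    by (simp add: sbs hom_fam_def)
  from inh_isprop_surj[OF H S r pS this] show ?thesis .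
qed

text \<open>Morphisms over \<open>X\<close> into \<open>g\<close> correspond to sections of the
  fibers of \<open>g\<close>. The path in a fiber has the opposite direction, hence
  \<open>inh_sym\<close> on the way in and on the way out.\<close>

lemma inh_Hom_back:
  assumes A: "\<Gamma> \<turnstile> A \<Colon> Ty" and A': "\<Gamma> \<turnstile> A' \<Colon> Ty" and B: "\<Gamma> \<turnstile> B \<Colon> Ty" and X: "\<Gamma> \<turnstile> X \<Colon> Ty"
    and f: "\<Gamma> \<turnstile> f \<Colon> arrow A X" and i: "\<Gamma> \<turnstile> i \<Colon> arrow A' X" and g: "\<Gamma> \<turnstile> g \<Colon> arrow B X"
    and E: "inh \<Gamma> (arrow (Pi A (fiber B\<up>1 X\<up>1 g\<up>1 (App f\<up>1 (Var 0)))) (Pi A' (fiber B\<up>1 X\<up>1 g\<up>1 (App i\<up>1 (Var 0)))))"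
  shows "inh \<Gamma> (arrow (Hom A B X f g) (Hom A' B X i g))"
proof -
  note H = Hom_ty[OF A B X f g] and F = hom_fam_ty[OF A B X f g] and H' = Hom_ty[OF A' B X i g]
  let ?\<Theta> = "hom_fam A X f g # arrow A B # \<Gamma>"
  have sb2: "sb \<Gamma> (\<up>2) ?\<Theta>"
    supply ty = F
    by (rule ty ty[THEN ty_sub] ty[THEN ty_ctx] | simp only: sbs | rule tyr)+
  have h: "?\<Theta> \<turnstile> Var 1 \<Colon> arrow A\<up>2 B\<up>2"
    supply ty = F
    by (rule ty ty[THEN ty_sub] ty[THEN ty_ctx] | simp only: sbs | rule tyr)+
  have "?\<Theta> \<turnstile> Var 0 \<Colon> (hom_fam A X f g)\<up>1"
    supply ty = F
    by (rule ty ty[THEN ty_sub] ty[THEN ty_ctx] | simp only: sbs | rule tyr)+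
  then have HH: "?\<Theta> \<turnstile> Var 0 \<Colon> htpy A\<up>2 X\<up>2 f\<up>2 (comp A\<up>2 g\<up>2 (Var 1))"
    by (simp add: hom_fam_def sbs)
  have w: "?\<Theta> \<turnstile> A\<up>2 \<Colon> Ty" "?\<Theta> \<turnstile> B\<up>2 \<Colon> Ty" "?\<Theta> \<turnstile> X\<up>2 \<Colon> Ty" "?\<Theta> \<turnstile> f\<up>2 \<Colon> arrow A\<up>2 X\<up>2" "?\<Theta> \<turnstile> g\<up>2 \<Colon> arrow B\<up>2 X\<up>2"
    "?\<Theta> \<turnstile> A'\<up>2 \<Colon> Ty" "?\<Theta> \<turnstile> i\<up>2 \<Colon> arrow A'\<up>2 X\<up>2"
    using sub_Ty[OF A sb2] sub_Ty[OF B sb2] sub_Ty[OF X sb2] ty_sub[OF f sb2 refl] ty_sub[OF g sb2 refl] sub_Ty[OF A' sb2] ty_sub[OF i sb2 refl] by (simp_all add: sbs)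
  have a: "A\<up>2 # ?\<Theta> \<turnstile> App (Var 0)\<up>1 (Var 0) \<Colon> Id X\<up>2\<up>1 (App f\<up>2\<up>1 (Var 0)) (App g\<up>2\<up>1 (App (Var 1)\<up>1 (Var 0)))"
    by (rule Pi_open[OF w(1) htpy_comp_app(1)[OF w(1,3,4,5) h HH]])
  have u: "A\<up>2 # ?\<Theta> \<turnstile> App (Var 2) (Var 0) \<Colon> B\<up>3" "A\<up>2 # ?\<Theta> \<turnstile> X\<up>3 \<Colon> Ty" "A\<up>2 # ?\<Theta> \<turnstile> App f\<up>3 (Var 0) \<Colon> X\<up>3"
    "A\<up>2 # ?\<Theta> \<turnstile> App g\<up>3 (App (Var 2) (Var 0)) \<Colon> X\<up>3"
    "B\<up>3 # A\<up>2 # ?\<Theta> \<turnstile> Id X\<up>4 (App g\<up>4 (Var 0)) (App f\<up>4 (Var 1)) \<Colon> Ty"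
    "A\<up>2 # ?\<Theta> \<turnstile> fiber B\<up>3 X\<up>3 g\<up>3 (App f\<up>3 (Var 0)) \<Colon> Ty"
    supply ty = w(1) h B F X f A g
    by (rule ty ty[THEN ty_sub] ty[THEN ty_ctx] | simp only: sbs | rule tyr)+
  have "inh (A\<up>2 # ?\<Theta>) (Id X\<up>3 (App f\<up>3 (Var 0)) (App g\<up>3 (App (Var 2) (Var 0))))"
    using inhI[OF a] by (simp add: sbs)
  from inh_sym[OF this u(2,3,4)]
  have "inh (A\<up>2 # ?\<Theta>) (Id X\<up>4 (App g\<up>4 (Var 0)) (App f\<up>4 (Var 1)))\<langle>App (Var 2) (Var 0) \<cdot> Var\<rangle>"
    by (simp add: sbs)
  from inh_Sigma[OF u(5,1) this]
  have "inh (A\<up>2 # ?\<Theta>) (fiber B\<up>3 X\<up>3 g\<up>3 (App f\<up>3 (Var 0)))"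
    by (simp add: fiber_def sbs)
  from inh_Pi[OF u(6) this]
  have 1: "inh ?\<Theta> (Pi A\<up>2 (fiber B\<up>3 X\<up>3 g\<up>3 (App f\<up>3 (Var 0))))" .
  have "inh ?\<Theta> (arrow (Pi A\<up>2 (fiber B\<up>3 X\<up>3 g\<up>3 (App f\<up>3 (Var 0)))) (Pi A'\<up>2 (fiber B\<up>3 X\<up>3 g\<up>3 (App i\<up>3 (Var 0)))))"
    by (rule inh_sub[OF E sb2]) (simp add: sbs)
  with 1 have "inh ?\<Theta> (Pi A'\<up>2 (fiber B\<up>3 X\<up>3 g\<up>3 (App i\<up>3 (Var 0))))"
    by (metis inhE inhI App_arrow)
  from inh_open[OF this w(6)]
  have 2: "inh (A'\<up>2 # ?\<Theta>) (Sigma B\<up>3 (Id X\<up>4 (App g\<up>4 (Var 0)) (App i\<up>4 (Var 1))))"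
    by (simp add: fiber_def sbs)
  have v: "A'\<up>2 # ?\<Theta> \<turnstile> B\<up>3 \<Colon> Ty" "B\<up>3 # A'\<up>2 # ?\<Theta> \<turnstile> Id X\<up>4 (App g\<up>4 (Var 0)) (App i\<up>4 (Var 1)) \<Colon> Ty"
    "A'\<up>2 # ?\<Theta> \<turnstile> X\<up>3 \<Colon> Ty" "A'\<up>2 # ?\<Theta> \<turnstile> App i\<up>3 (Var 0) \<Colon> X\<up>3"
    supply ty = w(6) F B X A' g i
    by (rule ty ty[THEN ty_sub] ty[THEN ty_ctx] | simp only: sbs | rule tyr)+
  obtain b where b: "A'\<up>2 # ?\<Theta> \<turnstile> b \<Colon> B\<up>3" and "inh (A'\<up>2 # ?\<Theta>) (Id X\<up>3 (App g\<up>3 b) (App i\<up>3 (Var 0)))"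
    using inh_Sigma_obtain[OF 2 v(1,2)] by (auto simp: sbs)
  moreover have "A'\<up>2 # ?\<Theta> \<turnstile> App g\<up>3 b \<Colon> X\<up>3"
    supply ty = b g w(6) F
    by (rule ty ty[THEN ty_sub] ty[THEN ty_ctx] | simp only: sbs | rule tyr)+
  ultimately have "inh (A'\<up>2 # ?\<Theta>) (Id X\<up>3 (App i\<up>3 (Var 0)) (App g\<up>3 b))"
    using inh_sym v(3,4) by blast
  then obtain e where "A'\<up>2 # ?\<Theta> \<turnstile> e \<Colon> Id X\<up>3 (App i\<up>3 (Var 0)) (App g\<up>3 b)"
    by (rule inhE)
  then have "inh ?\<Theta> (Hom A'\<up>2 B\<up>2 X\<up>2 i\<up>2 g\<up>2)"
    using inhI[OF hom_intro(2)[OF w(6,2,3,7,5), of b e]] b by (simp add: sbs)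
  then have 3: "inh ?\<Theta> (Hom A' B X i g)\<up>1\<langle>Pair (hom_fam A X f g)\<langle>Var 0 \<cdot> \<up>3\<rangle> (Var 1) (Var 0) \<cdot> \<up>2\<rangle>"
    by (simp add: sbs)
  have 4: "Hom A B X f g # \<Gamma> \<turnstile> (Hom A' B X i g)\<up>1 \<Colon> Ty"
    by (rule sub_Ty[OF H' sb_shifts(1)[OF ctx_cons[OF H]]])
  have "inh (Hom A B X f g # \<Gamma>) (Hom A' B X i g)\<up>1"
    by (rule inh_Sigma_open[OF arrow_ty[OF A B] F, folded Hom_def, OF 4 3])
  from inh_Pi[OF 4 this] show ?thesis
    by (simp add: arrow_def)
qed

section \<open>Images\<close>

lemma isemb_ty:
  assumes A: "\<Gamma> \<turnstile> A \<Colon> Ty" and B: "\<Gamma> \<turnstile> B \<Colon> Ty" and f: "\<Gamma> \<turnstile> f \<Colon> arrow A B"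
  shows "\<Gamma> \<turnstile> isemb A B f \<Colon> Ty"
  unfolding isemb_def
  supply ty = A B f
  by (rule ty ty[THEN ty_sub] ty[THEN ty_ctx] | simp only: sbs | rule tyr)+

text \<open>What remains of the universal property once the types \<open>Hom\<close> are
  propositions: sections of the fibers of \<open>g\<close> extend from \<open>A\<close> to
  \<open>A'\<close>. Being a single type, it is easily moved along judgemental equality.\<close>

definition ext_type :: "tm \<Rightarrow> tm \<Rightarrow> tm \<Rightarrow> tm \<Rightarrow> tm \<Rightarrow> tm \<Rightarrow> tm \<Rightarrow> tm" where
  "ext_type A A' B X f i g = arrow (Pi A (fiber B\<up>1 X\<up>1 g\<up>1 (App f\<up>1 (Var 0))))
    (Pi A' (fiber B\<up>1 X\<up>1 g\<up>1 (App i\<up>1 (Var 0))))"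

lemma ext_type_sub: "(ext_type A A' B X f i g)\<langle>\<sigma>\<rangle> = ext_type A\<langle>\<sigma>\<rangle> A'\<langle>\<sigma>\<rangle> B\<langle>\<sigma>\<rangle> X\<langle>\<sigma>\<rangle> f\<langle>\<sigma>\<rangle> i\<langle>\<sigma>\<rangle> g\<langle>\<sigma>\<rangle>"
  by (simp add: ext_type_def sbs)

lemma ext_type_ty:
  assumes A: "\<Gamma> \<turnstile> A \<Colon> Ty" and A': "\<Gamma> \<turnstile> A' \<Colon> Ty" and B: "\<Gamma> \<turnstile> B \<Colon> Ty" and X: "\<Gamma> \<turnstile> X \<Colon> Ty"
    and f: "\<Gamma> \<turnstile> f \<Colon> arrow A X" and i: "\<Gamma> \<turnstile> i \<Colon> arrow A' X" and g: "\<Gamma> \<turnstile> g \<Colon> arrow B X"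
  shows "\<Gamma> \<turnstile> ext_type A A' B X f i g \<Colon> Ty"
  unfolding ext_type_def
  supply ty = A A' B X f i g
  by (rule ty ty[THEN ty_sub] ty[THEN ty_ctx] | simp only: sbs | rule tyr)+

lemma is_imageI:
  assumes A: "\<Gamma> \<turnstile> A \<Colon> Ty" and X: "\<Gamma> \<turnstile> X \<Colon> Ty" and f: "\<Gamma> \<turnstile> f \<Colon> arrow A X"
    and im: "\<Gamma> \<turnstile> im \<Colon> U" and i: "\<Gamma> \<turnstile> i \<Colon> arrow im X" and e: "inh \<Gamma> (isemb im X i)"
    and q: "\<Gamma> \<turnstile> q \<Colon> arrow A im" and Q: "\<Gamma> \<turnstile> Q \<Colon> htpy A X f (comp A i q)"
    and ext: "\<And>B g. \<Gamma> \<turnstile> B \<Colon> Ty \<Longrightarrow> \<Gamma> \<turnstile> g \<Colon> arrow B X \<Longrightarrow> inh \<Gamma> (isemb B X g) \<Longrightarrow> inh \<Gamma> (ext_type A im B X f i g)"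
  shows "is_image \<Gamma> A X f im i q Q"
proof -
  have "inh \<Gamma> (isequiv (Hom im B X i g) (Hom A B X f g) (phi A im B X f i g q Q))"
    if B: "\<Gamma> \<turnstile> B \<Colon> Ty" and g: "\<Gamma> \<turnstile> g \<Colon> arrow B X" and m: "inh \<Gamma> (isemb B X g)" for B g
    by (rule inh_isequiv_props[OF inh_isprop_Hom[OF small[OF im] B X i g m] inh_isprop_Hom[OF A B X f g m]
      Hom_ty[OF small[OF im] B X i g] Hom_ty[OF A B X f g] phi_ty[OF A small[OF im] B X f i g q Q]
      inh_Hom_back[OF A small[OF im] B X f i g ext[OF B g m, unfolded ext_type_def]]])
  then show ?thesis
    using im i e q Q by (auto simp: is_image_def inh_def)
qed

text \<open>The applied closed terms equal the intended ones only judgementally. Instead of showing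
  this invariance for the universal property, it is shown for the types from which
  \<open>is_imageI\<close> derives it.\<close>

lemma is_image_eq:
  assumes A: "\<Gamma> \<turnstile> A \<Colon> Ty" and X: "\<Gamma> \<turnstile> X \<Colon> Ty" and f: "\<Gamma> \<turnstile> f \<Colon> arrow A X"
    and im: "\<Gamma> \<turnstile> im \<Colon> U" "\<Gamma> \<turnstile> im \<doteq> im' \<Colon> U"
    and i: "\<Gamma> \<turnstile> i \<Colon> arrow im' X" "\<Gamma> \<turnstile> i \<doteq> i' \<Colon> arrow im' X" and e: "inh \<Gamma> (isemb im' X i')"
    and q: "\<Gamma> \<turnstile> q \<Colon> arrow A im'" "\<Gamma> \<turnstile> q \<doteq> q' \<Colon> arrow A im'" and Q: "\<Gamma> \<turnstile> Q \<Colon> htpy A X f (comp A i' q')"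
    and ext: "\<And>B g. \<Gamma> \<turnstile> B \<Colon> Ty \<Longrightarrow> \<Gamma> \<turnstile> g \<Colon> arrow B X \<Longrightarrow> inh \<Gamma> (isemb B X g) \<Longrightarrow> inh \<Gamma> (ext_type A im' B X f i' g)"
  shows "is_image \<Gamma> A X f im i q Q"
proof -
  \<comment> \<open>Every type to be transferred is formed over generic \<open>im\<close>,
    \<open>i\<close>, \<open>q\<close>, so that \<open>subst_eq\<close> changes all of them at once.
    The equal substitutions grow one variable at a time, because the types of \<open>i\<close> and
    \<open>q\<close> depend on \<open>im\<close>.\<close>
  let ?\<Delta> = "U # \<Gamma>" and ?\<Theta> = "arrow (Var 0) X\<up>1 # U # \<Gamma>"
  let ?\<Phi> = "arrow A\<up>2 (Var 1) # ?\<Theta>"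
  have U: "\<Gamma> \<turnstile> U \<Colon> Ty"
    supply ty = A
    by (rule ty ty[THEN ty_sub] ty[THEN ty_ctx] | simp only: sbs | rule tyr)+
  have v: "?\<Delta> \<turnstile> Var 0 \<Colon> U"
    supply ty = U
    by (rule ty ty[THEN ty_sub] ty[THEN ty_ctx] | simp only: sbs | rule tyr)+
  have iT: "?\<Delta> \<turnstile> arrow (Var 0) X\<up>1 \<Colon> Ty"
    supply ty = X U and tyU = v
    by (rule ty tyU tyU[THEN small] tyU[THEN sub_U] tyU[THEN sub_small] ty[THEN ty_sub] ty[THEN ty_ctx] tyU[THEN ty_ctx]
        | simp only: sbs | rule tyr)+
  have v': "?\<Theta> \<turnstile> Var 1 \<Colon> U"
    supply ty = iT
    by (rule ty ty[THEN ty_sub] ty[THEN ty_ctx] | simp only: sbs | rule tyr)+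
  have qT: "?\<Theta> \<turnstile> arrow A\<up>2 (Var 1) \<Colon> Ty"
    supply ty = A iT and tyU = v'
    by (rule ty tyU tyU[THEN small] tyU[THEN sub_U] tyU[THEN sub_small] ty[THEN ty_sub] ty[THEN ty_ctx] tyU[THEN ty_ctx]
        | simp only: sbs | rule tyr)+
  have s1: "sbe ?\<Delta> (im \<cdot> Var) (im' \<cdot> Var) \<Gamma>"
    by (rule sbe_scons[OF sbe_refl[OF sb_id[OF ty_ctx[OF A]]]]) (simp add: im sbs)
  have "\<Gamma> \<turnstile> arrow im X \<doteq> arrow im' X \<Colon> Ty"
    using sub_eq[OF iT s1 refl] by (simp add: sbs)
  note ii = conv[OF i(1) eq_sym[OF this]] eq_conv[OF i(2) eq_sym[OF this]]
  have s2: "sbe ?\<Theta> (i \<cdot> im \<cdot> Var) (i' \<cdot> im' \<cdot> Var) \<Gamma>"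
    by (rule sbe_scons[OF s1]) (simp add: ii sbs)
  have "\<Gamma> \<turnstile> arrow A im \<doteq> arrow A im' \<Colon> Ty"
    using sub_eq[OF qT s2 refl] by (simp add: sbs)
  note qq = conv[OF q(1) eq_sym[OF this]] eq_conv[OF q(2) eq_sym[OF this]]
  have s3: "sbe ?\<Phi> (q \<cdot> i \<cdot> im \<cdot> Var) (q' \<cdot> i' \<cdot> im' \<cdot> Var) \<Gamma>"
    by (rule sbe_scons[OF s2]) (simp add: qq sbs)
  have iv: "?\<Theta> \<turnstile> Var 0 \<Colon> arrow (Var 1) X\<up>2" and X2: "?\<Theta> \<turnstile> X\<up>2 \<Colon> Ty" and A2: "?\<Theta> \<turnstile> A\<up>2 \<Colon> Ty"
    and f2: "?\<Theta> \<turnstile> f\<up>2 \<Colon> arrow A\<up>2 X\<up>2" and sb2: "sb \<Gamma> (\<up>2) ?\<Theta>"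
    supply ty = iT X A f
    by (rule ty ty[THEN ty_sub] ty[THEN ty_ctx] | simp only: sbs | rule tyr)+
  have "\<Gamma> \<turnstile> isemb im X i \<doteq> isemb im' X i' \<Colon> Ty"
    using sub_eq[OF isemb_ty[OF small[OF v'] X2 iv] s2 refl] by (simp add: sbs)
  note ee = inh_conv[OF e eq_sym[OF this]]
  have "?\<Phi> \<turnstile> htpy A\<up>3 X\<up>3 f\<up>3 (comp A\<up>3 (Var 1) (Var 0)) \<Colon> Ty"
    supply ty = A X f qT
    by (rule ty ty[THEN ty_sub] ty[THEN ty_ctx] | simp only: sbs | rule tyr)+
  from sub_eq[OF this s3 refl]
  have "\<Gamma> \<turnstile> htpy A X f (comp A i q) \<doteq> htpy A X f (comp A i' q') \<Colon> Ty"
    by (simp add: sbs)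
  note QQ = conv[OF Q eq_sym[OF this]]
  have xx: "inh \<Gamma> (ext_type A im B X f i g)"
    if B: "\<Gamma> \<turnstile> B \<Colon> Ty" and g: "\<Gamma> \<turnstile> g \<Colon> arrow B X" and m: "inh \<Gamma> (isemb B X g)" for B g
  proof -
    have "?\<Theta> \<turnstile> g\<up>2 \<Colon> arrow B\<up>2 X\<up>2"
      by (rule ty_sub[OF g sb2]) (simp add: sbs)
    from sub_eq[OF ext_type_ty[OF A2 small[OF v'] sub_Ty[OF B sb2] X2 f2 iv this] s2 refl]
    have "\<Gamma> \<turnstile> ext_type A im B X f i g \<doteq> ext_type A im' B X f i' g \<Colon> Ty"
      by (simp add: sbs ext_type_sub)
    from inh_conv[OF ext[OF B g m] eq_sym[OF this]] show ?thesis .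
  qed
  show ?thesis
    by (rule is_imageI[OF A X f im(1) ii(1) ee qq(1) QQ xx])
qed

section \<open>The image of a map between small types\<close>

definition imfib :: "tm \<Rightarrow> tm \<Rightarrow> tm \<Rightarrow> tm" where
  "imfib A X f = fiber A\<up>1 X\<up>1 f\<up>1 (Var 0)"

definition im_ty :: "tm \<Rightarrow> tm \<Rightarrow> tm \<Rightarrow> tm" where
  "im_ty A X f = Sigma X (trunc (imfib A X f))"

definition im_i :: "tm \<Rightarrow> tm \<Rightarrow> tm \<Rightarrow> tm" where
  "im_i A X f = Lam (im_ty A X f) (pfst X\<up>1 (Var 0))"

definition im_q :: "tm \<Rightarrow> tm \<Rightarrow> tm \<Rightarrow> tm" where
  "im_q A X f = (let a = Var 0; fa = App f\<up>1 a in
     Lam A (Pair (trunc (imfib A X f))\<langle>Var 0 \<cdot> \<up>2\<rangle> fa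
       (trin (imfib A X f)\<langle>fa \<cdot> \<up>1\<rangle> (fpair X\<up>1 f\<up>1 fa a (Refl fa)))))"

text \<open>Reflexivity suffices, since the first component of the pair formed by
  \<open>im_q\<close> is the value of \<open>f\<close> itself.\<close>

definition im_Q :: "tm \<Rightarrow> tm \<Rightarrow> tm \<Rightarrow> tm" where
  "im_Q A X f = Lam A (Refl (App f\<up>1 (Var 0)))"

lemma im_sub:
  "(im_ty A X f)\<langle>\<sigma>\<rangle> = im_ty A\<langle>\<sigma>\<rangle> X\<langle>\<sigma>\<rangle> f\<langle>\<sigma>\<rangle>"
  "(im_i A X f)\<langle>\<sigma>\<rangle> = im_i A\<langle>\<sigma>\<rangle> X\<langle>\<sigma>\<rangle> f\<langle>\<sigma>\<rangle>"
  "(im_q A X f)\<langle>\<sigma>\<rangle> = im_q A\<langle>\<sigma>\<rangle> X\<langle>\<sigma>\<rangle> f\<langle>\<sigma>\<rangle>"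
  "(im_Q A X f)\<langle>\<sigma>\<rangle> = im_Q A\<langle>\<sigma>\<rangle> X\<langle>\<sigma>\<rangle> f\<langle>\<sigma>\<rangle>"
  by (simp_all add: im_ty_def im_i_def im_q_def im_Q_def imfib_def trunc_sub sbs Let_def)

locale small_map =
  fixes \<Gamma> A X f
  assumes A: "\<Gamma> \<turnstile> A \<Colon> U" and X: "\<Gamma> \<turnstile> X \<Colon> U" and f: "\<Gamma> \<turnstile> f \<Colon> arrow A X"
begin

abbreviation "F \<equiv> imfib A X f"
abbreviation "P \<equiv> trunc F"
abbreviation "im \<equiv> im_ty A X f"
abbreviation "i \<equiv> im_i A X f"
abbreviation "q \<equiv> im_q A X f"

lemma F: "X # \<Gamma> \<turnstile> F \<Colon> U"
  unfolding imfib_def fiber_def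
  supply ty = f and tyU = A X
  by (rule ty tyU tyU[THEN small] tyU[THEN sub_U] tyU[THEN sub_small] ty[THEN ty_sub] ty[THEN ty_ctx] tyU[THEN ty_ctx]
      | simp only: sbs | rule tyr)+

lemma P: "X # \<Gamma> \<turnstile> P \<Colon> U"
  by (rule trunc_U[OF F])

lemma im: "\<Gamma> \<turnstile> im \<Colon> U"
  unfolding im_ty_def
  supply tyU = P X
  by (rule tyU tyU[THEN small] tyU[THEN sub_U] tyU[THEN sub_small] tyU[THEN ty_ctx] | simp only: sbs | rule tyr)+

lemma i: "\<Gamma> \<turnstile> i \<Colon> arrow im X"
proof -
  have v: "im # \<Gamma> \<turnstile> Var 0 \<Colon> Sigma X\<up>1 P\<langle>Var 0 \<cdot> \<up>2\<rangle>"
    unfolding im_ty_def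
    supply tyU = P X
    by (rule tyU tyU[THEN small] tyU[THEN sub_U] tyU[THEN sub_small] tyU[THEN ty_ctx] | simp only: sbs | rule tyr)+
  have "im # \<Gamma> \<turnstile> pfst X\<up>1 (Var 0) \<Colon> X\<up>1"
    apply (rule pfst_ty[OF v])
    supply tyU = P X im
    by (rule tyU tyU[THEN small] tyU[THEN sub_U] tyU[THEN sub_small] tyU[THEN ty_ctx] | simp only: sbs | rule tyr)+
  then show ?thesis
    unfolding im_i_def by (rule Lam_arrow[OF small[OF X]])
qed

lemma i_beta:
  assumes x: "\<Gamma> \<turnstile> x \<Colon> X" and y: "\<Gamma> \<turnstile> y \<Colon> P\<langle>x \<cdot> Var\<rangle>"
  shows "\<Gamma> \<turnstile> App i (Pair P x y) \<doteq> x \<Colon> X"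
proof -
  have v: "im # \<Gamma> \<turnstile> Var 0 \<Colon> Sigma X\<up>1 P\<langle>Var 0 \<cdot> \<up>2\<rangle>" and X1: "im # \<Gamma> \<turnstile> X\<up>1 \<Colon> Ty"
    subgoal unfolding im_ty_def
      supply tyU = P X
      by (rule tyU tyU[THEN small] tyU[THEN sub_U] tyU[THEN sub_small] tyU[THEN ty_ctx] | simp only: sbs | rule tyr)+
    supply tyU = X im
    by (rule tyU tyU[THEN small] tyU[THEN sub_U] tyU[THEN sub_small] tyU[THEN ty_ctx] | simp only: sbs | rule tyr)+
  have "im # \<Gamma> \<turnstile> pfst X\<up>1 (Var 0) \<Colon> X\<up>1"
    apply (rule pfst_ty[OF v])
    supply tyU = P X im
    by (rule tyU tyU[THEN small] tyU[THEN sub_U] tyU[THEN sub_small] tyU[THEN ty_ctx] | simp only: sbs | rule tyr)+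
  from Pi_beta[OF X1 this Pair[OF small[OF P] x y, folded im_ty_def]]
  have "\<Gamma> \<turnstile> App i (Pair P x y) \<doteq> pfst X (Pair P x y) \<Colon> X"
    by (simp add: im_i_def sbs)
  from eq_trans[OF this pfst_beta[OF small[OF X] small[OF P] x y]] show ?thesis .
qed

end

text \<open>Needed in \<open>ext\<close>, where the construction is used over a context extended by
  an assumed section.\<close>

lemma (in small_map) weaken: "sb \<Gamma> \<sigma> \<Delta> \<Longrightarrow> small_map \<Delta> A\<langle>\<sigma>\<rangle> X\<langle>\<sigma>\<rangle> f\<langle>\<sigma>\<rangle>"
  by unfold_locales (auto intro: sub_U A X ty_sub[OF f] simp: sbs)

context small_map
begin

lemma P_sub: "P\<langle>Var 0 \<cdot> (\<sigma> ;; \<up>1)\<rangle> = trunc (imfib A\<langle>\<sigma>\<rangle> X\<langle>\<sigma>\<rangle> f\<langle>\<sigma>\<rangle>)"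
  by (simp add: trunc_sub imfib_def sbs)

lemma i_beta_sub:
  assumes \<sigma>: "sb \<Gamma> \<sigma> \<Delta>" and x: "\<Delta> \<turnstile> x \<Colon> X\<langle>\<sigma>\<rangle>" and y: "\<Delta> \<turnstile> y \<Colon> P\<langle>x \<cdot> \<sigma>\<rangle>"
  shows "\<Delta> \<turnstile> App i\<langle>\<sigma>\<rangle> (Pair P\<langle>Var 0 \<cdot> (\<sigma> ;; \<up>1)\<rangle> x y) \<doteq> x \<Colon> X\<langle>\<sigma>\<rangle>"
  unfolding P_sub im_sub
proof (rule small_map.i_beta[OF weaken[OF \<sigma>] x])
  show "\<Delta> \<turnstile> y \<Colon> (trunc (imfib A\<langle>\<sigma>\<rangle> X\<langle>\<sigma>\<rangle> f\<langle>\<sigma>\<rangle>))\<langle>x \<cdot> Var\<rangle>"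
    using y by (simp add: trunc_sub imfib_def sbs)
qed

lemma i_beta_open: "P # X # \<Gamma> \<turnstile> App i\<up>2 (Pair P\<langle>Var 0 \<cdot> \<up>3\<rangle> (Var 1) (Var 0)) \<doteq> Var 1 \<Colon> X\<up>2"
proof -
  have 1: "sb \<Gamma> (\<up>2) (P # X # \<Gamma>)" "P # X # \<Gamma> \<turnstile> Var 1 \<Colon> X\<up>2" "P # X # \<Gamma> \<turnstile> Var 0 \<Colon> P\<langle>Var 1 \<cdot> \<up>2\<rangle>"
    supply tyU = P
    by (rule tyU tyU[THEN small] tyU[THEN sub_U] tyU[THEN sub_small] tyU[THEN ty_ctx] | simp only: sbs | rule tyr)+
  from i_beta_sub[OF 1] show ?thesis
    by (simp add: sbs)
qed

lemma i_emb: "inh \<Gamma> (isemb im X i)"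
  unfolding im_ty_def
  by (rule inh_isemb_fst[OF small[OF X] small[OF P] inh_isprop_trunc[OF F] i[unfolded im_ty_def] i_beta_open])

lemma q_point:
  shows "A # \<Gamma> \<turnstile> App f\<up>1 (Var 0) \<Colon> X\<up>1"
    and "A # \<Gamma> \<turnstile> trin F\<langle>App f\<up>1 (Var 0) \<cdot> \<up>1\<rangle> (fpair X\<up>1 f\<up>1 (App f\<up>1 (Var 0)) (Var 0) (Refl (App f\<up>1 (Var 0))))
      \<Colon> P\<langle>App f\<up>1 (Var 0) \<cdot> \<up>1\<rangle>"
proof -
  show fa: "A # \<Gamma> \<turnstile> App f\<up>1 (Var 0) \<Colon> X\<up>1"
    supply ty = f and tyU = A
    by (rule ty tyU tyU[THEN small] tyU[THEN sub_U] tyU[THEN sub_small] ty[THEN ty_sub] ty[THEN ty_ctx] tyU[THEN ty_ctx]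
        | simp only: sbs | rule tyr)+
  have 1: "A # \<Gamma> \<turnstile> F\<langle>App f\<up>1 (Var 0) \<cdot> \<up>1\<rangle> \<Colon> U"
    supply ty = fa and tyU = F A
    by (rule ty tyU tyU[THEN small] tyU[THEN sub_U] tyU[THEN sub_small] ty[THEN ty_sub] ty[THEN ty_ctx] tyU[THEN ty_ctx]
        | simp only: sbs | rule tyr)+
  have "A # \<Gamma> \<turnstile> fpair X\<up>1 f\<up>1 (App f\<up>1 (Var 0)) (Var 0) (Refl (App f\<up>1 (Var 0))) \<Colon> fiber A\<up>1 X\<up>1 f\<up>1 (App f\<up>1 (Var 0))"
    supply ty = f fa and tyU = A X
    by (rule ty tyU tyU[THEN small] tyU[THEN sub_U] tyU[THEN sub_small] ty[THEN ty_sub] ty[THEN ty_ctx] tyU[THEN ty_ctx]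
        | simp only: sbs | rule tyr)+
  then have "A # \<Gamma> \<turnstile> fpair X\<up>1 f\<up>1 (App f\<up>1 (Var 0)) (Var 0) (Refl (App f\<up>1 (Var 0))) \<Colon> F\<langle>App f\<up>1 (Var 0) \<cdot> \<up>1\<rangle>"
    by (simp add: imfib_def sbs)
  from trin_ty[OF 1 this]
  show "A # \<Gamma> \<turnstile> trin F\<langle>App f\<up>1 (Var 0) \<cdot> \<up>1\<rangle> (fpair X\<up>1 f\<up>1 (App f\<up>1 (Var 0)) (Var 0) (Refl (App f\<up>1 (Var 0))))
      \<Colon> P\<langle>App f\<up>1 (Var 0) \<cdot> \<up>1\<rangle>"
    by (simp add: trunc_sub)
qed

lemma q_pair:
  "A # \<Gamma> \<turnstile> Pair P\<langle>Var 0 \<cdot> \<up>2\<rangle> (App f\<up>1 (Var 0)) (trin F\<langle>App f\<up>1 (Var 0) \<cdot> \<up>1\<rangle> (fpair X\<up>1 f\<up>1 (App f\<up>1 (Var 0)) (Var 0) (Refl (App f\<up>1 (Var 0)))))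
     \<Colon> im\<up>1"
  unfolding im_ty_def
  supply ty = q_point(1) q_point(2) and tyU = P A X
  by (rule ty tyU tyU[THEN small] tyU[THEN sub_U] tyU[THEN sub_small] ty[THEN ty_sub] ty[THEN ty_ctx] tyU[THEN ty_ctx] Pair
      | simp only: sbs | rule tyr)+

lemma q: "\<Gamma> \<turnstile> q \<Colon> arrow A im"
  unfolding im_q_def Let_def by (rule Lam_arrow[OF small[OF im] q_pair])

lemma Q: "\<Gamma> \<turnstile> im_Q A X f \<Colon> htpy A X f (comp A i q)"
proof -
  note A' = small[OF A] and X' = small[OF X]
  have 1: "A # \<Gamma> \<turnstile> X\<up>1 \<Colon> Ty" "A # \<Gamma> \<turnstile> im\<up>1 \<Colon> Ty" "sb \<Gamma> (\<up>1) (A # \<Gamma>)" "A # \<Gamma> \<turnstile> i\<up>1 \<Colon> arrow im\<up>1 X\<up>1"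
    supply ty = i and tyU = A X im
    by (rule ty tyU tyU[THEN small] tyU[THEN sub_U] tyU[THEN sub_small] ty[THEN ty_sub] ty[THEN ty_ctx] tyU[THEN ty_ctx]
        | simp only: sbs | rule tyr)+
  let ?z = "Pair P\<langle>Var 0 \<cdot> \<up>2\<rangle> (App f\<up>1 (Var 0)) (trin F\<langle>App f\<up>1 (Var 0) \<cdot> \<up>1\<rangle> (fpair X\<up>1 f\<up>1 (App f\<up>1 (Var 0)) (Var 0) (Refl (App f\<up>1 (Var 0)))))"
  have "A # \<Gamma> \<turnstile> App q\<up>1 (Var 0) \<doteq> ?z \<Colon> im\<up>1"
    unfolding im_q_def Let_def by (rule Lam_eq_beta[OF A' 1(2) q_pair])
  from htpy_comp_eq[OF A' X' f i q this]
  have E: "\<Gamma> \<turnstile> htpy A X f (comp A i q) \<doteq> Pi A (Id X\<up>1 (App f\<up>1 (Var 0)) (App i\<up>1 ?z)) \<Colon> Ty" .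
  have b: "A # \<Gamma> \<turnstile> App i\<up>1 ?z \<doteq> App f\<up>1 (Var 0) \<Colon> X\<up>1"
    using i_beta_sub[OF 1(3) q_point] by (simp add: sbs)
  have "A # \<Gamma> \<turnstile> Id X\<up>1 (App f\<up>1 (Var 0)) (App f\<up>1 (Var 0)) \<doteq> Id X\<up>1 (App f\<up>1 (Var 0)) (App i\<up>1 ?z) \<Colon> Ty"
    by (rule Id_cong[of Ty, OF _ eq_refl[OF 1(1)] eq_refl[OF q_point(1)] eq_sym[OF b]]) simp
  note r = conv[OF Refl[OF 1(1) q_point(1)] this]
  have iz: "A # \<Gamma> \<turnstile> App i\<up>1 ?z \<Colon> X\<up>1"
    by (rule App_arrow[OF 1(4) q_pair])
  show ?thesis
    unfolding im_Q_def
    by (rule conv[OF Lam[OF former_ty(5)[OF 1(1) q_point(1) iz] r] eq_sym[OF E]])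
qed

text \<open>A point of the image is a pair of \<open>x\<close> and an element of the truncated
  fiber. The goal, the fiber of \<open>g\<close> over \<open>x\<close>, is a proposition, so the
  element may come from some \<open>a\<close> with \<open>f a = x\<close>; the point over
  \<open>f a\<close> is then transported.\<close>

lemma ext_open:
  assumes B: "\<Gamma> \<turnstile> B \<Colon> Ty" and g: "\<Gamma> \<turnstile> g \<Colon> arrow B X" and e: "inh \<Gamma> (isemb B X g)"
    and h: "inh (A # \<Gamma>) (fiber B\<up>1 X\<up>1 g\<up>1 (App f\<up>1 (Var 0)))"
  shows "inh \<Gamma> (Pi im (fiber B\<up>1 X\<up>1 g\<up>1 (App i\<up>1 (Var 0))))"
proof -
  let ?G = "fiber B\<up>1 X\<up>1 g\<up>1 (App i\<up>1 (Var 0))"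
  have G: "im # \<Gamma> \<turnstile> ?G \<Colon> Ty"
    supply ty = B g i and tyU = X im
    by (rule ty tyU tyU[THEN small] tyU[THEN sub_U] tyU[THEN sub_small] ty[THEN ty_sub] ty[THEN ty_ctx] tyU[THEN ty_ctx]
        | simp only: sbs | rule tyr)+
  let ?H = "fiber B\<up>2 X\<up>2 g\<up>2 (Var 1)"
  have H: "P # X # \<Gamma> \<turnstile> ?H \<Colon> Ty"
    supply ty = B g and tyU = X P
    by (rule ty tyU tyU[THEN small] tyU[THEN sub_U] tyU[THEN sub_small] ty[THEN ty_sub] ty[THEN ty_ctx] tyU[THEN ty_ctx]
        | simp only: sbs | rule tyr)+
  have "inh (X # \<Gamma>) (isprop (fiber B\<up>1 X\<up>1 g\<up>1 (Var 0)))"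
    by (rule inh_open[OF e[unfolded isemb_def] small[OF X]])
  then have pH: "inh (P # X # \<Gamma>) (isprop ?H)"
    apply - apply (rule inh_sub[of "X # \<Gamma>" _ "\<up>1"], assumption)
    supply tyU = P
    by (rule tyU tyU[THEN small] tyU[THEN sub_U] tyU[THEN sub_small] tyU[THEN ty_ctx] | simp only: sbs | rule tyr)+
  let ?E = "Id X\<up>2 (App f\<up>2 (Var 0)) (Var 1)"
  have E: "X # \<Gamma> \<turnstile> A\<up>1 \<Colon> Ty" "A\<up>1 # X # \<Gamma> \<turnstile> ?E \<Colon> Ty"
    supply ty = f and tyU = A X
    by (rule ty tyU tyU[THEN small] tyU[THEN sub_U] tyU[THEN sub_small] ty[THEN ty_sub] ty[THEN ty_ctx] tyU[THEN ty_ctx]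
        | simp only: sbs | rule tyr)+
  have F_eq: "F = Sigma A\<up>1 ?E"
    by (simp add: imfib_def fiber_def sbs)
  have H1: "F # X # \<Gamma> \<turnstile> ?H \<Colon> Ty"
    supply ty = B g and tyU = X F
    by (rule ty tyU tyU[THEN small] tyU[THEN sub_U] tyU[THEN sub_small] ty[THEN ty_sub] ty[THEN ty_ctx] tyU[THEN ty_ctx]
        | simp only: sbs | rule tyr)+
  let ?\<Delta> = "?E # A\<up>1 # X # \<Gamma>"
  \<comment> \<open>The given point over \<open>f a\<close>, displayed as an instance of the family
    of fibers of \<open>g\<close> over all of \<open>X\<close>, ready for transport.\<close>
  have "inh ?\<Delta> (fiber B\<up>4 X\<up>4 g\<up>4 (Var 0))\<langle>App f\<up>3 (Var 1) \<cdot> Var\<rangle>"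
    apply (rule inh_sub[OF h, of "Var 1 \<cdot> \<up>3"])
    supply ty = f E(2) and tyU = A X
    by (rule ty tyU tyU[THEN small] tyU[THEN sub_U] tyU[THEN sub_small] ty[THEN ty_sub] ty[THEN ty_ctx] tyU[THEN ty_ctx]
        | simp only: sbs | rule tyr)+
  note base = this
  have "?\<Delta> \<turnstile> Var 0 \<Colon> Id X\<up>3 (App f\<up>3 (Var 1)) (Var 2)"
    supply ty = E(2)
    by (rule ty ty[THEN ty_sub] ty[THEN ty_ctx] | simp only: sbs | rule tyr)+
  from inh_transport[OF _ inhI[OF this] _ _ _ base refl]
  have "inh ?\<Delta> (fiber B\<up>4 X\<up>4 g\<up>4 (Var 0))\<langle>Var 2 \<cdot> Var\<rangle>"
    apply (rule meta_mp) prefer 2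
    supply ty = f g B E(2) and tyU = A X
    by (rule ty tyU tyU[THEN small] tyU[THEN sub_U] tyU[THEN sub_small] ty[THEN ty_sub] ty[THEN ty_ctx] tyU[THEN ty_ctx]
        | simp only: sbs | rule tyr)+
  then have "inh ?\<Delta> ?H\<langle>Pair ?E\<langle>Var 0 \<cdot> \<up>3\<rangle> (Var 1) (Var 0) \<cdot> \<up>2\<rangle>"
    by (simp add: sbs)
  from inh_Sigma_open[OF E H1[unfolded F_eq] this]
  have "inh (F # X # \<Gamma>) ?H\<langle>trin F\<up>1 (Var 0) \<cdot> \<up>1\<rangle>"
    by (simp add: F_eq sbs)
  from inh_trunc_elim[OF F H pH this]
  have 1: "inh (P # X # \<Gamma>) ?H" .
  let ?z = "Pair P\<langle>Var 0 \<cdot> \<up>3\<rangle> (Var 1) (Var 0)"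
  have 2: "X\<up>2 # P # X # \<Gamma> \<turnstile> fiber B\<up>3 X\<up>3 g\<up>3 (Var 0) \<Colon> Ty"
    supply ty = B g and tyU = X P
    by (rule ty tyU tyU[THEN small] tyU[THEN sub_U] tyU[THEN sub_small] ty[THEN ty_sub] ty[THEN ty_ctx] tyU[THEN ty_ctx]
        | simp only: sbs | rule tyr)+
  \<comment> \<open>The goal is stated over \<open>i z\<close>; for \<open>z\<close> a pair this
    computes to its first component.\<close>
  have "P # X # \<Gamma> \<turnstile> ?H \<doteq> ?G\<langle>?z \<cdot> \<up>2\<rangle> \<Colon> Ty"
    by (rule eq_inst[OF 2 eq_sym[OF i_beta_open]]) (simp_all add: sbs)
  from inh_conv[OF 1 this]
  have "inh (P # X # \<Gamma>) ?G\<langle>?z \<cdot> \<up>2\<rangle>" .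
  from inh_Sigma_open[OF small[OF X] small[OF P], folded im_ty_def, OF G this]
  have "inh (im # \<Gamma>) ?G" .
  from inh_Pi[OF G this] show ?thesis .
qed

text \<open>\<open>ext_open\<close> takes its hypothesis as a derivation, not as a variable.
  Applying it in the context extended by that variable internalises it as a function.\<close>

lemma ext:
  assumes B: "\<Gamma> \<turnstile> B \<Colon> Ty" and g: "\<Gamma> \<turnstile> g \<Colon> arrow B X" and e: "inh \<Gamma> (isemb B X g)"
  shows "inh \<Gamma> (ext_type A im B X f i g)"
proof -
  let ?L = "Pi A (fiber B\<up>1 X\<up>1 g\<up>1 (App f\<up>1 (Var 0)))"
    and ?R = "Pi im (fiber B\<up>1 X\<up>1 g\<up>1 (App i\<up>1 (Var 0)))"
  have L: "\<Gamma> \<turnstile> ?L \<Colon> Ty" and R: "\<Gamma> \<turnstile> ?R \<Colon> Ty"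
    supply ty = B f g i and tyU = A X im
    by (rule ty tyU tyU[THEN small] tyU[THEN sub_U] tyU[THEN sub_small] ty[THEN ty_sub] ty[THEN ty_ctx] tyU[THEN ty_ctx]
        | simp only: sbs | rule tyr)+
  note s = sb_shifts(1)[OF ctx_cons[OF L]]
  have 1: "?L # \<Gamma> \<turnstile> g\<up>1 \<Colon> arrow B\<up>1 X\<up>1" "inh (?L # \<Gamma>) (isemb B\<up>1 X\<up>1 g\<up>1)" "?L # \<Gamma> \<turnstile> A\<up>1 \<Colon> Ty"
    using ty_sub[OF g s refl] inh_sub[OF e s refl] sub_Ty[OF small[OF A] s] by (simp_all add: sbs)
  have "?L # \<Gamma> \<turnstile> Var 0 \<Colon> ?L\<up>1"
    by (rule var_ty(1)[OF ctx_cons[OF L] refl])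
  then have "inh (?L # \<Gamma>) (Pi A\<up>1 (fiber B\<up>2 X\<up>2 g\<up>2 (App f\<up>2 (Var 0))))"
    using inhI by (simp add: sbs)
  from inh_open[OF this 1(3)]
  have "inh (A\<up>1 # ?L # \<Gamma>) (fiber B\<up>1\<up>1 X\<up>1\<up>1 g\<up>1\<up>1 (App f\<up>1\<up>1 (Var 0)))"
    by (simp add: sbs)
  from small_map.ext_open[OF weaken[OF s] sub_Ty[OF B s] 1(1,2) this]
  have "inh (?L # \<Gamma>) ?R\<up>1"
    by (simp add: sbs im_sub)
  from inh_Pi[OF sub_Ty[OF R s] this]
  show ?thesis
    by (simp add: ext_type_def arrow_def)
qed

end

section \<open>Closed terms for images\<close>

definition lam3 :: "tm \<Rightarrow> tm" where
  "lam3 t = Lam U (Lam U (Lam (arrow (Var 1) (Var 0)) t))"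

abbreviation map_ctx :: "tm list" where
  "map_ctx \<equiv> [arrow (Var 1) (Var 0), U, U]"

text \<open>Terms of a closed context keep their indices when further types are appended at its far
  end.\<close>

lemma sb_append: "ctx (\<Delta> @ \<Gamma>) \<Longrightarrow> sb \<Delta> Var (\<Delta> @ \<Gamma>)"
proof -
  assume c: "ctx (\<Delta> @ \<Gamma>)"
  have "\<Delta> @ \<Gamma> \<turnstile> Var i \<Colon> (\<Delta> ! i)\<langle>\<up>(i + 1)\<rangle>" if "i < length \<Delta>" for i
    using var[OF c, of i] that by (simp add: nth_append)
  then show ?thesis
    using c by (simp add: sb_def sub_Var)
qed

text \<open>Three beta steps, one argument at a time. In \<open>map_ctx\<close> the source has index
  2, the target index 1 and the map index 0, which fixes the order of the resulting
  substitution.\<close>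

lemma lam3:
  assumes t: "map_ctx \<turnstile> t \<Colon> T" and T: "map_ctx \<turnstile> T \<Colon> Ty"
    and A: "\<Gamma> \<turnstile> A \<Colon> U" and X: "\<Gamma> \<turnstile> X \<Colon> U" and f: "\<Gamma> \<turnstile> f \<Colon> arrow A X"
  shows "\<Gamma> \<turnstile> app3 (lam3 t) A X f \<Colon> T\<langle>f \<cdot> X \<cdot> A \<cdot> Var\<rangle>"
    and "\<Gamma> \<turnstile> app3 (lam3 t) A X f \<doteq> t\<langle>f \<cdot> X \<cdot> A \<cdot> Var\<rangle> \<Colon> T\<langle>f \<cdot> X \<cdot> A \<cdot> Var\<rangle>"
proof -
  let ?a = "arrow (Var 1) (Var 0)"
  have U0: "\<Gamma> \<turnstile> U \<Colon> Ty"
    supply tyU = A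
    by (rule tyU tyU[THEN small] tyU[THEN sub_U] tyU[THEN sub_small] tyU[THEN ty_ctx] | simp only: sbs | rule tyr)+
  have U1: "U # \<Gamma> \<turnstile> U \<Colon> Ty"
    supply ty = U0
    by (rule ty ty[THEN ty_sub] ty[THEN ty_ctx] | simp only: sbs | rule tyr)+
  have v: "U # U # \<Gamma> \<turnstile> Var 1 \<Colon> U" "U # U # \<Gamma> \<turnstile> Var 0 \<Colon> U"
    supply ty = U1
    by (rule ty ty[THEN ty_sub] ty[THEN ty_ctx] | simp only: sbs | rule tyr)+
  have a: "U # U # \<Gamma> \<turnstile> ?a \<Colon> Ty"
    by (rule arrow_ty[OF v[THEN small]])
  have sb: "sb map_ctx Var (?a # U # U # \<Gamma>)"
    using sb_append[of map_ctx \<Gamma>] ctx_cons[OF a] by simp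
  have t': "?a # U # U # \<Gamma> \<turnstile> t \<Colon> T" and T': "?a # U # U # \<Gamma> \<turnstile> T \<Colon> Ty"
    using ty_sub[OF t sb refl] sub_Ty[OF T sb] by (simp_all add: sbs)
  note l2 = Lam[OF T' t'] and p2 = former_ty(1)[OF a T']
  note l1 = Lam[OF p2 l2] and p1 = former_ty(1)[OF U1 p2]
  note l0 = Lam[OF p1 l1]
  have aX: "\<Gamma> \<turnstile> arrow A X \<Colon> Ty"
    by (rule arrow_ty[OF small[OF A] small[OF X]])
  have t0: "\<Gamma> \<turnstile> App (lam3 t) A \<Colon> Pi U (Pi (arrow A\<up>1 (Var 0)) T\<langle>Var 0 \<cdot> Var 1 \<cdot> A\<up>2 \<cdot> \<up>2\<rangle>)"
    using App[OF l0 A] by (simp add: lam3_def sbs)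
  have t1: "\<Gamma> \<turnstile> App (App (lam3 t) A) X \<Colon> Pi (arrow A X) T\<langle>Var 0 \<cdot> X\<up>1 \<cdot> A\<up>1 \<cdot> \<up>1\<rangle>"
    using App[OF t0 X] by (simp add: sbs)
  show "\<Gamma> \<turnstile> app3 (lam3 t) A X f \<Colon> T\<langle>f \<cdot> X \<cdot> A \<cdot> Var\<rangle>"
    using App[OF t1 f] by (simp add: app3_def sbs)
  have e0: "\<Gamma> \<turnstile> App (lam3 t) A \<doteq> Lam U (Lam (arrow A\<up>1 (Var 0)) t\<langle>Var 0 \<cdot> Var 1 \<cdot> A\<up>2 \<cdot> \<up>2\<rangle>)
    \<Colon> Pi U (Pi (arrow A\<up>1 (Var 0)) T\<langle>Var 0 \<cdot> Var 1 \<cdot> A\<up>2 \<cdot> \<up>2\<rangle>)"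
    using Pi_beta[OF p1 l1 A] by (simp add: lam3_def sbs)
  have s1: "sb (U # U # \<Gamma>) (Var 0 \<cdot> A\<up>1 \<cdot> \<up>1) (U # \<Gamma>)"
    supply ty = U0 and tyU = A
    by (rule ty tyU tyU[THEN small] tyU[THEN sub_U] tyU[THEN sub_small] ty[THEN ty_sub] ty[THEN ty_ctx] tyU[THEN ty_ctx]
        | simp only: sbs | rule tyr)+
  from Pi_beta[OF sub_Ty[OF p2 s1] ty_sub[OF l2 s1 refl] X]
  have "\<Gamma> \<turnstile> App (Lam U (Lam (arrow A\<up>1 (Var 0)) t\<langle>Var 0 \<cdot> Var 1 \<cdot> A\<up>2 \<cdot> \<up>2\<rangle>)) X
    \<doteq> Lam (arrow A X) t\<langle>Var 0 \<cdot> X\<up>1 \<cdot> A\<up>1 \<cdot> \<up>1\<rangle> \<Colon> Pi (arrow A X) T\<langle>Var 0 \<cdot> X\<up>1 \<cdot> A\<up>1 \<cdot> \<up>1\<rangle>"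
    by (simp add: sbs)
  with App_cong[OF e0 eq_refl[OF X]]
  have e1: "\<Gamma> \<turnstile> App (App (lam3 t) A) X \<doteq> Lam (arrow A X) t\<langle>Var 0 \<cdot> X\<up>1 \<cdot> A\<up>1 \<cdot> \<up>1\<rangle> \<Colon> Pi (arrow A X) T\<langle>Var 0 \<cdot> X\<up>1 \<cdot> A\<up>1 \<cdot> \<up>1\<rangle>"
    using eq_trans by (simp add: sbs)
  have s2: "sb (?a # U # U # \<Gamma>) (Var 0 \<cdot> X\<up>1 \<cdot> A\<up>1 \<cdot> \<up>1) (arrow A X # \<Gamma>)"
    supply ty = aX and tyU = A X
    by (rule ty tyU tyU[THEN small] tyU[THEN sub_U] tyU[THEN sub_small] ty[THEN ty_sub] ty[THEN ty_ctx] tyU[THEN ty_ctx]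
        | simp only: sbs | rule tyr)+
  from Pi_beta[OF sub_Ty[OF T' s2] ty_sub[OF t' s2 refl] f]
  have "\<Gamma> \<turnstile> App (Lam (arrow A X) t\<langle>Var 0 \<cdot> X\<up>1 \<cdot> A\<up>1 \<cdot> \<up>1\<rangle>) f \<doteq> t\<langle>f \<cdot> X \<cdot> A \<cdot> Var\<rangle> \<Colon> T\<langle>f \<cdot> X \<cdot> A \<cdot> Var\<rangle>"
    by (simp add: sbs)
  with App_cong[OF e1 eq_refl[OF f]]
  show "\<Gamma> \<turnstile> app3 (lam3 t) A X f \<doteq> t\<langle>f \<cdot> X \<cdot> A \<cdot> Var\<rangle> \<Colon> T\<langle>f \<cdot> X \<cdot> A \<cdot> Var\<rangle>"
    using eq_trans by (simp add: sbs app3_def)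
qed

theorem theorem3p3:
  shows "\<exists>im i q Q.
    \<forall>\<Gamma> A X f. \<Gamma> \<turnstile> A \<Colon> U \<longrightarrow> \<Gamma> \<turnstile> X \<Colon> U \<longrightarrow> \<Gamma> \<turnstile> f \<Colon> arrow A X \<longrightarrow>
      is_image \<Gamma> A X f (app3 im A X f) (app3 i A X f) (app3 q A X f) (app3 Q A X f)"
proof -
  let ?im = "im_ty (Var 2) (Var 1) (Var 0)" and ?i = "im_i (Var 2) (Var 1) (Var 0)"
    and ?q = "im_q (Var 2) (Var 1) (Var 0)" and ?Q = "im_Q (Var 2) (Var 1) (Var 0)"
  have "ctx []"
    by (rule ctx_nil)
  note c1 = ctx_cons[OF univ[OF this]]
  note c2 = ctx_cons[OF univ[OF c1]]
  have "[U, U] \<turnstile> arrow (Var 1) (Var 0) \<Colon> Ty"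
    by (intro arrow_ty small var_ty c2) (simp_all add: sbs)
  note c3 = ctx_cons[OF this]
  \<comment> \<open>The generic map between small types. Its image terms, once abstracted, serve all
    contexts uniformly.\<close>
  interpret M: small_map map_ctx "Var 2" "Var 1" "Var 0"
    by unfold_locales (intro var_ty c3, simp add: sbs)+
  have "is_image \<Gamma> A X f (app3 (lam3 ?im) A X f) (app3 (lam3 ?i) A X f) (app3 (lam3 ?q) A X f) (app3 (lam3 ?Q) A X f)"
    if A: "\<Gamma> \<turnstile> A \<Colon> U" and X: "\<Gamma> \<turnstile> X \<Colon> U" and f: "\<Gamma> \<turnstile> f \<Colon> arrow A X" for \<Gamma> A X f
  proof -
    \<comment> \<open>The same construction for the given map. Substituting that map into the
      generic terms returns these terms by \<open>im_sub\<close>, so the embedding and extension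
      properties can be taken from here.\<close>
    interpret N: small_map \<Gamma> A X f
      by unfold_locales (fact A X f)+
    note im = lam3[OF M.im univ[OF c3] A X f]
      and i = lam3[OF M.i arrow_ty[OF small[OF M.im] small[OF M.X]] A X f]
      and q = lam3[OF M.q arrow_ty[OF small[OF M.A] small[OF M.im]] A X f]
      and Q = lam3[OF M.Q htpy_ty[OF small[OF M.A] small[OF M.X] M.f comp_ty[OF M.q M.i small[OF M.A] small[OF M.X]]] A X f]
    show ?thesis
      by (rule is_image_eq[OF small[OF A] small[OF X] f _ _ _ _ N.i_emb _ _ _ N.ext])
        (use im i q Q(1) in \<open>simp_all add: sbs im_sub\<close>)
  qed
  then show ?thesis
    by blast
qed

end
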